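(* Let $\pmb k$ be an algebraically closed field, and let $B,d,g_1,g_2,g_3,\Psi,\mathcal C,\varphi,d_1,d_2$ be as in the context, with $d$ equal to the even number $2c$. (1) If $p$ is a point on $\mathcal C$ and $q$ is a singularity of multiplicity $c$ infinitely near to $p$, then the multiplicity of $p$ is also equal to $c$. (2) If $p$ is a singularity on $\mathcal C$ of multiplicity $c$, then the parameters $d_1$ and $d_2$ are both equal to $c$. (3) Suppose that $p$ is a singularity on $\mathcal C$ of multiplicity $c$. Then there is a singularity of $\mathcal C$, infinitely near to $p$, of multiplicity $c$ if and only if there exist invertible matrices $\chi$ and $\xi$, with entries in $\pmb k$, such that $p=(0,0,1)\chi$ and $$\chi\varphi\xi=\begin{bmatrix}P_1&Q_1\\Q_3&Q_2\\0&Q_3\end{bmatrix},$$ where the homogeneous forms $P_1$ and $Q_i$ all have degree $c$. (4) Suppose that $p$ is a singularity on $\mathcal C$ of multiplicity $c$. Then there are two singularities of $\mathcal C$, infinitely near to $p$, of multiplicity $c$ if and only if there exist invertible matrices $\chi$ and $\xi$, with entries in $\pmb k$, such that $p=(0,0,1)\chi$ and $$\chi\varphi\xi=\begin{bmatrix}Q_2&Q_1\\Q_3&Q_2\\0&Q_3\end{bmatrix},$$ where the homogeneous forms $Q_i$ all have degree $c$.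
   Context: Setting: $B=\pmb k[x,y]$ is the standard graded polynomial ring, $g_1,g_2,g_3$ are homogeneous forms of degree $d$ in $B$, $I=(g_1,g_2,g_3)B$, $\Psi:\mathbb P^1\to\mathbb P^2$ is the morphism $[g_1:g_2:g_3]$, and $\mathcal C$ is the image of $\Psi$. Assume: $I$ is minimally generated by $g_1,g_2,g_3$; $I$ has height two; and $\Psi:\mathbb P^1\to\mathcal C$ is a birational morphism. $\varphi$ is a homogeneous Hilbert-Burch matrix for $[g_1,g_2,g_3]$: a $3\times2$ matrix such that $0\to B(-d_1-d)\oplus B(-d_2-d)\xrightarrow{\varphi}B(-d)^3\xrightarrow{[g_1,g_2,g_3]}I\to0$ is a homogeneous resolution, with $d_1\le d_2$. A point $p=[a_1:a_2:a_3]$ is also viewed as a row vector $(a_1,a_2,a_3)$, determined up to a non-zero scalar. The multiplicity of a point on a curve is the multiplicity of the local ring of the curve at the point; a singularity is a point whose local ring is not regular. Points in the first neighborhood of $p\in\mathcal C$ are the points of the blow-up of $\mathcal C$ at $p$ which map to $p$; the points in the $(i+1)$-st neighborhood of $p$ are the points in the first neighborhoods of the points in the $i$-th neighborhood of $p$. The singularities of $\mathcal C$ infinitely near to $p$ are the singular points in the $i$-th neighborhoods of $p$, for $i\ge1$ (thus, infinitely near singularities are not points on $\mathcal C$ itself). *)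

theory Defs
  imports
    "HOL-Analysis.Analysis"
    "HOL-Algebra.Algebraic_Closure_Type"
    "HOL-Algebra.Generated_Rings"
    "HOL-Algebra.Ideal_Product"
    "HOL-Computational_Algebra.Computational_Algebra"
    "HOL-Library.Extended_Nat"
begin

section \<open>Commutative algebra\<close>

definition prime_chain :: "('a, 'b) ring_scheme \<Rightarrow> (nat \<Rightarrow> 'a set) \<Rightarrow> nat \<Rightarrow> bool" where
  "prime_chain R P n \<longleftrightarrow> (\<forall>i\<le>n. primeideal (P i) R) \<and> (\<forall>i<n. P i \<subset> P (Suc i))"

definition krull_dim :: "('a, 'b) ring_scheme \<Rightarrow> enat" where
  "krull_dim R = Sup {enat n | n. \<exists>P. prime_chain R P n}"

definition prime_height :: "('a, 'b) ring_scheme \<Rightarrow> 'a set \<Rightarrow> enat" where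
  "prime_height R Q = Sup {enat n | n. \<exists>P. prime_chain R P n \<and> P n = Q}"

definition ideal_height :: "('a, 'b) ring_scheme \<Rightarrow> 'a set \<Rightarrow> enat" where
  "ideal_height R I = Inf {prime_height R Q | Q. primeideal Q R \<and> I \<subseteq> Q}"

text \<open>The length of the module \<open>R/I\<close>: its submodules correspond to the ideals of \<open>R\<close>
  that contain \<open>I\<close>.\<close>

definition quotient_length :: "('a, 'b) ring_scheme \<Rightarrow> 'a set \<Rightarrow> enat" where
  "quotient_length R I = Sup {enat n | n. \<exists>J. (\<forall>i\<le>n. ideal (J i) R \<and> I \<subseteq> J i) \<and>
     (\<forall>i<n. J i \<subset> J (Suc i))}"

text \<open>The following three notions are meant for Noetherian local rings only.\<close>

definition max_ideal :: "('a, 'b) ring_scheme \<Rightarrow> 'a set" where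
  "max_ideal R = (THE m. maximalideal m R)"

definition regular_local :: "('a, 'b) ring_scheme \<Rightarrow> bool" where
  "regular_local R \<longleftrightarrow> (\<exists>S. finite S \<and> S \<subseteq> carrier R \<and> enat (card S) = krull_dim R \<and>
     max_ideal R = Idl\<^bsub>R\<^esub> S)"

text \<open>The Hilbert-Samuel multiplicity: with \<open>s = dim R\<close>, the limit of
  \<open>s! length(R/m^n) / n^s\<close>.\<close>

definition local_mult :: "('a, 'b) ring_scheme \<Rightarrow> real" where
  "local_mult R = (let s = the_enat (krull_dim R) in
     lim (\<lambda>n::nat. fact s *
       real (the_enat (quotient_length R (max_ideal R [^]\<^bsub>ideals_set R\<^esub> n))) / real n ^ s))"


section \<open>Blow-ups of local domains inside a field\<close>

text \<open>A point of an integral curve, or of one of its iterated blow-ups, is encoded by its local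
  ring, as a subring of the function field.  These curves are separated and the blow-up maps are
  birational, so within one blow-up a point is determined by its local ring.  A local ring that
  is not regular becomes strictly larger under blowing up, so singular points of distinct
  neighborhoods of a given point have distinct local rings as well.\<close>

abbreviation as_ring :: "'l::field set \<Rightarrow> 'l ring" where
  "as_ring R \<equiv> ring_of_type_algebra\<lparr>carrier := R\<rparr>"

definition localize :: "'l::field set \<Rightarrow> 'l set \<Rightarrow> 'l set" where
  "localize A Q = {a / s | a s. a \<in> A \<and> s \<in> A \<and> s \<notin> Q}"

text \<open>The ring \<open>R[m/a]\<close>.\<close>

definition blowup_chart :: "'l::field set \<Rightarrow> 'l \<Rightarrow> 'l set" where
  "blowup_chart R a =
     generate_ring ring_of_type_algebra (R \<union> {b / a | b. b \<in> max_ideal (as_ring R)})"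

text \<open>The blow-up \<open>Proj (R \<oplus> m \<oplus> m^2 \<oplus> \<dots>)\<close> of \<open>Spec R\<close> at its closed point is covered by the
  affine schemes \<open>Spec R[m/a]\<close> with \<open>a\<close> a non-zero element of \<open>m\<close>; a prime of \<open>R[m/a]\<close> lies over
  \<open>m\<close> if and only if it contains \<open>m\<close>.  Blowing up commutes with the passage from a curve
  to its local ring at the point that is blown up.\<close>

definition first_nbhd :: "'l::field set \<Rightarrow> 'l set set" where
  "first_nbhd R = {localize (blowup_chart R a) Q | a Q.
     a \<in> max_ideal (as_ring R) \<and> a \<noteq> 0 \<and>
     primeideal Q (as_ring (blowup_chart R a)) \<and> max_ideal (as_ring R) \<subseteq> Q}"

fun nbhd :: "nat \<Rightarrow> 'l::field set \<Rightarrow> 'l set set" where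
  "nbhd 0 R = {R}"
| "nbhd (Suc i) R = (\<Union>S\<in>nbhd i R. first_nbhd S)"

definition inf_near_sing :: "'l::field set \<Rightarrow> 'l set set" where
  "inf_near_sing R = {S. (\<exists>i\<ge>1. S \<in> nbhd i R) \<and> \<not> regular_local (as_ring S)}"


section \<open>Forms and rational plane curves\<close>

text \<open>The polynomial ring \<open>k[x,y]\<close> is \<open>(k[x])[y]\<close>: the coefficient of \<open>x^i y^j\<close> in \<open>f\<close> is
  \<open>coeff (coeff f j) i\<close>.  Zero is a form of every degree.\<close>

type_synonym 'k bipoly = "'k poly poly"

definition homog :: "nat \<Rightarrow> 'k::zero bipoly \<Rightarrow> bool" where
  "homog n f \<longleftrightarrow> (\<forall>i j. Polynomial.coeff (Polynomial.coeff f j) i \<noteq> 0 \<longrightarrow> i + j = n)"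

definition eval2 :: "'k::comm_ring_1 bipoly \<Rightarrow> 'k \<Rightarrow> 'k \<Rightarrow> 'k" where
  "eval2 f s t = poly (poly f [:t:]) s"

abbreviation const2 :: "'k::zero \<Rightarrow> 'k bipoly" where
  "const2 a \<equiv> [:[:a:]:]"

text \<open>A form of degree \<open>n\<close> in three variables over \<open>k\<close> is given by its coefficients
  \<open>c e\<close>, where \<open>e\<close> runs over the exponent vectors with entry sum \<open>n\<close>; the other values of \<open>c\<close> are
  ignored.  It is evaluated at a triple \<open>v\<close> of elements of a \<open>k\<close>-algebra with structure map
  \<open>\<iota>\<close>.\<close>

definition eval_form ::
  "('k \<Rightarrow> 'b::comm_ring_1) \<Rightarrow> nat \<Rightarrow> ((3 \<Rightarrow> nat) \<Rightarrow> 'k) \<Rightarrow> 'b^3 \<Rightarrow> 'b" where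
  "eval_form \<iota> n c v =
     (\<Sum>e | (\<Sum>i\<in>UNIV. e i) = n. \<iota> (c e) * (\<Prod>i\<in>UNIV. (v $ i) ^ e i))"

definition P1_function_field :: "'k::field bipoly fract set" where
  "P1_function_field = {Fract F G | n F G. homog n F \<and> homog n G \<and> G \<noteq> 0}"

text \<open>The homogeneous ideal of the image \<open>C\<close> of \<open>[g1:g2:g3]\<close> is the kernel of \<open>T_i \<mapsto> g_i\<close>, so
  substitution embeds the function field of \<open>C\<close> and the local rings of \<open>C\<close> into the function
  field of the projective line.\<close>

definition curve_function_field :: "('k::field bipoly)^3 \<Rightarrow> 'k bipoly fract set" where
  "curve_function_field g = {Fract (eval_form const2 n F g) (eval_form const2 n G g) | n F G.
     eval_form const2 n G g \<noteq> 0}"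

definition birational_param :: "('k::field bipoly)^3 \<Rightarrow> bool" where
  "birational_param g \<longleftrightarrow> curve_function_field g = P1_function_field"

text \<open>\<open>p\<close> is a coordinate vector of a point in the image of \<open>[g1:g2:g3]\<close>.\<close>

definition on_curve :: "('k::field bipoly)^3 \<Rightarrow> 'k^3 \<Rightarrow> bool" where
  "on_curve g p \<longleftrightarrow> p \<noteq> 0 \<and>
     (\<exists>s t. (s, t) \<noteq> (0, 0) \<and> (\<exists>u. u \<noteq> 0 \<and> (\<forall>i. eval2 (g $ i) s t = u * p $ i)))"

definition curve_local_ring :: "('k::field bipoly)^3 \<Rightarrow> 'k^3 \<Rightarrow> 'k bipoly fract set" where
  "curve_local_ring g p = {Fract (eval_form const2 n F g) (eval_form const2 n G g) | n F G.
     eval_form (\<lambda>a. a) n G p \<noteq> 0}"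

definition curve_mult :: "('k::field bipoly)^3 \<Rightarrow> 'k^3 \<Rightarrow> real" where
  "curve_mult g p = local_mult (as_ring (curve_local_ring g p))"

definition curve_singular :: "('k::field bipoly)^3 \<Rightarrow> 'k^3 \<Rightarrow> bool" where
  "curve_singular g p \<longleftrightarrow> on_curve g p \<and> \<not> regular_local (as_ring (curve_local_ring g p))"

definition gen_ideal :: "('k::field bipoly)^3 \<Rightarrow> 3 set \<Rightarrow> 'k bipoly set" where
  "gen_ideal g A = Idl\<^bsub>ring_of_type_algebra\<^esub> ((\<lambda>i. g $ i) ` A)"

definition minimally_generating :: "('k::field bipoly)^3 \<Rightarrow> bool" where
  "minimally_generating g \<longleftrightarrow> (\<forall>A. A \<subset> UNIV \<longrightarrow> gen_ideal g A \<noteq> gen_ideal g UNIV)"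

text \<open>Homogeneity and exactness of
  \<open>0 \<rightarrow> B(-d1-d) \<oplus> B(-d2-d) \<rightarrow> B(-d)^3 \<rightarrow> I \<rightarrow> 0\<close>; exactness at \<open>I\<close> holds by definition of \<open>I\<close>.\<close>

definition hilbert_burch ::
  "('k::field bipoly)^3 \<Rightarrow> ('k bipoly)^2^3 \<Rightarrow> nat \<Rightarrow> nat \<Rightarrow> bool" where
  "hilbert_burch g \<phi> d1 d2 \<longleftrightarrow>
     (\<forall>i. homog d1 (\<phi> $ i $ 1) \<and> homog d2 (\<phi> $ i $ 2)) \<and>
     inj (\<lambda>v. \<phi> *v v) \<and>
     {w. (\<Sum>i\<in>UNIV. g $ i * w $ i) = 0} = range (\<lambda>v. \<phi> *v v)"

end

theory Submission
  imports Defs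
begin

text \<open>Since the parametrization is birational, the local rings of the curve \<open>C\<close> and of all its iterated blow-ups
  at points lie in the function field \<open>K\<close> of the projective line. Such a ring \<open>S\<close> is cut out by orders of vanishing: finitely
  many points \<open>P\<close> of the line lie over it, and \<open>S\<close> contains every function that vanishes at all of them to a high
  order. Therefore \<open>S\<close> has dimension one, its multiplicity is the sum over these \<open>P\<close> of the least order at \<open>P\<close> of an
  element of the maximal ideal (\<open>curve_local_mult\<close>), and it is regular if and only if this sum is one.
  If the maximal ideal is \<open>(a, b)\<close>, then the point of the first neighborhood at which \<open>b / a\<close> vanishes has maximal
  ideal \<open>(a, b / a)\<close> (\<open>blowup_gen2\<close>). So blowing up preserves the class of local rings with two generators, it never
  increases the multiplicity, and at most one point of the first neighborhood keeps the multiplicity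
  (\<open>first_nbhd_unique\<close>).

  Choose coordinates with \<open>p = [0:0:1]\<close>, let \<open>h\<close> of degree \<open>e\<close> be the greatest common divisor of \<open>g1\<close> and \<open>g2\<close>, and
  write \<open>g1 = h s2\<close>, \<open>g2 = - h s1\<close>. The maximal ideal at \<open>p\<close> is generated by \<open>g1 / g3\<close> and \<open>g2 / g3\<close>, so \<open>p\<close> has
  multiplicity \<open>e\<close>. A point of its first neighborhood belongs to a combination \<open>w = a s1 + b s2\<close>, and its multiplicity
  is the sum of \<open>min (ord_P h) (ord_P w)\<close> over the roots \<open>P\<close> of \<open>h\<close>, which is at most \<open>deg w = d - e\<close> and at most \<open>e\<close>.
  For \<open>d = 2 c\<close>, a point of multiplicity \<open>c\<close> infinitely near to \<open>p\<close> therefore forces \<open>e = c\<close>, which is the first assertion.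
  When \<open>e = c\<close>, all of \<open>h\<close>, \<open>s1\<close>, \<open>s2\<close> have degree \<open>c\<close>, and the first neighborhood has a point of multiplicity \<open>c\<close> if and only
  if some \<open>w\<close> is a multiple of \<open>h\<close>; after a change of coordinates this reads \<open>s2 = y h\<close> with \<open>y\<close> in \<open>k\<close>
  (\<open>nbr_full\<close>, \<open>tangent_nbr\<close>). Blowing up once more, there is a point of multiplicity \<open>c\<close> above that one if and only if
  \<open>h\<close> divides \<open>s1^2 - \<kappa> g3\<close> for some \<open>\<kappa> \<noteq> 0\<close> (\<open>second_nbr_full\<close>, \<open>second_nbr_exists\<close>). By uniqueness, two distinct
  infinitely near points of multiplicity \<open>c\<close> exist if and only if this second point exists.

  It remains to read these divisibilities in the matrix \<open>\<phi>\<close>. The column \<open>(s1, s2, 0)\<close> is a syzygy, and the third entry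
  of every syzygy is divisible by \<open>h\<close>, because \<open>h\<close> and \<open>g3\<close> have no common root. When \<open>e = c\<close>, this excludes syzygies
  of degree below \<open>c\<close> and minimal generators of degree above \<open>c\<close> (\<open>d1_ge\<close>, \<open>d2_le\<close>), which gives \<open>d1 = d2 = c\<close>, and constant
  column operations turn \<open>\<phi>\<close> into the columns \<open>(s1, s2, 0)\<close> and \<open>(Q1, Q2, r h)\<close> with \<open>r g3 = s1 Q2 - s2 Q1\<close>
  (\<open>normal_basis\<close>). The condition \<open>s2 = y h\<close> says that the entries \<open>s2\<close> and \<open>r h\<close> are proportional, which is the shape in
  the third assertion. Given this, \<open>h\<close> divides \<open>s1^2 - \<kappa> g3\<close> if and only if \<open>h\<close> divides \<open>r s1 - \<kappa> Q2\<close>, and then a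
  constant multiple of the second row can be added to the first one to make the top left entry proportional to \<open>Q2\<close>,
  which is the shape in the fourth assertion.\<close>

section \<open>Subrings of a field and their ideals\<close>

definition sring :: "'l::field set \<Rightarrow> bool" where
  "sring S \<longleftrightarrow> 1 \<in> S \<and> (\<forall>x\<in>S. \<forall>y\<in>S. x - y \<in> S \<and> x * y \<in> S)"

lemma sring_1: "sring S \<Longrightarrow> 1 \<in> S"
  and sring_diff: "sring S \<Longrightarrow> x \<in> S \<Longrightarrow> y \<in> S \<Longrightarrow> x - y \<in> S"
  and sring_mult: "sring S \<Longrightarrow> x \<in> S \<Longrightarrow> y \<in> S \<Longrightarrow> x * y \<in> S"
  by (auto simp: sring_def)

lemma sring_0: "sring S \<Longrightarrow> 0 \<in> S"
  using sring_diff[of S 1 1] sring_1 by auto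

lemma sring_uminus: "sring S \<Longrightarrow> x \<in> S \<Longrightarrow> - x \<in> S"
  using sring_diff[of S 0 x] sring_0 by auto

lemma sring_add: "sring S \<Longrightarrow> x \<in> S \<Longrightarrow> y \<in> S \<Longrightarrow> x + y \<in> S"
  using sring_diff[of S x "- y"] sring_uminus by auto

lemma sring_power: "sring S \<Longrightarrow> x \<in> S \<Longrightarrow> x ^ n \<in> S"
  by (induction n) (auto intro: sring_1 sring_mult)

lemma sring_sum: "sring S \<Longrightarrow> (\<And>i. i \<in> A \<Longrightarrow> f i \<in> S) \<Longrightarrow> sum f A \<in> S"
  by (induction A rule: infinite_finite_induct) (auto intro: sring_0 sring_add)

lemma sring_prod: "sring S \<Longrightarrow> (\<And>i. i \<in> A \<Longrightarrow> f i \<in> S) \<Longrightarrow> prod f A \<in> S"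
  by (induction A rule: infinite_finite_induct) (auto intro: sring_1 sring_mult)

lemmas sring_closed = sring_0 sring_1 sring_add sring_diff sring_uminus sring_mult sring_power

lemma type_algebra_simps [simp]:
  "carrier (ring_of_type_algebra :: 'l::comm_ring_1 ring) = UNIV"
  "x \<otimes>\<^bsub>(ring_of_type_algebra :: 'l ring)\<^esub> y = x * y"
  "x \<oplus>\<^bsub>(ring_of_type_algebra :: 'l ring)\<^esub> y = x + y"
  "\<one>\<^bsub>(ring_of_type_algebra :: 'l ring)\<^esub> = 1"
  "\<zero>\<^bsub>(ring_of_type_algebra :: 'l ring)\<^esub> = 0"
  by (simp_all add: ring_of_type_algebra_def)

lemma type_algebra_uminus [simp]:
  "\<ominus>\<^bsub>(ring_of_type_algebra :: 'l::comm_ring_1 ring)\<^esub> x = - x"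
proof -
  interpret cring "ring_of_type_algebra :: 'l ring" by (rule cring_from_type_algebra)
  have "x + \<ominus>\<^bsub>(ring_of_type_algebra :: 'l ring)\<^esub> x = 0"
    using r_neg[of x] by simp
  then show ?thesis by (simp add: eq_neg_iff_add_eq_0 add.commute)
qed

lemma cring_as_ring:
  assumes "sring S"
  shows "cring (as_ring S)"
proof (rule cringI)
  show "abelian_group (as_ring S)"
  proof (rule abelian_groupI)
    fix x assume "x \<in> carrier (as_ring S)"
    then show "\<exists>y\<in>carrier (as_ring S). y \<oplus>\<^bsub>as_ring S\<^esub> x = \<zero>\<^bsub>as_ring S\<^esub>"
      using sring_uminus[OF assms] by (intro bexI[of _ "- x"]) auto
  qed (use assms in \<open>auto intro: sring_closed simp: algebra_simps\<close>)
  show "Group.comm_monoid (as_ring S)"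
    by (rule comm_monoidI) (use assms in \<open>auto intro: sring_closed simp: algebra_simps\<close>)
qed (auto simp: algebra_simps)

lemma ideal_as_ring_iff:
  assumes S: "sring S"
  shows "ideal J (as_ring S) \<longleftrightarrow> J \<subseteq> S \<and> 0 \<in> J \<and> (\<forall>x\<in>J. \<forall>y\<in>J. x + y \<in> J) \<and> (\<forall>s\<in>S. \<forall>x\<in>J. s * x \<in> J)"
    (is "_ \<longleftrightarrow> ?R")
proof
  assume "ideal J (as_ring S)"
  then interpret ideal J "as_ring S" .
  show ?R
    using a_subset additive_subgroup.zero_closed[OF is_additive_subgroup]
      additive_subgroup.a_closed[OF is_additive_subgroup] I_l_closed by auto
next
  assume R: ?R
  interpret cring "as_ring S" by (rule cring_as_ring[OF S])
  have neg: "- x \<in> J" if "x \<in> J" for x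
    using R that sring_uminus[OF S sring_1[OF S]] by (metis mult_minus1)
  have inv: "\<ominus>\<^bsub>as_ring S\<^esub> x = - x" if "x \<in> S" for x
    using minus_equality[of "- x" x] that sring_uminus[OF S] by auto
  show "ideal J (as_ring S)"
  proof (rule idealI)
    show "subgroup J (add_monoid (as_ring S))"
    proof (rule subgroup.intro)
      show "inv\<^bsub>add_monoid (as_ring S)\<^esub> x \<in> J" if "x \<in> J" for x
        using inv[of x] neg[OF that] that R unfolding a_inv_def[symmetric] by auto
    qed (use R in auto)
    show "a \<otimes>\<^bsub>as_ring S\<^esub> x \<in> J" if "a \<in> J" "x \<in> carrier (as_ring S)" for a x
      using R that by (simp add: mult.commute[of a x])
  qed (use R in \<open>auto simp: ring_axioms\<close>)
qed

lemma ideal_as_ringI: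
  assumes "sring S" "J \<subseteq> S" "0 \<in> J" "\<And>x y. x \<in> J \<Longrightarrow> y \<in> J \<Longrightarrow> x + y \<in> J"
    "\<And>s x. s \<in> S \<Longrightarrow> x \<in> J \<Longrightarrow> s * x \<in> J"
  shows "ideal J (as_ring S)"
  using assms by (simp add: ideal_as_ring_iff)

lemma primeideal_as_ring_iff:
  assumes "sring S"
  shows "primeideal Q (as_ring S) \<longleftrightarrow> ideal Q (as_ring S) \<and> Q \<noteq> S \<and>
    (\<forall>x\<in>S. \<forall>y\<in>S. x * y \<in> Q \<longrightarrow> x \<in> Q \<or> y \<in> Q)"
  using assms cring_as_ring[OF assms]
  by (auto simp: primeideal_def primeideal_axioms_def)

lemma ideal_eq_carrier:
  assumes "sring S" "ideal J (as_ring S)" "u \<in> J" "u \<noteq> 0" "inverse u \<in> S"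
  shows "J = S"
proof -
  have J: "J \<subseteq> S" "\<And>s x. s \<in> S \<Longrightarrow> x \<in> J \<Longrightarrow> s * x \<in> J"
    using assms by (auto simp: ideal_as_ring_iff)
  have "s \<in> J" if "s \<in> S" for s
  proof -
    have "(s * inverse u) * u \<in> J"
      by (rule J(2)[OF sring_mult[OF assms(1) that assms(5)] assms(3)])
    then show ?thesis using assms(4) by (simp add: mult.assoc)
  qed
  then show ?thesis using J(1) by auto
qed

lemma primeideal_power:
  assumes S: "sring S" and Q: "primeideal Q (as_ring S)" and "x \<in> S" "x ^ n \<in> Q"
  shows "x \<in> Q"
  using \<open>x ^ n \<in> Q\<close>
proof (induction n)
  case 0
  then have "Q = S" using ideal_eq_carrier[OF S, of Q 1] Q sring_1[OF S]
    by (auto simp: primeideal_as_ring_iff[OF S])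
  then show ?case using Q by (auto simp: primeideal_as_ring_iff[OF S])
next
  case (Suc n)
  then show ?case
    using Q assms(3) sring_power[OF S assms(3)] by (auto simp: primeideal_as_ring_iff[OF S])
qed

lemma primeideal_prod:
  assumes S: "sring S" and Q: "primeideal Q (as_ring S)" and "finite A" "\<And>i. i \<in> A \<Longrightarrow> f i \<in> S"
    "prod f A \<in> Q"
  shows "\<exists>i\<in>A. f i \<in> Q"
  using assms(3-5)
proof (induction A)
  case empty
  then have "Q = S" using ideal_eq_carrier[OF S, of Q 1] Q sring_1[OF S]
    by (auto simp: primeideal_as_ring_iff[OF S])
  then show ?case using Q by (auto simp: primeideal_as_ring_iff[OF S])
next
  case (insert a A)
  have "prod f A \<in> S" using insert by (intro sring_prod[OF S]) auto
  then show ?case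
    using insert Q by (auto simp: primeideal_as_ring_iff[OF S])
qed

section \<open>Semilocal and local subrings cut out by valuations\<close>

text \<open>The abstract setting: a field \<open>K\<close> inside the ambient field, an infinite field of constants \<open>C\<close>, and a family of
  valuations with residue field \<open>C\<close> whose values can be prescribed at finitely many places. Since \<open>v P 0\<close> is a
  junk value, orders are compared with \<open>ge\<close>, which treats zero as having infinite order.\<close>

locale places =
  fixes K C :: "'l::field set" and PP :: "'p set" and v :: "'p \<Rightarrow> 'l \<Rightarrow> int"
  assumes K: "sring K" and K_inverse: "x \<in> K \<Longrightarrow> inverse x \<in> K"
    and C: "sring C" and C_inverse: "x \<in> C \<Longrightarrow> inverse x \<in> C"
    and CK: "C \<subseteq> K" and C_infinite: "infinite C"
    and v_mult: "P \<in> PP \<Longrightarrow> x \<in> K \<Longrightarrow> y \<in> K \<Longrightarrow> x \<noteq> 0 \<Longrightarrow> y \<noteq> 0 \<Longrightarrow> v P (x * y) = v P x + v P y"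
    and v_add: "P \<in> PP \<Longrightarrow> x \<in> K \<Longrightarrow> y \<in> K \<Longrightarrow> x \<noteq> 0 \<Longrightarrow> y \<noteq> 0 \<Longrightarrow> x + y \<noteq> 0 \<Longrightarrow>
      min (v P x) (v P y) \<le> v P (x + y)"
    and v_const: "P \<in> PP \<Longrightarrow> c \<in> C \<Longrightarrow> c \<noteq> 0 \<Longrightarrow> v P c = 0"
    and v_residue: "P \<in> PP \<Longrightarrow> x \<in> K \<Longrightarrow> x \<noteq> 0 \<Longrightarrow> v P x = 0 \<Longrightarrow>
      \<exists>c\<in>C. x = c \<or> 0 < v P (x - c)"
    and approx: "finite Z \<Longrightarrow> Z \<subseteq> PP \<Longrightarrow> \<exists>x\<in>K. x \<noteq> 0 \<and> (\<forall>P\<in>Z. v P x = n P)"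
begin

definition ge :: "'p \<Rightarrow> int \<Rightarrow> 'l \<Rightarrow> bool" where
  "ge P n x \<longleftrightarrow> x = 0 \<or> n \<le> v P x"

lemma K_divide: "x \<in> K \<Longrightarrow> y \<in> K \<Longrightarrow> x / y \<in> K"
  by (simp add: divide_inverse K K_inverse sring_mult)

lemma C_divide: "x \<in> C \<Longrightarrow> y \<in> C \<Longrightarrow> x / y \<in> C"
  by (simp add: divide_inverse C C_inverse sring_mult)

lemma C_K: "c \<in> C \<Longrightarrow> c \<in> K"
  using CK by auto

lemmas K_closed = sring_closed[OF K] K_inverse K_divide
lemmas C_closed = sring_closed[OF C] C_inverse C_divide

lemma ge_0 [simp]: "ge P n 0"
  by (simp add: ge_def)

lemma ge_mono: "ge P n x \<Longrightarrow> m \<le> n \<Longrightarrow> ge P m x"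
  by (auto simp: ge_def)

lemma ge_v: "ge P (v P x) x"
  by (simp add: ge_def)

lemma v_1: "P \<in> PP \<Longrightarrow> v P 1 = 0"
  by (intro v_const) (auto intro: C_closed)

lemma ge_const: "P \<in> PP \<Longrightarrow> c \<in> C \<Longrightarrow> n \<le> 0 \<Longrightarrow> ge P n c"
  using v_const[of P c] by (cases "c = 0") (auto simp: ge_def)

lemma ge_one: "P \<in> PP \<Longrightarrow> ge P 0 1"
  by (auto intro: ge_const C_closed)

lemma not_ge_const: "P \<in> PP \<Longrightarrow> c \<in> C \<Longrightarrow> c \<noteq> 0 \<Longrightarrow> \<not> ge P 1 c"
  using v_const by (auto simp: ge_def)

lemma ge_mult: "P \<in> PP \<Longrightarrow> x \<in> K \<Longrightarrow> y \<in> K \<Longrightarrow> ge P m x \<Longrightarrow> ge P n y \<Longrightarrow> ge P (m + n) (x * y)"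
  using v_mult[of P x y] by (cases "x = 0 \<or> y = 0") (auto simp: ge_def)

lemma ge_mult0: "P \<in> PP \<Longrightarrow> x \<in> K \<Longrightarrow> y \<in> K \<Longrightarrow> ge P 0 x \<Longrightarrow> ge P n y \<Longrightarrow> ge P n (x * y)"
  using ge_mult[of P x y 0 n] by auto

lemma ge_const_mult: "P \<in> PP \<Longrightarrow> c \<in> C \<Longrightarrow> y \<in> K \<Longrightarrow> ge P n y \<Longrightarrow> ge P n (c * y)"
  by (intro ge_mult0) (auto intro: K_closed ge_const C_K)

lemma ge_add: "P \<in> PP \<Longrightarrow> x \<in> K \<Longrightarrow> y \<in> K \<Longrightarrow> ge P n x \<Longrightarrow> ge P n y \<Longrightarrow> ge P n (x + y)"
  using v_add[of P x y] by (force simp: ge_def)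

lemma ge_uminus: "P \<in> PP \<Longrightarrow> x \<in> K \<Longrightarrow> ge P n x \<Longrightarrow> ge P n (- x)"
  using ge_const_mult[of P "-1" x n] C_closed by auto

lemma ge_diff: "P \<in> PP \<Longrightarrow> x \<in> K \<Longrightarrow> y \<in> K \<Longrightarrow> ge P n x \<Longrightarrow> ge P n y \<Longrightarrow> ge P n (x - y)"
  using ge_add[of P x "- y" n] ge_uminus[of P y n] K_closed by auto

lemma ge_cancel: "P \<in> PP \<Longrightarrow> x \<in> K \<Longrightarrow> c \<in> K \<Longrightarrow> ge P n x \<Longrightarrow> ge P n (x - c) \<Longrightarrow> ge P n c"
  using ge_diff[of P x "x - c" n] K_closed by simp

lemma v_power: "P \<in> PP \<Longrightarrow> x \<in> K \<Longrightarrow> x \<noteq> 0 \<Longrightarrow> v P (x ^ n) = int n * v P x"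
  by (induction n) (auto simp: v_1 v_mult K_closed algebra_simps)

lemma v_inverse: "P \<in> PP \<Longrightarrow> x \<in> K \<Longrightarrow> x \<noteq> 0 \<Longrightarrow> v P (inverse x) = - v P x"
  using v_mult[of P x "inverse x"] v_1[of P] K_closed by simp

lemma v_divide:
  "P \<in> PP \<Longrightarrow> x \<in> K \<Longrightarrow> y \<in> K \<Longrightarrow> x \<noteq> 0 \<Longrightarrow> y \<noteq> 0 \<Longrightarrow> v P (x / y) = v P x - v P y"
  by (simp add: divide_inverse v_mult v_inverse K_closed)

lemma ge_divide: "P \<in> PP \<Longrightarrow> x \<in> K \<Longrightarrow> y \<in> K \<Longrightarrow> y \<noteq> 0 \<Longrightarrow> ge P n x \<Longrightarrow> ge P (n - v P y) (x / y)"
  using v_divide[of P x y] by (cases "x = 0") (auto simp: ge_def)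

lemma ge_power:
  assumes "P \<in> PP" "x \<in> K" "ge P m x" "n > 0"
  shows "ge P (int n * m) (x ^ n)"
  using assms v_power[of P x n] by (cases "x = 0") (auto simp: ge_def mult_left_mono)

lemma ge_power1: "P \<in> PP \<Longrightarrow> x \<in> K \<Longrightarrow> ge P 1 x \<Longrightarrow> ge P (int n) (x ^ n)"
  using ge_power[of P x 1 n] ge_const[of P 1 0] C_closed by (cases "n = 0") auto

lemma ge_power0: "P \<in> PP \<Longrightarrow> x \<in> K \<Longrightarrow> ge P 0 x \<Longrightarrow> ge P 0 (x ^ n)"
  using ge_power[of P x 0 n] ge_const[of P 1 0] C_closed by (cases "n = 0") auto

lemma ge_prod0:
  assumes "finite A" "P \<in> PP" "\<And>i. i \<in> A \<Longrightarrow> f i \<in> K" "\<And>i. i \<in> A \<Longrightarrow> ge P 0 (f i)"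
  shows "ge P 0 (prod f A)"
  using assms
  by (induction A rule: finite_induct)
     (auto intro!: ge_mult0 ge_one sring_prod[OF K])

lemma ge_prod1:
  assumes "finite A" "P \<in> PP" "\<And>i. i \<in> A \<Longrightarrow> f i \<in> K" "\<And>i. i \<in> A \<Longrightarrow> ge P 0 (f i)"
    "j \<in> A" "ge P 1 (f j)"
  shows "ge P 1 (prod f A)"
proof -
  have "prod f A = prod f (A - {j}) * f j" using assms prod.remove[of A j f] by (simp add: mult.commute)
  then show ?thesis using assms
    by (auto intro!: ge_mult0 ge_prod0 sring_prod[OF K])
qed

lemma v_prod0:
  assumes "finite A" "P \<in> PP" "\<And>i. i \<in> A \<Longrightarrow> f i \<in> K" "\<And>i. i \<in> A \<Longrightarrow> f i \<noteq> 0 \<and> v P (f i) = 0"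
  shows "v P (prod f A) = 0"
  using assms
  by (induction A rule: finite_induct) (auto simp: v_1 v_mult sring_prod[OF K])

lemma residue:
  assumes "P \<in> PP" "x \<in> K" "ge P 0 x"
  shows "\<exists>c\<in>C. ge P 1 (x - c)"
proof (cases "ge P 1 x")
  case True
  then show ?thesis using C_closed by (intro bexI[of _ 0]) auto
next
  case False
  then have "x \<noteq> 0" "v P x = 0" using assms by (auto simp: ge_def)
  then obtain c where "c \<in> C" "x = c \<or> 0 < v P (x - c)" using v_residue assms by blast
  then show ?thesis by (intro bexI[of _ c]) (auto simp: ge_def)
qed

text \<open>Over an infinite field a linear combination can be chosen that has no cancellation at any of
  finitely many places, because each place excludes at most one coefficient.\<close>

lemma avoid_cancellation:
  assumes Z: "finite Z" "Z \<subseteq> PP" and xy: "x \<in> K" "y \<in> K"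
    and n: "\<And>P. P \<in> Z \<Longrightarrow> \<not> (ge P (n P) x \<and> ge P (n P) y)"
  shows "\<exists>c\<in>C. c \<noteq> 0 \<and> (\<forall>P\<in>Z. \<not> ge P (n P) (x + c * y))"
proof -
  define bad where "bad P = {c\<in>C. ge P (n P) (x + c * y)}" for P
  have fin: "finite (bad P)" if P: "P \<in> Z" for P
  proof -
    have PX: "P \<in> PP" using P Z by auto
    have "c = d" if "c \<in> bad P" "d \<in> bad P" for c d
    proof (rule ccontr)
      assume ne: "c \<noteq> d"
      have cd: "c \<in> C" "d \<in> C" "ge P (n P) (x + c * y)" "ge P (n P) (x + d * y)"
        using that by (auto simp: bad_def)
      have "ge P (n P) ((x + c * y) - (x + d * y))"
        using cd xy PX by (intro ge_diff) (auto intro!: K_closed intro: C_K)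
      also have "(x + c * y) - (x + d * y) = (c - d) * y" by (simp add: algebra_simps)
      finally have "ge P (n P) ((c - d) * y)" .
      moreover have ic: "inverse (c - d) \<in> C" using cd by (intro C_inverse sring_diff[OF C])
      moreover have "(c - d) * y \<in> K" using cd xy by (simp add: sring_mult[OF K] sring_diff[OF K] C_K)
      ultimately have "ge P (n P) (inverse (c - d) * ((c - d) * y))"
        by (rule ge_const_mult[OF PX, rotated 2])
      moreover have "inverse (c - d) * ((c - d) * y) = y" using ne by (simp add: mult.assoc[symmetric])
      ultimately have y: "ge P (n P) y" by simp
      have "ge P (n P) ((x + c * y) - c * y)"
        using cd xy PX y by (intro ge_diff ge_const_mult) (auto intro!: K_closed intro: C_K)
      then show False using n[OF P] y by simp
    qed
    then have "bad P = {} \<or> (\<exists>c. bad P = {c})" by blast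
    then show ?thesis by auto
  qed
  have "finite (insert 0 (\<Union>P\<in>Z. bad P))" using Z fin by auto
  then obtain c where "c \<in> C" "c \<notin> insert 0 (\<Union>P\<in>Z. bad P)"
    using C_infinite by (meson finite_subset subsetI)
  then show ?thesis by (intro bexI[of _ c]) (auto simp: bad_def)
qed

lemma int_bound:
  assumes "finite Z"
  shows "\<exists>N::nat. \<forall>P\<in>Z. f P \<le> int N"
proof -
  have "f P \<le> int (\<Sum>P\<in>Z. nat (f P))" if "P \<in> Z" for P
    using member_le_sum[of P Z "\<lambda>P. nat (f P)"] assms that by (auto simp: nat_le_iff)
  then show ?thesis by blast
qed

text \<open>A subring of \<open>K\<close> containing \<open>C\<close> whose normalization is the intersection of the valuation rings of \<open>Z\<close>,
  in the form in which this is used: integral at \<open>Z\<close>, and with non-zero conductor, expressed by the bound \<open>N\<close>.\<close>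

definition semilocal :: "'p set \<Rightarrow> 'l set \<Rightarrow> bool" where
  "semilocal Z T \<longleftrightarrow> finite Z \<and> Z \<subseteq> PP \<and> sring T \<and> T \<subseteq> K \<and> C \<subseteq> T \<and> (\<forall>x\<in>T. \<forall>P\<in>Z. ge P 0 x) \<and>
     (\<exists>N::nat. \<forall>x\<in>K. (\<forall>P\<in>Z. ge P (int N) x) \<longrightarrow> x \<in> T)"

lemma semilocal_conductor:
  assumes "semilocal Z T"
  obtains N :: nat where "N > 0" "\<And>x. x \<in> K \<Longrightarrow> (\<And>P. P \<in> Z \<Longrightarrow> ge P (int N) x) \<Longrightarrow> x \<in> T"
proof -
  obtain N :: nat where N: "\<forall>x\<in>K. (\<forall>P\<in>Z. ge P (int N) x) \<longrightarrow> x \<in> T"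
    using assms by (auto simp: semilocal_def)
  show ?thesis
  proof (rule that[of "Suc N"])
    fix x assume "x \<in> K" and x: "\<And>P. P \<in> Z \<Longrightarrow> ge P (int (Suc N)) x"
    moreover have "ge P (int N) x" if "P \<in> Z" for P
      by (rule ge_mono[OF x[OF that]]) auto
    ultimately show "x \<in> T" using N by auto
  qed auto
qed

text \<open>Every element \<open>x\<close> has residues \<open>c P\<close> at the places of \<open>Z\<close>, and a high power of the product of the \<open>x - c P\<close> lies
  deep enough to be in \<open>Q\<close>; so \<open>Q\<close> contains some \<open>x - c P\<close>. If every place had an element of \<open>Q\<close> that is a unit there, then a
  combination without cancellation would be a unit at all places, and its residue would be a unit in \<open>Q\<close>.\<close>

lemma semilocal_prime:
  assumes T: "semilocal Z T" and Q: "primeideal Q (as_ring T)" and a: "a \<in> Q" "a \<noteq> 0"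
  shows "\<exists>P\<in>Z. Q = {x\<in>T. ge P 1 x}"
proof -
  have Tr: "sring T" and Z: "finite Z" "Z \<subseteq> PP" and TK: "T \<subseteq> K" and CT: "C \<subseteq> T"
    and T0: "\<And>x P. x \<in> T \<Longrightarrow> P \<in> Z \<Longrightarrow> ge P 0 x"
    using T by (auto simp: semilocal_def)
  note TC = sring_closed[OF Tr]
  have Qi: "Q \<subseteq> T" "0 \<in> Q" "\<And>x y. x \<in> Q \<Longrightarrow> y \<in> Q \<Longrightarrow> x + y \<in> Q" "\<And>s x. s \<in> T \<Longrightarrow> x \<in> Q \<Longrightarrow> s * x \<in> Q"
    and Qid: "ideal Q (as_ring T)" and QT: "Q \<noteq> T"
    using Q by (auto simp: primeideal_as_ring_iff[OF Tr] ideal_as_ring_iff[OF Tr])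
  have Qd: "x - y \<in> Q" if "x \<in> Q" "y \<in> Q" for x y
    using Qi(3)[of x "-1 * y"] Qi(4)[of "-1" y] TC that by auto
  obtain N :: nat where N: "N > 0" "\<And>x. x \<in> K \<Longrightarrow> (\<And>P. P \<in> Z \<Longrightarrow> ge P (int N) x) \<Longrightarrow> x \<in> T"
    using semilocal_conductor[OF T] by blast
  obtain M :: nat where M: "\<forall>P\<in>Z. v P a \<le> int M" using int_bound[OF Z(1), of "\<lambda>P. v P a"] by blast
  have deep: "y \<in> Q" if y: "y \<in> K" "\<And>P. P \<in> Z \<Longrightarrow> ge P (int (N + M)) y" for y
  proof -
    have "y / a \<in> T"
    proof (rule N(2))
      show "y / a \<in> K" using y a Qi TK K_closed by auto
      fix P assume P: "P \<in> Z"
      have "ge P (int (N + M) - v P a) (y / a)"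
        using y(2)[OF P] P Z y(1) a Qi(1) TK by (intro ge_divide) auto
      then show "ge P (int N) (y / a)" by (rule ge_mono) (use M P in auto)
    qed
    then have "(y / a) * a \<in> Q" using Qi(4) a by blast
    then show ?thesis using a by simp
  qed
  have resid: "\<exists>P\<in>Z. \<exists>c\<in>C. ge P 1 (x - c) \<and> x - c \<in> Q" if x: "x \<in> T" for x
  proof -
    have "\<forall>P\<in>Z. \<exists>c\<in>C. ge P 1 (x - c)" using residue T0 x Z TK by blast
    then obtain c where c: "\<And>P. P \<in> Z \<Longrightarrow> c P \<in> C \<and> ge P 1 (x - c P)" by metis
    define w where "w = (\<Prod>P\<in>Z. x - c P)"
    have xc: "x - c P \<in> T" if "P \<in> Z" for P using c[OF that] x CT TC by auto
    have wT: "w \<in> T" unfolding w_def using xc by (intro sring_prod[OF Tr]) auto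
    have "ge P 1 w" if P: "P \<in> Z" for P
      unfolding w_def using Z P xc c TK T0 by (intro ge_prod1[where j = P]) auto
    then have "w ^ (N + M) \<in> Q" using wT TK Z
      by (intro deep ge_power1) (auto intro!: K_closed intro: C_K)
    then have "w \<in> Q" by (rule primeideal_power[OF Tr Q wT])
    then obtain P where "P \<in> Z" "x - c P \<in> Q"
      using primeideal_prod[OF Tr Q Z(1), of "\<lambda>P. x - c P"] xc by (auto simp: w_def)
    then show ?thesis using c by blast
  qed
  have "\<exists>P\<in>Z. \<forall>x\<in>Q. ge P 1 x"
  proof (rule ccontr)
    assume neg: "\<not> ?thesis"
    have "\<exists>x\<in>Q. \<forall>P\<in>Y. \<not> ge P 1 x" if "finite Y" "Y \<subseteq> Z" for Y
      using that
    proof (induction Y rule: finite_induct)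
      case empty
      then show ?case using Qi by auto
    next
      case (insert P Y)
      then obtain x where x: "x \<in> Q" "\<forall>P\<in>Y. \<not> ge P 1 x" by auto
      obtain y where y: "y \<in> Q" "\<not> ge P 1 y" using neg insert by auto
      have "\<exists>c\<in>C. c \<noteq> 0 \<and> (\<forall>P\<in>insert P Y. \<not> ge P 1 (x + c * y))"
        using insert x y Qi TK Z by (intro avoid_cancellation) auto
      then obtain c where "c \<in> C" "\<forall>P\<in>insert P Y. \<not> ge P 1 (x + c * y)" by auto
      moreover have "x + c * y \<in> Q" using x y Qi CT \<open>c \<in> C\<close> by auto
      ultimately show ?case by blast
    qed
    from this[OF Z(1) subset_refl] obtain x where x: "x \<in> Q" "\<forall>P\<in>Z. \<not> ge P 1 x" by blast
    have "x \<in> T" using x(1) Qi(1) by auto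
    from resid[OF this] obtain P c where P: "P \<in> Z" "c \<in> C" "ge P 1 (x - c)" "x - c \<in> Q"
      by (elim bexE conjE)
    have "c \<noteq> 0" using P(1,3) x(2) by force
    moreover have "c \<in> Q" using Qd[OF x(1) P(4)] by simp
    moreover have "inverse c \<in> T" using P CT C_inverse by auto
    ultimately show False using ideal_eq_carrier[OF Tr Qid] QT by blast
  qed
  then obtain P where P: "P \<in> Z" "\<forall>x\<in>Q. ge P 1 x" by blast
  have "x \<in> Q" if x: "x \<in> T" "ge P 1 x" for x
  proof -
    from resid[OF x(1)] obtain P1 c where c: "P1 \<in> Z" "c \<in> C" "ge P1 1 (x - c)" "x - c \<in> Q" by (elim bexE conjE)
    have PX: "P \<in> PP" using P(1) Z(2) by blast
    have "ge P 1 (x - c)" using P(2) c(4) by blast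
    then have "ge P 1 c" by (rule ge_cancel[OF PX subsetD[OF TK x(1)] C_K[OF c(2)] x(2)])
    then have "c = 0" using not_ge_const[OF PX c(2)] by blast
    then show ?thesis using c by simp
  qed
  then have "Q = {x\<in>T. ge P 1 x}" using P(2) Qi(1) by blast
  then show ?thesis using P(1) by (intro bexI)
qed

text \<open>Local means that the residue of an element does not depend on the place.\<close>

definition curve_local :: "'p set \<Rightarrow> 'l set \<Rightarrow> bool" where
  "curve_local Z S \<longleftrightarrow> semilocal Z S \<and> Z \<noteq> {} \<and> (\<forall>x\<in>S. \<exists>c\<in>C. \<forall>P\<in>Z. ge P 1 (x - c))"

definition mx :: "'p set \<Rightarrow> 'l set \<Rightarrow> 'l set" where
  "mx Z S = {x\<in>S. \<forall>P\<in>Z. ge P 1 x}"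

lemma curve_localD:
  assumes "curve_local Z S"
  shows "semilocal Z S" "finite Z" "Z \<subseteq> PP" "Z \<noteq> {}" "sring S" "S \<subseteq> K" "C \<subseteq> S"
    "\<And>x P. x \<in> S \<Longrightarrow> P \<in> Z \<Longrightarrow> ge P 0 x"
  using assms by (auto simp: curve_local_def semilocal_def)

lemma curve_local_residue:
  assumes "curve_local Z S" "x \<in> S"
  obtains c where "c \<in> C" "\<And>P. P \<in> Z \<Longrightarrow> ge P 1 (x - c)"
  using assms unfolding curve_local_def by blast

lemma curve_local_mx_iff:
  assumes G: "curve_local Z S" and "P \<in> Z" "x \<in> S"
  shows "ge P 1 x \<longleftrightarrow> x \<in> mx Z S"
proof
  assume x: "ge P 1 x"
  obtain c where c: "c \<in> C" "\<And>P. P \<in> Z \<Longrightarrow> ge P 1 (x - c)" using curve_local_residue[OF G assms(3)] by blast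
  have "ge P 1 c" using c x assms curve_localD(3,6)[OF G] by (rule_tac ge_cancel[of P x]) (auto intro: C_K)
  then have "c = 0" using not_ge_const[of P c] assms(2) curve_localD(3)[OF G] c by blast
  then show "x \<in> mx Z S" using c assms by (auto simp: mx_def)
qed (use assms in \<open>auto simp: mx_def\<close>)

lemma curve_local_v0:
  assumes G: "curve_local Z S" and "x \<in> S" "x \<notin> mx Z S" "P \<in> Z"
  shows "x \<noteq> 0" "v P x = 0"
  using curve_local_mx_iff[OF G assms(4,2)] assms curve_localD(8)[OF G assms(2,4)]
  by (auto simp: ge_def)

text \<open>Divided by its residue, \<open>x\<close> becomes \<open>1 - u\<close> with \<open>u\<close> of positive order. The geometric series for the
  inverse may be cut off, because its tail lies in the conductor.\<close>

lemma curve_local_unit: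
  assumes G: "curve_local Z S" and x: "x \<in> S" "x \<notin> mx Z S"
  shows "inverse x \<in> S"
proof -
  note D = curve_localD[OF G]
  note SC = sring_closed[OF D(5)]
  obtain N :: nat where N: "\<And>x. x \<in> K \<Longrightarrow> (\<And>P. P \<in> Z \<Longrightarrow> ge P (int N) x) \<Longrightarrow> x \<in> S"
    using semilocal_conductor[OF D(1)] by blast
  obtain c where c: "c \<in> C" "\<And>P. P \<in> Z \<Longrightarrow> ge P 1 (x - c)" using curve_local_residue[OF G x(1)] by blast
  have x0: "x \<noteq> 0" using curve_local_v0[OF G x] D(4) by auto
  have c0: "c \<noteq> 0" using c x by (auto simp: mx_def)
  define u where "u = 1 - x / c"
  have icS: "inverse c \<in> S" using c D(7) C_inverse by auto
  have uS: "u \<in> S" unfolding u_def divide_inverse using SC x icS by auto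
  have xK: "x \<in> K" using x D by auto
  have u1: "ge P 1 u" if P: "P \<in> Z" for P
  proof -
    have "ge P 1 ((- inverse c) * (x - c))" using c P D xK
      by (intro ge_const_mult) (auto intro!: C_closed K_closed intro: C_K)
    also have "(- inverse c) * (x - c) = u" using c0 by (simp add: u_def field_simps)
    finally show ?thesis .
  qed
  have uK: "u \<in> K" using uS D by auto
  have A: "inverse x * u ^ N \<in> S"
  proof (rule N)
    show "inverse x * u ^ N \<in> K" using xK uK by (auto intro!: K_closed intro: C_K)
    fix P assume P: "P \<in> Z"
    have "ge P 0 (inverse x)" using P curve_local_v0[OF G x P] D v_inverse[of P x] xK by (auto simp: ge_def)
    then show "ge P (int N) (inverse x * u ^ N)"
      using P D xK uK u1[OF P] by (intro ge_mult0 ge_power1) (auto intro!: K_closed intro: C_K)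
  qed
  have B: "inverse c * (\<Sum>i<N. u ^ i) \<in> S"
    using icS uS by (intro SC sring_sum[OF D(5)]) auto
  have "x = c * (1 - u)" using c0 by (simp add: u_def)
  then have "x * (inverse c * (\<Sum>i<N. u ^ i)) = 1 - u ^ N"
    using c0 one_diff_power_eq[of u N] by simp
  then have "x * (inverse c * (\<Sum>i<N. u ^ i) + inverse x * u ^ N) = 1"
    using x0 by (simp add: distrib_left mult.assoc[symmetric])
  then have "inverse x = inverse c * (\<Sum>i<N. u ^ i) + inverse x * u ^ N"
    using x0 by (metis inverse_unique)
  then show ?thesis using A B SC by metis
qed

lemma curve_local_mx_ideal:
  assumes G: "curve_local Z S"
  shows "ideal (mx Z S) (as_ring S)"
proof -
  note D = curve_localD[OF G]
  note SC = sring_closed[OF D(5)]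
  show ?thesis
    using D SC
    by (intro ideal_as_ringI) (auto simp: mx_def subset_iff intro!: ge_add ge_mult0)
qed

lemma curve_local_deep_nonzero:
  assumes G: "curve_local Z S"
  shows "\<exists>x. x \<in> mx Z S \<and> x \<noteq> 0"
proof -
  note D = curve_localD[OF G]
  obtain N :: nat where N: "N > 0" "\<And>x. x \<in> K \<Longrightarrow> (\<And>P. P \<in> Z \<Longrightarrow> ge P (int N) x) \<Longrightarrow> x \<in> S"
    using semilocal_conductor[OF D(1)] by blast
  obtain x where "x \<in> K" "x \<noteq> 0" "\<forall>P\<in>Z. v P x = int N" using approx[of Z "\<lambda>_. int N"] D by auto
  then show ?thesis using N by (intro exI[of _ x]) (auto simp: mx_def ge_def)
qed

lemma curve_local_mx_maximal:
  assumes G: "curve_local Z S"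
  shows "maximalideal J (as_ring S) \<longleftrightarrow> J = mx Z S"
proof -
  note D = curve_localD[OF G]
  have proper: "J \<subseteq> mx Z S" if J: "ideal J (as_ring S)" "J \<noteq> S" for J
  proof
    fix x assume x: "x \<in> J"
    then have xS: "x \<in> S" using J by (auto simp: ideal_as_ring_iff[OF D(5)])
    show "x \<in> mx Z S"
    proof (rule ccontr)
      assume n: "x \<notin> mx Z S"
      have "x \<noteq> 0" using curve_local_v0[OF G xS n] D(4) by auto
      then show False using ideal_eq_carrier[OF D(5) J(1) x] curve_local_unit[OF G xS n] J by auto
    qed
  qed
  have "1 \<notin> mx Z S" using D(3,4) not_ge_const[OF _ C_closed(2)] by (auto simp: mx_def)
  then have ne: "mx Z S \<noteq> S" using sring_1[OF D(5)] by auto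
  show ?thesis
  proof
    assume J: "maximalideal J (as_ring S)"
    then interpret maximalideal J "as_ring S" .
    have "J \<subseteq> mx Z S" using proper[OF ideal_axioms] I_notcarr by auto
    then show "J = mx Z S"
      using I_maximal[OF curve_local_mx_ideal[OF G]] ne by (auto simp: mx_def)
  next
    assume "J = mx Z S"
    then show "maximalideal J (as_ring S)"
      using ne proper curve_local_mx_ideal[OF G] by (intro maximalidealI) auto
  qed
qed

lemma curve_local_max_ideal:
  assumes "curve_local Z S"
  shows "max_ideal (as_ring S) = mx Z S"
  unfolding max_ideal_def using curve_local_mx_maximal[OF assms] by simp

lemma curve_local_prime:
  assumes G: "curve_local Z S" and "primeideal Q (as_ring S)" "a \<in> Q" "a \<noteq> 0"
  shows "Q = mx Z S"
proof -
  obtain P where P: "P \<in> Z" "Q = {x\<in>S. ge P 1 x}"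
    using semilocal_prime[OF curve_localD(1)[OF G] assms(2-4)] by blast
  show ?thesis unfolding P(2) using curve_local_mx_iff[OF G P(1)] by (auto simp: mx_def)
qed

text \<open>By \<open>curve_local_prime\<close> there is only one non-zero prime ideal.\<close>

lemma curve_local_krull_dim:
  assumes G: "curve_local Z S"
  shows "krull_dim (as_ring S) = 1"
proof -
  note D = curve_localD[OF G]
  have m: "primeideal (mx Z S) (as_ring S)"
  proof -
    interpret cring "as_ring S" by (rule cring_as_ring[OF D(5)])
    show ?thesis using curve_local_mx_maximal[OF G] maximalideal_prime by blast
  qed
  have z: "primeideal {0} (as_ring S)"
    using D sring_closed[OF D(5)]
    by (auto simp: primeideal_as_ring_iff[OF D(5)] ideal_as_ring_iff[OF D(5)])
  obtain a where a: "a \<in> mx Z S" "a \<noteq> 0" using curve_local_deep_nonzero[OF G] by auto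
  have "prime_chain (as_ring S) (\<lambda>i. if i = 0 then {0} else mx Z S) 1"
    using m z a sring_0[OF D(5)] by (auto simp: prime_chain_def mx_def)
  then have one_le: "1 \<le> krull_dim (as_ring S)"
    unfolding krull_dim_def one_enat_def by (intro Sup_upper) blast
  have "n \<le> 1" if "prime_chain (as_ring S) P n" for n P
  proof (rule ccontr)
    assume n: "\<not> n \<le> 1"
    then have p: "primeideal (P 0) (as_ring S)" "primeideal (P 1) (as_ring S)" "primeideal (P 2) (as_ring S)"
      "P 0 \<subset> P 1" "P 1 \<subset> P 2"
      using that by (auto simp: prime_chain_def numeral_2_eq_2)
    have "0 \<in> P 0" using p(1) by (auto simp: primeideal_as_ring_iff[OF D(5)] ideal_as_ring_iff[OF D(5)])
    then obtain b where b: "b \<in> P 1" "b \<noteq> 0" using p(4) by auto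
    then have "P 1 = mx Z S" "P 2 = mx Z S" using curve_local_prime[OF G] p by blast+
    then show False using p by simp
  qed
  then have "krull_dim (as_ring S) \<le> 1"
    unfolding krull_dim_def one_enat_def by (intro Sup_least) auto
  then show ?thesis using one_le by simp
qed

end

section \<open>Multiplicity and regularity\<close>

context places
begin

text \<open>Fractional ideals of the normalization; they filter everything by subquotients that are one-dimensional over \<open>C\<close>.\<close>

definition Fil :: "'p set \<Rightarrow> ('p \<Rightarrow> int) \<Rightarrow> 'l set" where
  "Fil Z h = {x\<in>K. \<forall>P\<in>Z. ge P (h P) x}"

definition subsp :: "'l set \<Rightarrow> bool" where
  "subsp V \<longleftrightarrow> V \<subseteq> K \<and> (\<forall>x\<in>V. \<forall>y\<in>V. x - y \<in> V) \<and> (\<forall>c\<in>C. \<forall>x\<in>V. c * x \<in> V)"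

lemma subsp_add:
  assumes "subsp V" "x \<in> V" "y \<in> V"
  shows "x + y \<in> V"
proof -
  have "-1 * y \<in> V" using assms sring_uminus[OF C sring_1[OF C]] unfolding subsp_def by blast
  then have "x - (-1 * y) \<in> V" using assms unfolding subsp_def by blast
  then show ?thesis by simp
qed

lemma ge_plus: "ge P (m + int k) x \<Longrightarrow> ge P m x"
  by (rule ge_mono) auto

lemma Fil_upd_codim:
  assumes Z: "finite Z" "Z \<subseteq> PP" and P: "P \<in> Z" and x: "x \<in> Fil Z h"
    and y: "y \<in> Fil Z h" "y \<notin> Fil Z (h(P := h P + 1))"
  shows "\<exists>c\<in>C. x - c * y \<in> Fil Z (h(P := h P + 1))"
proof -
  have PX: "P \<in> PP" and xK: "x \<in> K" and yK: "y \<in> K" using x y P Z by (auto simp: Fil_def)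
  have "\<not> ge P (h P + 1) y" "ge P (h P) y"
    using y P by (auto simp: Fil_def split: if_splits)
  then have y0: "y \<noteq> 0" "v P y = h P" by (auto simp: ge_def)
  have "ge P (h P - v P y) (x / y)" using x P PX xK yK y0 by (intro ge_divide) (auto simp: Fil_def)
  then have "ge P 0 (x / y)" using y0 by simp
  then obtain c where c: "c \<in> C" "ge P 1 (x / y - c)" using residue[OF PX K_divide[OF xK yK]] by auto
  have cK: "c \<in> K" using c C_K by auto
  have "ge P (1 + h P) ((x / y - c) * y)"
    using c PX xK yK y0 cK by (intro ge_mult) (auto intro!: K_closed simp: ge_def)
  also have "(x / y - c) * y = x - c * y" using y0 by (simp add: field_simps)
  finally have 1: "ge P (h P + 1) (x - c * y)" by (simp add: add.commute)
  have "ge Q (h Q) (x - c * y)" if "Q \<in> Z" for Q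
    using that x y Z c xK yK cK by (intro ge_diff ge_const_mult) (auto simp: Fil_def intro!: K_closed)
  then have "x - c * y \<in> Fil Z (h(P := h P + 1))"
    using 1 xK yK cK by (auto simp: Fil_def intro!: K_closed)
  then show ?thesis using c by blast
qed

lemma subsp_Fil: "Z \<subseteq> PP \<Longrightarrow> subsp (Fil Z h)"
  by (auto simp: subsp_def Fil_def subset_iff intro!: K_closed ge_diff ge_const_mult intro: C_K)

text \<open>Raising \<open>h\<close> by one at one place costs at most one dimension over \<open>C\<close>, hence at most one jump of a chain of
  subspaces; induction over the total distance \<open>k\<close>.\<close>

lemma chain_jumps:
  assumes Z: "finite Z" "Z \<subseteq> PP"
    and J: "\<And>i. i \<le> L \<Longrightarrow> subsp (J i) \<and> Fil Z (\<lambda>P. h P + int (k P)) \<subseteq> J i \<and> J i \<subseteq> Fil Z h"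
    and mono: "\<And>i. i < L \<Longrightarrow> J i \<subseteq> J (Suc i)"
  shows "card {i. i < L \<and> J i \<noteq> J (Suc i)} \<le> (\<Sum>P\<in>Z. k P)"
  using J mono
proof (induction "\<Sum>P\<in>Z. k P" arbitrary: h k J)
  case 0
  then have k: "\<forall>P\<in>Z. k P = 0" using Z by auto
  have "Fil Z (\<lambda>P. h P + int (k P)) = Fil Z h" using k by (auto simp: Fil_def)
  then have "J i = Fil Z h" if "i \<le> L" for i using 0(2)[OF that] by auto
  then have no_jump: "{i. i < L \<and> J i \<noteq> J (Suc i)} = {}" by auto
  show ?case unfolding no_jump by simp
next
  case (Suc s)
  then have "\<exists>P\<in>Z. k P \<noteq> 0" using Z by (metis sum.neutral Zero_not_Suc)
  then obtain P where P: "P \<in> Z" "k P \<noteq> 0" by blast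
  define h' where "h' = h(P := h P + 1)"
  define k' where "k' = k(P := k P - 1)"
  define J' where "J' i = J i \<inter> Fil Z h'" for i
  have hk: "(\<lambda>P. h' P + int (k' P)) = (\<lambda>P. h P + int (k P))"
    using P by (auto simp: h'_def k'_def fun_eq_iff)
  have "(\<Sum>P\<in>Z. k P) = k P + sum k (Z - {P})" "(\<Sum>P\<in>Z. k' P) = k' P + sum k' (Z - {P})"
    using Z P by (auto simp: sum.remove)
  moreover have "sum k' (Z - {P}) = sum k (Z - {P})" by (rule sum.cong) (auto simp: k'_def)
  ultimately have sk: "(\<Sum>P\<in>Z. k P) = Suc (\<Sum>P\<in>Z. k' P)" using P by (simp add: k'_def)
  have sub: "Fil Z h' \<subseteq> Fil Z h"
  proof -
    have "ge Q (h Q) x" if "ge Q (h' Q) x" for Q x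
      using that by (rule ge_mono) (auto simp: h'_def)
    then show ?thesis by (auto simp: Fil_def)
  qed
  have subk: "Fil Z (\<lambda>P. h P + int (k P)) \<subseteq> Fil Z h'"
  proof -
    have "ge Q (h' Q) x" if "ge Q (h Q + int (k Q)) x" for Q x
      using that by (rule ge_mono) (use P in \<open>auto simp: h'_def\<close>)
    then show ?thesis by (auto simp: Fil_def)
  qed
  have IH: "card {i. i < L \<and> J' i \<noteq> J' (Suc i)} \<le> (\<Sum>P\<in>Z. k' P)"
  proof (rule Suc(1))
    show "s = (\<Sum>P\<in>Z. k' P)" using Suc(2) sk by simp
    show "subsp (J' i) \<and> Fil Z (\<lambda>P. h' P + int (k' P)) \<subseteq> J' i \<and> J' i \<subseteq> Fil Z h'" if "i \<le> L" for i
      using Suc(3)[OF that] subk subsp_Fil[OF Z(2), of h'] unfolding hk J'_def by (auto simp: subsp_def)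
    show "J' i \<subseteq> J' (Suc i)" if "i < L" for i
      using Suc(4)[OF that] by (auto simp: J'_def)
  qed
  define E where "E = {i. i < L \<and> J i \<subseteq> Fil Z h' \<and> \<not> J (Suc i) \<subseteq> Fil Z h'}"
  have "{i. i < L \<and> J i \<noteq> J (Suc i)} \<subseteq> {i. i < L \<and> J' i \<noteq> J' (Suc i)} \<union> E"
  proof (rule subsetI, rule ccontr)
    fix i assume i: "i \<in> {i. i < L \<and> J i \<noteq> J (Suc i)}" "i \<notin> {i. i < L \<and> J' i \<noteq> J' (Suc i)} \<union> E"
    then have iL: "i < L" "J i \<noteq> J (Suc i)" "J' i = J' (Suc i)" by auto
    then obtain x where x: "x \<in> J (Suc i)" "x \<notin> J i" using Suc(4)[of i] by auto
    then have nx: "x \<notin> Fil Z h'" using iL by (auto simp: J'_def)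
    then have "\<not> J i \<subseteq> Fil Z h'" using i iL x by (auto simp: E_def)
    then obtain y where y: "y \<in> J i" "y \<notin> Fil Z h'" by auto
    have xh: "x \<in> Fil Z h" "y \<in> Fil Z h" using x y Suc(3)[of i] Suc(3)[of "Suc i"] iL by auto
    then obtain c where c: "c \<in> C" "x - c * y \<in> Fil Z h'"
      using Fil_upd_codim[OF Z P(1), of x h y] y unfolding h'_def by auto
    have "x - c * y \<in> J (Suc i)"
      using x y c Suc(3)[of "Suc i"] Suc(4)[of i] iL by (auto simp: subsp_def)
    then have "x - c * y \<in> J i" using c iL by (auto simp: J'_def)
    moreover have "subsp (J i)" using Suc(3)[of i] iL by auto
    moreover have "c * y \<in> J i" using c y \<open>subsp (J i)\<close> by (auto simp: subsp_def)
    ultimately have "(x - c * y) + c * y \<in> J i" by (intro subsp_add)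
    then show False using x by simp
  qed
  then have "card {i. i < L \<and> J i \<noteq> J (Suc i)} \<le> card ({i. i < L \<and> J' i \<noteq> J' (Suc i)} \<union> E)"
    by (intro card_mono) (auto simp: E_def)
  also have "\<dots> \<le> card {i. i < L \<and> J' i \<noteq> J' (Suc i)} + card E" by (rule card_Un_le)
  also have "card E \<le> 1"
  proof -
    have mon: "J i \<subseteq> J j" if "i \<le> j" "j \<le> L" for i j
      using that
    proof (induction j rule: dec_induct)
      case (step n)
      then show ?case using Suc(4)[of n] by auto
    qed auto
    have "i = j" if "i \<in> E" "j \<in> E" for i j
    proof -
      have "\<not> i < j" "\<not> j < i" using that mon[of "Suc i" j] mon[of "Suc j" i] by (auto simp: E_def Suc_le_eq)
      then show ?thesis by auto
    qed
    then show ?thesis by (metis card_le_Suc0_iff_eq card.infinite One_nat_def le0)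
  qed
  finally show ?case using sk IH by simp
qed

text \<open>Conversely, lowering the required order at one place at a time gives a strict chain, since the
  approximation property provides elements of exactly prescribed orders.\<close>

lemma Fil_chain:
  assumes Z: "finite Z" "Z \<subseteq> PP"
  shows "\<exists>J. J 0 = Fil Z (\<lambda>P. h P + int (k P)) \<and>
    (\<forall>i\<le>\<Sum>P\<in>Z. k P. \<exists>k'. J i = Fil Z (\<lambda>P. h P + int (k' P)) \<and> (\<forall>P. k' P \<le> k P)) \<and>
    (\<forall>i<\<Sum>P\<in>Z. k P. J i \<subset> J (Suc i))"
proof (induction "\<Sum>P\<in>Z. k P" arbitrary: k)
  case 0
  then have s: "sum k Z = 0" by simp
  show ?case unfolding s by (rule exI[of _ "\<lambda>_. Fil Z (\<lambda>P. h P + int (k P))"]) auto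
next
  case (Suc s)
  then have "\<exists>P\<in>Z. k P \<noteq> 0" using Z by (metis sum.neutral Zero_not_Suc)
  then obtain P where P: "P \<in> Z" "k P \<noteq> 0" by blast
  define k1 where "k1 = k(P := k P - 1)"
  have "(\<Sum>P\<in>Z. k P) = k P + sum k (Z - {P})" "(\<Sum>P\<in>Z. k1 P) = k1 P + sum k1 (Z - {P})"
    using Z P by (auto simp: sum.remove)
  moreover have "sum k1 (Z - {P}) = sum k (Z - {P})" by (rule sum.cong) (auto simp: k1_def)
  ultimately have sk: "(\<Sum>P\<in>Z. k P) = Suc (\<Sum>P\<in>Z. k1 P)" using P by (simp add: k1_def)
  obtain J where J: "J 0 = Fil Z (\<lambda>P. h P + int (k1 P))"
    "\<forall>i\<le>\<Sum>P\<in>Z. k1 P. \<exists>k'. J i = Fil Z (\<lambda>P. h P + int (k' P)) \<and> (\<forall>P. k' P \<le> k1 P)"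
    "\<forall>i<\<Sum>P\<in>Z. k1 P. J i \<subset> J (Suc i)"
    using Suc(1)[of k1] Suc(2) sk by auto
  have le: "k1 P \<le> k P" for P by (auto simp: k1_def)
  obtain u where u: "u \<in> K" "u \<noteq> 0" "\<forall>Q\<in>Z. v Q u = h Q + int (k1 Q)" using approx[OF Z, of "\<lambda>Q. h Q + int (k1 Q)"] by blast
  have "u \<in> Fil Z (\<lambda>P. h P + int (k1 P))" using u by (auto simp: Fil_def ge_def)
  moreover have "u \<notin> Fil Z (\<lambda>P. h P + int (k P))"
    using u P by (auto simp: Fil_def ge_def k1_def intro!: bexI[of _ P])
  moreover have "Fil Z (\<lambda>P. h P + int (k P)) \<subseteq> Fil Z (\<lambda>P. h P + int (k1 P))"
    using le by (auto simp: Fil_def intro: ge_mono)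
  ultimately have strict: "Fil Z (\<lambda>P. h P + int (k P)) \<subset> J 0" unfolding J(1) by auto
  define J' where "J' = case_nat (Fil Z (\<lambda>P. h P + int (k P))) J"
  show ?case unfolding sk
  proof (intro exI[of _ J'] conjI allI impI)
    fix i assume i: "i \<le> Suc (sum k1 Z)"
    show "\<exists>k'. J' i = Fil Z (\<lambda>P. h P + int (k' P)) \<and> (\<forall>P. k' P \<le> k P)"
    proof (cases i)
      case 0
      then show ?thesis by (auto simp: J'_def)
    next
      case (Suc j)
      then obtain k' where "J j = Fil Z (\<lambda>P. h P + int (k' P))" "\<forall>P. k' P \<le> k1 P" using J(2) i by auto
      then show ?thesis using Suc le by (intro exI[of _ k']) (auto simp: J'_def intro: order_trans)
    qed
  next
    fix i assume i: "i < Suc (sum k1 Z)"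
    show "J' i \<subset> J' (Suc i)" using i J(3) strict by (cases i) (auto simp: J'_def)
  qed (auto simp: J'_def)
qed

text \<open>An element of least order simultaneously at all places, that is, a minimal reduction of the maximal ideal.\<close>

definition minel :: "'p set \<Rightarrow> 'l set \<Rightarrow> 'l \<Rightarrow> bool" where
  "minel Z S x \<longleftrightarrow> x \<in> mx Z S \<and> x \<noteq> 0 \<and> (\<forall>y\<in>mx Z S. \<forall>P\<in>Z. ge P (v P x) y)"

lemma minel_pos: "minel Z S x \<Longrightarrow> P \<in> Z \<Longrightarrow> 1 \<le> v P x"
  by (auto simp: minel_def mx_def ge_def)

lemma max_ideal_power:
  assumes G: "curve_local Z S" and x: "minel Z S x"
  defines "m n \<equiv> mx Z S [^]\<^bsub>ideals_set (as_ring S)\<^esub> (n::nat)"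
  shows "ideal (m n) (as_ring S)" "x ^ n \<in> m n" "\<And>y P. y \<in> m n \<Longrightarrow> P \<in> Z \<Longrightarrow> ge P (int n * v P x) y"
proof -
  note D = curve_localD[OF G]
  interpret cring "as_ring S" by (rule cring_as_ring[OF D(5)])
  have m0: "m 0 = S" by (simp add: m_def nat_pow_def ideals_set_def)
  have mS: "m (Suc n) = ideal_prod (as_ring S) (m n) (mx Z S)" for n
    by (simp add: m_def nat_pow_def ideals_set_def)
  have id: "ideal (m n) (as_ring S)" for n
  proof (induction n)
    case 0
    then show ?case using oneideal by (simp add: m0)
  next
    case (Suc n)
    then show ?case unfolding mS using curve_local_mx_ideal[OF G] by (intro ideal_prod_is_ideal)
  qed
  show "ideal (m n) (as_ring S)" by (rule id)
  show "x ^ n \<in> m n"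
  proof (induction n)
    case 0
    then show ?case using sring_1[OF D(5)] by (simp add: m0)
  next
    case (Suc n)
    have "x ^ n \<otimes>\<^bsub>as_ring S\<^esub> x \<in> m (Suc n)"
      unfolding mS using Suc x by (intro ideal_prod.prod) (auto simp: minel_def)
    then show ?case by (simp add: mult.commute)
  qed
  show "ge P (int n * v P x) y" if "y \<in> m n" and P: "P \<in> Z" for y P
    using that(1)
  proof (induction n arbitrary: y)
    case 0
    then show ?case using D(8) P by (simp add: m0)
  next
    case (Suc n)
    have sub: "m j \<subseteq> K" for j using id[of j] D(6) by (auto simp: ideal_as_ring_iff[OF D(5)])
    from Suc.prems show ?case unfolding mS
    proof (induction y rule: ideal_prod.induct)
      case (prod i j)
      have "ge P (int n * v P x + v P x) (i * j)"
        using Suc.IH[OF prod(1)] prod x P D sub[of n] by (intro ge_mult) (auto simp: minel_def mx_def)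
      then show ?case by (simp add: algebra_simps)
    next
      case (sum s1 s2)
      have "s1 \<in> K" "s2 \<in> K" using sum(1,2) sub[of "Suc n"] unfolding mS by auto
      then show ?case using sum D P by (auto intro!: ge_add)
    qed
  qed
qed

text \<open>The power \<open>m^n\<close> lies in the fractional ideal of order \<open>n v P x\<close>, and it contains \<open>x^n\<close> times the
  conductor. Up to an error that is independent of \<open>n\<close>, the length is that of the normalization modulo \<open>x^n\<close>.\<close>

lemma quotient_length_bounds:
  assumes G: "curve_local Z S" and x: "minel Z S x"
  obtains N :: nat where "\<And>n. n \<ge> N \<Longrightarrow>
    int n * (\<Sum>P\<in>Z. v P x) - int (card Z * N)
      \<le> int (the_enat (quotient_length (as_ring S) (max_ideal (as_ring S) [^]\<^bsub>ideals_set (as_ring S)\<^esub> n))) \<and>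
    int (the_enat (quotient_length (as_ring S) (max_ideal (as_ring S) [^]\<^bsub>ideals_set (as_ring S)\<^esub> n)))
      \<le> int n * (\<Sum>P\<in>Z. v P x) + int (card Z * N)"
proof -
  note D = curve_localD[OF G]
  obtain N :: nat where N: "N > 0" "\<And>y. y \<in> K \<Longrightarrow> (\<And>P. P \<in> Z \<Longrightarrow> ge P (int N) y) \<Longrightarrow> y \<in> S"
    using semilocal_conductor[OF D(1)] by blast
  define e where "e P = nat (v P x)" for P
  have e: "v P x = int (e P)" "1 \<le> e P" if "P \<in> Z" for P
    using minel_pos[OF x that] by (auto simp: e_def)
  have se: "(\<Sum>P\<in>Z. v P x) = int (\<Sum>P\<in>Z. e P)" using e by simp
  have xS: "x \<in> S" "x \<in> K" "x \<noteq> 0" using x D by (auto simp: minel_def mx_def)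
  have FilS: "Fil Z (\<lambda>P. int N + int (k P)) \<subseteq> S" for k
    using N(2) by (auto simp: Fil_def intro: ge_plus)
  have FilI: "ideal (Fil Z (\<lambda>P. int N + int (k P))) (as_ring S)" for k
    using FilS[of k] D
    by (intro ideal_as_ringI) (auto simp: Fil_def subset_iff intro!: K_closed ge_add ge_mult0)
  show ?thesis
  proof (rule that[of N])
    fix n :: nat assume n: "n \<ge> N"
    define I where "I = mx Z S [^]\<^bsub>ideals_set (as_ring S)\<^esub> n"
    note mI = max_ideal_power[OF G x, where n = n, folded I_def]
    define k where "k P = n * e P - N" for P
    have kN: "N + k P = n * e P" if "P \<in> Z" for P
    proof -
      have "N * 1 \<le> n * e P" using e(2)[OF that] n by (intro mult_le_mono)
      then show ?thesis by (simp add: k_def)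
    qed
    have IF: "I \<subseteq> Fil Z (\<lambda>P. int N + int (k P))"
    proof
      fix y assume y: "y \<in> I"
      have "y \<in> K" using y mI(1) D by (auto simp: ideal_as_ring_iff[OF D(5)])
      moreover have "int n * v P x = int N + int (k P)" if "P \<in> Z" for P
        using kN[OF that] e(1)[OF that] by (metis of_nat_add of_nat_mult)
      ultimately show "y \<in> Fil Z (\<lambda>P. int N + int (k P))" using mI(3)[OF y] by (auto simp: Fil_def)
    qed
    have FI: "Fil Z (\<lambda>P. 0 + int (n * e P + N)) \<subseteq> I"
    proof
      fix y assume y: "y \<in> Fil Z (\<lambda>P. 0 + int (n * e P + N))"
      then have yK: "y \<in> K" by (auto simp: Fil_def)
      have "y / x ^ n \<in> S"
      proof (rule N(2))
        show "y / x ^ n \<in> K" using yK xS by (auto intro!: K_closed)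
        fix P assume P: "P \<in> Z"
        have "ge P (int (n * e P + N) - v P (x ^ n)) (y / x ^ n)"
          using y P D xS yK by (intro ge_divide) (auto simp: Fil_def intro!: K_closed)
        moreover have "v P (x ^ n) = int (n * e P)" using v_power[of P x n] P D xS e(1)[OF P] by auto
        ultimately show "ge P (int N) (y / x ^ n)" by simp
      qed
      moreover have "\<forall>s\<in>S. \<forall>x\<in>I. s * x \<in> I" using mI(1) by (auto simp: ideal_as_ring_iff[OF D(5)])
      ultimately have "y / x ^ n * x ^ n \<in> I" using mI(2) by blast
      then show "y \<in> I" using xS by simp
    qed
    define A where "A = {enat L | L. \<exists>J. (\<forall>i\<le>L. ideal (J i) (as_ring S) \<and> I \<subseteq> J i) \<and> (\<forall>i<L. J i \<subset> J (Suc i))}"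
    have ql: "quotient_length (as_ring S) I = Sup A" by (simp add: quotient_length_def A_def)
    have up: "L \<le> (\<Sum>P\<in>Z. n * e P + N)"
      if J: "\<forall>i\<le>L. ideal (J i) (as_ring S) \<and> I \<subseteq> J i" "\<forall>i<L. J i \<subset> J (Suc i)" for L J
    proof -
      have "card {i. i < L \<and> J i \<noteq> J (Suc i)} \<le> (\<Sum>P\<in>Z. n * e P + N)"
      proof (rule chain_jumps[OF D(2,3), where h = "\<lambda>_. 0"])
        fix i assume "i \<le> L"
        then have i: "ideal (J i) (as_ring S)" "I \<subseteq> J i" using J by auto
        then have Ji: "J i \<subseteq> S" "\<And>x y. x \<in> J i \<Longrightarrow> y \<in> J i \<Longrightarrow> x + y \<in> J i" "\<And>s x. s \<in> S \<Longrightarrow> x \<in> J i \<Longrightarrow> s * x \<in> J i"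
          by (auto simp: ideal_as_ring_iff[OF D(5)])
        have "x - y \<in> J i" if "x \<in> J i" "y \<in> J i" for x y
          using Ji(2)[of x "-1 * y"] Ji(3)[of "-1" y] that sring_closed[OF D(5)] by auto
        then have "subsp (J i)" using Ji D by (auto simp: subsp_def)
        moreover have "J i \<subseteq> Fil Z (\<lambda>_. 0)" using Ji(1) D by (auto simp: Fil_def)
        ultimately show "subsp (J i) \<and> Fil Z (\<lambda>P. 0 + int (n * e P + N)) \<subseteq> J i \<and> J i \<subseteq> Fil Z (\<lambda>_. 0)"
          using FI i by blast
      qed (use J in auto)
      moreover have "{i. i < L \<and> J i \<noteq> J (Suc i)} = {..<L}" using J by auto
      ultimately show ?thesis by simp
    qed
    then have "Sup A \<le> enat (\<Sum>P\<in>Z. n * e P + N)" by (intro Sup_least) (auto simp: A_def)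
    moreover have "enat (\<Sum>P\<in>Z. k P) \<le> Sup A"
    proof -
      obtain J where J: "J 0 = Fil Z (\<lambda>P. int N + int (k P))"
        "\<forall>i\<le>\<Sum>P\<in>Z. k P. \<exists>k'. J i = Fil Z (\<lambda>P. int N + int (k' P)) \<and> (\<forall>P. k' P \<le> k P)"
        "\<forall>i<\<Sum>P\<in>Z. k P. J i \<subset> J (Suc i)"
        using Fil_chain[OF D(2,3), of "\<lambda>_. int N" k] by blast
      have "ideal (J i) (as_ring S) \<and> I \<subseteq> J i" if i: "i \<le> (\<Sum>P\<in>Z. k P)" for i
      proof -
        obtain k' where k': "J i = Fil Z (\<lambda>P. int N + int (k' P))" "\<forall>P. k' P \<le> k P" using J(2) i by blast
        have "Fil Z (\<lambda>P. int N + int (k P)) \<subseteq> J i"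
          unfolding k'(1) using k'(2) by (auto simp: Fil_def intro: ge_mono)
        then show ?thesis using k'(1) FilI IF by auto
      qed
      then show ?thesis using J(3) by (intro Sup_upper) (auto simp: A_def)
    qed
    ultimately obtain q where q: "Sup A = enat q" "(\<Sum>P\<in>Z. k P) \<le> q" "q \<le> (\<Sum>P\<in>Z. n * e P + N)"
      by (cases "Sup A") auto
    have "(\<Sum>P\<in>Z. N + k P) = (\<Sum>P\<in>Z. n * e P)" using kN by simp
    then have "card Z * N + (\<Sum>P\<in>Z. k P) = n * (\<Sum>P\<in>Z. e P)"
      by (simp add: sum.distrib sum_distrib_left)
    then have 1: "int n * int (\<Sum>P\<in>Z. e P) - int (card Z * N) \<le> int q"
      using q(2) by (metis add.commute add_le_cancel_left diff_le_eq of_nat_add of_nat_le_iff of_nat_mult)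
    have "q \<le> n * (\<Sum>P\<in>Z. e P) + card Z * N"
      using q(3) by (simp add: sum.distrib sum_distrib_left)
    then have 2: "int q \<le> int n * int (\<Sum>P\<in>Z. e P) + int (card Z * N)"
      by (metis of_nat_add of_nat_le_iff of_nat_mult)
    show "int n * (\<Sum>P\<in>Z. v P x) - int (card Z * N)
      \<le> int (the_enat (quotient_length (as_ring S) (max_ideal (as_ring S) [^]\<^bsub>ideals_set (as_ring S)\<^esub> n))) \<and>
    int (the_enat (quotient_length (as_ring S) (max_ideal (as_ring S) [^]\<^bsub>ideals_set (as_ring S)\<^esub> n)))
      \<le> int n * (\<Sum>P\<in>Z. v P x) + int (card Z * N)"
      using 1 2 unfolding curve_local_max_ideal[OF G] I_def[symmetric] ql q(1) se by simp
  qed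
qed

lemma curve_local_local_mult:
  assumes G: "curve_local Z S" and x: "minel Z S x"
  shows "local_mult (as_ring S) = real_of_int (\<Sum>P\<in>Z. v P x)"
proof -
  define q where "q n = the_enat (quotient_length (as_ring S) (max_ideal (as_ring S) [^]\<^bsub>ideals_set (as_ring S)\<^esub> n))" for n :: nat
  define e where "e = (\<Sum>P\<in>Z. v P x)"
  obtain N :: nat where N: "\<And>n. n \<ge> N \<Longrightarrow> int n * e - int (card Z * N) \<le> int (q n) \<and> int (q n) \<le> int n * e + int (card Z * N)"
    using quotient_length_bounds[OF G x] unfolding q_def e_def by blast
  define B where "B = real (card Z * N)"
  have bnd: "real_of_int e - B / real n \<le> real (q n) / real n \<and> real (q n) / real n \<le> real_of_int e + B / real n"
    if n: "n \<ge> Suc N" for n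
  proof -
    have "real_of_int (int n * e - int (card Z * N)) \<le> real_of_int (int (q n))"
      "real_of_int (int (q n)) \<le> real_of_int (int n * e + int (card Z * N))"
      using N[of n] n by (simp_all only: of_int_le_iff)
    then have "real n * e - B \<le> real (q n)" "real (q n) \<le> real n * e + B" by (simp_all add: B_def)
    then have "(real n * e - B) / real n \<le> real (q n) / real n" "real (q n) / real n \<le> (real n * e + B) / real n"
      by (auto intro!: divide_right_mono)
    moreover have "(real n * e - B) / real n = real_of_int e - B / real n"
      "(real n * e + B) / real n = real_of_int e + B / real n"
      using n by (simp_all add: diff_divide_distrib add_divide_distrib)
    ultimately show ?thesis by simp
  qed
  have lim0: "(\<lambda>n. B / real n) \<longlonglongrightarrow> 0" by (rule lim_const_over_n)
  have "(\<lambda>n. real (q n) / real n) \<longlonglongrightarrow> real_of_int e"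
  proof (rule tendsto_sandwich)
    show "\<forall>\<^sub>F n in sequentially. real_of_int e - B / real n \<le> real (q n) / real n"
      by (rule eventually_mono[OF eventually_ge_at_top[of "Suc N"]]) (use bnd in blast)
    show "\<forall>\<^sub>F n in sequentially. real (q n) / real n \<le> real_of_int e + B / real n"
      by (rule eventually_mono[OF eventually_ge_at_top[of "Suc N"]]) (use bnd in blast)
    show "(\<lambda>n. real_of_int e - B / real n) \<longlonglongrightarrow> real_of_int e" using tendsto_diff[OF tendsto_const lim0] by simp
    show "(\<lambda>n. real_of_int e + B / real n) \<longlonglongrightarrow> real_of_int e" using tendsto_add[OF tendsto_const lim0] by simp
  qed
  moreover have "the_enat (krull_dim (as_ring S)) = 1" using curve_local_krull_dim[OF G] by (simp add: one_enat_def)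
  ultimately show ?thesis
    unfolding local_mult_def Let_def q_def[symmetric] e_def[symmetric] by (simp add: limI)
qed

lemma principal_regular:
  assumes G: "curve_local Z S" and x: "x \<in> mx Z S" and gen: "\<And>y. y \<in> mx Z S \<Longrightarrow> \<exists>s\<in>S. y = s * x"
  shows "regular_local (as_ring S)"
proof -
  note D = curve_localD[OF G]
  interpret cring "as_ring S" by (rule cring_as_ring[OF D(5)])
  have xS: "x \<in> S" using x by (auto simp: mx_def)
  have "mx Z S = Idl\<^bsub>as_ring S\<^esub> {x}"
  proof
    show "Idl\<^bsub>as_ring S\<^esub> {x} \<subseteq> mx Z S" using curve_local_mx_ideal[OF G] x by (intro genideal_minimal) auto
    have id: "ideal (Idl\<^bsub>as_ring S\<^esub> {x}) (as_ring S)" using xS by (intro genideal_ideal) auto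
    have "x \<in> Idl\<^bsub>as_ring S\<^esub> {x}" using xS by (intro genideal_self') auto
    then show "mx Z S \<subseteq> Idl\<^bsub>as_ring S\<^esub> {x}"
      using gen id by (force simp: ideal_as_ring_iff[OF D(5)])
  qed
  then show ?thesis
    unfolding regular_local_def curve_local_max_ideal[OF G] curve_local_krull_dim[OF G]
    using xS by (intro exI[of _ "{x}"]) (auto simp: one_enat_def)
qed

lemma regular_principal:
  assumes G: "curve_local Z S" and R: "regular_local (as_ring S)"
  obtains x where "x \<in> mx Z S" "\<And>y. y \<in> mx Z S \<Longrightarrow> \<exists>s\<in>S. y = s * x"
proof -
  note D = curve_localD[OF G]
  interpret cring "as_ring S" by (rule cring_as_ring[OF D(5)])
  obtain A where A: "finite A" "A \<subseteq> S" "card A = 1" "mx Z S = Idl\<^bsub>as_ring S\<^esub> A"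
    using R unfolding regular_local_def curve_local_max_ideal[OF G] curve_local_krull_dim[OF G] by (auto simp: one_enat_def)
  then obtain x where x: "A = {x}" by (auto simp: card_1_singleton_iff)
  have xS: "x \<in> S" using A x by auto
  have "x \<in> Idl\<^bsub>as_ring S\<^esub> {x}" using xS by (intro genideal_self') auto
  moreover have "\<exists>s\<in>S. y = s * x" if "y \<in> mx Z S" for y
  proof -
    have "ideal {s * x | s. s \<in> S} (as_ring S)"
    proof (rule ideal_as_ringI[OF D(5)])
      show "{s * x |s. s \<in> S} \<subseteq> S" using xS sring_mult[OF D(5)] by auto
      show "0 \<in> {s * x |s. s \<in> S}" using sring_0[OF D(5)] by force
      show "a + b \<in> {s * x |s. s \<in> S}" if "a \<in> {s * x |s. s \<in> S}" "b \<in> {s * x |s. s \<in> S}" for a b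
        using that sring_add[OF D(5)] by (auto simp: distrib_right[symmetric])
      show "a * b \<in> {s * x |s. s \<in> S}" if "a \<in> S" "b \<in> {s * x |s. s \<in> S}" for a b
        using that sring_mult[OF D(5)] by (auto simp: mult.assoc[symmetric])
    qed
    moreover have "x \<in> {s * x | s. s \<in> S}" using sring_1[OF D(5)] by force
    ultimately have "Idl\<^bsub>as_ring S\<^esub> {x} \<subseteq> {s * x | s. s \<in> S}" by (intro genideal_minimal) auto
    then show ?thesis using that A x by auto
  qed
  ultimately show ?thesis using that A x by blast
qed

text \<open>With a principal maximal ideal \<open>(x)\<close>, the orders of any element are a common multiple \<open>j\<close> of the orders of \<open>x\<close>.
  But the conductor contains elements whose orders agree except for a difference of one at a single
  place; this leaves one place, where \<open>x\<close> has order one.\<close>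

lemma regular_imp_sum_1:
  assumes G: "curve_local Z S" and x0: "minel Z S x0" and R: "regular_local (as_ring S)"
  shows "(\<Sum>P\<in>Z. v P x0) = 1"
proof -
  note D = curve_localD[OF G]
  obtain x where x: "x \<in> mx Z S" "\<And>y. y \<in> mx Z S \<Longrightarrow> \<exists>s\<in>S. y = s * x" using regular_principal[OF G R] by blast
  have xx: "x \<noteq> 0" using x(2)[of x0] x0 by (auto simp: minel_def)
  have xS: "x \<in> S" "x \<in> K" using x D by (auto simp: mx_def)
  have xv: "1 \<le> v P x" if "P \<in> Z" for P using x(1) xx that by (auto simp: mx_def ge_def)
  have ord: "\<exists>j::nat. \<forall>P\<in>Z. v P y = int j * v P x" if "y \<in> S" "y \<noteq> 0" for y
  proof -
    obtain P0 where P0: "P0 \<in> Z" using D(4) by auto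
    show ?thesis using that
    proof (induction "nat (v P0 y)" arbitrary: y rule: less_induct)
      case less
      show ?case
      proof (cases "y \<in> mx Z S")
        case False
        then show ?thesis using curve_local_v0[OF G less(2)] by (intro exI[of _ 0]) auto
      next
        case True
        then obtain s where s: "s \<in> S" "y = s * x" using x(2) by blast
        have sv: "v P y = v P s + v P x" if "P \<in> Z" for P
          using s xS D that less(3) by (auto intro!: v_mult)
        have "0 \<le> v P0 s" using D(8)[OF s(1) P0] s less(3) by (auto simp: ge_def)
        then have "nat (v P0 s) < nat (v P0 y)" using sv[OF P0] xv[OF P0] by auto
        then obtain j :: nat where "\<forall>P\<in>Z. v P s = int j * v P x" using less(1) s less(3) by force
        then show ?thesis using sv by (intro exI[of _ "Suc j"]) (auto simp: algebra_simps)
      qed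
    qed
  qed
  obtain N :: nat where N: "N > 0" "\<And>y. y \<in> K \<Longrightarrow> (\<And>P. P \<in> Z \<Longrightarrow> ge P (int N) y) \<Longrightarrow> y \<in> S"
    using semilocal_conductor[OF D(1)] by blast
  have ex: "\<exists>j::nat. \<forall>P\<in>Z. int N + int (f P) = int j * v P x" for f
  proof -
    obtain u where u: "u \<in> K" "u \<noteq> 0" "\<forall>P\<in>Z. v P u = int N + int (f P)"
      using approx[OF D(2,3), of "\<lambda>P. int N + int (f P)"] by blast
    have "u \<in> S" using u by (intro N(2)) (auto simp: ge_def)
    then show ?thesis using ord[of u] u by auto
  qed
  obtain P0 where P0: "P0 \<in> Z" using D(4) by auto
  obtain j :: nat where j: "\<forall>P\<in>Z. int N = int j * v P x" using ex[of "\<lambda>_. 0"] by auto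
  obtain j' :: nat where j': "\<forall>P\<in>Z. int N + int (if P = P0 then 1 else 0) = int j' * v P x"
    using ex[of "\<lambda>P. if P = P0 then 1 else 0"] by blast
  have "int N = int j * v P0 x" "int N + 1 = int j' * v P0 x" using j j' P0 by auto
  then have d: "(int j' - int j) * v P0 x = 1" by (simp add: algebra_simps)
  then have v1: "v P0 x = 1" using d xv[OF P0] by (auto simp: zmult_eq_1_iff)
  have "P = P0" if P: "P \<in> Z" for P
  proof (rule ccontr)
    assume "P \<noteq> P0"
    then have "int N = int j * v P x" "int N = int j' * v P x" using j j' P by auto
    then have "int j = int j'" using xv[OF P] by simp
    then show False using d by simp
  qed
  then have Z: "Z = {P0}" using P0 by blast
  have "ge P0 (v P0 x0) x" using x0 x(1) P0 by (auto simp: minel_def)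
  then have "v P0 x0 \<le> 1" using xx v1 by (auto simp: ge_def)
  then show ?thesis using minel_pos[OF x0 P0] Z by simp
qed

text \<open>There is a single place and \<open>x0\<close> is a uniformizer, so expansion in powers of \<open>x0\<close> down to the conductor
  shows that the ring is the full valuation ring.\<close>

lemma sum_1_imp_regular:
  assumes G: "curve_local Z S" and x0: "minel Z S x0" and s: "(\<Sum>P\<in>Z. v P x0) = 1"
  shows "regular_local (as_ring S)"
proof -
  note D = curve_localD[OF G]
  obtain P0 where P0: "P0 \<in> Z" using D(4) by auto
  have s2: "(\<Sum>P\<in>Z. v P x0) = v P0 x0 + sum (\<lambda>P. v P x0) (Z - {P0})" using P0 D by (simp add: sum.remove)
  have p: "1 \<le> v P x0" if "P \<in> Z" for P using minel_pos[OF x0 that] .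
  have "0 \<le> sum (\<lambda>P. v P x0) (Z - {P0})" using p by (intro sum_nonneg) force
  then have v1: "v P0 x0 = 1" "sum (\<lambda>P. v P x0) (Z - {P0}) = 0" using s s2 p[OF P0] by auto
  have Z: "Z = {P0}"
  proof (rule ccontr)
    assume "Z \<noteq> {P0}"
    then obtain P where P: "P \<in> Z - {P0}" using P0 by auto
    have "v P x0 \<le> sum (\<lambda>P. v P x0) (Z - {P0})" using P p D by (intro member_le_sum) force+
    then show False using v1(2) p[of P] P by simp
  qed
  have xS: "x0 \<in> S" "x0 \<in> K" "x0 \<noteq> 0" using x0 D by (auto simp: minel_def mx_def)
  obtain N :: nat where N: "\<And>y. y \<in> K \<Longrightarrow> (\<And>P. P \<in> Z \<Longrightarrow> ge P (int N) y) \<Longrightarrow> y \<in> S"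
    using semilocal_conductor[OF D(1)] by blast
  have PX: "P0 \<in> PP" using P0 D by auto
  have full: "y \<in> S" if "y \<in> K" "ge P0 (int j) y" for j y
    using that
  proof (induction "N - j" arbitrary: j y)
    case 0
    then show ?case using N[of y] Z ge_mono[of P0 "int j" y "int N"] by auto
  next
    case (Suc d)
    have vx: "v P0 (x0 ^ j) = int j" using v_power[OF PX xS(2,3)] v1 by simp
    have "ge P0 (int j - v P0 (x0 ^ j)) (y / x0 ^ j)" using Suc PX xS by (intro ge_divide) (auto intro!: K_closed)
    then have "ge P0 0 (y / x0 ^ j)" using vx by simp
    then obtain c where c: "c \<in> C" "ge P0 1 (y / x0 ^ j - c)"
      using residue[OF PX, of "y / x0 ^ j"] Suc(3) xS by (auto intro!: K_closed)
    have "ge P0 (1 + int j) ((y / x0 ^ j - c) * x0 ^ j)"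
      using c Suc PX xS vx by (intro ge_mult) (auto intro!: K_closed intro: C_K simp: ge_def)
    moreover have "(y / x0 ^ j - c) * x0 ^ j = y - c * x0 ^ j" using xS by (simp add: field_simps)
    ultimately have "ge P0 (int (Suc j)) (y - c * x0 ^ j)" by simp
    then have "y - c * x0 ^ j \<in> S" using Suc c xS by (intro Suc(1)[of "Suc j"]) (auto intro!: K_closed intro: C_K)
    moreover have "c * x0 ^ j \<in> S" using c D xS sring_closed[OF D(5)] by auto
    ultimately have "(y - c * x0 ^ j) + c * x0 ^ j \<in> S" by (rule sring_add[OF D(5)])
    then show ?case by simp
  qed
  show ?thesis
  proof (rule principal_regular[OF G])
    show "x0 \<in> mx Z S" using x0 by (auto simp: minel_def)
    fix y assume y: "y \<in> mx Z S"
    then have yK: "y \<in> K" using D by (auto simp: mx_def)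
    have "ge P0 (1 - v P0 x0) (y / x0)" using y P0 PX xS yK by (intro ge_divide) (auto simp: mx_def)
    then have "y / x0 \<in> S" using v1 yK xS by (intro full[of _ 0]) (auto intro!: K_closed)
    then show "\<exists>s\<in>S. y = s * x0" using xS by (intro bexI[of _ "y / x0"]) auto
  qed
qed

end

section \<open>Maximal ideals with two generators\<close>

context places
begin

text \<open>The maximal ideal needs at most two generators, as for a point of a curve on a smooth surface. The generators are
  recorded because blowing up changes them in a controlled way.\<close>

definition gen2 :: "'p set \<Rightarrow> 'l set \<Rightarrow> 'l \<Rightarrow> 'l \<Rightarrow> bool" where
  "gen2 Z S a b \<longleftrightarrow> curve_local Z S \<and> a \<in> mx Z S \<and> b \<in> mx Z S \<and>
     (\<forall>x\<in>mx Z S. \<exists>s\<in>S. \<exists>t\<in>S. x = s * a + t * b)"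

text \<open>The integer \<open>e\<close> is the smaller of the orders of \<open>a\<close> and \<open>b\<close>, with zero of infinite order.\<close>

definition exact2 :: "'p \<Rightarrow> int \<Rightarrow> 'l \<Rightarrow> 'l \<Rightarrow> bool" where
  "exact2 P e a b \<longleftrightarrow> ge P e a \<and> ge P e b \<and> \<not> (ge P (e + 1) a \<and> ge P (e + 1) b)"

lemma exact2_exists: "a \<noteq> 0 \<or> b \<noteq> 0 \<Longrightarrow> \<exists>e. exact2 P e a b"
  by (rule exI[of _ "if a = 0 then v P b else if b = 0 then v P a else min (v P a) (v P b)"])
     (auto simp: exact2_def ge_def min_def)

lemma gen2D:
  assumes "gen2 Z S a b"
  shows "curve_local Z S" "a \<in> mx Z S" "b \<in> mx Z S" "a \<in> S" "b \<in> S" "a \<in> K" "b \<in> K" "a \<noteq> 0 \<or> b \<noteq> 0"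
proof -
  show g: "curve_local Z S" "a \<in> mx Z S" "b \<in> mx Z S" using assms by (auto simp: gen2_def)
  then show "a \<in> S" "b \<in> S" by (auto simp: mx_def)
  then show "a \<in> K" "b \<in> K" using curve_localD(6)[OF g(1)] by auto
  obtain x where x: "x \<in> mx Z S" "x \<noteq> 0" using curve_local_deep_nonzero[OF g(1)] by blast
  then obtain s t where "x = s * a + t * b" using assms unfolding gen2_def by blast
  then show "a \<noteq> 0 \<or> b \<noteq> 0" using x by auto
qed

lemma gen2_span:
  assumes "gen2 Z S a b" "x \<in> mx Z S"
  obtains s t where "s \<in> S" "t \<in> S" "x = s * a + t * b"
  using assms unfolding gen2_def by blast

lemma gen2_ge:
  assumes G: "gen2 Z S a b" and P: "P \<in> Z" and ab: "ge P n a" "ge P n b" and x: "x \<in> mx Z S"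
  shows "ge P n x"
proof -
  note D = curve_localD[OF gen2D(1)[OF G]]
  obtain s t where st: "s \<in> S" "t \<in> S" "x = s * a + t * b" using gen2_span[OF G x] by blast
  have PX: "P \<in> PP" using P D by auto
  have K: "s \<in> K" "t \<in> K" using st D by auto
  have "ge P n (s * a)" "ge P n (t * b)"
    using ge_mult0[OF PX K(1) gen2D(6)[OF G] D(8)[OF st(1) P] ab(1)]
      ge_mult0[OF PX K(2) gen2D(7)[OF G] D(8)[OF st(2) P] ab(2)] by auto
  then show ?thesis unfolding st(3) using K gen2D(6,7)[OF G] by (intro ge_add[OF PX]) (auto intro!: K_closed)
qed

text \<open>Some combination \<open>a + c b\<close> has no cancellation at any place of \<open>Z\<close>, so it attains the minimal order everywhere.\<close>

lemma gen2_minel: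
  assumes G: "gen2 Z S a b" and e: "\<And>P. P \<in> Z \<Longrightarrow> exact2 P (e P) a b"
  obtains x where "minel Z S x" "\<And>P. P \<in> Z \<Longrightarrow> v P x = e P"
proof -
  note D = curve_localD[OF gen2D(1)[OF G]]
  have n: "\<not> (ge P (e P + 1) a \<and> ge P (e P + 1) b)" if "P \<in> Z" for P
    using e[OF that] by (simp add: exact2_def)
  from avoid_cancellation[OF D(2,3) gen2D(6,7)[OF G], of "\<lambda>P. e P + 1", OF n]
  obtain c where c: "c \<in> C" "c \<noteq> 0" "\<forall>P\<in>Z. \<not> ge P (e P + 1) (a + c * b)"
    by blast
  define x where "x = a + c * b"
  have cS: "c \<in> S" "c \<in> K" using c D C_K by auto
  have id: "ideal (mx Z S) (as_ring S)" by (rule curve_local_mx_ideal[OF gen2D(1)[OF G]])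
  have xm: "x \<in> mx Z S"
    using id gen2D(2,3)[OF G] cS unfolding x_def by (auto simp: ideal_as_ring_iff[OF D(5)])
  have ve: "x \<noteq> 0 \<and> v P x = e P" if P: "P \<in> Z" for P
  proof -
    have "ge P (e P) x" using gen2_ge[OF G P _ _ xm] e[OF P] by (auto simp: exact2_def)
    moreover have "\<not> ge P (e P + 1) x" using c P by (auto simp: x_def)
    ultimately show ?thesis by (auto simp: ge_def)
  qed
  have "minel Z S x"
    unfolding minel_def
  proof (intro conjI ballI)
    show "x \<noteq> 0" using ve D(4) by auto
    fix y P assume y: "y \<in> mx Z S" and P: "P \<in> Z"
    show "ge P (v P x) y" using gen2_ge[OF G P _ _ y] e[OF P] ve[OF P] by (auto simp: exact2_def)
  qed (rule xm)
  then show ?thesis using that ve by blast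
qed

lemma gen2_has_minel:
  assumes G: "gen2 Z S a b"
  obtains x where "minel Z S x"
proof -
  have "\<exists>e. \<forall>P. exact2 P (e P) a b" using exact2_exists[OF gen2D(8)[OF G]] by metis
  then show ?thesis using gen2_minel[OF G] that by metis
qed

lemma gen2_local_mult:
  assumes G: "gen2 Z S a b" and e: "\<And>P. P \<in> Z \<Longrightarrow> exact2 P (e P) a b"
  shows "local_mult (as_ring S) = real_of_int (\<Sum>P\<in>Z. e P)"
proof -
  obtain x where x: "minel Z S x" "\<And>P. P \<in> Z \<Longrightarrow> v P x = e P" using gen2_minel[OF G e] by blast
  show ?thesis using curve_local_local_mult[OF gen2D(1)[OF G] x(1)] x(2) by simp
qed

lemma gen2_swap: "gen2 Z S a b \<Longrightarrow> gen2 Z S b a"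
  unfolding gen2_def by (metis add.commute)

lemma gen2_shear:
  assumes G: "gen2 Z S a b" and c: "c \<in> C"
  shows "gen2 Z S a (b - c * a)"
proof -
  note D = curve_localD[OF gen2D(1)[OF G]]
  have cS: "c \<in> S" using c D by auto
  have "- c * a \<in> mx Z S" "b \<in> mx Z S"
    using curve_local_mx_ideal[OF gen2D(1)[OF G]] gen2D(2,3)[OF G] sring_uminus[OF D(5) cS]
    unfolding ideal_as_ring_iff[OF D(5)] by blast+
  then have "b + - c * a \<in> mx Z S"
    using curve_local_mx_ideal[OF gen2D(1)[OF G]] unfolding ideal_as_ring_iff[OF D(5)] by blast
  then have 1: "b - c * a \<in> mx Z S" by simp
  have "\<exists>s\<in>S. \<exists>t\<in>S. x = s * a + t * (b - c * a)" if x: "x \<in> mx Z S" for x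
  proof -
    obtain s t where st: "s \<in> S" "t \<in> S" "x = s * a + t * b" using gen2_span[OF G x] by blast
    have "s + t * c \<in> S" using st cS sring_closed[OF D(5)] by auto
    moreover have "x = (s + t * c) * a + t * (b - c * a)" using st by (simp add: algebra_simps)
    ultimately show ?thesis using st by blast
  qed
  then show ?thesis using 1 gen2D[OF G] by (auto simp: gen2_def)
qed

section \<open>Blowing up\<close>

lemma chart_closed:
  assumes "curve_local Z S"
  shows "sring (blowup_chart S a)" "S \<subseteq> blowup_chart S a" "\<And>b. b \<in> mx Z S \<Longrightarrow> b / a \<in> blowup_chart S a"
proof -
  let ?H = "S \<union> {b / a | b. b \<in> mx Z S}"
  have T: "blowup_chart S a = generate_ring ring_of_type_algebra ?H"
    by (simp add: blowup_chart_def curve_local_max_ideal[OF assms])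
  show "sring (blowup_chart S a)"
    unfolding sring_def T
  proof (intro conjI ballI)
    show "1 \<in> generate_ring ring_of_type_algebra ?H"
      using generate_ring.one[of ring_of_type_algebra ?H] by simp
    fix x y assume xy: "x \<in> generate_ring ring_of_type_algebra ?H" "y \<in> generate_ring ring_of_type_algebra ?H"
    show "x * y \<in> generate_ring ring_of_type_algebra ?H" using generate_ring.eng_mult[OF xy] by simp
    show "x - y \<in> generate_ring ring_of_type_algebra ?H"
      using generate_ring.eng_add[OF xy(1) generate_ring.a_inv[OF xy(2)]] by simp
  qed
  show "S \<subseteq> blowup_chart S a" "\<And>b. b \<in> mx Z S \<Longrightarrow> b / a \<in> blowup_chart S a"
    unfolding T by (auto intro: generate_ring.incl)
qed

lemma chart_minimal:
  assumes "curve_local Z S" "sring E" "S \<subseteq> E" "\<And>b. b \<in> mx Z S \<Longrightarrow> b / a \<in> E"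
  shows "blowup_chart S a \<subseteq> E"
proof
  fix x assume "x \<in> blowup_chart S a"
  then have "x \<in> generate_ring ring_of_type_algebra (S \<union> {b / a | b. b \<in> mx Z S})"
    by (simp add: blowup_chart_def curve_local_max_ideal[OF assms(1)])
  then show "x \<in> E"
    by (induction rule: generate_ring.induct) (use assms sring_closed[OF assms(2)] in auto)
qed

lemma chart_K:
  assumes "curve_local Z S" "a \<in> K"
  shows "blowup_chart S a \<subseteq> K"
  using assms curve_localD(6)[OF assms(1)]
  by (intro chart_minimal[OF assms(1) K]) (auto simp: mx_def intro!: K_divide)

lemma sring_valuation:
  assumes "Y \<subseteq> PP"
  shows "sring {x\<in>K. \<forall>P\<in>Y. ge P 0 x}"
  using assms K_closed unfolding sring_def by (auto intro!: ge_diff ge_mult0 ge_one simp: subset_iff)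

lemma minel_le:
  assumes "minel Z S x" "a \<in> mx Z S" "a \<noteq> 0" "P \<in> Z"
  shows "v P x \<le> v P a"
  using assms by (auto simp: minel_def ge_def)

text \<open>The places that survive are those at which \<open>a\<close> has minimal order. At the others \<open>x / a\<close> has a pole, and it
  is an element of the chart: multiplying \<open>y\<close> by a high power of the inverse \<open>a / x\<close> moves it into the conductor of
  \<open>S\<close>, and multiplying back by the power of \<open>x / a\<close> stays in the chart.\<close>

lemma chart_semilocal:
  assumes G: "curve_local Z S" and x: "minel Z S x" and a: "a \<in> mx Z S" "a \<noteq> 0"
  shows "semilocal {P\<in>Z. v P a = v P x} (blowup_chart S a)"
proof -
  note D = curve_localD[OF G]
  let ?Y = "{P\<in>Z. v P a = v P x}"
  have aK: "a \<in> K" using a D by (auto simp: mx_def)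
  have xK: "x \<in> K" "x \<noteq> 0" "x \<in> mx Z S" using x D by (auto simp: mx_def minel_def)
  note T = chart_closed[OF G, where a = a]
  have "blowup_chart S a \<subseteq> {x\<in>K. \<forall>P\<in>?Y. ge P 0 x}"
  proof (rule chart_minimal[OF G])
    show "sring {x\<in>K. \<forall>P\<in>?Y. ge P 0 x}" using D by (intro sring_valuation) auto
    show "S \<subseteq> {x\<in>K. \<forall>P\<in>?Y. ge P 0 x}" using D by auto
    fix b assume b: "b \<in> mx Z S"
    have bK: "b \<in> K" using b D by (auto simp: mx_def)
    have "ge P 0 (b / a)" if P: "P \<in> ?Y" for P
    proof -
      have PP: "P \<in> PP" "P \<in> Z" using P D by auto
      have "ge P (v P x - v P a) (b / a)" using x b PP bK aK a
        by (intro ge_divide) (auto simp: minel_def)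
      then show ?thesis using P by simp
    qed
    then show "b / a \<in> {x\<in>K. \<forall>P\<in>?Y. ge P 0 x}" using bK aK K_divide by auto
  qed
  moreover have "\<exists>N::nat. \<forall>y\<in>K. (\<forall>P\<in>?Y. ge P (int N) y) \<longrightarrow> y \<in> blowup_chart S a"
  proof -
    obtain N :: nat where N: "\<And>x. x \<in> K \<Longrightarrow> (\<And>P. P \<in> Z \<Longrightarrow> ge P (int N) x) \<Longrightarrow> x \<in> S"
      using semilocal_conductor[OF D(1)] by blast
    have "y \<in> blowup_chart S a" if y: "y \<in> K" "\<forall>P\<in>?Y. ge P (int N) y" for y
    proof -
      obtain M :: nat where M: "\<forall>P\<in>Z. int N - v P y \<le> int M"
        using int_bound[OF D(2), of "\<lambda>P. int N - v P y"] by blast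
      have "y * (a / x) ^ M \<in> S"
      proof (rule N)
        show "y * (a / x) ^ M \<in> K" using y aK xK by (auto intro!: K_closed)
        fix P assume P: "P \<in> Z"
        have PX: "P \<in> PP" using P D by auto
        have vax: "v P (a / x) = v P a - v P x" using v_divide[OF PX aK xK(1) a(2) xK(2)] .
        have axK: "a / x \<in> K" "a / x \<noteq> 0" using aK xK a K_divide by auto
        have vM: "v P ((a / x) ^ M) = int M * (v P a - v P x)" using v_power[OF PX axK] vax by simp
        show "ge P (int N) (y * (a / x) ^ M)"
        proof (cases "P \<in> ?Y")
          case True
          then have "ge P 0 ((a / x) ^ M)" using vM by (simp add: ge_def)
          then have "ge P (int N) ((a / x) ^ M * y)"
            using True y axK by (intro ge_mult0[OF PX]) (auto intro!: K_closed)
          then show ?thesis by (simp add: mult.commute)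
        next
          case False
          then have "1 \<le> v P a - v P x" using minel_le[OF x a P] P by auto
          then have "int M * 1 \<le> v P ((a / x) ^ M)" unfolding vM by (intro mult_left_mono) auto
          then have "ge P (int M) ((a / x) ^ M)" by (simp add: ge_def)
          then have "ge P (v P y + int M) (y * (a / x) ^ M)"
            using y axK ge_v by (intro ge_mult[OF PX]) (auto intro!: K_closed)
          then show ?thesis by (rule ge_mono) (use M P in auto)
        qed
      qed
      moreover have "x / a \<in> blowup_chart S a" using T(3) xK by auto
      ultimately have "(y * (a / x) ^ M) * (x / a) ^ M \<in> blowup_chart S a"
        using T(2) sring_closed[OF T(1)] by auto
      moreover have "(y * (a / x) ^ M) * (x / a) ^ M = y"
        using a xK by (simp add: mult.assoc power_mult_distrib[symmetric])
      ultimately show ?thesis by simp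
    qed
    then show ?thesis by blast
  qed
  ultimately show ?thesis
    unfolding semilocal_def using D T by auto
qed

text \<open>The point of the blow-up that is the image of the place \<open>P\<close>, seen in the chart of \<open>a\<close>.\<close>

definition loc :: "'l set \<Rightarrow> 'l \<Rightarrow> 'p \<Rightarrow> 'l set" where
  "loc S a P = localize (blowup_chart S a) {x\<in>blowup_chart S a. ge P 1 x}"

lemma first_nbhd_cases:
  assumes G: "curve_local Z S" and x: "minel Z S x" and S': "S' \<in> first_nbhd S"
  obtains a P where "a \<in> mx Z S" "a \<noteq> 0" "P \<in> Z" "v P a = v P x" "S' = loc S a P"
proof -
  obtain a Q where a: "a \<in> mx Z S" "a \<noteq> 0" "primeideal Q (as_ring (blowup_chart S a))" "mx Z S \<subseteq> Q"
    "S' = localize (blowup_chart S a) Q"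
    using S' unfolding first_nbhd_def curve_local_max_ideal[OF G] by blast
  have aQ: "a \<in> Q" using a by blast
  obtain P where P: "P \<in> {P\<in>Z. v P a = v P x}" "Q = {x\<in>blowup_chart S a. ge P 1 x}"
    using semilocal_prime[OF chart_semilocal[OF G x a(1,2)] a(3) aQ a(2)] by blast
  then show ?thesis using a that by (auto simp: loc_def)
qed

lemma loc_first_nbhd:
  assumes G: "curve_local Z S" and x: "minel Z S x" and a: "a \<in> mx Z S" "a \<noteq> 0" and P: "P \<in> Z" "v P a = v P x"
  shows "loc S a P \<in> first_nbhd S"
proof -
  note D = curve_localD[OF G]
  let ?T = "blowup_chart S a" and ?Q = "{x\<in>blowup_chart S a. ge P 1 x}"
  have T: "sring ?T" "S \<subseteq> ?T" using chart_closed[OF G] by auto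
  have aK: "a \<in> K" using a D by (auto simp: mx_def)
  have TK: "?T \<subseteq> K" by (rule chart_K[OF G aK])
  have T0: "ge P 0 y" if "y \<in> ?T" for y using chart_semilocal[OF G x a] that P by (auto simp: semilocal_def)
  have PX: "P \<in> PP" using P D by auto
  have id: "ideal ?Q (as_ring ?T)"
  proof (rule ideal_as_ringI[OF T(1)])
    show "a + b \<in> ?Q" if "a \<in> ?Q" "b \<in> ?Q" for a b
      using that TK sring_add[OF T(1)] by (auto intro!: ge_add[OF PX])
    show "a * b \<in> ?Q" if "a \<in> ?T" "b \<in> ?Q" for a b
      using that TK sring_mult[OF T(1)] T0 by (auto intro!: ge_mult0[OF PX])
  qed (auto simp: sring_0[OF T(1)])
  have "primeideal ?Q (as_ring ?T)"
    unfolding primeideal_as_ring_iff[OF T(1)]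
  proof (intro conjI ballI impI)
    have "\<not> ge P 1 1" using not_ge_const[OF PX sring_1[OF C]] by simp
    then show "?Q \<noteq> ?T" using sring_1[OF T(1)] by auto
    fix y z assume yz: "y \<in> ?T" "z \<in> ?T" "y * z \<in> ?Q"
    show "y \<in> ?Q \<or> z \<in> ?Q"
    proof (rule ccontr)
      assume "\<not> ?thesis"
      then have n: "\<not> ge P 1 y" "\<not> ge P 1 z" using yz by auto
      then have "y \<noteq> 0" "z \<noteq> 0" "v P y = 0" "v P z = 0" using T0[OF yz(1)] T0[OF yz(2)] by (auto simp: ge_def)
      then have "v P (y * z) = 0" "y * z \<noteq> 0" using v_mult[OF PX, of y z] yz TK by auto
      then show False using yz(3) by (auto simp: ge_def)
    qed
  qed (rule id)
  moreover have "mx Z S \<subseteq> ?Q" using T(2) P by (auto simp: mx_def)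
  ultimately show ?thesis
    unfolding first_nbhd_def curve_local_max_ideal[OF G] loc_def using a by blast
qed

lemma loc_props:
  assumes G: "curve_local Z S" and x: "minel Z S x" and a: "a \<in> mx Z S" "a \<noteq> 0" and P: "P \<in> Z" "v P a = v P x"
  shows "sring (loc S a P)" "blowup_chart S a \<subseteq> loc S a P" "S \<subseteq> loc S a P" "loc S a P \<subseteq> K"
    "\<And>y. y \<in> loc S a P \<Longrightarrow> ge P 0 y"
    "\<And>y. y \<in> loc S a P \<Longrightarrow> y \<noteq> 0 \<Longrightarrow> v P y = 0 \<Longrightarrow> inverse y \<in> loc S a P"
    "\<And>u w. u \<in> mx Z S \<Longrightarrow> w \<in> mx Z S \<Longrightarrow> w \<noteq> 0 \<Longrightarrow> v P w = v P x \<Longrightarrow> u / w \<in> loc S a P"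
    "\<And>y. y \<in> loc S a P \<Longrightarrow> \<exists>t\<in>blowup_chart S a. \<exists>s\<in>blowup_chart S a. y = t / s \<and> s \<noteq> 0 \<and> v P s = 0"
proof -
  note D = curve_localD[OF G]
  let ?T = "blowup_chart S a" and ?L = "loc S a P"
  have T: "sring ?T" "S \<subseteq> ?T" "\<And>b. b \<in> mx Z S \<Longrightarrow> b / a \<in> ?T" using chart_closed[OF G] by auto
  have aK: "a \<in> K" using a D by (auto simp: mx_def)
  have TK: "?T \<subseteq> K" by (rule chart_K[OF G aK])
  have T0: "ge P 0 y" if "y \<in> ?T" for y using chart_semilocal[OF G x a] that P by (auto simp: semilocal_def)
  have PX: "P \<in> PP" using P D by auto
  have unit: "s \<in> ?T \<and> s \<notin> {x\<in>?T. ge P 1 x} \<longleftrightarrow> s \<in> ?T \<and> s \<noteq> 0 \<and> v P s = 0" for s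
    using T0[of s] by (auto simp: ge_def)
  have L: "?L = {t / s | t s. t \<in> ?T \<and> s \<in> ?T \<and> s \<noteq> 0 \<and> v P s = 0}"
    unfolding loc_def localize_def using unit by blast
  have LI: "t / s \<in> ?L" if "t \<in> ?T" "s \<in> ?T" "s \<noteq> 0" "v P s = 0" for t s
    unfolding L using that by blast
  show LE: "\<exists>t\<in>?T. \<exists>s\<in>?T. y = t / s \<and> s \<noteq> 0 \<and> v P s = 0" if "y \<in> ?L" for y
    using that unfolding L by blast
  have one: "1 \<in> ?T" "(1::'l) \<noteq> 0" "v P 1 = 0" using sring_1[OF T(1)] v_1[OF PX] by auto
  show TL: "?T \<subseteq> ?L" using LI[OF _ one] by auto
  show "S \<subseteq> ?L" using TL T(2) by auto
  show "?L \<subseteq> K" unfolding L using TK by (auto intro!: K_divide)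
  show "sring ?L"
    unfolding sring_def
  proof (intro conjI ballI)
    show "1 \<in> ?L" using one TL by auto
    fix y z assume "y \<in> ?L" "z \<in> ?L"
    then obtain t s t' s' where ts: "t \<in> ?T" "s \<in> ?T" "y = t / s" "s \<noteq> 0" "v P s = 0"
      "t' \<in> ?T" "s' \<in> ?T" "z = t' / s'" "s' \<noteq> 0" "v P s' = 0" using LE by meson
    have ss: "s * s' \<in> ?T" "s * s' \<noteq> 0" "v P (s * s') = 0"
      using ts v_mult[OF PX, of s s'] TK sring_mult[OF T(1)] by auto
    have "(t * s' - t' * s) / (s * s') \<in> ?L" "(t * t') / (s * s') \<in> ?L"
      using ts ss by (auto intro!: LI sring_closed[OF T(1)])
    moreover have "(t * s' - t' * s) / (s * s') = y - z" "(t * t') / (s * s') = y * z"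
      using ts(3,4,8,9) by (simp_all add: diff_frac_eq)
    ultimately show "y - z \<in> ?L" "y * z \<in> ?L" by simp_all
  qed
  show "ge P 0 y" if y: "y \<in> ?L" for y
  proof -
    obtain t s where ts: "t \<in> ?T" "s \<in> ?T" "y = t / s" "s \<noteq> 0" "v P s = 0" using LE[OF y] by blast
    have "ge P (0 - v P s) (t / s)" using ts TK T0 by (intro ge_divide[OF PX]) auto
    then show ?thesis using ts by simp
  qed
  show inv: "inverse y \<in> ?L" if y: "y \<in> ?L" "y \<noteq> 0" "v P y = 0" for y
  proof -
    obtain t s where ts: "t \<in> ?T" "s \<in> ?T" "y = t / s" "s \<noteq> 0" "v P s = 0" using LE[OF y(1)] by blast
    have t: "t \<noteq> 0" "v P t = 0" using y ts v_divide[OF PX, of t s] TK by auto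
    have "inverse y = s / t" unfolding ts(3) by simp
    then show ?thesis using LI[OF ts(2,1) t] by simp
  qed
  show "u / w \<in> ?L" if uw: "u \<in> mx Z S" "w \<in> mx Z S" "w \<noteq> 0" "v P w = v P x" for u w
  proof -
    have w: "w \<in> K" using uw D by (auto simp: mx_def)
    have "(u / a) / (w / a) \<in> ?L"
      using uw a w aK P(2) T(3) v_divide[OF PX w aK] by (intro LI) auto
    then show ?thesis using a by simp
  qed
qed

lemma loc_minimal:
  assumes G: "curve_local Z S" and x: "minel Z S x" and a: "a \<in> mx Z S" "a \<noteq> 0" and P: "P \<in> Z" "v P a = v P x"
    and E: "sring E" "S \<subseteq> E" "\<And>b. b \<in> mx Z S \<Longrightarrow> b / a \<in> E"
    "\<And>y. y \<in> E \<Longrightarrow> y \<noteq> 0 \<Longrightarrow> v P y = 0 \<Longrightarrow> inverse y \<in> E"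
  shows "loc S a P \<subseteq> E"
proof
  fix y assume "y \<in> loc S a P"
  then obtain t s where ts: "t \<in> blowup_chart S a" "s \<in> blowup_chart S a" "y = t / s" "s \<noteq> 0" "v P s = 0"
    using loc_props(8)[OF G x a P] by blast
  have "t \<in> E" "s \<in> E" using ts chart_minimal[OF G E(1-3)] by auto
  then show "y \<in> E" using ts E(4)[of s] sring_mult[OF E(1)] by (simp add: divide_inverse)
qed

text \<open>Both sides contain \<open>S\<close> and all quotients \<open>u / w\<close> of elements of the maximal ideal where \<open>w\<close> has least order at
  \<open>P\<close>, and both are closed under inverses of units at \<open>P\<close>. By \<open>loc_minimal\<close> each contains the other.\<close>

lemma loc_indep:
  assumes G: "curve_local Z S" and x: "minel Z S x" and a: "a \<in> mx Z S" "a \<noteq> 0" and a': "a' \<in> mx Z S" "a' \<noteq> 0"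
    and P: "P \<in> Z" "v P a = v P x" "v P a' = v P x"
  shows "loc S a P = loc S a' P"
proof
  note L = loc_props[OF G x a P(1,2)] and L' = loc_props[OF G x a' P(1,3)]
  show "loc S a P \<subseteq> loc S a' P"
    by (rule loc_minimal[OF G x a P(1,2) L'(1,3) L'(7)[OF _ a P(2)] L'(6)])
  show "loc S a' P \<subseteq> loc S a P"
    by (rule loc_minimal[OF G x a' P(1,3) L(1,3) L(7)[OF _ a' P(3)] L(6)])
qed

text \<open>A point of the first neighborhood contains all \<open>y / x\<close> with \<open>y\<close> in the maximal ideal. If it is \<open>S\<close> itself, then
  the maximal ideal is generated by \<open>x\<close>.\<close>

lemma first_nbhd_self_regular:
  assumes G: "curve_local Z S" and x: "minel Z S x" and S: "S \<in> first_nbhd S"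
  shows "regular_local (as_ring S)"
proof -
  obtain a P where a: "a \<in> mx Z S" "a \<noteq> 0" "P \<in> Z" "v P a = v P x" "S = loc S a P"
    using first_nbhd_cases[OF G x S] by blast
  have xm: "x \<in> mx Z S" "x \<noteq> 0" using x by (auto simp: minel_def)
  have "y / x \<in> S" if "y \<in> mx Z S" for y
    using loc_props(7)[OF G x a(1-4) that xm] a(5) by simp
  then show ?thesis
    using xm by (intro principal_regular[OF G xm(1)]) (metis nonzero_mult_div_cancel_right times_divide_eq_left)
qed

text \<open>The blow-up of a local ring with maximal ideal \<open>(a,b)\<close> at a place where \<open>b/a\<close> vanishes: the new local
  ring collects exactly the places where \<open>b/a\<close> vanishes, and its maximal ideal is \<open>(a, b/a)\<close>.\<close>

lemma blowup_gen2:
  assumes G: "gen2 Z S a b" and P0: "P0 \<in> Z" and a0: "a \<noteq> 0" and ba: "ge P0 (v P0 a + 1) b"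
    and x: "minel Z S x"
  defines "Y \<equiv> {P\<in>Z. ge P (v P a + 1) b}"
  shows "gen2 Y (loc S a P0) a (b / a)" "\<And>P. P \<in> Y \<Longrightarrow> v P a = v P x" "\<And>P. P \<in> Y \<Longrightarrow> loc S a P = loc S a P0"
    "loc S a P0 \<in> first_nbhd S"
proof -
  note g = gen2D(1)[OF G]
  note D = curve_localD[OF g]
  note ab = gen2D[OF G]
  let ?T = "blowup_chart S a" and ?L = "loc S a P0"
  define f where "f = b / a"
  have YZ: "Y \<subseteq> Z" "P0 \<in> Y" and YPP: "Y \<subseteq> PP" and finY: "finite Y" using P0 ba D by (auto simp: Y_def)
  have xK: "x \<in> K" "x \<noteq> 0" "x \<in> mx Z S" using x D by (auto simp: mx_def minel_def)
  show va: "v P a = v P x" if P: "P \<in> Y" for P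
  proof -
    have "ge P (v P a) b" using P ge_mono[of P "v P a + 1" b "v P a"] by (auto simp: Y_def)
    then have "ge P (v P a) x" using gen2_ge[OF G subsetD[OF YZ(1) P] ge_v _ xK(3)] by blast
    then have "v P a \<le> v P x" using xK by (auto simp: ge_def)
    moreover have "v P x \<le> v P a" using minel_le[OF x ab(2) a0] P YZ by auto
    ultimately show ?thesis by simp
  qed
  note L = loc_props[OF g x ab(2) a0 P0 va[OF YZ(2)]]
  have T: "sring ?T" "S \<subseteq> ?T" "\<And>b. b \<in> mx Z S \<Longrightarrow> b / a \<in> ?T" using chart_closed[OF g] by auto
  note TC = sring_closed[OF T(1)]
  have TK: "?T \<subseteq> K" by (rule chart_K[OF g ab(6)])
  have T0: "ge P 0 y" if "y \<in> ?T" "P \<in> Y" for y P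
    using chart_semilocal[OF g x ab(2) a0] that YZ va[OF that(2)] by (auto simp: semilocal_def)
  have fT: "f \<in> ?T" using T(3) ab by (simp add: f_def)
  have fK: "f \<in> K" using ab K_divide by (simp add: f_def)
  have f1: "ge P 1 f" if P: "P \<in> Y" for P
  proof -
    have "ge P (v P a + 1 - v P a) f" unfolding f_def using P ab a0 YPP by (intro ge_divide) (auto simp: Y_def)
    then show ?thesis by simp
  qed
  have Tform: "\<exists>s\<in>S. \<exists>t\<in>?T. y = s + f * t" if "y \<in> ?T" for y
  proof -
    let ?E = "{s + f * t | s t. s \<in> S \<and> t \<in> ?T}"
    have "?T \<subseteq> ?E"
    proof (rule chart_minimal[OF g])
      have 1: "1 + f * 0 \<in> ?E" using sring_1[OF D(5)] TC by blast
      have 2: "(s + f * t) - (s' + f * t') \<in> ?E" "(s + f * t) * (s' + f * t') \<in> ?E"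
        if "s \<in> S" "t \<in> ?T" "s' \<in> S" "t' \<in> ?T" for s t s' t'
      proof -
        have alg: "(s + f * t) - (s' + f * t') = (s - s') + f * (t - t')"
          "(s + f * t) * (s' + f * t') = s * s' + f * (s * t' + t * s' + f * t * t')" for f
          by (simp_all add: algebra_simps)
        have sT: "s \<in> ?T" "s' \<in> ?T" using that T(2) by auto
        have S: "s - s' \<in> S" "s * s' \<in> S" using that D(5) by (auto simp: sring_def)
        have "t - t' \<in> ?T" "s * t' + t * s' + f * t * t' \<in> ?T"
          using that sT fT by (simp_all add: TC)
        then show "(s + f * t) - (s' + f * t') \<in> ?E" "(s + f * t) * (s' + f * t') \<in> ?E"
          unfolding alg using S by blast+
      qed
      show "sring ?E" unfolding sring_def using 1 2 by auto
      show "S \<subseteq> ?E"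
      proof
        fix s assume "s \<in> S"
        then have "s + f * 0 \<in> ?E" using TC by blast
        then show "s \<in> ?E" by simp
      qed
      fix b' assume "b' \<in> mx Z S"
      then obtain s t where st: "s \<in> S" "t \<in> S" "b' = s * a + t * b" using gen2_span[OF G] by blast
      have "b' / a = s + f * t" using a0 st by (simp add: f_def field_simps)
      then show "b' / a \<in> ?E" using st T(2) by blast
    qed
    then show ?thesis using that by blast
  qed
  have Tres: "\<exists>c\<in>C. \<forall>P\<in>Y. ge P 1 (y - c)" if y: "y \<in> ?T" for y
  proof -
    obtain s t where st: "s \<in> S" "t \<in> ?T" "y = s + f * t" using Tform[OF y] by blast
    obtain c where c: "c \<in> C" "\<And>P. P \<in> Z \<Longrightarrow> ge P 1 (s - c)" using curve_local_residue[OF g st(1)] by blast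
    have "ge P 1 (y - c)" if P: "P \<in> Y" for P
    proof -
      have PX: "P \<in> PP" using P YPP by auto
      have "ge P 1 (t * f)" using st TK fK T0 f1 P by (intro ge_mult0[OF PX]) auto
      moreover have "ge P 1 (s - c)" using c P YZ by auto
      moreover have "s - c \<in> K" "t * f \<in> K" using st TK fK c D C_K by (auto intro!: K_closed)
      ultimately have "ge P 1 ((s - c) + t * f)" by (intro ge_add[OF PX])
      then show ?thesis using st by (simp add: algebra_simps)
    qed
    then show ?thesis using c by blast
  qed
  have unitT: "v P s = 0" if s: "s \<in> ?T" "s \<noteq> 0" "v P0 s = 0" and P: "P \<in> Y" for s P
  proof -
    obtain c where c: "c \<in> C" "\<forall>P\<in>Y. ge P 1 (s - c)" using Tres[OF s(1)] by blast
    have "c \<noteq> 0" using c YZ s by (auto simp: ge_def)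
    have "\<not> ge P 1 s"
    proof
      assume "ge P 1 s"
      moreover have PX: "P \<in> PP" using P YPP by auto
      moreover have "ge P 1 (s - c)" using c P by blast
      ultimately have "ge P 1 c" using ge_cancel[OF PX subsetD[OF TK s(1)] C_K[OF c(1)]] by blast
      then show False using not_ge_const[OF PX c(1) \<open>c \<noteq> 0\<close>] by blast
    qed
    then show ?thesis using T0[OF s(1) P] s by (auto simp: ge_def)
  qed
  have Lres: "\<exists>c\<in>C. \<forall>P\<in>Y. ge P 1 (y - c)" if y: "y \<in> ?L" for y
  proof -
    obtain t s where ts: "t \<in> ?T" "s \<in> ?T" "y = t / s" "s \<noteq> 0" "v P0 s = 0" using L(8)[OF y] by blast
    obtain c where c: "c \<in> C" "\<forall>P\<in>Y. ge P 1 (t - c)" using Tres[OF ts(1)] by blast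
    obtain d where d: "d \<in> C" "\<forall>P\<in>Y. ge P 1 (s - d)" using Tres[OF ts(2)] by blast
    have d0: "d \<noteq> 0" using d YZ ts by (auto simp: ge_def)
    have tK: "t \<in> K" "s \<in> K" "c \<in> K" "d \<in> K" "c / d \<in> C" "c / d \<in> K"
      using ts TK c d C_K C_divide[of c d] by auto
    have "ge P 1 (y - c / d)" if P: "P \<in> Y" for P
    proof -
      have PX: "P \<in> PP" using P YPP by auto
      have g1: "ge P 1 (t - c)" "ge P 1 (s - d)" using c d P by auto
      have k: "t - c \<in> K" "s - d \<in> K" using tK sring_diff[OF K] by auto
      have "ge P 1 ((t - c) - c / d * (s - d))"
        by (rule ge_diff[OF PX k(1) sring_mult[OF K tK(6) k(2)] g1(1) ge_const_mult[OF PX tK(5) k(2) g1(2)]])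
      then have "ge P (1 - v P s) (((t - c) - c / d * (s - d)) / s)"
        using ge_divide[OF PX sring_diff[OF K k(1) sring_mult[OF K tK(6) k(2)]] tK(2) ts(4)] by blast
      moreover have "((t - c) - c / d * (s - d)) / s = y - c / d" using ts d0 by (simp add: field_simps)
      ultimately show ?thesis using unitT[OF ts(2,4,5) P] by simp
    qed
    then show ?thesis using tK(5) by blast
  qed
  have L0: "ge P 0 y" if y: "y \<in> ?L" and P: "P \<in> Y" for y P
  proof -
    have PX: "P \<in> PP" using P YPP by auto
    obtain c where c: "c \<in> C" "\<forall>P\<in>Y. ge P 1 (y - c)" using Lres[OF y] by blast
    have "ge P 0 (y - c)" by (rule ge_mono[of P 1]) (use c P in auto)
    moreover have "ge P 0 c" using ge_const[OF PX c(1)] by simp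
    moreover have "y - c \<in> K" using y L(4) c C_K by (auto intro!: K_closed)
    ultimately have "ge P 0 ((y - c) + c)" using C_K[OF c(1)] by (intro ge_add[OF PX])
    then show ?thesis by simp
  qed
  have omega: "\<exists>w\<in>?L. (\<forall>Q\<in>Z. ge Q 0 w) \<and> ge P 1 w \<and> (\<forall>Q\<in>Y. w \<noteq> 0 \<and> v Q w = 0)" if P: "P \<in> Z - Y" for P
  proof -
    have PX: "P \<in> PP" using P D by auto
    have nb: "b \<noteq> 0" "v P b \<le> v P a" using P by (auto simp: Y_def ge_def)
    have "ge P (v P a - v P b) (a / b)" using ab nb by (intro ge_divide[OF PX _ _ _ ge_v]) auto
    then have "ge P 0 (a / b)" by (rule ge_mono) (use nb in auto)
    then obtain c where c: "c \<in> C" "ge P 1 (a / b - c)" using residue[OF PX, of "a / b"] ab K_divide by auto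
    have cK: "c \<in> K" using c C_K by auto
    have "ge P (1 + v P b) ((a / b - c) * b)"
      using c ab cK by (intro ge_mult[OF PX _ _ _ ge_v]) (auto intro!: K_closed)
    moreover have "(a / b - c) * b = a - c * b" using nb by (simp add: field_simps)
    ultimately have 1: "ge P (1 + v P b) (a - c * b)" by simp
    define u where "u = a - c * b"
    have uK: "u \<in> K" using ab cK by (auto simp: u_def intro!: K_closed)
    have "gen2 Z S b (a - c * b)" by (rule gen2_shear[OF gen2_swap[OF G] c(1)])
    then have um: "u \<in> mx Z S" by (auto simp: gen2_def u_def)
    have "u / x \<in> ?L" using L(7)[OF um xK(3,2)] by simp
    moreover have "ge Q 0 (u / x)" if Q: "Q \<in> Z" for Q
    proof -
      have "ge Q (v Q x - v Q x) (u / x)"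
        using um x Q D uK xK by (intro ge_divide) (auto simp: minel_def)
      then show ?thesis by simp
    qed
    moreover have "ge P 1 (u / x)"
    proof -
      have "ge P (1 + v P b - v P x) (u / x)" using 1 uK xK unfolding u_def[symmetric] by (intro ge_divide[OF PX])
      then show ?thesis by (rule ge_mono) (use minel_le[OF x ab(3) nb(1)] P in auto)
    qed
    moreover have "u / x \<noteq> 0 \<and> v Q (u / x) = 0" if Q: "Q \<in> Y" for Q
    proof -
      have QX: "Q \<in> PP" "Q \<in> Z" using Q YPP YZ by auto
      have "ge Q (v Q a + 1) (c * b)" using Q ab c by (intro ge_const_mult[OF QX(1)]) (auto simp: Y_def)
      moreover have "\<not> ge Q (v Q a + 1) a" using a0 by (auto simp: ge_def)
      moreover have "u - (- c * b) = a" by (simp add: u_def)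
      moreover have "c * b \<in> K" using cK ab K_closed by auto
      ultimately have nu: "\<not> ge Q (v Q a + 1) u"
        using ge_add[OF QX(1) uK, of "c * b" "v Q a + 1"] by (auto simp: u_def)
      then have u0: "u \<noteq> 0" by auto
      have "v Q u \<le> v Q a" using nu by (auto simp: ge_def)
      moreover have "v Q x \<le> v Q u" using minel_le[OF x um u0 QX(2)] .
      ultimately have "v Q u = v Q x" using va[OF Q] by simp
      then show ?thesis using v_divide[OF QX(1) uK xK(1) u0 xK(2)] u0 xK by simp
    qed
    ultimately show ?thesis by blast
  qed
  then obtain w where w: "\<And>P. P \<in> Z - Y \<Longrightarrow> w P \<in> ?L" "\<And>P Q. P \<in> Z - Y \<Longrightarrow> Q \<in> Z \<Longrightarrow> ge Q 0 (w P)"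
    "\<And>P. P \<in> Z - Y \<Longrightarrow> ge P 1 (w P)" "\<And>P Q. P \<in> Z - Y \<Longrightarrow> Q \<in> Y \<Longrightarrow> w P \<noteq> 0 \<and> v Q (w P) = 0"
    by metis
  define W where "W = (\<Prod>P\<in>Z - Y. w P)"
  have finZY: "finite (Z - Y)" using D by auto
  have wK: "w P \<in> K" if "P \<in> Z - Y" for P using w(1)[OF that] L(4) by auto
  have WL: "W \<in> ?L" unfolding W_def using w(1) by (intro sring_prod[OF L(1)])
  have WK: "W \<in> K" using WL L(4) by auto
  have W0: "ge Q 0 W" if "Q \<in> Z" for Q
    unfolding W_def using w wK that D(3) by (intro ge_prod0[OF finZY]) auto
  have W1: "ge P 1 W" if "P \<in> Z - Y" for P
    unfolding W_def using w wK that D(3) by (intro ge_prod1[OF finZY, where j = P]) auto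
  have WY: "W \<noteq> 0" "v P0 W = 0"
  proof -
    show "v P0 W = 0" unfolding W_def using w(4) wK YZ YPP by (intro v_prod0[OF finZY]) auto
    show "W \<noteq> 0" unfolding W_def using w(4) YZ finZY by (simp add: prod_zero_iff)
  qed
  have cond: "\<exists>N::nat. \<forall>y\<in>K. (\<forall>P\<in>Y. ge P (int N) y) \<longrightarrow> y \<in> ?L"
  proof -
    obtain N :: nat where N: "\<And>x. x \<in> K \<Longrightarrow> (\<And>P. P \<in> Z \<Longrightarrow> ge P (int N) x) \<Longrightarrow> x \<in> S"
      using semilocal_conductor[OF D(1)] by blast
    have "y \<in> ?L" if y: "y \<in> K" "\<forall>P\<in>Y. ge P (int N) y" for y
    proof -
      obtain M :: nat where M: "\<forall>P\<in>Z. int N - v P y \<le> int M"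
        using int_bound[OF D(2), of "\<lambda>P. int N - v P y"] by blast
      have WMK: "W ^ M \<in> K" using WK K_closed by auto
      have "y * W ^ M \<in> S"
      proof (rule N)
        show "y * W ^ M \<in> K" using y WMK K_closed by auto
        fix P assume P: "P \<in> Z"
        have PX: "P \<in> PP" using P D by auto
        show "ge P (int N) (y * W ^ M)"
        proof (cases "P \<in> Y")
          case True
          have "ge P (int N) (W ^ M * y)"
            using ge_mult0[OF PX WMK y(1) ge_power0[OF PX WK W0[OF P]]] y(2) True by blast
          then show ?thesis by (simp add: mult.commute)
        next
          case False
          then have "ge P (int M) (W ^ M)" using W1[of P] P by (intro ge_power1[OF PX WK]) auto
          then have "ge P (v P y + int M) (y * W ^ M)" by (intro ge_mult[OF PX y(1) WMK ge_v])
          then show ?thesis by (rule ge_mono) (use M P in auto)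
        qed
      qed
      moreover have "inverse (W ^ M) \<in> ?L"
        using WY YPP YZ WK WL v_power[of P0 W M] by (intro L(6) sring_power[OF L(1)]) auto
      ultimately have "(y * W ^ M) * inverse (W ^ M) \<in> ?L" using L(3) sring_mult[OF L(1)] by blast
      then show ?thesis using WY by (simp add: mult.assoc)
    qed
    then show ?thesis by blast
  qed
  have semiL: "semilocal Y ?L"
    unfolding semilocal_def using finY YPP L(1,4) cond L0 D(7) L(3) by auto
  then have goodL: "curve_local Y ?L" unfolding curve_local_def using YZ Lres by auto
  have aY: "a \<in> mx Y ?L" using ab(2) L(3) YZ by (auto simp: mx_def)
  have fY: "f \<in> mx Y ?L" using fT L(2) f1 by (auto simp: mx_def)
  have "\<exists>s\<in>?L. \<exists>t\<in>?L. y = s * a + t * f" if y: "y \<in> mx Y ?L" for y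
  proof -
    have yL: "y \<in> ?L" "ge P0 1 y" using y YZ by (auto simp: mx_def)
    obtain t s where ts: "t \<in> ?T" "s \<in> ?T" "y = t / s" "s \<noteq> 0" "v P0 s = 0" using L(8)[OF yL(1)] by blast
    have PX: "P0 \<in> PP" using YZ YPP by auto
    obtain t0 t1 where t: "t0 \<in> S" "t1 \<in> ?T" "t = t0 + f * t1" using Tform[OF ts(1)] by blast
    have K: "y \<in> K" "s \<in> K" "t0 \<in> K" "t1 \<in> K" using yL L(4) ts t TK D(6) by auto
    have "ge P0 1 (s * y)" using ge_mult0[OF PX K(2,1) T0[OF ts(2) YZ(2)] yL(2)] .
    moreover have "ge P0 1 (t1 * f)" using ge_mult0[OF PX K(4) fK T0[OF t(2) YZ(2)] f1[OF YZ(2)]] .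
    ultimately have "ge P0 1 (s * y - t1 * f)" using K fK by (intro ge_diff[OF PX]) (auto intro!: K_closed)
    moreover have "s * y - t1 * f = t0" using ts t by simp
    ultimately have "t0 \<in> mx Z S" using curve_local_mx_iff[OF g P0 t(1)] by simp
    then obtain s1 s2 where s12: "s1 \<in> S" "s2 \<in> S" "t0 = s1 * a + s2 * b" using gen2_span[OF G] by blast
    have invs: "inverse s \<in> ?L" using ts L(2,6) by auto
    have "s1 * inverse s \<in> ?L" "(s2 * a + t1) * inverse s \<in> ?L"
      using invs s12 t L(2,3) ab(4) by (auto intro!: sring_mult[OF L(1)] sring_add[OF L(1)])
    moreover have "b = f * a" using a0 by (simp add: f_def)
    then have "y = (s1 * inverse s) * a + ((s2 * a + t1) * inverse s) * f"
      unfolding ts(3) t(3) s12(3) by (simp add: divide_inverse algebra_simps)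
    ultimately show ?thesis by blast
  qed
  then show "gen2 Y ?L a (b / a)" unfolding f_def[symmetric] gen2_def using goodL aY fY by blast
  show "loc S a P = loc S a P0" if P: "P \<in> Y" for P
  proof -
    have "ge P 1 t \<longleftrightarrow> ge P0 1 t" if "t \<in> ?T" for t
      using curve_local_mx_iff[OF goodL P] curve_local_mx_iff[OF goodL YZ(2)] that L(2) by blast
    then show ?thesis unfolding loc_def by (metis (mono_tags, lifting) Collect_cong)
  qed
  show "loc S a P0 \<in> first_nbhd S" by (rule loc_first_nbhd[OF g x ab(2) a0 P0 va[OF YZ(2)]])
qed

end

section \<open>Chains of neighborhoods\<close>

lemma nbhd_Suc_front:
  "S' \<in> nbhd (Suc i) S \<Longrightarrow> \<exists>S1\<in>first_nbhd S. S' \<in> nbhd i S1"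
proof (induction i arbitrary: S')
  case (Suc i)
  then obtain T where T: "T \<in> nbhd (Suc i) S" "S' \<in> first_nbhd T" by auto
  then show ?case using Suc.IH[OF T(1)] by auto
qed auto

context places
begin

text \<open>The property does not mention places or generators, so that it can be carried along a chain of neighborhoods.\<close>

definition planar :: "'l set \<Rightarrow> bool" where
  "planar S \<longleftrightarrow> (\<exists>Z a b. gen2 Z S a b)"

text \<open>At the given place, exchange the generators so that the first one has minimal order, and subtract from the other
  one its leading coefficient times the first.\<close>

lemma first_nbhd_adapted:
  assumes G: "gen2 Z S a b" and x: "minel Z S x" and S': "S' \<in> first_nbhd S"
  obtains a' b' P where "gen2 Z S a' b'" "a' \<noteq> 0" "P \<in> Z" "ge P (v P a' + 1) b'" "S' = loc S a' P"
proof -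
  note g = gen2D(1)[OF G] and ab = gen2D[OF G]
  obtain a1 P where a1: "a1 \<in> mx Z S" "a1 \<noteq> 0" "P \<in> Z" "v P a1 = v P x" "S' = loc S a1 P"
    using first_nbhd_cases[OF g x S'] by blast
  have PX: "P \<in> PP" using a1(3) curve_localD(3)[OF g] by auto
  have xK: "x \<in> mx Z S" "x \<noteq> 0" using x by (auto simp: minel_def)
  have gab: "ge P (v P x) a" "ge P (v P x) b" using x ab a1 by (auto simp: minel_def)
  show ?thesis
  proof (cases "ge P (v P x + 1) a")
    case True
    have "\<not> ge P (v P x + 1) b"
    proof
      assume "ge P (v P x + 1) b"
      then have "ge P (v P x + 1) x" by (rule gen2_ge[OF G a1(3) True _ xK(1)])
      then show False using xK by (auto simp: ge_def)
    qed
    then have b: "b \<noteq> 0" "v P b = v P x" using gab by (auto simp: ge_def)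
    have "S' = loc S b P" using loc_indep[OF g x a1(1,2) ab(3) b(1) a1(3,4) b(2)] a1 by simp
    then show ?thesis using True b a1 by (intro that[OF gen2_swap[OF G] b(1) a1(3)]) auto
  next
    case False
    then have a: "a \<noteq> 0" "v P a = v P x" using gab by (auto simp: ge_def)
    have "ge P (v P x - v P a) (b / a)" using ge_divide[OF PX ab(7,6) a(1) gab(2)] .
    then obtain c where c: "c \<in> C" "ge P 1 (b / a - c)" using residue[OF PX K_divide[OF ab(7,6)]] a by auto
    have "ge P (1 + v P a) ((b / a - c) * a)"
      by (rule ge_mult[OF PX sring_diff[OF K K_divide[OF ab(7,6)] C_K[OF c(1)]] ab(6) c(2) ge_v])
    moreover have "(b / a - c) * a = b - c * a" using a by (simp add: field_simps)
    ultimately have "ge P (v P a + 1) (b - c * a)" by (simp add: add.commute)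
    moreover have "S' = loc S a P" using loc_indep[OF g x a1(1,2) ab(2) a(1) a1(3,4) a(2)] a1 by simp
    ultimately show ?thesis using a1(3) by (intro that[OF gen2_shear[OF G c(1)] a(1)])
  qed
qed

text \<open>The element \<open>x'\<close> of minimal order in \<open>(a', b' / a')\<close> has order at most that of \<open>a'\<close>, which is minimal in the
  original ring. This gives the monotonicity of the multiplicity place by place.\<close>

lemma first_nbhd_gen2:
  assumes G: "gen2 Z S a b" and x: "minel Z S x" and S': "S' \<in> first_nbhd S"
  shows "\<exists>Y a' b' x'. gen2 Y S' a' b' \<and> Y \<subseteq> Z \<and> minel Y S' x' \<and>
    (\<forall>P\<in>Y. v P x' \<le> v P x \<and> (\<exists>a''\<in>mx Z S. a'' \<noteq> 0 \<and> v P a'' = v P x \<and> S' = loc S a'' P))"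
proof -
  obtain a' b' P where ab: "gen2 Z S a' b'" "a' \<noteq> 0" "P \<in> Z" "ge P (v P a' + 1) b'" "S' = loc S a' P"
    using first_nbhd_adapted[OF G x S'] by blast
  define Y where "Y = {P\<in>Z. ge P (v P a' + 1) b'}"
  note B = blowup_gen2[OF ab(1,3,2,4) x, folded Y_def ab(5)]
  have YZ: "Y \<subseteq> Z" by (auto simp: Y_def)
  obtain x' where x': "minel Y S' x'" using gen2_has_minel[OF B(1)] by blast
  have "v P x' \<le> v P x" if P: "P \<in> Y" for P
    using minel_le[OF x' gen2D(2)[OF B(1)] ab(2) P] B(2)[OF P] by simp
  moreover have "\<exists>a''\<in>mx Z S. a'' \<noteq> 0 \<and> v P a'' = v P x \<and> S' = loc S a'' P" if P: "P \<in> Y" for P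
    using gen2D(2)[OF ab(1)] ab(2) B(2)[OF P] B(3)[OF P] by (intro bexI[of _ a']) auto
  ultimately show ?thesis using B(1) YZ x' by blast
qed

lemma first_nbhd_planar:
  assumes "planar S" and S': "S' \<in> first_nbhd S"
  shows "planar S'" "local_mult (as_ring S') \<le> local_mult (as_ring S)"
proof -
  obtain Z a b where G: "gen2 Z S a b" using assms by (auto simp: planar_def)
  obtain x where x: "minel Z S x" using gen2_has_minel[OF G] by blast
  from first_nbhd_gen2[OF G x S'] obtain Y a' b' x' where Y: "gen2 Y S' a' b'" "Y \<subseteq> Z" "minel Y S' x'"
    and Yx: "\<forall>P\<in>Y. v P x' \<le> v P x \<and> (\<exists>a''\<in>mx Z S. a'' \<noteq> 0 \<and> v P a'' = v P x \<and> S' = loc S a'' P)"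
    by (elim exE conjE)
  show "planar S'" using Y(1) unfolding planar_def by blast
  have "(\<Sum>P\<in>Y. v P x') \<le> (\<Sum>P\<in>Y. v P x)" using Yx by (intro sum_mono) blast
  also have "\<dots> \<le> (\<Sum>P\<in>Z. v P x)"
  proof (rule sum_mono2[OF curve_localD(2)[OF gen2D(1)[OF G]] Y(2)])
    show "0 \<le> v P x" if "P \<in> Z - Y" for P using minel_pos[OF x, of P] that by auto
  qed
  finally show "local_mult (as_ring S') \<le> local_mult (as_ring S)"
    unfolding curve_local_local_mult[OF gen2D(1)[OF G] x] curve_local_local_mult[OF gen2D(1)[OF Y(1)] Y(3)]
    by (simp only: of_int_le_iff)
qed

lemma nbhd_planar:
  assumes "planar S" "S' \<in> nbhd i S"
  shows "planar S' \<and> local_mult (as_ring S') \<le> local_mult (as_ring S)"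
  using assms(2)
proof (induction i arbitrary: S')
  case 0
  then show ?case using assms(1) by simp
next
  case (Suc i)
  then obtain T where T: "T \<in> nbhd i S" "S' \<in> first_nbhd T" by auto
  show ?case using Suc.IH[OF T(1)] first_nbhd_planar[OF _ T(2)] by auto
qed

lemma planar_regular_iff:
  assumes "planar S"
  shows "regular_local (as_ring S) \<longleftrightarrow> local_mult (as_ring S) = 1"
proof -
  obtain Z a b where G: "gen2 Z S a b" using assms by (auto simp: planar_def)
  note g = gen2D(1)[OF G]
  obtain x where x: "minel Z S x" using gen2_has_minel[OF G] by blast
  have "local_mult (as_ring S) = 1 \<longleftrightarrow> (\<Sum>P\<in>Z. v P x) = 1"
    unfolding curve_local_local_mult[OF g x] by (simp only: of_int_eq_1_iff)
  then show ?thesis using regular_imp_sum_1[OF g x] sum_1_imp_regular[OF g x] by blast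
qed

lemma planar_self_nbhd:
  assumes "planar S" "S \<in> first_nbhd S"
  shows "regular_local (as_ring S)"
proof -
  obtain Z a b where G: "gen2 Z S a b" using assms by (auto simp: planar_def)
  obtain x where x: "minel Z S x" using gen2_has_minel[OF G] by blast
  show ?thesis by (rule first_nbhd_self_regular[OF gen2D(1)[OF G] x assms(2)])
qed

text \<open>The multiplicities of the points of the first neighborhood add up to at most the multiplicity of the
  point blown up; so at most one of them can keep the multiplicity.\<close>

lemma first_nbhd_full:
  assumes G: "gen2 Z S a b" and x: "minel Z S x" and S': "S' \<in> first_nbhd S"
    and m: "local_mult (as_ring S') = local_mult (as_ring S)" and P: "P \<in> Z"
  shows "\<exists>a''\<in>mx Z S. a'' \<noteq> 0 \<and> v P a'' = v P x \<and> S' = loc S a'' P"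
proof -
  from first_nbhd_gen2[OF G x S'] obtain Y a' b' x' where Y: "gen2 Y S' a' b'" "Y \<subseteq> Z" "minel Y S' x'"
    and Yx: "\<forall>P\<in>Y. v P x' \<le> v P x \<and> (\<exists>a''\<in>mx Z S. a'' \<noteq> 0 \<and> v P a'' = v P x \<and> S' = loc S a'' P)"
    by (elim exE conjE)
  have "P \<in> Y"
  proof (rule ccontr)
    assume "P \<notin> Y"
    have fin: "finite Z" using curve_localD(2)[OF gen2D(1)[OF G]] .
    have "(\<Sum>P\<in>Y. v P x') \<le> (\<Sum>P\<in>Y. v P x)" using Yx by (intro sum_mono) blast
    also have "\<dots> < v P x + (\<Sum>P\<in>Y. v P x)" using minel_pos[OF x P] by simp
    also have "\<dots> = (\<Sum>P\<in>insert P Y. v P x)" using \<open>P \<notin> Y\<close> finite_subset[OF Y(2) fin] by simp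
    also have "\<dots> \<le> (\<Sum>P\<in>Z. v P x)"
    proof (rule sum_mono2[OF fin])
      show "insert P Y \<subseteq> Z" using P Y by auto
      show "0 \<le> v Q x" if "Q \<in> Z - insert P Y" for Q using minel_pos[OF x, of Q] that by auto
    qed
    finally show False
      using m unfolding curve_local_local_mult[OF gen2D(1)[OF G] x] curve_local_local_mult[OF gen2D(1)[OF Y(1)] Y(3)]
      by (simp only: of_int_eq_iff)
  qed
  then show ?thesis using Yx by blast
qed

lemma first_nbhd_unique:
  assumes S: "planar S" and S1: "S1 \<in> first_nbhd S" "local_mult (as_ring S1) = local_mult (as_ring S)"
    and S2: "S2 \<in> first_nbhd S" "local_mult (as_ring S2) = local_mult (as_ring S)"
  shows "S1 = S2"
proof -
  obtain Z a b where G: "gen2 Z S a b" using S by (auto simp: planar_def)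
  note g = gen2D(1)[OF G]
  obtain x where x: "minel Z S x" using gen2_has_minel[OF G] by blast
  obtain P where P: "P \<in> Z" using curve_localD(4)[OF g] by auto
  obtain a1 where a1: "a1 \<in> mx Z S" "a1 \<noteq> 0" "v P a1 = v P x" "S1 = loc S a1 P"
    using first_nbhd_full[OF G x S1 P] by blast
  obtain a2 where a2: "a2 \<in> mx Z S" "a2 \<noteq> 0" "v P a2 = v P x" "S2 = loc S a2 P"
    using first_nbhd_full[OF G x S2 P] by blast
  show ?thesis using loc_indep[OF g x a1(1,2) a2(1,2) P a1(3) a2(3)] a1(4) a2(4) by simp
qed

end

section \<open>Binary forms\<close>

hide_const (open) UnivPoly.coeff UnivPoly.monom

lemma alg_closed_infinite: "infinite (UNIV :: 'k::alg_closed_field set)"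
proof
  assume fin: "finite (UNIV :: 'k set)"
  define p where "p = (\<Prod>a\<in>(UNIV::'k set). [:- a, 1:])"
  have deg: "Polynomial.degree p = card (UNIV :: 'k set)"
    unfolding p_def by (subst degree_prod_eq_sum_degree) auto
  then have "Polynomial.degree p > 0" using fin by (simp add: card_gt_0_iff)
  then have "Polynomial.degree (p + 1) > 0" by (simp add: degree_add_eq_left)
  then obtain x where "poly (p + 1) x = 0" using alg_closed_imp_poly_has_root by blast
  moreover have "poly p x = 0" unfolding p_def poly_prod using fin by (simp add: prod_zero_iff)
  ultimately show False by simp
qed

abbreviation ccf :: "'k::zero bipoly \<Rightarrow> nat \<Rightarrow> nat \<Rightarrow> 'k" where
  "ccf F j i \<equiv> Polynomial.coeff (Polynomial.coeff F j) i"

lemma homogD: "homog n F \<Longrightarrow> ccf F j i \<noteq> 0 \<Longrightarrow> i + j = n"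
  by (auto simp: homog_def)

lemma homog_0 [simp]: "homog n 0"
  by (simp add: homog_def)

lemma homog_const2 [simp]: "homog 0 (const2 c)"
  by (auto simp: homog_def coeff_pCons split: nat.splits)

lemma homog_1 [simp]: "homog 0 1"
  using homog_const2[of 1] by (simp add: one_pCons)

lemma homog_add: "homog n F \<Longrightarrow> homog n G \<Longrightarrow> homog n (F + G :: 'k::comm_ring_1 bipoly)"
  by (auto simp: homog_def) (metis add.right_neutral)

lemma homog_uminus: "homog n F \<Longrightarrow> homog n (- F :: 'k::comm_ring_1 bipoly)"
  by (auto simp: homog_def)

lemma homog_diff: "homog n F \<Longrightarrow> homog n G \<Longrightarrow> homog n (F - G :: 'k::comm_ring_1 bipoly)"
  using homog_add[of n F "- G"] homog_uminus[of n G] by simp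

lemma homog_sum: "(\<And>i. i \<in> A \<Longrightarrow> homog n (f i)) \<Longrightarrow> homog n (sum f A :: 'k::comm_ring_1 bipoly)"
  by (induction A rule: infinite_finite_induct) (auto intro: homog_add)

lemma homog_mult:
  assumes "homog m F" "homog n G"
  shows "homog (m + n) (F * G :: 'k::comm_ring_1 bipoly)"
  unfolding homog_def
proof (intro allI impI)
  fix i j assume "ccf (F * G) j i \<noteq> 0"
  then have "(\<Sum>a\<le>j. \<Sum>b\<le>i. ccf F a b * ccf G (j - a) (i - b)) \<noteq> 0"
    by (simp add: coeff_mult coeff_sum)
  then obtain a where a: "a \<le> j" "(\<Sum>b\<le>i. ccf F a b * ccf G (j - a) (i - b)) \<noteq> 0"
    by (meson atMost_iff sum.neutral)
  then obtain b where b: "b \<le> i" "ccf F a b * ccf G (j - a) (i - b) \<noteq> 0"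
    by (meson atMost_iff sum.neutral)
  then have "ccf F a b \<noteq> 0" "ccf G (j - a) (i - b) \<noteq> 0" by auto
  then have "b + a = m" "(i - b) + (j - a) = n" using assms homogD by blast+
  then show "i + j = m + n" using a b by auto
qed

lemma homog_mult': "homog m F \<Longrightarrow> homog n G \<Longrightarrow> k = m + n \<Longrightarrow> homog k (F * G :: 'k::comm_ring_1 bipoly)"
  using homog_mult by auto

lemma homog_cmult: "homog n F \<Longrightarrow> homog n (const2 c * F :: 'k::comm_ring_1 bipoly)"
  by (rule homog_mult'[of 0]) auto

lemma homog_power: "homog n F \<Longrightarrow> homog (k * n) (F ^ k :: 'k::comm_ring_1 bipoly)"
  by (induction k) (auto intro: homog_mult)

lemma homog_prod:
  assumes "finite A" "\<And>i. i \<in> A \<Longrightarrow> homog (d i) (f i)"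
  shows "homog (sum d A) (prod f A :: 'k::comm_ring_1 bipoly)"
  using assms by (induction A rule: finite_induct) (auto intro: homog_mult)

lemma homog_unique:
  assumes "homog m F" "homog n F" "F \<noteq> 0"
  shows "m = n"
proof -
  obtain j i where "ccf F j i \<noteq> 0" using assms(3) by (metis leading_coeff_0_iff)
  then show ?thesis using assms homogD by metis
qed

lemma const2_simps:
  "const2 (0::'k::comm_ring_1) = 0" "const2 (1::'k) = 1" "const2 (a + b) = const2 a + const2 (b::'k)"
  "const2 (a - b) = const2 a - const2 (b::'k)" "const2 (a * b) = const2 a * const2 (b::'k)" "const2 (- a) = - const2 (a::'k)"
  by (simp_all add: one_pCons)

lemma homog_0_const:
  assumes "homog 0 F"
  shows "F = const2 (ccf F 0 0)"
proof (intro poly_eqI)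
  fix j i
  show "ccf F j i = ccf (const2 (ccf F 0 0)) j i"
    using homogD[OF assms, of j i] by (auto simp: coeff_pCons split: nat.splits)
qed

definition ev :: "'k \<times> 'k \<Rightarrow> 'k::comm_ring_1 bipoly \<Rightarrow> 'k" where
  "ev P F = eval2 F (fst P) (snd P)"

lemma ev_simps [simp]:
  "ev P (F + G) = ev P F + ev P G" "ev P (F - G) = ev P F - ev P G" "ev P (- F) = - ev P F"
  "ev P (F * G) = ev P F * ev P G" "ev P (const2 c) = c" "ev P 0 = 0" "ev P 1 = 1" "ev P (F ^ k) = ev P F ^ k"
  by (simp_all add: ev_def eval2_def)

lemma ev_smult [simp]: "ev P (Polynomial.smult q F) = poly q (fst P) * ev P F"
  by (simp add: ev_def eval2_def)

lemma ev_sum: "ev P (sum f A) = (\<Sum>i\<in>A. ev P (f i))"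
  by (induction A rule: infinite_finite_induct) auto

lemma ev_prod: "ev P (prod f A) = (\<Prod>i\<in>A. ev P (f i))"
  by (induction A rule: infinite_finite_induct) auto

text \<open>One coordinate vector for each point of the projective line.\<close>

definition pts :: "('k::field \<times> 'k) set" where
  "pts = insert (0, 1) (range (Pair 1))"

definition lf :: "'k::comm_ring_1 \<times> 'k \<Rightarrow> 'k bipoly" where
  "lf P = [:[:0, snd P:], [:- fst P:]:]"

lemma homog_lf [simp]: "homog 1 (lf P)"
  by (auto simp: homog_def lf_def coeff_pCons split: nat.splits)

lemma homog_lf_Suc [simp]: "homog (Suc 0) (lf P)"
  using homog_lf[of P] by simp

lemma ev_lf: "ev Q (lf P) = snd P * fst Q - fst P * snd Q"
  by (simp add: ev_def eval2_def lf_def algebra_simps)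

lemma ev_lf_0_iff: "P \<in> pts \<Longrightarrow> Q \<in> pts \<Longrightarrow> ev Q (lf P) = 0 \<longleftrightarrow> P = Q"
  by (auto simp: ev_lf pts_def)

lemma lf_nonzero [simp]: "P \<in> pts \<Longrightarrow> lf P \<noteq> (0 :: 'k::field bipoly)"
  by (auto simp: lf_def pts_def)

lemma proj_rep:
  assumes "(s, t) \<noteq> (0, 0 :: 'k::field)"
  obtains P u where "P \<in> pts" "u \<noteq> 0" "s = u * fst P" "t = u * snd P"
proof (cases "s = 0")
  case True
  then show ?thesis using assms that[of "(0,1)" t] by (auto simp: pts_def)
next
  case False
  then show ?thesis using assms that[of "(1, t / s)" s] by (auto simp: pts_def)
qed

lemma infinite_pts: "infinite (pts :: ('k::alg_closed_field \<times> 'k) set)"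
proof -
  have "infinite (range (Pair (1::'k)) :: ('k \<times> 'k) set)"
    using alg_closed_infinite range_inj_infinite[of "Pair (1::'k)"]
    by (metis finite_imageD injI prod.inject)
  then show ?thesis by (simp add: pts_def)
qed

lemma homog_degree:
  assumes "homog n (F :: 'k::comm_ring_1 bipoly)"
  shows "Polynomial.degree F \<le> n"
proof (rule degree_le, intro allI impI poly_eqI)
  fix j i assume "n < j"
  then show "ccf F j i = Polynomial.coeff 0 i" using homogD[OF assms, of j i] by auto
qed

lemma homog_coeff:
  assumes "homog n (F :: 'k::comm_ring_1 bipoly)" "j \<le> n"
  shows "Polynomial.coeff F j = Polynomial.monom (ccf F j (n - j)) (n - j)"
proof (rule poly_eqI)
  fix i show "ccf F j i = Polynomial.coeff (Polynomial.monom (ccf F j (n - j)) (n - j)) i"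
    using homogD[OF assms(1), of j i] assms(2) by (cases "ccf F j i = 0") auto
qed

lemma poly_homog:
  assumes "homog n (F :: 'k::comm_ring_1 bipoly)"
  shows "poly F q = (\<Sum>j\<le>n. Polynomial.monom (ccf F j (n - j)) (n - j) * q ^ j)"
proof -
  have "poly F q = (\<Sum>j\<le>Polynomial.degree F. Polynomial.coeff F j * q ^ j)" by (rule poly_altdef)
  also have "\<dots> = (\<Sum>j\<le>n. Polynomial.coeff F j * q ^ j)"
    using homog_degree[OF assms] by (intro sum.mono_neutral_left) (auto simp: coeff_eq_0)
  also have "\<dots> = (\<Sum>j\<le>n. Polynomial.monom (ccf F j (n - j)) (n - j) * q ^ j)"
    using homog_coeff[OF assms] by (intro sum.cong) auto
  finally show ?thesis .
qed

lemma ev_homog: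
  assumes "homog n (F :: 'k::comm_ring_1 bipoly)"
  shows "ev (s, t) F = (\<Sum>j\<le>n. ccf F j (n - j) * s ^ (n - j) * t ^ j)"
  unfolding ev_def eval2_def poly_homog[OF assms] fst_conv snd_conv
  by (simp add: poly_sum poly_monom algebra_simps)

lemma ev_scale:
  assumes "homog n (F :: 'k::comm_ring_1 bipoly)"
  shows "ev (u * s, u * t) F = u ^ n * ev (s, t) F"
proof -
  have "ccf F j (n - j) * (u * s) ^ (n - j) * (u * t) ^ j = u ^ n * (ccf F j (n - j) * s ^ (n - j) * t ^ j)"
    if "j \<le> n" for j
  proof -
    have "u ^ n = u ^ (n - j) * u ^ j" using that by (simp flip: power_add)
    then show ?thesis by (simp add: power_mult_distrib algebra_simps)
  qed
  then show ?thesis unfolding ev_homog[OF assms] sum_distrib_left by (intro sum.cong) auto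
qed

text \<open>A form that vanishes at a point is divisible by the linear form of that point.\<close>

lemma form_root_factor:
  fixes F :: "'k::field bipoly"
  assumes F: "homog n F" and P: "P \<in> pts" and root: "ev P F = 0"
  obtains G where "F = lf P * G" "homog (n - 1) G" "F \<noteq> 0 \<Longrightarrow> n > 0"
proof -
  have "\<exists>G. F = lf P * G \<and> homog (n - 1) G"
  proof (cases "P = (0, 1)")
    case True
    have "ev P F = (\<Sum>j\<le>n. if j = n then ccf F n 0 else 0)"
      unfolding True ev_homog[OF F] by (intro sum.cong) auto
    then have c0: "ccf F n 0 = 0" using root by simp
    have z: "ccf F j 0 = 0" for j using homogD[OF F, of j 0] c0 by auto
    define G where "G = map_poly (poly_shift 1) F"
    have cG: "Polynomial.coeff G j = poly_shift 1 (Polynomial.coeff F j)" for j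
      unfolding G_def by (rule coeff_map_poly) (simp add: poly_shift_0)
    have "F = lf P * G"
    proof (intro poly_eqI)
      fix j i
      have "lf P * G = Polynomial.smult [:0, 1:] G" by (simp add: lf_def True)
      then have "ccf (lf P * G) j i = Polynomial.coeff ([:0, 1:] * poly_shift 1 (Polynomial.coeff F j)) i"
        by (simp add: cG)
      also have "\<dots> = ccf F j i" using z by (cases i) (auto simp: coeff_poly_shift coeff_pCons)
      finally show "ccf F j i = ccf (lf P * G) j i" by simp
    qed
    moreover have "homog (n - 1) G"
      unfolding homog_def
    proof (intro allI impI)
      fix i j assume "ccf G j i \<noteq> 0"
      then have "ccf F j (Suc i) \<noteq> 0" by (simp add: cG coeff_poly_shift)
      then have "Suc i + j = n" by (rule homogD[OF F])
      then show "i + j = n - 1" by auto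
    qed
    ultimately show ?thesis by blast
  next
    case False
    then obtain t where t: "P = (1, t)" using P by (auto simp: pts_def)
    have "poly F [:0, t:] = (\<Sum>j\<le>n. Polynomial.monom (ccf F j (n - j) * t ^ j) n)"
      unfolding poly_homog[OF F]
    proof (rule sum.cong[OF refl])
      fix j assume "j \<in> {..n}"
      moreover have "[:0, t:] = Polynomial.monom t 1" by (simp add: monom_altdef)
      ultimately show "Polynomial.monom (ccf F j (n - j)) (n - j) * [:0, t:] ^ j = Polynomial.monom (ccf F j (n - j) * t ^ j) n"
        by (simp add: monom_power mult_monom)
    qed
    also have "\<dots> = Polynomial.monom (ev P F) n"
      unfolding t ev_homog[OF F] by (rule poly_eqI) (auto simp: coeff_sum)
    finally have "poly F [:0, t:] = 0" using root by simp
    then obtain G' where G': "F = [:- [:0, t:], 1:] * G'" unfolding poly_eq_0_iff_dvd by (elim dvdE)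
    define G where "G = - G'"
    have "lf P = - [:- [:0, t:], 1:]" by (simp add: lf_def t one_pCons)
    then have FG: "F = lf P * G" unfolding G' G_def by (simp only: minus_mult_minus)
    have rec: "ccf G j i = (if i = 0 then 0 else t * ccf G (Suc j) (i - 1)) - ccf F (Suc j) i" for j i
    proof -
      have "Polynomial.coeff F (Suc j) = [:0, t:] * Polynomial.coeff G (Suc j) - Polynomial.coeff G j"
        unfolding FG by (simp add: lf_def t mult_pCons_left)
      then show ?thesis by (cases i) (auto simp: coeff_pCons)
    qed
    have "ccf G j i \<noteq> 0 \<longrightarrow> Suc (i + j) = n" for i j
    proof (induction "Polynomial.degree G - j" arbitrary: i j)
      case 0
      show ?case
      proof
        assume nz: "ccf G j i \<noteq> 0"
        have "Polynomial.coeff G (Suc j) = 0" using 0 by (intro coeff_eq_0) auto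
        then have "ccf F (Suc j) i \<noteq> 0" using nz rec[of j i] by (auto split: if_splits)
        then show "Suc (i + j) = n" using homogD[OF F] by fastforce
      qed
    next
      case (Suc d)
      show ?case
      proof
        assume nz: "ccf G j i \<noteq> 0"
        then consider "ccf F (Suc j) i \<noteq> 0" | "i \<noteq> 0" "ccf G (Suc j) (i - 1) \<noteq> 0"
          using rec[of j i] by (cases "ccf F (Suc j) i = 0"; cases "ccf G (Suc j) (i - 1) = 0") (auto split: if_splits)
        then show "Suc (i + j) = n"
        proof cases
          case 1
          then show ?thesis using homogD[OF F] by fastforce
        next
          case 2
          then show ?thesis using Suc(1)[of "Suc j" "i - 1"] Suc(2) by auto
        qed
      qed
    qed
    then have "homog (n - 1) G" unfolding homog_def by (metis diff_Suc_1)
    then show ?thesis using FG by blast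
  qed
  moreover have "n > 0" if "F \<noteq> 0"
  proof (rule ccontr)
    assume "\<not> n > 0"
    then have "homog 0 F" using F by simp
    then have "F = const2 (ev P F)" using homog_0_const by (metis ev_simps(5))
    then show False using root that by simp
  qed
  ultimately show ?thesis using that by blast
qed

text \<open>If \<open>F(1, t)\<close> is not constant, then the field provides a root; otherwise the coefficient of \<open>y^n\<close> vanishes and
  \<open>(0, 1)\<close> is a root.\<close>

lemma form_has_root:
  fixes F :: "'k::alg_closed_field bipoly"
  assumes F: "homog n F" and n: "n > 0"
  shows "\<exists>P\<in>pts. ev P F = 0"
proof -
  define f where "f = (\<Sum>j\<le>n. Polynomial.monom (ccf F j (n - j)) j)"
  have pf: "poly f t = ev (1, t) F" for t
    unfolding ev_homog[OF F] f_def by (simp add: poly_sum poly_monom)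
  show ?thesis
  proof (cases "Polynomial.degree f > 0")
    case True
    then obtain t where "poly f t = 0" using alg_closed_imp_poly_has_root by blast
    then show ?thesis using pf by (intro bexI[of _ "(1, t)"]) (auto simp: pts_def)
  next
    case False
    have "Polynomial.coeff f n = ccf F n 0" unfolding f_def by (simp add: coeff_sum)
    moreover have "Polynomial.coeff f n = 0" using False n by (intro coeff_eq_0) auto
    moreover have "ev (0, 1) F = (\<Sum>j\<le>n. if j = n then ccf F n 0 else 0)"
      unfolding ev_homog[OF F] by (intro sum.cong) auto
    ultimately show ?thesis by (intro bexI[of _ "(0, 1)"]) (auto simp: pts_def)
  qed
qed

text \<open>Over an algebraically closed field, a form is a product of linear forms.\<close>

lemma form_induct [consumes 2, case_names const linear]:
  fixes F :: "'k::alg_closed_field bipoly"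
  assumes "homog n F" "F \<noteq> 0"
    and const: "\<And>c. c \<noteq> 0 \<Longrightarrow> Q 0 (const2 c)"
    and linear: "\<And>P n F. P \<in> pts \<Longrightarrow> homog n F \<Longrightarrow> F \<noteq> 0 \<Longrightarrow> Q n F \<Longrightarrow> Q (Suc n) (lf P * F)"
  shows "Q n F"
  using assms(1,2)
proof (induction n arbitrary: F)
  case 0
  then show ?case using const homog_0_const[OF 0(1)] by (metis pCons_0_0)
next
  case (Suc n)
  obtain P where P: "P \<in> pts" "ev P F = 0" using form_has_root[OF Suc(2)] by auto
  obtain G where G: "F = lf P * G" "homog n G" using form_root_factor[OF Suc(2) P] by auto
  then show ?case using linear[OF P(1) G(2)] Suc(1)[OF G(2)] Suc(3) by auto
qed

text \<open>The order of vanishing of a form at \<open>P\<close>.\<close>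

definition mul :: "'k::field \<times> 'k \<Rightarrow> 'k bipoly \<Rightarrow> nat" where
  "mul P F = (THE k. \<exists>G. F = lf P ^ k * G \<and> ev P G \<noteq> 0)"

lemma mulI:
  fixes F :: "'k::field bipoly"
  assumes P: "P \<in> pts" and F: "F = lf P ^ k * G" "ev P G \<noteq> 0"
  shows "mul P F = k"
  unfolding mul_def
proof (rule the_equality)
  show "\<exists>G. F = lf P ^ k * G \<and> ev P G \<noteq> 0" using F by blast
  fix j assume "\<exists>G. F = lf P ^ j * G \<and> ev P G \<noteq> 0"
  then obtain H where H: "F = lf P ^ j * H" "ev P H \<noteq> 0" by blast
  have aux: False if "lf P ^ a * A = lf P ^ b * B" "a < b" "ev P A \<noteq> 0" for a b A B
  proof -
    have "lf P ^ b = lf P ^ a * lf P ^ (b - a)" using that by (simp flip: power_add)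
    then have "lf P ^ a * A = lf P ^ a * (lf P ^ (b - a) * B)" using that by (simp add: mult.assoc)
    then have "A = lf P ^ (b - a) * B" using P by simp
    then have "ev P A = 0" using that(2) ev_lf_0_iff[OF P P] by (simp add: power_0_left)
    then show False using that by simp
  qed
  show "j = k" using aux[of j H k G] aux[of k G j H] F H by (metis linorder_neqE_nat)
qed

lemma form_mul_factor:
  fixes F :: "'k::field bipoly"
  assumes F: "homog n F" "F \<noteq> 0" and P: "P \<in> pts"
  obtains G where "F = lf P ^ mul P F * G" "homog (n - mul P F) G" "ev P G \<noteq> 0" "mul P F \<le> n"
proof -
  have "\<exists>k G. F = lf P ^ k * G \<and> homog (n - k) G \<and> ev P G \<noteq> 0 \<and> k \<le> n"
    using F
  proof (induction n arbitrary: F)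
    case 0
    have "ev P F \<noteq> 0" using form_root_factor[OF 0(1) P] 0(2) by blast
    then show ?case using 0 by (intro exI[of _ 0] exI[of _ F]) auto
  next
    case (Suc n)
    show ?case
    proof (cases "ev P F = 0")
      case False
      then show ?thesis using Suc by (intro exI[of _ 0] exI[of _ F]) auto
    next
      case True
      obtain G where G: "F = lf P * G" "homog n G" using form_root_factor[OF Suc(2) P True] by auto
      then obtain k H where "G = lf P ^ k * H" "homog (n - k) H" "ev P H \<noteq> 0" "k \<le> n"
        using Suc(1)[OF G(2)] Suc(3) by auto
      then show ?thesis using G by (intro exI[of _ "Suc k"] exI[of _ H]) (auto simp: mult.assoc)
    qed
  qed
  then obtain k G where G: "F = lf P ^ k * G" "homog (n - k) G" "ev P G \<noteq> 0" "k \<le> n" by blast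
  have "mul P F = k" by (rule mulI[OF P G(1,3)])
  then show ?thesis using G that by blast
qed

lemma mul_mult:
  fixes F G :: "'k::field bipoly"
  assumes "homog m F" "F \<noteq> 0" "homog n G" "G \<noteq> 0" and P: "P \<in> pts"
  shows "mul P (F * G) = mul P F + mul P G"
proof -
  obtain A where A: "F = lf P ^ mul P F * A" "ev P A \<noteq> 0" using form_mul_factor[OF assms(1,2) P] by blast
  obtain B where B: "G = lf P ^ mul P G * B" "ev P B \<noteq> 0" using form_mul_factor[OF assms(3,4) P] by blast
  have "F * G = (lf P ^ mul P F * A) * (lf P ^ mul P G * B)" using A(1) B(1) by simp
  also have "\<dots> = lf P ^ (mul P F + mul P G) * (A * B)" by (simp add: power_add algebra_simps)
  finally show ?thesis by (rule mulI[OF P]) (use A B in simp)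
qed

lemma mul_0I: "P \<in> pts \<Longrightarrow> ev P F \<noteq> 0 \<Longrightarrow> mul P (F :: 'k::field bipoly) = 0"
  by (rule mulI[of P F 0 F]) auto

lemma mul_const2 [simp]: "P \<in> pts \<Longrightarrow> c \<noteq> 0 \<Longrightarrow> mul P (const2 (c :: 'k::field)) = 0"
  by (rule mul_0I) auto

lemma mul_pos_iff:
  fixes F :: "'k::field bipoly"
  assumes F: "homog n F" "F \<noteq> 0" and P: "P \<in> pts"
  shows "0 < mul P F \<longleftrightarrow> ev P F = 0"
proof
  assume m: "0 < mul P F"
  obtain G where G: "F = lf P ^ mul P F * G" using form_mul_factor[OF F P] by blast
  have "ev P F = ev P (lf P ^ mul P F * G)" using G by simp
  then show "ev P F = 0" using m ev_lf_0_iff[OF P P] by (simp add: power_0_left)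
next
  assume root: "ev P F = 0"
  obtain G where G: "F = lf P ^ mul P F * G" "ev P G \<noteq> 0" using form_mul_factor[OF F P] by blast
  show "0 < mul P F"
  proof (rule ccontr)
    assume "\<not> 0 < mul P F"
    then have "F = G" using G(1) by simp
    then show False using root G(2) by simp
  qed
qed

lemma mul_lf: "P \<in> pts \<Longrightarrow> Q \<in> pts \<Longrightarrow> mul P (lf Q :: 'k::field bipoly) = (if P = Q then 1 else 0)"
  using mulI[of P "lf P" 1 1] mul_0I[of P "lf Q"] ev_lf_0_iff[of Q P] by auto

lemma mul_power:
  fixes F :: "'k::field bipoly"
  assumes "homog n F" "F \<noteq> 0" "P \<in> pts"
  shows "mul P (F ^ k) = k * mul P F"
proof (induction k)
  case 0
  then show ?case using mul_const2[OF assms(3), of 1] by (simp add: one_pCons)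
next
  case (Suc k)
  then show ?case using mul_mult[OF assms(1,2) homog_power[OF assms(1)] _ assms(3), of k] assms(2) by simp
qed

lemma mul_prod:
  fixes f :: "'i \<Rightarrow> 'k::field bipoly"
  assumes "finite A" "\<And>i. i \<in> A \<Longrightarrow> homog (d i) (f i)" "\<And>i. i \<in> A \<Longrightarrow> f i \<noteq> 0" and P: "P \<in> pts"
  shows "mul P (prod f A) = (\<Sum>i\<in>A. mul P (f i))"
  using assms(1-3)
proof (induction A rule: finite_induct)
  case empty
  then show ?case using mul_const2[OF P, of 1] by (simp add: one_pCons)
next
  case (insert i A)
  then have "mul P (f i * prod f A) = mul P (f i) + mul P (prod f A)"
    by (intro mul_mult[OF _ _ homog_prod _ P]) auto
  then show ?case using insert by simp
qed

lemma mul_ge_factor: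
  fixes F :: "'k::field bipoly"
  assumes F: "homog n F" "F \<noteq> 0" and P: "P \<in> pts" and k: "k \<le> mul P F"
  obtains G where "F = lf P ^ k * G" "homog (n - k) G" "k \<le> n" "G \<noteq> 0"
proof -
  obtain G where G: "F = lf P ^ mul P F * G" "homog (n - mul P F) G" "mul P F \<le> n"
    using form_mul_factor[OF F P] by blast
  have "lf P ^ mul P F = lf P ^ k * lf P ^ (mul P F - k)" using k by (simp flip: power_add)
  then have 1: "F = lf P ^ k * (lf P ^ (mul P F - k) * G)" using G(1) by (simp add: mult.assoc)
  have "homog (n - k) (lf P ^ (mul P F - k) * G)"
    using k G by (intro homog_mult'[OF homog_power[OF homog_lf] G(2)]) auto
  moreover have "lf P ^ (mul P F - k) * G \<noteq> 0"
  proof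
    assume "lf P ^ (mul P F - k) * G = 0"
    then have "F = lf P ^ k * 0" using 1 by (simp only:)
    then show False using F(2) by simp
  qed
  ultimately show ?thesis using 1 G k by (intro that) auto
qed

lemma mul_add:
  fixes F G :: "'k::field bipoly"
  assumes "homog n F" "F \<noteq> 0" "homog n G" "G \<noteq> 0" "F + G \<noteq> 0" and P: "P \<in> pts"
  shows "min (mul P F) (mul P G) \<le> mul P (F + G)"
proof -
  define k where "k = min (mul P F) (mul P G)"
  obtain A where A: "F = lf P ^ k * A" "homog (n - k) A" using mul_ge_factor[OF assms(1,2) P, of k] by (auto simp: k_def)
  obtain B where B: "G = lf P ^ k * B" "homog (n - k) B" using mul_ge_factor[OF assms(3,4) P, of k] by (auto simp: k_def)
  have s: "F + G = lf P ^ k * (A + B)" using A B by (simp add: distrib_left)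
  have "mul P (F + G) = k * mul P (lf P) + mul P (A + B)"
    unfolding s mul_power[OF homog_lf lf_nonzero[OF P] P, symmetric]
    using assms(5) s P by (intro mul_mult[OF homog_power[OF homog_lf] _ homog_add[OF A(2) B(2)]]) auto
  then show ?thesis using mul_lf[OF P P] by (simp add: k_def)
qed

lemma finite_roots:
  fixes F :: "'k::alg_closed_field bipoly"
  assumes "homog n F" "F \<noteq> 0"
  shows "finite {P\<in>pts. ev P F = 0}"
  using assms
proof (induction rule: form_induct)
  case (linear P n F)
  have "{Q\<in>pts. ev Q (lf P * F) = 0} \<subseteq> insert P {Q\<in>pts. ev Q F = 0}"
    using ev_lf_0_iff[OF linear(1)] by auto
  then show ?case using linear(4) finite_subset by blast
qed auto

lemma sum_mul:
  fixes F :: "'k::alg_closed_field bipoly"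
  assumes "homog n F" "F \<noteq> 0" and Z: "finite Z" "Z \<subseteq> pts"
  shows "(\<Sum>P\<in>Z. mul P F) \<le> n \<and> ({P\<in>pts. ev P F = 0} \<subseteq> Z \<longrightarrow> (\<Sum>P\<in>Z. mul P F) = n)"
  using assms(1,2)
proof (induction rule: form_induct)
  case (const c)
  have "(\<Sum>P\<in>Z. mul P (const2 c)) = 0" using Z const by (intro sum.neutral) auto
  then show ?case by simp
next
  case (linear Q n F)
  have "(\<Sum>P\<in>Z. mul P (lf Q * F)) = (\<Sum>P\<in>Z. (if P = Q then 1 else 0) + mul P F)"
  proof (rule sum.cong[OF refl])
    fix P assume "P \<in> Z"
    then have P: "P \<in> pts" using Z by auto
    show "mul P (lf Q * F) = (if P = Q then 1 else 0) + mul P F"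
      using mul_mult[OF homog_lf lf_nonzero[OF linear(1)] linear(2,3) P] mul_lf[OF P linear(1)] by simp
  qed
  also have "\<dots> = (if Q \<in> Z then 1 else 0) + (\<Sum>P\<in>Z. mul P F)"
    using Z by (simp add: sum.distrib)
  finally have eq: "(\<Sum>P\<in>Z. mul P (lf Q * F)) = (if Q \<in> Z then 1 else 0) + (\<Sum>P\<in>Z. mul P F)" .
  show ?case
  proof (intro conjI impI)
    show "(\<Sum>P\<in>Z. mul P (lf Q * F)) \<le> Suc n" using eq linear(4) by auto
    assume R: "{P \<in> pts. ev P (lf Q * F) = 0} \<subseteq> Z"
    have "Q \<in> Z" using R linear(1) ev_lf_0_iff[OF linear(1,1)] by auto
    moreover have "{P \<in> pts. ev P F = 0} \<subseteq> Z" using R by auto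
    ultimately show "(\<Sum>P\<in>Z. mul P (lf Q * F)) = Suc n" using eq linear(4) by auto
  qed
qed

text \<open>Divisibility by a form can be tested against a cofactor without common roots.\<close>

lemma form_coprime_dvd:
  fixes h :: "'k::alg_closed_field bipoly"
  assumes h: "homog m h" "h \<noteq> 0" and a: "homog n a" and b: "\<And>P. P \<in> pts \<Longrightarrow> ev P h = 0 \<Longrightarrow> ev P b \<noteq> 0"
    and eq: "a * b = h * q"
  obtains r where "a = h * r" "homog (n - m) r" "a \<noteq> 0 \<Longrightarrow> m \<le> n"
proof -
  have "\<exists>r. a = h * r \<and> homog (n - m) r \<and> (a \<noteq> 0 \<longrightarrow> m \<le> n)"
    using h a b eq
  proof (induction arbitrary: a n q rule: form_induct)
    case (const c)
    have "a = const2 c * (const2 (inverse c) * a)"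
      using const by (simp add: mult.assoc[symmetric] one_pCons[symmetric])
    then show ?case using homog_cmult[OF const(2)] by (intro exI[of _ "const2 (inverse c) * a"]) auto
  next
    case (linear P m h)
    have "ev P (a * b) = ev P (lf P * h * q)" using linear.prems(3) by simp
    then have "ev P a * ev P b = 0" using ev_lf_0_iff[OF linear(1,1)] by simp
    moreover have "ev P b \<noteq> 0" using linear.prems(2)[OF linear(1)] ev_lf_0_iff[OF linear(1,1)] by simp
    ultimately have "ev P a = 0" by simp
    then obtain a' where a': "a = lf P * a'" "homog (n - 1) a'" "a \<noteq> 0 \<Longrightarrow> n > 0"
      using form_root_factor[OF linear.prems(1) linear(1)] by blast
    have "lf P * (a' * b) = lf P * (h * q)" using linear.prems(3) a' by (simp add: mult.assoc)
    then have "a' * b = h * q" using linear(1) by simp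
    moreover have "ev Q b \<noteq> 0" if "Q \<in> pts" "ev Q h = 0" for Q
      using linear.prems(2)[OF that(1)] that(2) by simp
    ultimately obtain r where r: "a' = h * r" "homog (n - 1 - m) r" "a' \<noteq> 0 \<longrightarrow> m \<le> n - 1"
      using linear(4)[OF a'(2)] by blast
    then show ?case using a' by (intro exI[of _ r]) (auto simp: mult.assoc)
  qed
  then show ?thesis using that by blast
qed

section \<open>The function field of the projective line\<close>

definition cfield :: "'k::field bipoly fract set" where
  "cfield = range (\<lambda>c. Fract (const2 c) 1)"

text \<open>The order of a rational function is well defined because numerator and denominator are determined up to a common
  factor.\<close>

definition vP :: "'k::field \<times> 'k \<Rightarrow> 'k bipoly fract \<Rightarrow> int" where
  "vP P x = (THE m. \<exists>n F G. x = Fract F G \<and> homog n F \<and> homog n G \<and> F \<noteq> 0 \<and> G \<noteq> 0 \<and>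
     m = int (mul P F) - int (mul P G))"

lemma vP_Fract:
  fixes F G :: "'k::field bipoly"
  assumes P: "P \<in> pts" and F: "homog n F" "F \<noteq> 0" and G: "homog n G" "G \<noteq> 0"
  shows "vP P (Fract F G) = int (mul P F) - int (mul P G)"
  unfolding vP_def
proof (rule the_equality)
  show "\<exists>n F' G'. Fract F G = Fract F' G' \<and> homog n F' \<and> homog n G' \<and> F' \<noteq> 0 \<and> G' \<noteq> 0 \<and>
     int (mul P F) - int (mul P G) = int (mul P F') - int (mul P G')" using F G by blast
  fix m assume "\<exists>n F' G'. Fract F G = Fract F' G' \<and> homog n F' \<and> homog n G' \<and> F' \<noteq> 0 \<and> G' \<noteq> 0 \<and>
     m = int (mul P F') - int (mul P G')"
  then obtain n' F' G' where FG': "Fract F G = Fract F' G'" "homog n' F'" "homog n' G'" "F' \<noteq> 0" "G' \<noteq> 0"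
    "m = int (mul P F') - int (mul P G')" by blast
  have "F * G' = F' * G" using FG' G by (simp add: eq_fract)
  then have "mul P F + mul P G' = mul P F' + mul P G"
    using mul_mult[OF F FG'(3,5) P] mul_mult[OF FG'(2,4) G P] by simp
  then show "m = int (mul P F) - int (mul P G)" using FG' by simp
qed

lemma P1K_I: "homog n F \<Longrightarrow> homog n G \<Longrightarrow> G \<noteq> 0 \<Longrightarrow> Fract F G \<in> P1_function_field"
  unfolding P1_function_field_def by blast

lemma P1K_E:
  assumes "x \<in> P1_function_field"
  obtains n F G where "x = Fract F G" "homog n F" "homog n G" "G \<noteq> 0"
  using assms unfolding P1_function_field_def by blast

lemma Fract_0_iff: "G \<noteq> 0 \<Longrightarrow> Fract F G = 0 \<longleftrightarrow> F = (0 :: 'k::field bipoly)"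
  by (simp add: Zero_fract_def eq_fract)

text \<open>Numerator and denominator are products of powers of the linear forms of points of \<open>Z\<close>. Their degrees are made equal
  with powers of the linear form of a point outside of \<open>Z\<close>.\<close>

lemma P1_approx:
  fixes n :: "'k::alg_closed_field \<times> 'k \<Rightarrow> int"
  assumes Z: "finite Z" "Z \<subseteq> pts"
  shows "\<exists>x\<in>P1_function_field. x \<noteq> 0 \<and> (\<forall>P\<in>Z. vP P x = n P)"
proof -
  obtain Q where Q: "Q \<in> pts" "Q \<notin> Z" using infinite_pts Z(1) by (meson finite_subset subsetI)
  have form: "\<exists>F. homog (sum a Z + b) F \<and> F \<noteq> 0 \<and> (\<forall>P\<in>Z. mul P F = a P)" for a :: "'k \<times> 'k \<Rightarrow> nat" and b
  proof -
    define F where "F = (\<Prod>P\<in>Z. lf P ^ a P)"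
    have hp: "homog (a P) (lf P ^ a P)" for P using homog_power[OF homog_lf, of "a P" P] by simp
    have F: "homog (sum a Z) F" "F \<noteq> 0" unfolding F_def using Z hp by (auto intro!: homog_prod simp: prod_zero_iff)
    have hq: "homog b (lf Q ^ b)" "lf Q ^ b \<noteq> 0" using homog_power[OF homog_lf, of b Q] Q by simp_all
    have "mul P (F * lf Q ^ b) = a P" if P: "P \<in> Z" for P
    proof -
      have Pp: "P \<in> pts" using P Z by auto
      have "mul P (lf Q ^ b) = 0"
        using mul_power[OF homog_lf lf_nonzero[OF Q(1)] Pp, of b] mul_lf[OF Pp Q(1)] P Q by auto
      moreover have "mul P F = (\<Sum>R\<in>Z. mul P (lf R ^ a R))"
        unfolding F_def using Z hp by (intro mul_prod[OF Z(1) _ _ Pp]) auto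
      moreover have "(\<Sum>R\<in>Z. mul P (lf R ^ a R)) = (\<Sum>R\<in>Z. if R = P then a P else 0)"
      proof (rule sum.cong[OF refl])
        fix R assume "R \<in> Z"
        then have R: "R \<in> pts" using Z by auto
        show "mul P (lf R ^ a R) = (if R = P then a P else 0)"
          using mul_power[OF homog_lf lf_nonzero[OF R] Pp, of "a R"] mul_lf[OF Pp R] by auto
      qed
      ultimately show ?thesis using mul_mult[OF F hq Pp] P Z by simp
    qed
    then show ?thesis using homog_mult[OF F(1) hq(1)] F hq by (intro exI[of _ "F * lf Q ^ b"]) auto
  qed
  define a b where "a P = nat (n P)" and "b P = nat (- n P)" for P
  obtain F where F: "homog (sum a Z + sum b Z) F" "F \<noteq> 0" "\<forall>P\<in>Z. mul P F = a P" using form[of a "sum b Z"] by blast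
  obtain G where G: "homog (sum b Z + sum a Z) G" "G \<noteq> 0" "\<forall>P\<in>Z. mul P G = b P" using form[of b "sum a Z"] by blast
  have G': "homog (sum a Z + sum b Z) G" using G(1) by (simp add: add.commute)
  have "vP P (Fract F G) = n P" if "P \<in> Z" for P
    using vP_Fract[of P, OF _ F(1,2) G' G(2)] F G that Z by (auto simp: a_def b_def)
  then show ?thesis using P1K_I[OF F(1) G' G(2)] F G by (intro bexI[of _ "Fract F G"]) (auto simp: Fract_0_iff)
qed

lemma P1_residue:
  fixes x :: "'k::field bipoly fract"
  assumes P: "P \<in> pts" and x: "x \<in> P1_function_field" "x \<noteq> 0" "vP P x = 0"
  shows "\<exists>c\<in>cfield. x = c \<or> 0 < vP P (x - c)"
proof -
  obtain n F G where FG: "x = Fract F G" "homog n F" "homog n G" "G \<noteq> 0" using P1K_E[OF x(1)] .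
  have F0: "F \<noteq> 0" using x FG by (auto simp: Fract_0_iff)
  have eq: "mul P F = mul P G" using vP_Fract[OF P FG(2) F0 FG(3,4)] x FG by simp
  define k where "k = mul P F"
  obtain A where A: "F = lf P ^ k * A" "homog (n - k) A" "ev P A \<noteq> 0"
    using form_mul_factor[OF FG(2) F0 P] unfolding k_def by blast
  obtain B where B: "G = lf P ^ k * B" "homog (n - k) B" "ev P B \<noteq> 0" "k \<le> n"
    using form_mul_factor[OF FG(3,4) P] unfolding k_def eq by blast
  define c where "c = ev P A / ev P B"
  have xc: "x - Fract (const2 c) 1 = Fract (F - const2 c * G) G" using FG by simp
  show ?thesis
  proof (cases "F - const2 c * G = 0")
    case True
    then have "x = Fract (const2 c) 1" using FG by (simp add: eq_fract)
    then show ?thesis by (auto simp: cfield_def)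
  next
    case False
    define D where "D = A - const2 c * B"
    have FD: "F - const2 c * G = lf P ^ k * D" unfolding A(1) B(1) D_def by (simp add: algebra_simps)
    have D: "homog (n - k) D" "D \<noteq> 0"
      unfolding D_def using homog_diff[OF A(2) homog_cmult[OF B(2)]] False FD by (auto simp: D_def)
    have "ev P D = 0" using B by (simp add: D_def c_def)
    then have "0 < mul P D" using mul_pos_iff[OF D P] by simp
    moreover have "mul P (lf P ^ k * D) = k * mul P (lf P) + mul P D"
      unfolding mul_power[OF homog_lf lf_nonzero[OF P] P, symmetric]
      using P D by (intro mul_mult[OF homog_power[OF homog_lf] _ D(1)]) auto
    ultimately have "mul P G < mul P (F - const2 c * G)" unfolding FD using mul_lf[OF P P] eq k_def by simp
    moreover have "homog n (F - const2 c * G)" using FG by (intro homog_diff homog_cmult)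
    ultimately have "0 < vP P (x - Fract (const2 c) 1)"
      unfolding xc using vP_Fract[OF P _ False FG(3,4)] by simp
    then show ?thesis by (auto simp: cfield_def)
  qed
qed

lemma places_P1: "places (P1_function_field :: 'k::alg_closed_field bipoly fract set) cfield pts vP"
proof (rule places.intro)
  show "sring (P1_function_field :: 'k bipoly fract set)"
    unfolding sring_def
  proof (intro conjI ballI)
    show "1 \<in> (P1_function_field :: 'k bipoly fract set)"
      unfolding One_fract_def by (rule P1K_I[of 0]) auto
    fix x y :: "'k bipoly fract" assume xy: "x \<in> P1_function_field" "y \<in> P1_function_field"
    obtain n F G where FG: "x = Fract F G" "homog n F" "homog n G" "G \<noteq> 0" using P1K_E[OF xy(1)] .
    obtain m F' G' where FG': "y = Fract F' G'" "homog m F'" "homog m G'" "G' \<noteq> 0" using P1K_E[OF xy(2)] .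
    have 1: "homog (n + m) (F * G')" "homog (n + m) (F' * G)" "homog (n + m) (G * G')" "homog (n + m) (F * F')"
      using FG FG' by (auto intro: homog_mult homog_mult')
    show "x - y \<in> P1_function_field" "x * y \<in> P1_function_field"
      using FG FG' 1 by (auto intro!: P1K_I homog_diff)
  qed
  show "inverse x \<in> P1_function_field" if x: "x \<in> P1_function_field" for x :: "'k bipoly fract"
  proof -
    obtain n F G where FG: "x = Fract F G" "homog n F" "homog n G" "G \<noteq> 0" using P1K_E[OF x] .
    have "(0 :: 'k bipoly fract) \<in> P1_function_field" unfolding Zero_fract_def by (rule P1K_I[of 0]) auto
    then show ?thesis using FG P1K_I[of n G F] by (cases "F = 0") (auto simp: fract_collapse)
  qed
  show "sring (cfield :: 'k bipoly fract set)"
    unfolding sring_def cfield_def One_fract_def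
  proof (intro conjI ballI)
    show "Fract 1 1 \<in> range (\<lambda>c::'k. Fract (const2 c) 1)" by (rule range_eqI[of _ _ 1]) (simp add: one_pCons)
    fix x y assume "x \<in> range (\<lambda>c::'k. Fract (const2 c) 1)" "y \<in> range (\<lambda>c::'k. Fract (const2 c) 1)"
    then obtain c d :: 'k where "x = Fract (const2 c) 1" "y = Fract (const2 d) 1" by blast
    then have "x - y = Fract (const2 (c - d)) 1" "x * y = Fract (const2 (c * d)) 1" by simp_all
    then show "x - y \<in> range (\<lambda>c::'k. Fract (const2 c) 1)" "x * y \<in> range (\<lambda>c::'k. Fract (const2 c) 1)" by blast+
  qed
  show "inverse x \<in> cfield" if x: "x \<in> cfield" for x :: "'k bipoly fract"
  proof -
    obtain c :: 'k where c: "x = Fract (const2 c) 1" using x by (auto simp: cfield_def)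
    have "inverse x = Fract (const2 (inverse c)) 1"
    proof (cases "c = 0")
      case True
      then show ?thesis unfolding c by (simp add: Fract_0_iff fract_collapse)
    next
      case False
      then show ?thesis unfolding c by (simp add: eq_fract one_pCons)
    qed
    then show ?thesis by (auto simp: cfield_def)
  qed
  show "cfield \<subseteq> (P1_function_field :: 'k bipoly fract set)"
    unfolding cfield_def by (auto intro!: P1K_I[of 0])
  have "inj (\<lambda>c::'k. Fract (const2 c) 1)" by (rule injI) (simp add: eq_fract)
  then show "infinite (cfield :: 'k bipoly fract set)"
    unfolding cfield_def using alg_closed_infinite[where 'k = 'k] finite_imageD by blast
next
  fix P :: "'k \<times> 'k" and x y :: "'k bipoly fract"
  assume P: "P \<in> pts" and xy: "x \<in> P1_function_field" "y \<in> P1_function_field" "x \<noteq> 0" "y \<noteq> 0"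
  obtain n F G where FG: "x = Fract F G" "homog n F" "homog n G" "G \<noteq> 0" using P1K_E[OF xy(1)] .
  obtain m F' G' where FG': "y = Fract F' G'" "homog m F'" "homog m G'" "G' \<noteq> 0" using P1K_E[OF xy(2)] .
  have F0: "F \<noteq> 0" "F' \<noteq> 0" using xy FG FG' by (auto simp: Fract_0_iff)
  have 1: "homog (n + m) (F * G')" "homog (n + m) (F' * G)" "homog (n + m) (G * G')" "homog (n + m) (F * F')"
    using FG FG' by (auto intro: homog_mult homog_mult')
  have vx: "vP P x = int (mul P F) - int (mul P G)" "vP P y = int (mul P F') - int (mul P G')"
    using vP_Fract[OF P] FG FG' F0 by auto
  have m: "mul P (F * F') = mul P F + mul P F'" "mul P (G * G') = mul P G + mul P G'"
    "mul P (F * G') = mul P F + mul P G'" "mul P (F' * G) = mul P F' + mul P G"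
    using mul_mult[OF _ _ _ _ P] FG FG' F0 by blast+
  show "vP P (x * y) = vP P x + vP P y"
    using vP_Fract[OF P 1(4) _ 1(3)] FG FG' F0 vx m by simp
  show "min (vP P x) (vP P y) \<le> vP P (x + y)" if nz: "x + y \<noteq> 0"
  proof -
    have s: "x + y = Fract (F * G' + F' * G) (G * G')" using FG FG' by simp
    have n0: "F * G' + F' * G \<noteq> 0" using nz s FG FG' by (auto simp: Fract_0_iff)
    have "min (mul P (F * G')) (mul P (F' * G)) \<le> mul P (F * G' + F' * G)"
      using FG FG' F0 n0 by (intro mul_add[OF 1(1) _ 1(2) _ _ P]) auto
    then show ?thesis
      unfolding s using vP_Fract[OF P homog_add[OF 1(1,2)] n0 1(3)] FG FG' vx m by simp
  qed
next
  fix P :: "'k \<times> 'k" and c :: "'k bipoly fract"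
  assume P: "P \<in> pts" and c: "c \<in> cfield" "c \<noteq> 0"
  then obtain d where d: "c = Fract (const2 d) 1" "d \<noteq> 0" by (auto simp: cfield_def Fract_0_iff)
  show "vP P c = 0"
    using vP_Fract[OF P homog_const2 _ homog_1, of d] d P mul_const2[OF P, of 1] by (simp add: one_pCons)
next
  show "\<exists>c\<in>cfield. x = c \<or> 0 < vP P (x - c)"
    if "P \<in> pts" "x \<in> P1_function_field" "x \<noteq> 0" "vP P x = 0" for P and x :: "'k bipoly fract"
    using P1_residue[OF that] .
  show "\<exists>x\<in>P1_function_field. x \<noteq> 0 \<and> (\<forall>P\<in>Z. vP P x = n P)"
    if "finite Z" "Z \<subseteq> pts" for Z and n :: "'k \<times> 'k \<Rightarrow> int"
    by (rule P1_approx[OF that])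
qed

interpretation P1: places "P1_function_field :: 'k::alg_closed_field bipoly fract set" cfield pts vP
  by (rule places_P1)

lemma ge_Fract:
  fixes F G :: "'k::alg_closed_field bipoly"
  assumes P: "P \<in> pts" and "homog n F" "homog n G" "G \<noteq> 0"
  shows "P1.ge P k (Fract F G) \<longleftrightarrow> F = 0 \<or> k \<le> int (mul P F) - int (mul P G)"
  using vP_Fract[OF P, of n F G] assms by (cases "F = 0") (auto simp: P1.ge_def Fract_0_iff fract_collapse)

section \<open>The homogeneous coordinate ring of a parametrized curve\<close>

text \<open>The degree \<open>n\<close> part of the subalgebra generated by \<open>u\<close>, \<open>v\<close>, \<open>w\<close>, that is, of the homogeneous coordinate ring of the
  curve. The recursion avoids exponent vectors.\<close>

primrec fspan :: "'k::comm_ring_1 bipoly \<Rightarrow> 'k bipoly \<Rightarrow> 'k bipoly \<Rightarrow> nat \<Rightarrow> 'k bipoly set" where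
  "fspan u v w 0 = range const2"
| "fspan u v w (Suc n) = {u * a + v * b + w * c | a b c. a \<in> fspan u v w n \<and> b \<in> fspan u v w n \<and> c \<in> fspan u v w n}"

lemma fspan_Suc_I: "a \<in> fspan u v w n \<Longrightarrow> b \<in> fspan u v w n \<Longrightarrow> c \<in> fspan u v w n \<Longrightarrow> u * a + v * b + w * c \<in> fspan u v w (Suc n)"
  by auto

lemma fspan_const: "const2 a \<in> fspan u v w 0"
  by auto

lemma fspan_add: "x \<in> fspan u v w n \<Longrightarrow> y \<in> fspan u v w n \<Longrightarrow> x + y \<in> fspan u v w n"
proof (induction n arbitrary: x y)
  case 0
  then obtain a b where "x = const2 a" "y = const2 b" by auto
  then have "x + y = const2 (a + b)" by simp
  then show ?case by (simp only: fspan_const)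
next
  case (Suc n)
  then obtain a b c a' b' c' where *: "x = u * a + v * b + w * c" "y = u * a' + v * b' + w * c'"
    "a \<in> fspan u v w n" "b \<in> fspan u v w n" "c \<in> fspan u v w n"
    "a' \<in> fspan u v w n" "b' \<in> fspan u v w n" "c' \<in> fspan u v w n" by auto
  have "x + y = u * (a + a') + v * (b + b') + w * (c + c')" using * by (simp add: algebra_simps)
  then show ?case using fspan_Suc_I[OF Suc.IH[OF *(3,6)] Suc.IH[OF *(4,7)] Suc.IH[OF *(5,8)]] by simp
qed

lemma fspan_cmult: "x \<in> fspan u v w n \<Longrightarrow> const2 r * x \<in> fspan u v w n"
proof (induction n arbitrary: x)
  case 0
  then obtain a where "x = const2 a" by auto
  then have "const2 r * x = const2 (r * a)" by simp
  then show ?case by (simp only: fspan_const)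
next
  case (Suc n)
  then obtain a b c where *: "x = u * a + v * b + w * c" "a \<in> fspan u v w n" "b \<in> fspan u v w n" "c \<in> fspan u v w n" by auto
  have "const2 r * x = u * (const2 r * a) + v * (const2 r * b) + w * (const2 r * c)"
    unfolding *(1) by (simp only: distrib_left mult.left_commute)
  then show ?case using fspan_Suc_I[OF Suc.IH[OF *(2)] Suc.IH[OF *(3)] Suc.IH[OF *(4)]] by simp
qed

lemma fspan_0: "0 \<in> fspan u v w n"
proof -
  have "const2 0 \<in> range const2" by (rule rangeI)
  then have "(0 :: 'a bipoly) \<in> range const2" by simp
  then show ?thesis
  proof (induction n)
    case (Suc n)
    then show ?case using fspan_Suc_I[of 0 u v w n 0 0] by simp
  qed simp
qed

lemma fspan_uminus: "x \<in> fspan u v w n \<Longrightarrow> - x \<in> fspan u v w n"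
proof -
  assume "x \<in> fspan u v w n"
  then have "const2 (- 1) * x \<in> fspan u v w n" by (rule fspan_cmult)
  moreover have "const2 (- 1 :: 'a) = - 1" by (simp add: one_pCons)
  ultimately show ?thesis by simp
qed

lemma fspan_diff: "x \<in> fspan u v w n \<Longrightarrow> y \<in> fspan u v w n \<Longrightarrow> x - y \<in> fspan u v w n"
  using fspan_add[OF _ fspan_uminus, of x u v w n y] by simp

lemma fspan_mult: "x \<in> fspan u v w m \<Longrightarrow> y \<in> fspan u v w n \<Longrightarrow> x * y \<in> fspan u v w (m + n)"
proof (induction m arbitrary: x)
  case 0
  then show ?case using fspan_cmult by auto
next
  case (Suc m)
  then obtain a b c where *: "x = u * a + v * b + w * c" "a \<in> fspan u v w m" "b \<in> fspan u v w m" "c \<in> fspan u v w m" by auto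
  have "x * y = u * (a * y) + v * (b * y) + w * (c * y)" using * by (simp add: algebra_simps)
  then show ?case
    using fspan_Suc_I[OF Suc.IH[OF *(2) Suc.prems(2)] Suc.IH[OF *(3) Suc.prems(2)] Suc.IH[OF *(4) Suc.prems(2)]] by simp
qed

lemma fspan_1: "1 \<in> fspan u v w 0"
  using fspan_const[of 1] by (simp add: one_pCons)

lemma fspan_gens: "u \<in> fspan u v w 1" "v \<in> fspan u v w 1" "w \<in> fspan u v w 1"
  using fspan_Suc_I[OF fspan_1 fspan_0 fspan_0, of u v w] fspan_Suc_I[OF fspan_0 fspan_1 fspan_0, of u v w]
    fspan_Suc_I[OF fspan_0 fspan_0 fspan_1, of u v w]
  by (simp_all only: One_nat_def mult_1_right mult_zero_right add_0_left add_0_right)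

lemma fspan_gen_mult:
  "x \<in> fspan u v w n \<Longrightarrow> u * x \<in> fspan u v w (Suc n)"
  "x \<in> fspan u v w n \<Longrightarrow> v * x \<in> fspan u v w (Suc n)"
  "x \<in> fspan u v w n \<Longrightarrow> w * x \<in> fspan u v w (Suc n)"
  using fspan_mult[OF fspan_gens(1)] fspan_mult[OF fspan_gens(2)] fspan_mult[OF fspan_gens(3)]
  by (metis plus_1_eq_Suc)+

lemma fspan_power: "x \<in> fspan u v w m \<Longrightarrow> x ^ k \<in> fspan u v w (k * m)"
  by (induction k) (auto intro: fspan_1 fspan_mult simp del: fspan.simps)

lemma fspan_homog:
  assumes "homog d u" "homog d v" "homog d w" "x \<in> fspan u v w n"
  shows "homog (n * d) x"
  using assms(4)
proof (induction n arbitrary: x)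
  case (Suc n)
  then obtain a b c where *: "x = u * a + v * b + w * c" "a \<in> fspan u v w n" "b \<in> fspan u v w n" "c \<in> fspan u v w n" by auto
  have "homog (d + n * d) (u * a)" "homog (d + n * d) (v * b)" "homog (d + n * d) (w * c)"
    using Suc.IH * assms by (auto intro!: homog_mult)
  then show ?case unfolding *(1) by (auto intro!: homog_add)
qed auto

text \<open>Separates the pure power of \<open>w\<close>, the only monomial that does not vanish where \<open>u\<close> and \<open>v\<close> do.\<close>

lemma fspan_decomp:
  assumes "x \<in> fspan u v w (Suc n)"
  shows "\<exists>r a b. x = const2 r * w ^ Suc n + u * a + v * b \<and> a \<in> fspan u v w n \<and> b \<in> fspan u v w n"
  using assms
proof (induction n arbitrary: x)
  case 0
  then obtain a b c where *: "x = u * a + v * b + w * c" "a \<in> fspan u v w 0" "b \<in> fspan u v w 0" "c \<in> fspan u v w 0" by auto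
  then obtain r where r: "c = const2 r" by auto
  have "x = const2 r * w ^ Suc 0 + u * a + v * b" unfolding *(1) r by (simp only: power_Suc power_0 mult_1_right mult_1_left ac_simps)
  then show ?case using * by blast
next
  case (Suc n)
  then obtain a b c where *: "x = u * a + v * b + w * c" "a \<in> fspan u v w (Suc n)" "b \<in> fspan u v w (Suc n)"
    "c \<in> fspan u v w (Suc n)" unfolding fspan.simps(2)[of u v w "Suc n"] by blast
  obtain r a' b' where r: "c = const2 r * w ^ Suc n + u * a' + v * b'" "a' \<in> fspan u v w n" "b' \<in> fspan u v w n"
    using Suc.IH[OF *(4)] by blast
  have "x = const2 r * w ^ Suc (Suc n) + u * (a + w * a') + v * (b + w * b')"
    unfolding *(1) r(1) by (simp only: power_Suc distrib_left ac_simps)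
  moreover have "a + w * a' \<in> fspan u v w (Suc n)" "b + w * b' \<in> fspan u v w (Suc n)"
    using * r by (auto intro!: fspan_add fspan_gen_mult simp del: fspan.simps)
  ultimately show ?case by blast
qed

declare fspan.simps(2) [simp del]

text \<open>The ideal of forms without common root contains all forms of large degree. Induction over the linear factors
  of \<open>u\<close>: the cofactor \<open>a\<close> is corrected by a multiple of \<open>v\<close> or \<open>w\<close>, whichever does not vanish at the new root, until it
  vanishes there and the linear form can be split off.\<close>

lemma form_generation:
  fixes u :: "'k::alg_closed_field bipoly"
  assumes "homog e u" "u \<noteq> 0" and v: "homog d v" "homog d w"
    and nc: "\<And>P. P \<in> pts \<Longrightarrow> ev P u = 0 \<Longrightarrow> ev P v \<noteq> 0 \<or> ev P w \<noteq> 0"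
    and F: "homog n F" "n \<ge> e + d"
  shows "\<exists>a b c. F = u * a + v * b + w * c \<and> homog (n - e) a \<and> homog (n - d) b \<and> homog (n - d) c"
  using assms(1,2) nc F
proof (induction arbitrary: F rule: form_induct)
  case (const r)
  have "F = const2 r * (const2 (inverse r) * F) + v * 0 + w * 0"
    using const(1) by (simp add: mult.assoc[symmetric] one_pCons[symmetric])
  moreover have "homog (n - 0) (const2 (inverse r) * F)" using homog_cmult[OF const(3)] by simp
  ultimately show ?case using homog_0 by blast
next
  case (linear P e u)
  have "\<exists>a b c. F = u * a + v * b + w * c \<and> homog (n - e) a \<and> homog (n - d) b \<and> homog (n - d) c"
    using linear.prems by (intro linear.IH) auto
  then obtain a b c where abc: "F = u * a + v * b + w * c" "homog (n - e) a" "homog (n - d) b" "homog (n - d) c" by blast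
  have nz: "ev P v \<noteq> 0 \<or> ev P w \<noteq> 0" using linear.prems(1)[OF linear(1)] ev_lf_0_iff[OF linear(1,1)] by simp
  obtain Q :: "'k \<times> 'k" where Q: "Q \<in> pts" "Q \<noteq> P"
    using infinite_pts by (metis finite.emptyI finite_insert finite_subset insertCI subsetI)
  \<comment> \<open>A power of \<open>lf Q\<close> fills the degree of the correction without vanishing at \<open>P\<close>.\<close>
  define k where "k = n - Suc e - d"
  have hk: "homog (k + 1) (lf Q ^ (k + 1))" using homog_power[OF homog_lf, of "k+1" Q] by simp
  have k: "n - e = d + (k + 1)" using linear.prems(3) by (simp add: k_def)
  have evQ: "ev P (lf Q ^ (k + 1)) \<noteq> 0" using ev_lf_0_iff[OF Q(1) linear(1)] Q(2) by simp
  have step: "\<exists>a' r. a = lf P * a' + t * (const2 r * lf Q ^ (k + 1)) \<and> homog (n - Suc e) a'"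
    if t: "homog d t" "ev P t \<noteq> 0" for t
  proof -
    define r where "r = ev P a / (ev P t * ev P (lf Q ^ (k + 1)))"
    define D where "D = a - t * (const2 r * lf Q ^ (k + 1))"
    have "homog (n - e) D" unfolding D_def k
      using abc(2) k by (intro homog_diff homog_mult t homog_cmult hk) simp
    moreover have "ev P D = 0" using t evQ by (simp add: D_def r_def)
    ultimately obtain a' where "D = lf P * a'" "homog (n - e - 1) a'" using form_root_factor[OF _ linear(1)] by blast
    moreover have "a = D + t * (const2 r * lf Q ^ (k + 1))" by (simp add: D_def)
    ultimately show ?thesis by (intro exI[of _ a'] exI[of _ r]) simp
  qed
  have nd: "homog (n - d) (u * (const2 r * lf Q ^ (k + 1)))" for r
  proof -
    have "n - d = e + (k + 1)" using linear.prems(3) by (simp add: k_def)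
    then show ?thesis by (simp only: homog_mult[OF linear(2) homog_cmult[OF hk]])
  qed
  from nz show ?case
  proof
    assume "ev P v \<noteq> 0"
    then obtain a' r where a': "a = lf P * a' + v * (const2 r * lf Q ^ (k + 1))" "homog (n - Suc e) a'" using step v by blast
    have "F = lf P * u * a' + v * (b + u * (const2 r * lf Q ^ (k + 1))) + w * c"
      unfolding abc(1) a'(1) by (simp only: distrib_left ac_simps)
    then show ?thesis using a'(2) abc(3,4) homog_add[OF abc(3) nd[of r]] by blast
  next
    assume "ev P w \<noteq> 0"
    then obtain a' r where a': "a = lf P * a' + w * (const2 r * lf Q ^ (k + 1))" "homog (n - Suc e) a'" using step v by blast
    have "F = lf P * u * a' + v * b + w * (c + u * (const2 r * lf Q ^ (k + 1)))"
      unfolding abc(1) a'(1) by (simp only: distrib_left ac_simps)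
    then show ?thesis using a'(2) abc(3,4) homog_add[OF abc(4) nd[of r]] by blast
  qed
qed

lemma form_monomials:
  assumes "homog n (F :: 'k::comm_ring_1 bipoly)"
  shows "F = (\<Sum>j\<le>n. const2 (ccf F j (n - j)) * Polynomial.monom (Polynomial.monom 1 (n - j)) j)"
proof -
  have e: "const2 r * Polynomial.monom (Polynomial.monom 1 i) j = Polynomial.monom (Polynomial.monom r i) j" for r :: 'k and i j
    by (simp add: smult_monom)
  show ?thesis
    unfolding e
  proof (intro poly_eqI)
    fix j i
    have "ccf (\<Sum>j\<le>n. Polynomial.monom (Polynomial.monom (ccf F j (n - j)) (n - j)) j) j i
      = (\<Sum>l\<le>n. if l = j then (if n - j = i then ccf F j (n - j) else 0) else 0)"
      unfolding coeff_sum by (intro sum.cong) auto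
    also have "\<dots> = (if j \<le> n \<and> n - j = i then ccf F j (n - j) else 0)" by auto
    also have "\<dots> = ccf F j i" using homogD[OF assms, of j i] by (cases "ccf F j i = 0") auto
    finally show "ccf F j i = ccf (\<Sum>j\<le>n. Polynomial.monom (Polynomial.monom (ccf F j (n - j)) (n - j)) j) j i" by simp
  qed
qed

lemma homog_monomial: "j \<le> n \<Longrightarrow> homog n (Polynomial.monom (Polynomial.monom (1::'k::comm_ring_1) (n - j)) j)"
  by (auto simp: homog_def split: if_splits)

lemma split_factors:
  fixes F :: "'k::field bipoly"
  assumes F: "homog n F" "F \<noteq> 0" and Z: "finite Z" "Z \<subseteq> pts" and k: "\<And>P. P \<in> Z \<Longrightarrow> k P \<le> mul P F"
  shows "\<exists>G. F = (\<Prod>P\<in>Z. lf P ^ k P) * G \<and> homog (n - sum k Z) G \<and> sum k Z \<le> n \<and> G \<noteq> 0 \<and>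
    (\<forall>P\<in>pts. mul P G = (if P \<in> Z then mul P F - k P else mul P F))"
  using Z k
proof (induction Z rule: finite_induct)
  case empty
  then show ?case using F by (intro exI[of _ F]) auto
next
  case (insert Q Z)
  then have "\<exists>G. F = (\<Prod>P\<in>Z. lf P ^ k P) * G \<and> homog (n - sum k Z) G \<and> sum k Z \<le> n \<and> G \<noteq> 0 \<and>
    (\<forall>P\<in>pts. mul P G = (if P \<in> Z then mul P F - k P else mul P F))" by auto
  then obtain G where G: "F = (\<Prod>P\<in>Z. lf P ^ k P) * G" "homog (n - sum k Z) G" "sum k Z \<le> n" "G \<noteq> 0"
    "\<forall>P\<in>pts. mul P G = (if P \<in> Z then mul P F - k P else mul P F)" by blast
  have Q: "Q \<in> pts" "k Q \<le> mul Q G" using insert G by auto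
  obtain H where H: "G = lf Q ^ k Q * H" "homog (n - sum k Z - k Q) H" "k Q \<le> n - sum k Z" "H \<noteq> 0"
    using mul_ge_factor[OF G(2,4) Q] by blast
  have hq: "homog (k Q) (lf Q ^ k Q)" "lf Q ^ k Q \<noteq> 0"
    using homog_power[OF homog_lf, of "k Q" Q] lf_nonzero[OF Q(1)] by simp_all
  have mH: "mul P G = (if P = Q then k Q else 0) + mul P H" if P: "P \<in> pts" for P
    unfolding H(1) mul_mult[OF hq H(2,4) P] mul_power[OF homog_lf lf_nonzero[OF Q(1)] P] mul_lf[OF P Q(1)] by simp
  show ?case
  proof (intro exI[of _ H] conjI ballI)
    show "F = (\<Prod>P\<in>insert Q Z. lf P ^ k P) * H" using G(1) H(1) insert by (simp add: ac_simps)
    show "homog (n - sum k (insert Q Z)) H" using H(2) insert by (simp add: add.commute)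
    show "sum k (insert Q Z) \<le> n" using H(3) G(3) insert by simp
    show "mul P H = (if P \<in> insert Q Z then mul P F - k P else mul P F)" if P: "P \<in> pts" for P
    proof (cases "P = Q")
      case True
      then have "mul Q G = mul Q F" using G(5) Q(1) insert by auto
      then show ?thesis using mH[OF P] True by simp
    next
      case False
      then show ?thesis using mH[OF P] G(5) P by auto
    qed
  qed (rule H(4))
qed

text \<open>A parametrized curve in coordinates in which the point under study is \<open>[0:0:1]\<close>.\<close>

locale curve =
  fixes g1 g2 g3 :: "'k::alg_closed_field bipoly" and d :: nat
  assumes g_homog: "homog d g1" "homog d g2" "homog d g3"
    and no_common_root: "P \<in> pts \<Longrightarrow> ev P g1 \<noteq> 0 \<or> ev P g2 \<noteq> 0 \<or> ev P g3 \<noteq> 0"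
    and independent: "const2 a * g1 + const2 b * g2 + const2 c * g3 = 0 \<Longrightarrow> a = 0 \<and> b = 0 \<and> c = 0"
    and on_origin: "\<exists>P\<in>pts. ev P g1 = 0 \<and> ev P g2 = 0"
    and bir: "x \<in> P1_function_field \<Longrightarrow>
      \<exists>n a b. x = Fract a b \<and> a \<in> fspan g1 g2 g3 n \<and> b \<in> fspan g1 g2 g3 n \<and> b \<noteq> 0"
begin

abbreviation A :: "nat \<Rightarrow> 'k bipoly set" where "A \<equiv> fspan g1 g2 g3"

lemma g_nonzero: "g1 \<noteq> 0" "g2 \<noteq> 0" "g3 \<noteq> 0"
  using independent[of 1 0 0] independent[of 0 1 0] independent[of 0 0 1] by auto

lemma A_homog: "x \<in> A n \<Longrightarrow> homog (n * d) x"
  using fspan_homog[OF g_homog] by auto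

lemma d_pos: "d > 0"
proof (rule ccontr)
  assume "\<not> d > 0"
  then have "homog 0 g1" "homog 0 g2" using g_homog by auto
  then obtain a b where "g1 = const2 a" "g2 = const2 b" using homog_0_const by blast
  then have "const2 b * g1 + const2 (- a) * g2 + const2 0 * g3 = 0" by simp
  then have "b = 0" using independent by blast
  then show False using g_nonzero \<open>g2 = const2 b\<close> by simp
qed

text \<open>Birationality writes each quotient \<open>t / g1^2\<close> with numerator and denominator in the coordinate ring; multiply the
  denominators.\<close>

lemma denominators:
  assumes "finite T" "\<And>t. t \<in> T \<Longrightarrow> homog (2 * d) t"
  shows "\<exists>b m. b \<in> A m \<and> b \<noteq> 0 \<and> (\<forall>t\<in>T. b * t \<in> A (m + 2))"
  using assms
proof (induction T rule: finite_induct)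
  case empty
  then show ?case using fspan_1 by (intro exI[of _ 1] exI[of _ 0]) auto
next
  case (insert t T)
  then obtain b m where b: "b \<in> A m" "b \<noteq> 0" "\<forall>t\<in>T. b * t \<in> A (m + 2)" by auto
  have g2': "homog (2 * d) (g1 ^ 2)" "g1 ^ 2 \<noteq> 0" "g1 ^ 2 \<in> A 2"
    using homog_power[OF g_homog(1), of 2] g_nonzero fspan_power[OF fspan_gens(1), where k = 2 and u = g1 and v = g2 and w = g3] by auto
  have "Fract t (g1 ^ 2) \<in> P1_function_field" using insert g2' by (intro P1K_I[of "2 * d"]) auto
  then obtain n a b' where ab: "Fract t (g1 ^ 2) = Fract a b'" "a \<in> A n" "b' \<in> A n" "b' \<noteq> 0" using bir by blast
  have tb: "b' * t = a * g1 ^ 2" using ab g2' by (simp add: eq_fract mult.commute)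
  show ?case
  proof (intro exI[of _ "b * b'"] exI[of _ "m + n"] conjI ballI)
    show "b * b' \<in> A (m + n)" using fspan_mult b ab by blast
    show "b * b' \<noteq> 0" using b ab by auto
    fix s assume "s \<in> insert t T"
    then consider "s = t" | "s \<in> T" by auto
    then show "b * b' * s \<in> A (m + n + 2)"
    proof cases
      case 1
      have "b * (a * g1 ^ 2) \<in> A (m + (n + 2))" by (rule fspan_mult[OF b(1) fspan_mult[OF ab(2) g2'(3)]])
      then show ?thesis using 1 tb by (simp add: mult.assoc add.assoc)
    next
      case 2
      have "b' * (b * s) \<in> A (n + (m + 2))" by (rule fspan_mult[OF ab(3)]) (use b 2 in blast)
      then show ?thesis by (simp add: ac_simps)
    qed
  qed
qed

text \<open>A common denominator \<open>b\<close> of the monomials of degree \<open>2 d\<close> works for all forms of degree \<open>2 d\<close>, and for larger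
  degrees by writing a form as a combination of \<open>g1\<close>, \<open>g2\<close>, \<open>g3\<close>. The factor \<open>g1^2\<close> takes care of the small degrees.\<close>

lemma conductor_forms:
  "\<exists>b m. b \<in> A m \<and> b \<noteq> 0 \<and> (\<forall>n F. homog (n * d) F \<longrightarrow> b * F \<in> A (n + m))"
proof -
  define mon where "mon j = Polynomial.monom (Polynomial.monom (1::'k) (2 * d - j)) j" for j
  have "\<exists>b m. b \<in> A m \<and> b \<noteq> 0 \<and> (\<forall>t\<in>mon ` {..2 * d}. b * t \<in> A (m + 2))"
    by (rule denominators) (auto simp: mon_def homog_monomial)
  then obtain b m where b: "b \<in> A m" "b \<noteq> 0" "\<And>j. j \<le> 2 * d \<Longrightarrow> b * mon j \<in> A (m + 2)" by auto
  have base: "b * F \<in> A (2 + m)" if "homog (2 * d) F" for F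
  proof -
    have eq: "b * F = (\<Sum>j\<le>2 * d. const2 (ccf F j (2 * d - j)) * (b * mon j))"
      by (subst form_monomials[OF that]) (simp add: sum_distrib_left mon_def)
    have mem: "(\<Sum>j\<in>J. const2 (ccf F j (2 * d - j)) * (b * mon j)) \<in> A (2 + m)" if "J \<subseteq> {..2 * d}" for J
      using that
    proof (induction J rule: infinite_finite_induct)
      case (insert j J)
      then show ?case using b(3)[of j] fspan_cmult[of "b * mon j" g1 g2 g3 "2 + m"]
        by (auto intro!: fspan_add simp del: fspan.simps mult_pCons_left simp: add.commute)
    qed (simp_all add: fspan_0 del: fspan.simps)
    show ?thesis using mem[OF subset_refl] by (simp only: eq)
  qed
  have big: "b * F \<in> A (n + 2 + m)" if "homog ((n + 2) * d) F" for n F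
    using that
  proof (induction n arbitrary: F)
    case 0
    then have "homog (2 * d) F" by (simp add: mult_2)
    then show ?case using base[of F] by simp
  next
    case (Suc n)
    have "\<exists>x y z. F = g1 * x + g2 * y + g3 * z \<and> homog ((Suc n + 2) * d - d) x \<and> homog ((Suc n + 2) * d - d) y \<and> homog ((Suc n + 2) * d - d) z"
    proof (rule form_generation[OF g_homog(1) g_nonzero(1) g_homog(2,3) _ Suc.prems])
      show "ev P g2 \<noteq> 0 \<or> ev P g3 \<noteq> 0" if "P \<in> pts" "ev P g1 = 0" for P
        using no_common_root that by blast
      show "d + d \<le> (Suc n + 2) * d" by simp
    qed
    moreover have "(Suc n + 2) * d - d = (n + 2) * d" by simp
    ultimately obtain x y z where xyz: "F = g1 * x + g2 * y + g3 * z" "homog ((n + 2) * d) x" "homog ((n + 2) * d) y" "homog ((n + 2) * d) z"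
      by auto
    have "b * F = g1 * (b * x) + g2 * (b * y) + g3 * (b * z)" unfolding xyz(1) by (simp add: algebra_simps)
    moreover have "g1 * (b * x) + g2 * (b * y) + g3 * (b * z) \<in> A (Suc (n + 2 + m))"
      using Suc.IH xyz(2-4) by (intro fspan_Suc_I)
    ultimately show ?case by simp
  qed
  have g1sq: "g1 ^ 2 \<in> A 2" "homog (2 * d) (g1 ^ 2)"
    using homog_power[OF g_homog(1), of 2] fspan_power[OF fspan_gens(1), where k = 2 and u = g1 and v = g2 and w = g3] by auto
  show ?thesis
  proof (intro exI[of _ "b * g1 ^ 2"] exI[of _ "m + 2"] conjI allI impI)
    show "b * g1 ^ 2 \<in> A (m + 2)" by (rule fspan_mult[OF b(1) g1sq(1)])
    show "b * g1 ^ 2 \<noteq> 0" using b g_nonzero by auto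
    fix n and F :: "'k bipoly" assume F: "homog (n * d) F"
    have "homog ((n + 2) * d) (g1 ^ 2 * F)" by (rule homog_mult'[OF g1sq(2) F]) simp
    then have "b * (g1 ^ 2 * F) \<in> A (n + 2 + m)" by (rule big)
    then show "b * g1 ^ 2 * F \<in> A (n + (m + 2))" by (simp add: ac_simps)
  qed
qed

section \<open>The local ring at a point of the curve\<close>

text \<open>The preimage of the point \<open>[0:0:1]\<close>.\<close>

definition Z :: "('k \<times> 'k) set" where
  "Z = {P\<in>pts. ev P g1 = 0 \<and> ev P g2 = 0}"

definition R :: "'k bipoly fract set" where
  "R = {Fract a b | n a b. a \<in> A n \<and> b \<in> A n \<and> (\<forall>P\<in>Z. ev P b \<noteq> 0)}"

definition xX :: "'k bipoly fract" where "xX = Fract g1 g3"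
definition xY :: "'k bipoly fract" where "xY = Fract g2 g3"

lemma Z_pts: "Z \<subseteq> pts" and Z_finite: "finite Z"
  using finite_roots[OF g_homog(1) g_nonzero(1)] by (auto simp: Z_def elim: finite_subset[rotated])

lemma Z_nonempty: "Z \<noteq> {}"
  using on_origin by (auto simp: Z_def)

lemma g3_Z: "P \<in> Z \<Longrightarrow> ev P g3 \<noteq> 0"
  using no_common_root by (auto simp: Z_def)

lemma A_ev_Z:
  assumes "a \<in> A n"
  obtains r where "\<And>P. P \<in> Z \<Longrightarrow> ev P a = r * ev P g3 ^ n"
proof (cases n)
  case 0
  then obtain r where "a = const2 r" using assms by auto
  then show ?thesis using that[of r] 0 by simp
next
  case (Suc m)
  obtain r u w where "a = const2 r * g3 ^ Suc m + g1 * u + g2 * w" using fspan_decomp[OF assms[unfolded Suc]] by blast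
  then have "ev P a = r * ev P g3 ^ n" if "P \<in> Z" for P using that Suc by (simp add: Z_def)
  then show ?thesis by (rule that)
qed

text \<open>Through each root \<open>Q\<close> of \<open>G\<close>, which does not lie over \<open>[0:0:1]\<close>, passes the pullback of a line that misses
  \<open>[0:0:1]\<close>. The product of these lines is a multiple of \<open>G\<close>.\<close>

lemma clear_denominator:
  assumes "homog e G" "G \<noteq> 0" "\<forall>P\<in>Z. ev P G \<noteq> 0"
  shows "\<exists>G' e'. homog e' G' \<and> e + e' = e * d \<and> G * G' \<in> A e \<and> G' \<noteq> 0 \<and> (\<forall>P\<in>Z. ev P G' \<noteq> 0)"
  using assms
proof (induction rule: form_induct)
  case (const r)
  have "const2 r * 1 \<in> A 0" by (rule fspan_cmult[OF fspan_1])
  then show ?case by (intro exI[of _ 1] exI[of _ 0]) auto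
next
  case (linear Q e G)
  have "\<forall>P\<in>Z. ev P G \<noteq> 0" using linear.prems by auto
  then obtain G' e' where G': "homog e' G'" "e + e' = e * d" "G * G' \<in> A e" "G' \<noteq> 0" "\<forall>P\<in>Z. ev P G' \<noteq> 0" using linear.IH by blast
  have "Q \<notin> Z" using linear.prems ev_lf_0_iff[OF linear(1,1)] by auto
  then consider "ev Q g1 \<noteq> 0" | "ev Q g2 \<noteq> 0" using linear(1) by (auto simp: Z_def)
  then have "\<exists>l\<in>A 1. ev Q l = 0 \<and> (\<forall>P\<in>Z. ev P l \<noteq> 0)"
  proof cases
    case 1
    have "g3 - const2 (ev Q g3 / ev Q g1) * g1 \<in> A 1" by (intro fspan_diff fspan_gens fspan_cmult)
    moreover have "ev Q (g3 - const2 (ev Q g3 / ev Q g1) * g1) = 0" using 1 by simp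
    moreover have "\<forall>P\<in>Z. ev P (g3 - const2 (ev Q g3 / ev Q g1) * g1) \<noteq> 0" using g3_Z by (auto simp: Z_def)
    ultimately show ?thesis by blast
  next
    case 2
    have "g3 - const2 (ev Q g3 / ev Q g2) * g2 \<in> A 1" by (intro fspan_diff fspan_gens fspan_cmult)
    moreover have "ev Q (g3 - const2 (ev Q g3 / ev Q g2) * g2) = 0" using 2 by simp
    moreover have "\<forall>P\<in>Z. ev P (g3 - const2 (ev Q g3 / ev Q g2) * g2) \<noteq> 0" using g3_Z by (auto simp: Z_def)
    ultimately show ?thesis by blast
  qed
  then obtain l where l: "l \<in> A 1" "ev Q l = 0" "\<forall>P\<in>Z. ev P l \<noteq> 0" by blast
  have hl: "homog d l" using A_homog[OF l(1)] by simp
  obtain l' where l': "l = lf Q * l'" "homog (d - 1) l'" using form_root_factor[OF hl linear(1) l(2)] by blast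
  show ?case
  proof (intro exI[of _ "l' * G'"] exI[of _ "d - 1 + e'"] conjI ballI)
    show "homog (d - 1 + e') (l' * G')" by (rule homog_mult[OF l'(2) G'(1)])
    show "Suc e + (d - 1 + e') = Suc e * d" using d_pos G'(2) by simp
    have "(lf Q * G) * (l' * G') = l * (G * G')" using l'(1) by (simp add: ac_simps)
    then show "lf Q * G * (l' * G') \<in> A (Suc e)" using fspan_mult[OF l(1) G'(3)] by (simp only: plus_1_eq_Suc)
    have nz: "ev P l' \<noteq> 0" if "P \<in> Z" for P using l(3) l'(1) that by auto
    obtain P where "P \<in> Z" using Z_nonempty by auto
    then show "l' * G' \<noteq> 0" using nz G'(4) by fastforce
    show "ev P (l' * G') \<noteq> 0" if "P \<in> Z" for P using nz[OF that] G'(5) that by simp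
  qed
qed

lemma ev_A_iff: 
  assumes "b \<in> A n" "P \<in> Z" "Q \<in> Z"
  shows "ev P b = 0 \<longleftrightarrow> ev Q b = 0"
proof -
  obtain r where "\<And>P. P \<in> Z \<Longrightarrow> ev P b = r * ev P g3 ^ n" using A_ev_Z[OF assms(1)] by blast
  then show ?thesis using g3_Z assms by simp
qed

lemma R_I: "a \<in> A n \<Longrightarrow> b \<in> A n \<Longrightarrow> (\<And>P. P \<in> Z \<Longrightarrow> ev P b \<noteq> 0) \<Longrightarrow> Fract a b \<in> R"
  unfolding R_def by blast

lemma R_E:
  assumes "x \<in> R"
  obtains n a b where "x = Fract a b" "a \<in> A n" "b \<in> A n" "\<forall>P\<in>Z. ev P b \<noteq> 0" "b \<noteq> 0"
proof -
  obtain n a b where 1: "x = Fract a b" "a \<in> A n" "b \<in> A n" "\<forall>P\<in>Z. ev P b \<noteq> 0"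
    using assms unfolding R_def by blast
  obtain P where "P \<in> Z" using Z_nonempty by auto
  then have "b \<noteq> 0" using 1(4) by fastforce
  then show ?thesis using 1 that by blast
qed

lemma R_K: "R \<subseteq> P1_function_field"
proof
  fix x assume "x \<in> R"
  then obtain n a b where "x = Fract a b" "a \<in> A n" "b \<in> A n" "b \<noteq> 0" by (rule R_E)
  then show "x \<in> P1_function_field" using A_homog by (auto intro!: P1K_I)
qed

text \<open>A function that vanishes on \<open>Z\<close> at least as much as the form \<open>b\<close> of \<open>conductor_forms\<close> has a numerator which is
  divisible by the part of \<open>b\<close> supported on \<open>Z\<close>. The rest of \<open>b\<close> and of the denominator does not
  vanish on \<open>Z\<close> and can be completed to elements of the coordinate ring by \<open>clear_denominator\<close>.\<close>

lemma R_conductor: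
  "\<exists>N::nat. \<forall>x\<in>P1_function_field. (\<forall>P\<in>Z. P1.ge P (int N) x) \<longrightarrow> x \<in> R"
proof -
  obtain b m where b: "b \<in> A m" "b \<noteq> 0" and bA: "\<And>n F. homog (n * d) F \<Longrightarrow> b * F \<in> A (n + m)"
    using conductor_forms by blast
  have bh: "homog (m * d) b" by (rule A_homog[OF b(1)])
  define N where "N = (\<Sum>P\<in>Z. mul P b)"
  have N: "mul P b \<le> N" if "P \<in> Z" for P unfolding N_def using Z_finite that by (intro member_le_sum) auto
  have "x \<in> R" if x: "x \<in> P1_function_field" "\<forall>P\<in>Z. P1.ge P (int N) x" for x
  proof (cases "x = 0")
    case True
    have "Fract 0 1 \<in> R" by (rule R_I[OF fspan_0 fspan_1]) simp
    then show ?thesis using True by (simp add: Zero_fract_def)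
  next
    case False
    obtain e F G where FG: "x = Fract F G" "homog e F" "homog e G" "G \<noteq> 0" using P1K_E[OF x(1)] .
    have F0: "F \<noteq> 0" using False FG by (auto simp: Fract_0_iff)
    have le: "mul P G + mul P b \<le> mul P F" if P: "P \<in> Z" for P
    proof -
      have "P1.ge P (int N) (Fract F G)" using x(2) P FG by auto
      then have "int N \<le> int (mul P F) - int (mul P G)"
        using ge_Fract[OF subsetD[OF Z_pts P] FG(2-4)] F0 by simp
      then show ?thesis using N[OF P] by linarith
    qed
    define GZ where "GZ = (\<Prod>P\<in>Z. lf P ^ mul P G)"
    define bZ where "bZ = (\<Prod>P\<in>Z. lf P ^ mul P b)"
    have GZ0: "GZ \<noteq> 0" unfolding GZ_def using Z_finite Z_pts by (auto simp: prod_zero_iff)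
    have hGZ: "homog (\<Sum>P\<in>Z. mul P G) GZ" "homog (\<Sum>P\<in>Z. mul P b) bZ"
      unfolding GZ_def bZ_def using homog_power[OF homog_lf] Z_finite by (auto intro!: homog_prod)
    have "(\<Prod>P\<in>Z. lf P ^ (mul P G + mul P b)) = GZ * bZ"
      unfolding GZ_def bZ_def by (simp add: power_add prod.distrib)
    with split_factors[OF FG(2) F0 Z_finite Z_pts, of "\<lambda>P. mul P G + mul P b"] le
    obtain F1 where F1: "F = GZ * bZ * F1" "homog (e - (\<Sum>P\<in>Z. mul P G + mul P b)) F1" "(\<Sum>P\<in>Z. mul P G + mul P b) \<le> e" "F1 \<noteq> 0"
      by auto
    obtain G1 where G1: "G = GZ * G1" "homog (e - (\<Sum>P\<in>Z. mul P G)) G1" "(\<Sum>P\<in>Z. mul P G) \<le> e" "G1 \<noteq> 0"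
      "\<forall>P\<in>pts. mul P G1 = (if P \<in> Z then mul P G - mul P G else mul P G)"
      using split_factors[OF FG(3,4) Z_finite Z_pts, of "\<lambda>P. mul P G"] unfolding GZ_def by blast
    obtain b1 where b1: "b = bZ * b1" "homog (m * d - (\<Sum>P\<in>Z. mul P b)) b1" "(\<Sum>P\<in>Z. mul P b) \<le> m * d" "b1 \<noteq> 0"
      "\<forall>P\<in>pts. mul P b1 = (if P \<in> Z then mul P b - mul P b else mul P b)"
      using split_factors[OF bh b(2) Z_finite Z_pts, of "\<lambda>P. mul P b"] unfolding bZ_def by blast
    define s t where "s = (\<Sum>P\<in>Z. mul P G)" and "t = (\<Sum>P\<in>Z. mul P b)"
    have "\<forall>P\<in>Z. ev P G1 \<noteq> 0" using G1(5) mul_pos_iff[OF G1(2,4)] Z_pts by fastforce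
    then obtain G' e1' where G': "homog e1' G'" "(e - s) + e1' = (e - s) * d" "G1 * G' \<in> A (e - s)" "G' \<noteq> 0" "\<forall>P\<in>Z. ev P G' \<noteq> 0"
      using clear_denominator[OF G1(2,4)] unfolding s_def by blast
    have "\<forall>P\<in>Z. ev P b1 \<noteq> 0" using b1(5) mul_pos_iff[OF b1(2,4)] Z_pts by fastforce
    then obtain b' e2' where b': "homog e2' b'" "(m * d - t) + e2' = (m * d - t) * d" "b1 * b' \<in> A (m * d - t)" "b' \<noteq> 0" "\<forall>P\<in>Z. ev P b' \<noteq> 0"
      using clear_denominator[OF b1(2,4)] unfolding t_def by blast
    define q where "q = (e - s - t) + e2' + e1'"
    define k where "k = (e - s) + (m * d - t)"
    have F1h: "homog (e - s - t) F1" "s + t \<le> e" using F1(2,3) by (simp_all add: s_def t_def sum.distrib)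
    have tm: "t \<le> m * d" using b1(3) t_def by simp
    have qh: "homog q (F1 * b' * G')" unfolding q_def by (intro homog_mult F1h b'(1) G'(1))
    have qk: "q + m * d = k * d"
      using G'(2) b'(2) F1h(2) tm unfolding q_def k_def add_mult_distrib by linarith
    then have "q = (k - m) * d" by (simp add: diff_mult_distrib)
    moreover have "m \<le> k" using qk d_pos by (metis le_add2 mult_le_cancel2)
    ultimately have num: "b * (F1 * b' * G') \<in> A k" using bA[of "k - m" "F1 * b' * G'"] qh by simp
    have den: "(G1 * G') * (b1 * b') \<in> A k" unfolding k_def by (rule fspan_mult[OF G'(3) b'(3)])
    have dz: "ev P ((G1 * G') * (b1 * b')) \<noteq> 0" if "P \<in> Z" for P
      using that \<open>\<forall>P\<in>Z. ev P G1 \<noteq> 0\<close> \<open>\<forall>P\<in>Z. ev P b1 \<noteq> 0\<close> G'(5) b'(5) by simp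
    have "x = Fract (b * (F1 * b' * G')) ((G1 * G') * (b1 * b'))"
      unfolding FG(1) using FG(4) G1(4) b1(4) G'(4) b'(4)
      by (subst eq_fract) (auto simp: F1(1) G1(1) b1(1) ac_simps)
    then show ?thesis using R_I[OF num den dz] by simp
  qed
  then show ?thesis by blast
qed

lemma ge_1_Fract:
  assumes "homog n a" "homog n b" "P \<in> pts" "ev P b \<noteq> 0"
  shows "P1.ge P 1 (Fract a b) \<longleftrightarrow> ev P a = 0"
proof -
  have "b \<noteq> 0" using assms by auto
  then show ?thesis
    using ge_Fract[OF assms(3,1,2), of 1] mul_0I[OF assms(3,4)] mul_pos_iff[OF assms(1) _ assms(3)]
    by (cases "a = 0") auto
qed

lemma R_sring: "sring R"
  unfolding sring_def
proof (intro conjI ballI)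
  show "1 \<in> R" unfolding One_fract_def by (rule R_I[OF fspan_1 fspan_1]) simp
  fix x y assume x: "x \<in> R" and y: "y \<in> R"
  obtain n a b where ab: "x = Fract a b" "a \<in> A n" "b \<in> A n" "\<forall>P\<in>Z. ev P b \<noteq> 0" "b \<noteq> 0" using R_E[OF x] .
  obtain m a' b' where ab': "y = Fract a' b'" "a' \<in> A m" "b' \<in> A m" "\<forall>P\<in>Z. ev P b' \<noteq> 0" "b' \<noteq> 0" using R_E[OF y] .
  have "x * y = Fract (a * a') (b * b')" using ab ab' by simp
  moreover have "Fract (a * a') (b * b') \<in> R"
    using ab ab' by (intro R_I[of _ "n + m"] fspan_mult) auto
  ultimately show "x * y \<in> R" by simp
  have "x - y = Fract (a * b' - a' * b) (b * b')" using ab ab' by simp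
  moreover have "a' * b \<in> A (n + m)" using fspan_mult[OF ab'(2) ab(3)] by (simp add: add.commute)
  then have "Fract (a * b' - a' * b) (b * b') \<in> R"
    using ab(4) ab'(4)
    by (intro R_I[OF fspan_diff[OF fspan_mult[OF ab(2) ab'(3)]] fspan_mult[OF ab(3) ab'(3)]]) auto
  ultimately show "x - y \<in> R" by simp
qed

lemma cfield_R: "cfield \<subseteq> R"
proof
  fix c :: "'k bipoly fract" assume "c \<in> cfield"
  then obtain r where "c = Fract (const2 r) 1" by (auto simp: cfield_def)
  then show "c \<in> R" using R_I[OF fspan_const[of r] fspan_1] by auto
qed

lemma R_residue:
  assumes "x \<in> R"
  shows "\<exists>c\<in>cfield. \<forall>P\<in>Z. P1.ge P 1 (x - c)"
proof -
  obtain n a b where ab: "x = Fract a b" "a \<in> A n" "b \<in> A n" "\<forall>P\<in>Z. ev P b \<noteq> 0" "b \<noteq> 0" using R_E[OF assms] .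
  obtain r where r: "\<And>P. P \<in> Z \<Longrightarrow> ev P a = r * ev P g3 ^ n" using A_ev_Z[OF ab(2)] by blast
  obtain r' where r': "\<And>P. P \<in> Z \<Longrightarrow> ev P b = r' * ev P g3 ^ n" using A_ev_Z[OF ab(3)] by blast
  have x: "x - Fract (const2 (r / r')) 1 = Fract (a - const2 (r / r') * b) b" using ab by simp
  have h: "homog (n * d) (a - const2 (r / r') * b)" "homog (n * d) b"
    using ab A_homog by (auto intro!: homog_diff homog_cmult simp del: mult_pCons_left)
  have "P1.ge P 1 (x - Fract (const2 (r / r')) 1)" if P: "P \<in> Z" for P
  proof -
    have "r' \<noteq> 0" using r'[OF P] ab(4)[rule_format, OF P] by auto
    then have "ev P (a - const2 (r / r') * b) = 0" using r[OF P] r'[OF P] by simp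
    then show ?thesis unfolding x using ge_1_Fract[OF h subsetD[OF Z_pts P] ab(4)[rule_format, OF P]] by blast
  qed
  moreover have "Fract (const2 (r / r')) 1 \<in> cfield" by (auto simp: cfield_def)
  ultimately show ?thesis by blast
qed

lemma R_ge0:
  assumes "x \<in> R" "P \<in> Z"
  shows "P1.ge P 0 x"
proof -
  obtain n a b where ab: "x = Fract a b" "a \<in> A n" "b \<in> A n" "\<forall>P\<in>Z. ev P b \<noteq> 0" "b \<noteq> 0" using R_E[OF assms(1)] .
  have "P \<in> pts" using assms(2) Z_pts by auto
  then show ?thesis unfolding ab(1)
    using ge_Fract[OF _ A_homog[OF ab(2)] A_homog[OF ab(3)] ab(5)] mul_0I[OF _ ab(4)[rule_format, OF assms(2)]] by simp
qed

lemma R_curve_local: "P1.curve_local Z R"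
  unfolding P1.curve_local_def P1.semilocal_def
  using Z_finite Z_pts R_sring R_K cfield_R R_ge0 R_conductor R_residue Z_nonempty by blast

lemma R_gen2: "P1.gen2 Z R xX xY"
proof -
  have X: "xX \<in> R" "xY \<in> R" unfolding xX_def xY_def using fspan_gens g3_Z by (auto intro!: R_I simp del: fspan.simps)
  have ge: "P1.ge P 1 xX" "P1.ge P 1 xY" if P: "P \<in> Z" for P
    unfolding xX_def xY_def
    using ge_1_Fract[OF g_homog(1,3) subsetD[OF Z_pts P] g3_Z[OF P]] ge_1_Fract[OF g_homog(2,3) subsetD[OF Z_pts P] g3_Z[OF P]] P
    by (auto simp: Z_def)
  have "\<exists>s\<in>R. \<exists>t\<in>R. x = s * xX + t * xY" if x: "x \<in> P1.mx Z R" for x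
  proof -
    have xR: "x \<in> R" using x by (auto simp: P1.mx_def)
    obtain n a b where ab: "x = Fract a b" "a \<in> A n" "b \<in> A n" "\<forall>P\<in>Z. ev P b \<noteq> 0" "b \<noteq> 0" using R_E[OF xR] .
    obtain P where P: "P \<in> Z" using Z_nonempty by auto
    have eva: "ev P a = 0"
      using x P ge_1_Fract[OF A_homog[OF ab(2)] A_homog[OF ab(3)] subsetD[OF Z_pts P] ab(4)[rule_format, OF P]] ab(1)
      by (auto simp: P1.mx_def)
    show ?thesis
    proof (cases n)
      case 0
      then obtain r where r: "a = const2 r" using ab by auto
      then have "r = 0" using eva by simp
      then have "x = 0" using ab r by (simp add: fract_collapse)
      then show ?thesis using sring_0[OF R_sring] by (intro bexI[of _ 0]) auto
    next
      case (Suc m)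
      obtain r u w where ruw: "a = const2 r * g3 ^ Suc m + g1 * u + g2 * w" "u \<in> A m" "w \<in> A m"
        using fspan_decomp[OF ab(2)[unfolded Suc]] by blast
      have "r = 0" using eva P g3_Z[OF P] unfolding ruw(1) by (simp add: Z_def)
      then have a: "a = g1 * u + g2 * w" using ruw by simp
      have S: "Fract (g3 * u) b \<in> R" "Fract (g3 * w) b \<in> R"
        using ruw ab Suc by (auto intro!: R_I[of _ n] fspan_gen_mult simp del: fspan.simps)
      have "x = Fract (g3 * u) b * xX + Fract (g3 * w) b * xY"
        unfolding ab(1) a xX_def xY_def using ab(5) g_nonzero by (simp add: eq_fract algebra_simps)
      then show ?thesis using S by blast
    qed
  qed
  then show ?thesis unfolding P1.gen2_def using R_curve_local X ge by (auto simp: P1.mx_def)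
qed

end

section \<open>The first and second neighborhoods in terms of forms\<close>

lemma smult_const_1 [simp]:
  "Polynomial.smult [:1:] (F :: 'k::comm_ring_1 bipoly) = F" "Polynomial.smult [:- 1:] F = - F"
proof -
  show "Polynomial.smult [:1:] F = F" by (simp only: one_pCons[symmetric] smult_1_left)
  have "[:- 1 :: 'k:] = - 1" by (simp add: one_pCons)
  then show "Polynomial.smult [:- 1:] F = - F" by (simp only: smult_minus_left smult_1_left)
qed

text \<open>A point of the first neighborhood is the image of a place \<open>P\<close>, and it can be computed from every pair of generators
  that is adapted to \<open>P\<close>.\<close>

lemma (in places) first_nbhd_place:
  assumes G: "gen2 Z S a0 b0" and S': "S' \<in> first_nbhd S"
  shows "\<exists>P\<in>Z. \<forall>a b. gen2 Z S a b \<longrightarrow> a \<noteq> 0 \<longrightarrow> ge P (v P a + 1) b \<longrightarrow> S' = loc S a P"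
proof -
  note g = gen2D(1)[OF G]
  obtain x where x: "minel Z S x" using gen2_has_minel[OF G] by blast
  obtain a1 P where a1: "a1 \<in> mx Z S" "a1 \<noteq> 0" "P \<in> Z" "v P a1 = v P x" "S' = loc S a1 P"
    using first_nbhd_cases[OF g x S'] by blast
  have "S' = loc S a P" if ab: "gen2 Z S a b" "a \<noteq> 0" "ge P (v P a + 1) b" for a b
  proof -
    have "v P a = v P x" using blowup_gen2(2)[OF ab(1) a1(3) ab(2,3) x] a1(3) ab(3) by blast
    then show ?thesis using loc_indep[OF g x a1(1,2) gen2D(2)[OF ab(1)] ab(2) a1(3,4)] a1(5) by simp
  qed
  then show ?thesis using a1(3) by blast
qed

text \<open>Split off common linear factors one by one.\<close>

lemma common_factor:
  fixes a b :: "'k::field bipoly"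
  assumes "homog n a" "homog n b" "a \<noteq> 0 \<or> b \<noteq> 0"
  shows "\<exists>h e a' b'. e \<le> n \<and> homog e h \<and> h \<noteq> 0 \<and> homog (n - e) a' \<and> homog (n - e) b' \<and> a = h * a' \<and> b = h * b' \<and>
    (\<forall>P\<in>pts. ev P a' \<noteq> 0 \<or> ev P b' \<noteq> 0)"
  using assms
proof (induction n arbitrary: a b)
  case 0
  then obtain r s where rs: "a = const2 r" "b = const2 s" using homog_0_const by blast
  then have "r \<noteq> 0 \<or> s \<noteq> 0" using 0 by auto
  then show ?case using rs by (intro exI[of _ 1] exI[of _ 0] exI[of _ a] exI[of _ b]) auto
next
  case (Suc n)
  show ?case
  proof (cases "\<exists>P\<in>pts. ev P a = 0 \<and> ev P b = 0")
    case False
    then show ?thesis using Suc.prems by (intro exI[of _ 1] exI[of _ 0] exI[of _ a] exI[of _ b]) auto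
  next
    case True
    then obtain P where P: "P \<in> pts" "ev P a = 0" "ev P b = 0" by blast
    obtain a1 where a1: "a = lf P * a1" "homog n a1" using form_root_factor[OF Suc.prems(1) P(1,2)] by auto
    obtain b1 where b1: "b = lf P * b1" "homog n b1" using form_root_factor[OF Suc.prems(2) P(1,3)] by auto
    have "a1 \<noteq> 0 \<or> b1 \<noteq> 0" using Suc.prems(3) a1 b1 by auto
    from Suc.IH[OF a1(2) b1(2) this] obtain h e a' b' where *: "e \<le> n" "homog e h" "h \<noteq> 0" "homog (n - e) a'"
      "homog (n - e) b'" "a1 = h * a'" "b1 = h * b'" "\<forall>P\<in>pts. ev P a' \<noteq> 0 \<or> ev P b' \<noteq> 0" by blast
    have "homog (Suc e) (lf P * h)" using homog_mult[OF homog_lf *(2)] by simp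
    then show ?thesis using * a1 b1 P(1)
      by (intro exI[of _ "lf P * h"] exI[of _ "Suc e"] exI[of _ a'] exI[of _ b']) (auto simp: mult.assoc)
  qed
qed

lemma form_dvd_by_mul:
  fixes h :: "'k::alg_closed_field bipoly"
  assumes "homog m h" "h \<noteq> 0" "homog n a" "\<And>P. P \<in> pts \<Longrightarrow> ev P h = 0 \<Longrightarrow> a = 0 \<or> mul P h \<le> mul P a"
  shows "\<exists>r. a = h * r \<and> homog (n - m) r \<and> (a \<noteq> 0 \<longrightarrow> m \<le> n)"
  using assms
proof (induction arbitrary: a n rule: form_induct)
  case (const c)
  have "a = const2 c * (const2 (inverse c) * a)"
    using const by (simp add: mult.assoc[symmetric] one_pCons[symmetric])
  then show ?case using homog_cmult[OF const(2)] by (intro exI[of _ "const2 (inverse c) * a"]) auto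
next
  case (linear Q m h)
  show ?case
  proof (cases "a = 0")
    case False
    have mh: "mul P (lf Q * h) = (if P = Q then 1 else 0) + mul P h" if "P \<in> pts" for P
      using mul_mult[OF homog_lf lf_nonzero[OF linear(1)] linear(2,3) that] mul_lf[OF that linear(1)] by simp
    have "mul Q (lf Q * h) \<le> mul Q a"
      using linear.prems(2)[OF linear(1)] False ev_lf_0_iff[OF linear(1,1)] by simp
    then have "0 < mul Q a" using mh[OF linear(1)] by simp
    then have root: "ev Q a = 0" using mul_pos_iff[OF linear.prems(1) False linear(1)] by simp
    obtain a' where a'': "a = lf Q * a'" "homog (n - 1) a'" "a \<noteq> 0 \<Longrightarrow> n > 0"
      by (rule form_root_factor[OF linear.prems(1) linear(1) root], rule that) auto
    note a' = a''(1,2) a''(3)[OF False]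
    have a'0: "a' \<noteq> 0" using a' False by auto
    have ma: "mul P a = (if P = Q then 1 else 0) + mul P a'" if "P \<in> pts" for P
      unfolding a'(1) using mul_mult[OF homog_lf lf_nonzero[OF linear(1)] a'(2) a'0 that] mul_lf[OF that linear(1)] by simp
    have "a' = 0 \<or> mul P h \<le> mul P a'" if P: "P \<in> pts" "ev P h = 0" for P
      using linear.prems(2)[OF P(1)] P(2) False mh[OF P(1)] ma[OF P(1)] by auto
    then obtain r where "a' = h * r" "homog (n - 1 - m) r" "a' \<noteq> 0 \<longrightarrow> m \<le> n - 1"
      using linear.IH[OF a'(2)] by blast
    then show ?thesis using a' a'0 by (intro exI[of _ r]) (auto simp: mult.assoc)
  qed (auto intro!: exI[of _ 0])
qed

lemma sum_min_eq_imp_le: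
  fixes f g :: "'a \<Rightarrow> nat"
  assumes "finite Z" "(\<Sum>P\<in>Z. min (f P) (g P)) = (\<Sum>P\<in>Z. f P)" "P \<in> Z"
  shows "f P \<le> g P"
proof (rule ccontr)
  assume "\<not> f P \<le> g P"
  then have "(\<Sum>P\<in>Z. min (f P) (g P)) < (\<Sum>P\<in>Z. f P)"
    using assms by (intro sum_strict_mono_ex1 ballI bexI[of _ P]) auto
  then show False using assms(2) by simp
qed

text \<open>The form \<open>h\<close> is the greatest common divisor of \<open>g1\<close> and \<open>g2\<close>. The sign makes \<open>(s1, s2, 0)\<close> a syzygy.\<close>

locale curve_factored = curve g1 g2 g3 d for g1 g2 g3 :: "'k::alg_closed_field bipoly" and d +
  fixes h s1 s2 :: "'k bipoly" and e :: nat
  assumes h: "homog e h" "h \<noteq> 0" and e_le: "e \<le> d"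
    and s: "homog (d - e) s1" "homog (d - e) s2"
    and g1_eq: "g1 = h * s2" and g2_eq: "g2 = - (h * s1)"
    and s_coprime: "P \<in> pts \<Longrightarrow> ev P s1 \<noteq> 0 \<or> ev P s2 \<noteq> 0"

lemma (in curve) factored_exists: "\<exists>h s1 s2 e. curve_factored g1 g2 g3 d h s1 s2 e"
proof -
  obtain h e a' b' where *: "e \<le> d" "homog e h" "h \<noteq> 0" "homog (d - e) a'"
    "homog (d - e) b'" "g1 = h * a'" "g2 = h * b'" "\<forall>P\<in>pts. ev P a' \<noteq> 0 \<or> ev P b' \<noteq> 0"
    using common_factor[OF g_homog(1,2)] g_nonzero(1) by blast
  have "curve_factored g1 g2 g3 d h (- b') a' e"
    using * by unfold_locales (auto intro: homog_uminus)
  then show ?thesis by blast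
qed

context curve_factored
begin

lemma Z_eq: "Z = {P\<in>pts. ev P h = 0}"
proof -
  have "ev P g1 = ev P h * ev P s2" "ev P g2 = - (ev P h * ev P s1)" for P
    by (simp_all add: g1_eq g2_eq)
  then show ?thesis using s_coprime unfolding Z_def by auto
qed

lemma s_nonzero: "s1 \<noteq> 0" "s2 \<noteq> 0"
  using g_nonzero g1_eq g2_eq by auto

lemma s_comb_nonzero:
  assumes "(a, b) \<noteq> (0, 0)"
  shows "const2 a * s1 + const2 b * s2 \<noteq> 0"
proof
  assume z: "const2 a * s1 + const2 b * s2 = 0"
  have "const2 b * g1 + const2 (- a) * g2 + const2 0 * g3 = h * (const2 a * s1 + const2 b * s2)"
  proof -
    have alg: "q * (h * s2) + (- p) * (- (h * s1)) + 0 * g3 = h * (p * s1 + q * s2)" for p q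
      by (simp add: algebra_simps)
    show ?thesis unfolding g1_eq g2_eq const2_simps(1,6) by (rule alg)
  qed
  then have "b = 0 \<and> - a = 0 \<and> (0::'k) = 0" using z by (intro independent) simp
  then show False using assms by simp
qed

lemma sum_mul_h: "(\<Sum>P\<in>Z. mul P h) = e"
  using sum_mul[OF h Z_finite Z_pts] Z_eq by simp

lemma mul_g3: "P \<in> Z \<Longrightarrow> mul P g3 = 0"
  using mul_0I[OF subsetD[OF Z_pts] g3_Z] by blast

text \<open>At a root \<open>P\<close> of \<open>h\<close> one of \<open>s1\<close>, \<open>s2\<close> is non-zero, so the least order of \<open>g1 / g3\<close> and \<open>g2 / g3\<close> at \<open>P\<close> is that of
  \<open>h\<close>; and all roots of \<open>h\<close> lie in \<open>Z\<close>.\<close>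

lemma R_local_mult: "local_mult (as_ring R) = real e"
proof -
  have "P1.exact2 P (int (mul P h)) xX xY" if P: "P \<in> Z" for P
  proof -
    have Pp: "P \<in> pts" using P Z_pts by auto
    have m: "mul P g1 = mul P h + mul P s2" "mul P g2 = mul P h + mul P s1"
    proof -
      show "mul P g1 = mul P h + mul P s2" unfolding g1_eq by (rule mul_mult[OF h s(2) s_nonzero(2) Pp])
      have "g2 = h * (- s1)" using g2_eq by simp
      then have "mul P g2 = mul P h + mul P (- s1)"
        using mul_mult[OF h homog_uminus[OF s(1)] _ Pp] s_nonzero by simp
      moreover have "mul P (- s1) = mul P s1"
      proof -
        have c: "const2 (- 1 :: 'k) = - 1" by (simp add: one_pCons)
        have "mul P (const2 (- 1) * s1) = mul P (const2 (- 1 :: 'k)) + mul P s1"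
          by (rule mul_mult[OF homog_const2 _ s(1) s_nonzero(1) Pp]) simp
        then show ?thesis using mul_const2[OF Pp, of "- 1"] unfolding c by simp
      qed
      ultimately show "mul P g2 = mul P h + mul P s1" by simp
    qed
    have "mul P s1 = 0 \<or> mul P s2 = 0" using s_coprime[OF Pp] mul_0I[OF Pp, of s1] mul_0I[OF Pp, of s2] by auto
    then show ?thesis
      unfolding P1.exact2_def xX_def xY_def
        ge_Fract[OF Pp g_homog(1,3) g_nonzero(3)] ge_Fract[OF Pp g_homog(2,3) g_nonzero(3)]
      using m mul_g3[OF P] g_nonzero by auto
  qed
  then have "local_mult (as_ring R) = real_of_int (\<Sum>P\<in>Z. int (mul P h))"
    by (rule P1.gen2_local_mult[OF R_gen2])
  also have "(\<Sum>P\<in>Z. int (mul P h)) = int e" using sum_mul_h by (simp flip: of_nat_sum)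
  finally show ?thesis by simp
qed

lemma R_planar: "P1.planar R"
  using R_gen2 by (auto simp: P1.planar_def)

text \<open>The forms \<open>t\<close> and \<open>w\<close> stand for two combinations of \<open>s1\<close> and \<open>s2\<close>; the new generators are \<open>h t / g3\<close> and \<open>w / t\<close>, and
  \<open>t\<close> does not vanish where \<open>w\<close> does.\<close>

lemma nbr_general:
  assumes t: "homog (d - e) t" "t \<noteq> 0" and w: "homog (d - e) w" "w \<noteq> 0"
    and cop: "\<And>P. P \<in> pts \<Longrightarrow> ev P t \<noteq> 0 \<or> ev P w \<noteq> 0"
    and G: "P1.gen2 Z R (Fract (h * t) g3) (Fract (h * w) g3)"
    and P0: "P0 \<in> Z" "ev P0 w = 0"
  defines "a \<equiv> Fract (h * t) g3" and "b \<equiv> Fract (h * w) g3"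
  shows "P1.loc R a P0 \<in> first_nbhd R"
    "P1.gen2 {P\<in>Z. ev P w = 0} (P1.loc R a P0) a (Fract w t)"
    "local_mult (as_ring (P1.loc R a P0)) = real (\<Sum>P\<in>Z. min (mul P h) (mul P w))"
    "a \<noteq> 0" "P1.ge P0 (vP P0 a + 1) b"
proof -
  note G' = G[folded a_def b_def]
  have hd: "homog d (h * t)" "homog d (h * w)" "h * t \<noteq> 0" "h * w \<noteq> 0"
    using homog_mult[OF h(1) t(1)] homog_mult[OF h(1) w(1)] e_le h t w by auto
  show a0: "a \<noteq> 0" unfolding a_def using hd g_nonzero by (simp add: Fract_0_iff)
  have va: "vP P a = int (mul P h + mul P t)" if P: "P \<in> Z" for P
    unfolding a_def using vP_Fract[OF subsetD[OF Z_pts P] hd(1,3) g_homog(3) g_nonzero(3)]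
      mul_mult[OF h t subsetD[OF Z_pts P]] mul_g3[OF P] by simp
  have cases: "(mul P w > 0 \<longleftrightarrow> ev P w = 0) \<and> (mul P t = 0 \<or> mul P w = 0)" if P: "P \<in> Z" for P
    using mul_pos_iff[OF w subsetD[OF Z_pts P]] mul_0I[OF subsetD[OF Z_pts P], of t]
      mul_0I[OF subsetD[OF Z_pts P], of w] cop[OF subsetD[OF Z_pts P]] by auto
  have gb: "P1.ge P (vP P a + 1) b \<longleftrightarrow> ev P w = 0" if P: "P \<in> Z" for P
    unfolding b_def ge_Fract[OF subsetD[OF Z_pts P] hd(2) g_homog(3) g_nonzero(3)] va[OF P]
      mul_mult[OF h w subsetD[OF Z_pts P]] mul_g3[OF P]
    using cases[OF P] hd(4) by auto
  show b1: "P1.ge P0 (vP P0 a + 1) b" using gb[OF P0(1)] P0(2) by blast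
  obtain x where x: "P1.minel Z R x" using P1.gen2_has_minel[OF G'] by blast
  have Y: "{P\<in>Z. P1.ge P (vP P a + 1) b} = {P\<in>Z. ev P w = 0}" using gb by blast
  have ba: "b / a = Fract w t" unfolding a_def b_def using g_nonzero h t by (simp add: eq_fract ac_simps)
  show "P1.loc R a P0 \<in> first_nbhd R" by (rule P1.blowup_gen2(4)[OF G' P0(1) a0 b1 x])
  have g: "P1.gen2 {P\<in>Z. P1.ge P (vP P a + 1) b} (P1.loc R a P0) a (b / a)"
    by (rule P1.blowup_gen2(1)[OF G' P0(1) a0 b1 x])
  then show G2: "P1.gen2 {P\<in>Z. ev P w = 0} (P1.loc R a P0) a (Fract w t)"
    unfolding Y ba .
  have "local_mult (as_ring (P1.loc R a P0)) = real_of_int (\<Sum>P\<in>{P\<in>Z. ev P w = 0}. int (min (mul P h) (mul P w)))"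
  proof (rule P1.gen2_local_mult[OF G2])
    fix P assume "P \<in> {P\<in>Z. ev P w = 0}"
    then have P: "P \<in> Z" "ev P w = 0" "P \<in> pts" using Z_pts by auto
    have mt: "mul P t = 0" using cases[OF P(1)] P(2) by auto
    show "P1.exact2 P (int (min (mul P h) (mul P w))) a (Fract w t)"
      unfolding P1.exact2_def ge_Fract[OF P(3) w(1) t(1) t(2)]
      using va[OF P(1)] a0 mt w by (auto simp: P1.ge_def)
  qed
  also have "(\<Sum>P\<in>{P\<in>Z. ev P w = 0}. int (min (mul P h) (mul P w))) = (\<Sum>P\<in>Z. int (min (mul P h) (mul P w)))"
    using Z_finite cases by (intro sum.mono_neutral_left) auto
  finally show "local_mult (as_ring (P1.loc R a P0)) = real (\<Sum>P\<in>Z. min (mul P h) (mul P w))"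
    by simp
qed

text \<open>The combination is the one that vanishes at the place \<open>P0\<close> to which the point belongs.\<close>

lemma nbr_mult:
  assumes q: "q \<in> first_nbhd R"
  shows "\<exists>a b. (a, b) \<noteq> (0, 0) \<and>
    local_mult (as_ring q) = real (\<Sum>P\<in>Z. min (mul P h) (mul P (const2 a * s1 + const2 b * s2)))"
proof -
  obtain P0 where P0: "P0 \<in> Z"
    "\<And>a b. P1.gen2 Z R a b \<Longrightarrow> a \<noteq> 0 \<Longrightarrow> P1.ge P0 (vP P0 a + 1) b \<Longrightarrow> q = P1.loc R a P0"
    using P1.first_nbhd_place[OF R_gen2 q] by blast
  have X: "xX = Fract (h * s2) g3" "xY = Fract (h * (- s1)) g3" unfolding xX_def xY_def by (simp_all add: g1_eq g2_eq)
  show ?thesis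
  proof (cases "ev P0 s1 = 0")
    case True
    have G: "P1.gen2 Z R (Fract (h * s2) g3) (Fract (h * (- s1)) g3)" using R_gen2 unfolding X .
    note N = nbr_general[OF s(2) s_nonzero(2) homog_uminus[OF s(1)] _ _ G P0(1)]
    have c: "const2 (- 1) * s1 + const2 0 * s2 = - s1" unfolding const2_simps(6,2,1) by simp
    have "q = P1.loc R (Fract (h * s2) g3) P0"
      using P0(2)[OF G N(4,5)] s_coprime s_nonzero True by auto
    then have "local_mult (as_ring q) = real (\<Sum>P\<in>Z. min (mul P h) (mul P (- s1)))"
      using N(3) s_coprime s_nonzero True by auto
    then show ?thesis using c by (intro exI[of _ "- 1"] exI[of _ 0]) simp
  next
    case False
    define r where "r = - ev P0 s2 / ev P0 s1"
    define w where "w = const2 r * s1 + const2 1 * s2"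
    have w: "homog (d - e) w" unfolding w_def by (intro homog_add homog_cmult s)
    have w0: "w \<noteq> 0" unfolding w_def by (rule s_comb_nonzero) simp
    have evw: "ev P w = r * ev P s1 + ev P s2" for P by (simp add: w_def)
    have c: "Fract (const2 (- (- r))) 1 \<in> (cfield :: 'k bipoly fract set)" unfolding cfield_def by (rule range_eqI) (rule refl)
    have "P1.gen2 Z R (Fract (h * (- s1)) g3) (Fract (h * s2) g3 - Fract (const2 (- (- r))) 1 * Fract (h * (- s1)) g3)"
      using P1.gen2_shear[OF P1.gen2_swap[OF R_gen2] c] unfolding X .
    moreover have "Fract (h * s2) g3 - Fract (const2 (- (- r))) 1 * Fract (h * (- s1)) g3 = Fract (h * w) g3"
      using g_nonzero by (simp add: eq_fract w_def algebra_simps)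
    ultimately have G: "P1.gen2 Z R (Fract (h * (- s1)) g3) (Fract (h * w) g3)" by simp
    have cop: "ev P (- s1) \<noteq> 0 \<or> ev P w \<noteq> 0" if "P \<in> pts" for P
      using s_coprime[OF that] evw[of P] by auto
    have ms: "- s1 \<noteq> 0" using s_nonzero by simp
    have ev0: "ev P0 w = 0" unfolding evw using False by (simp add: r_def)
    note N = nbr_general[OF homog_uminus[OF s(1)] ms w w0 cop G P0(1) ev0]
    have "q = P1.loc R (Fract (h * (- s1)) g3) P0" by (rule P0(2)[OF G N(4,5)])
    then have "local_mult (as_ring q) = real (\<Sum>P\<in>Z. min (mul P h) (mul P w))" using N(3) by simp
    then show ?thesis unfolding w_def by (intro exI[of _ r] exI[of _ 1]) simp
  qed
qed

lemma nbr_bound: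
  assumes "q \<in> first_nbhd R"
  shows "local_mult (as_ring q) \<le> real (d - e)"
proof -
  obtain a b where ab: "(a, b) \<noteq> (0, 0)"
    "local_mult (as_ring q) = real (\<Sum>P\<in>Z. min (mul P h) (mul P (const2 a * s1 + const2 b * s2)))"
    using nbr_mult[OF assms] by blast
  have w: "homog (d - e) (const2 a * s1 + const2 b * s2)" by (intro homog_add homog_cmult s)
  have "(\<Sum>P\<in>Z. min (mul P h) (mul P (const2 a * s1 + const2 b * s2))) \<le> (\<Sum>P\<in>Z. mul P (const2 a * s1 + const2 b * s2))"
    by (intro sum_mono) simp
  also have "\<dots> \<le> d - e" using sum_mul[OF w s_comb_nonzero[OF ab(1)] Z_finite Z_pts] by simp
  finally show ?thesis unfolding ab(2) by (simp only: of_nat_le_iff)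
qed

text \<open>The sum of the minima reaches \<open>deg h\<close> only if the combination vanishes at least as much as \<open>h\<close> everywhere.\<close>

lemma nbr_full:
  assumes "q \<in> first_nbhd R" "local_mult (as_ring q) = real e"
  shows "\<exists>a b r. (a, b) \<noteq> (0, 0) \<and> const2 a * s1 + const2 b * s2 = h * r \<and> homog (d - e - e) r"
proof -
  obtain a b where ab: "(a, b) \<noteq> (0, 0)"
    "local_mult (as_ring q) = real (\<Sum>P\<in>Z. min (mul P h) (mul P (const2 a * s1 + const2 b * s2)))"
    using nbr_mult[OF assms(1)] by blast
  have w: "homog (d - e) (const2 a * s1 + const2 b * s2)" by (intro homog_add homog_cmult s)
  have "(\<Sum>P\<in>Z. min (mul P h) (mul P (const2 a * s1 + const2 b * s2))) = (\<Sum>P\<in>Z. mul P h)"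
    using ab(2) assms(2) unfolding sum_mul_h by (simp only: of_nat_eq_iff)
  then have "mul P h \<le> mul P (const2 a * s1 + const2 b * s2)" if "P \<in> Z" for P
    using that by (rule sum_min_eq_imp_le[OF Z_finite])
  then have "\<exists>r. const2 a * s1 + const2 b * s2 = h * r \<and> homog (d - e - e) r \<and> (const2 a * s1 + const2 b * s2 \<noteq> 0 \<longrightarrow> e \<le> d - e)"
    using Z_eq by (intro form_dvd_by_mul[OF h w]) blast
  then show ?thesis using ab(1) by blast
qed

end

text \<open>The coordinates are turned so that the combination of \<open>s1\<close> and \<open>s2\<close> that is divisible by \<open>h\<close> is \<open>s2\<close> itself; this
  fixes the tangent line at the point.\<close>

locale curve_tangent = curve_factored g1 g2 g3 d h s1 s2 e
  for g1 g2 g3 :: "'k::alg_closed_field bipoly" and d h s1 s2 e +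
  fixes y :: 'k
  assumes s2_eq: "s2 = const2 y * h"
begin

lemma y_nonzero: "y \<noteq> 0"
  using s2_eq s_nonzero by auto

lemma d_eq: "d = 2 * e" "d - e = e"
proof -
  have "homog e s2" unfolding s2_eq by (rule homog_cmult[OF h(1)])
  then show "d - e = e" using homog_unique[OF s(2) _ s_nonzero(2)] by simp
  then show "d = 2 * e" using e_le by simp
qed

lemma ev_s1: "P \<in> Z \<Longrightarrow> ev P s1 \<noteq> 0"
  using s_coprime unfolding Z_eq s2_eq by fastforce

text \<open>The combination \<open>w = s2\<close> vanishes on all of \<open>Z\<close> to the order of \<open>h\<close>, so the sum of the minima is \<open>deg h\<close>.\<close>

lemma tangent_nbr:
  "\<exists>q\<in>first_nbhd R. local_mult (as_ring q) = real e \<and> P1.gen2 Z q (Fract s2 (- s1)) xY"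
proof -
  obtain P0 where P0: "P0 \<in> Z" using Z_nonempty by auto
  have X: "xX = Fract (h * s2) g3" "xY = Fract (h * (- s1)) g3" unfolding xX_def xY_def by (simp_all add: g1_eq g2_eq)
  have G: "P1.gen2 Z R (Fract (h * (- s1)) g3) (Fract (h * s2) g3)" using P1.gen2_swap[OF R_gen2] unfolding X .
  have cop: "ev P (- s1) \<noteq> 0 \<or> ev P s2 \<noteq> 0" if "P \<in> pts" for P using s_coprime[OF that] by simp
  have ms: "- s1 \<noteq> 0" using s_nonzero by simp
  have z: "ev P s2 = 0" if "P \<in> Z" for P using that unfolding Z_eq s2_eq by simp
  note N = nbr_general[OF homog_uminus[OF s(1)] ms s(2) s_nonzero(2) cop G P0 z[OF P0]]
  have "{P\<in>Z. ev P s2 = 0} = Z" using z by auto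
  then have 1: "P1.gen2 Z (P1.loc R xY P0) (Fract s2 (- s1)) xY" using P1.gen2_swap[OF N(2)] unfolding X by simp
  have "mul P s2 = mul P h" if P: "P \<in> Z" for P
    unfolding s2_eq using mul_mult[OF homog_const2 _ h subsetD[OF Z_pts P], of y] mul_const2[OF subsetD[OF Z_pts P] y_nonzero] y_nonzero
    by (simp del: mult_pCons_left)
  then have "(\<Sum>P\<in>Z. min (mul P h) (mul P s2)) = e" using sum_mul_h by simp
  then have "local_mult (as_ring (P1.loc R xY P0)) = real e" using N(3) unfolding X by simp
  then show ?thesis using 1 N(1) unfolding X by blast
qed

text \<open>In the second blow-up, the forms \<open>T k\<close> play the role that the combinations of \<open>s1\<close> and \<open>s2\<close> play in the first.\<close>

definition T :: "'k \<Rightarrow> 'k bipoly" where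
  "T k = s1 * s1 - const2 k * g3"

lemma T_homog: "homog d (T k)"
  unfolding T_def using d_eq by (intro homog_diff homog_cmult g_homog homog_mult'[OF s(1) s(1)]) simp

text \<open>Subtracting \<open>k / y\<close> times \<open>s2 / (- s1)\<close> from \<open>g2 / g3\<close> yields \<open>- h (T k) / (g3 s1)\<close>, and its quotient by
  \<open>s2 / (- s1)\<close> is \<open>T k / (y g3)\<close>.\<close>

lemma second_nbr:
  assumes q: "P1.gen2 Z q (Fract s2 (- s1)) xY" and P0: "P0 \<in> Z" "ev P0 (T k) = 0"
  shows "\<exists>b. P1.gen2 Z q (Fract s2 (- s1)) b \<and> Fract s2 (- s1) \<noteq> 0 \<and> P1.ge P0 (vP P0 (Fract s2 (- s1)) + 1) b \<and>
    P1.loc q (Fract s2 (- s1)) P0 \<in> first_nbhd q \<and>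
    local_mult (as_ring (P1.loc q (Fract s2 (- s1)) P0)) = real (\<Sum>P\<in>Z. min (mul P h) (if T k = 0 then mul P h else mul P (T k)))"
proof -
  define a where "a = Fract s2 (- s1)"
  define c where "c = Fract (const2 (k / y)) (1 :: 'k bipoly)"
  define b where "b = xY - c * a"
  have cc: "c \<in> cfield" unfolding c_def cfield_def by (rule range_eqI) (rule refl)
  have G: "P1.gen2 Z q a b" unfolding b_def a_def by (rule P1.gen2_shear[OF q cc])
  have ms: "- s1 \<noteq> 0" "homog (d - e) (- s1)" using s_nonzero homog_uminus[OF s(1)] by auto
  have ky: "const2 (k / y) * s2 = const2 k * h" unfolding s2_eq using y_nonzero by simp
  have b_eq: "b = Fract (- (h * T k)) (g3 * s1)"
  proof -
    have "c * a = Fract (const2 k * h) (- s1)" unfolding c_def a_def using ky by (simp del: mult_pCons_left)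
    then show ?thesis unfolding b_def xY_def T_def using g_nonzero s_nonzero
      by (simp add: eq_fract g2_eq algebra_simps)
  qed
  have bh: "homog (e + d) (- (h * T k))" "homog (e + d) (g3 * s1)" "g3 * s1 \<noteq> 0"
    using homog_uminus[OF homog_mult[OF h(1) T_homog]] homog_mult[OF g_homog(3) s(1)] d_eq g_nonzero s_nonzero
    by (auto simp: add.commute)
  have a0: "a \<noteq> 0" unfolding a_def using ms s_nonzero by (simp add: Fract_0_iff)
  have ms2: "mul P s2 = mul P h" if P: "P \<in> Z" for P
    unfolding s2_eq using mul_mult[OF homog_const2 _ h subsetD[OF Z_pts P], of y] mul_const2[OF subsetD[OF Z_pts P] y_nonzero] y_nonzero
    by (simp del: mult_pCons_left)
  have mms1: "mul P (- s1) = 0" "mul P s1 = 0" if P: "P \<in> Z" for P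
    using mul_0I[OF subsetD[OF Z_pts P], of "- s1"] mul_0I[OF subsetD[OF Z_pts P], of s1] ev_s1[OF P] by auto
  have va: "vP P a = int (mul P h)" if P: "P \<in> Z" for P
    unfolding a_def using vP_Fract[OF subsetD[OF Z_pts P] s(2) s_nonzero(2) ms(2,1)] ms2[OF P] mms1[OF P] by simp
  have mb: "mul P (- (h * T k)) = mul P h + mul P (T k)" if "P \<in> Z" "T k \<noteq> 0" for P
  proof -
    have Pp: "P \<in> pts" using that Z_pts by auto
    have c: "const2 (- 1 :: 'k) = - 1" by (simp add: one_pCons)
    have "mul P (const2 (- 1) * (h * T k)) = mul P (const2 (- 1 :: 'k)) + mul P (h * T k)"
      using h that by (intro mul_mult[OF homog_const2 _ homog_mult[OF h(1) T_homog] _ Pp]) auto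
    then have "mul P (- (h * T k)) = mul P (h * T k)" using mul_const2[OF Pp, of "- 1"] unfolding c by simp
    then show ?thesis using mul_mult[OF h T_homog that(2) Pp] by simp
  qed
  have mg: "mul P (g3 * s1) = 0" if P: "P \<in> Z" for P
    using mul_mult[OF g_homog(3) g_nonzero(3) s(1) s_nonzero(1) subsetD[OF Z_pts P]] mul_g3[OF P] mms1[OF P] by simp
  have gb: "P1.ge P (vP P a + 1) b \<longleftrightarrow> ev P (T k) = 0" if P: "P \<in> Z" for P
  proof (cases "T k = 0")
    case True
    then show ?thesis unfolding b_eq by (simp add: fract_collapse)
  next
    case False
    then show ?thesis
      unfolding b_eq ge_Fract[OF subsetD[OF Z_pts P] bh] va[OF P] mb[OF P False] mg[OF P]
      using mul_pos_iff[OF T_homog False subsetD[OF Z_pts P]] h by auto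
  qed
  have b1: "P1.ge P0 (vP P0 a + 1) b" using gb[OF P0(1)] P0(2) by blast
  obtain x where x: "P1.minel Z q x" using P1.gen2_has_minel[OF G] by blast
  have Y: "{P\<in>Z. P1.ge P (vP P a + 1) b} = {P\<in>Z. ev P (T k) = 0}" using gb by blast
  have ba: "b / a = Fract (T k) (const2 y * g3)"
    unfolding b_eq a_def s2_eq using g_nonzero h s_nonzero y_nonzero by (simp add: eq_fract ac_simps)
  have yg: "homog d (const2 y * g3)" "const2 y * g3 \<noteq> 0" using homog_cmult[OF g_homog(3)] y_nonzero g_nonzero by auto
  have g: "P1.gen2 {P\<in>Z. ev P (T k) = 0} (P1.loc q a P0) a (Fract (T k) (const2 y * g3))"
    using P1.blowup_gen2(1)[OF G P0(1) a0 b1 x] unfolding Y ba .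
  have myg: "mul P (const2 y * g3) = 0" if P: "P \<in> Z" for P
    using mul_0I[OF subsetD[OF Z_pts P], of "const2 y * g3"] g3_Z[OF P] y_nonzero by simp
  let ?m = "\<lambda>P. min (mul P h) (if T k = 0 then mul P h else mul P (T k))"
  have "local_mult (as_ring (P1.loc q a P0)) = real_of_int (\<Sum>P\<in>{P\<in>Z. ev P (T k) = 0}. int (?m P))"
  proof (rule P1.gen2_local_mult[OF g])
    fix P assume "P \<in> {P\<in>Z. ev P (T k) = 0}"
    then have P: "P \<in> Z" "ev P (T k) = 0" "P \<in> pts" using Z_pts by auto
    show "P1.exact2 P (int (?m P)) a (Fract (T k) (const2 y * g3))"
      unfolding P1.exact2_def ge_Fract[OF P(3) T_homog yg] myg[OF P(1)]
      using va[OF P(1)] a0 by (auto simp: P1.ge_def)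
  qed
  also have "(\<Sum>P\<in>{P\<in>Z. ev P (T k) = 0}. int (?m P)) = (\<Sum>P\<in>Z. int (?m P))"
  proof (rule sum.mono_neutral_left[OF Z_finite])
    show "\<forall>P\<in>Z - {P \<in> Z. ev P (T k) = 0}. int (?m P) = 0"
    proof
      fix P assume P: "P \<in> Z - {P \<in> Z. ev P (T k) = 0}"
      then have "ev P (T k) \<noteq> 0" "P \<in> pts" using Z_pts by auto
      moreover from this have "T k \<noteq> 0" by auto
      ultimately show "int (?m P) = 0" using mul_0I[of P "T k"] by simp
    qed
  qed auto
  finally have "local_mult (as_ring (P1.loc q a P0)) = real (\<Sum>P\<in>Z. ?m P)" by simp
  then show ?thesis
    using G a0 b1 P1.blowup_gen2(4)[OF G P0(1) a0 b1 x] unfolding a_def by blast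
qed

text \<open>The value of \<open>k\<close> is that of \<open>s1^2 / g3\<close> at a place of \<open>q2\<close>, so that \<open>T k\<close> vanishes there.\<close>

lemma second_nbr_full:
  assumes q: "P1.gen2 Z q (Fract s2 (- s1)) xY" and q2: "q2 \<in> first_nbhd q" "local_mult (as_ring q2) = real e"
  shows "\<exists>k r. k \<noteq> 0 \<and> s1 * s1 - const2 k * g3 = h * r"
proof -
  obtain P0 where P0: "P0 \<in> Z"
    "\<And>a b. P1.gen2 Z q a b \<Longrightarrow> a \<noteq> 0 \<Longrightarrow> P1.ge P0 (vP P0 a + 1) b \<Longrightarrow> q2 = P1.loc q a P0"
    using P1.first_nbhd_place[OF q q2(1)] by blast
  define k where "k = ev P0 s1 * ev P0 s1 / ev P0 g3"
  have k0: "k \<noteq> 0" using ev_s1[OF P0(1)] g3_Z[OF P0(1)] by (simp add: k_def)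
  have T0: "ev P0 (T k) = 0" using g3_Z[OF P0(1)] by (simp add: T_def k_def)
  obtain b where b: "P1.gen2 Z q (Fract s2 (- s1)) b" "Fract s2 (- s1) \<noteq> 0" "P1.ge P0 (vP P0 (Fract s2 (- s1)) + 1) b"
    "local_mult (as_ring (P1.loc q (Fract s2 (- s1)) P0)) = real (\<Sum>P\<in>Z. min (mul P h) (if T k = 0 then mul P h else mul P (T k)))"
    using second_nbr[OF q P0(1) T0] by blast
  have "q2 = P1.loc q (Fract s2 (- s1)) P0" by (rule P0(2)[OF b(1-3)])
  then have "(\<Sum>P\<in>Z. min (mul P h) (if T k = 0 then mul P h else mul P (T k))) = (\<Sum>P\<in>Z. mul P h)"
    using b(4) q2(2) unfolding sum_mul_h by (simp only: of_nat_eq_iff)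
  then have le: "mul P h \<le> (if T k = 0 then mul P h else mul P (T k))" if "P \<in> Z" for P
    using that by (rule sum_min_eq_imp_le[OF Z_finite])
  have "T k = 0 \<or> mul P h \<le> mul P (T k)" if "P \<in> pts" "ev P h = 0" for P
    using le[of P] that unfolding Z_eq by (cases "T k = 0") auto
  then have "\<exists>r. T k = h * r \<and> homog (d - e) r \<and> (T k \<noteq> 0 \<longrightarrow> e \<le> d)"
    by (intro form_dvd_by_mul[OF h T_homog])
  then show ?thesis using k0 unfolding T_def by blast
qed

lemma second_nbr_exists:
  assumes q: "P1.gen2 Z q (Fract s2 (- s1)) xY" and k: "s1 * s1 - const2 k * g3 = h * r"
  shows "\<exists>q2\<in>first_nbhd q. local_mult (as_ring q2) = real e"
proof -
  have Th: "T k = h * r" unfolding T_def by (rule k)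
  obtain P0 where P0: "P0 \<in> Z" using Z_nonempty by auto
  then have T0: "ev P0 (T k) = 0" unfolding Th Z_eq by simp
  obtain b where b: "P1.loc q (Fract s2 (- s1)) P0 \<in> first_nbhd q"
    "local_mult (as_ring (P1.loc q (Fract s2 (- s1)) P0)) = real (\<Sum>P\<in>Z. min (mul P h) (if T k = 0 then mul P h else mul P (T k)))"
    using second_nbr[OF q P0 T0] by blast
  have "mul P h \<le> mul P (T k)" if P: "P \<in> Z" "T k \<noteq> 0" for P
  proof -
    have Pp: "P \<in> pts" using P Z_pts by auto
    have "T k * 1 = h * r" using Th by simp
    from form_coprime_dvd[OF h T_homog _ this] obtain r' where r': "T k = h * r'" "homog (d - e) r'"
      by (metis ev_simps(7) zero_neq_one)
    then have "r' \<noteq> 0" using P by auto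
    then show ?thesis unfolding r'(1) using mul_mult[OF h r'(2) _ Pp] by simp
  qed
  then have "(\<Sum>P\<in>Z. min (mul P h) (if T k = 0 then mul P h else mul P (T k))) = (\<Sum>P\<in>Z. mul P h)"
    by (intro sum.cong) auto
  then show ?thesis using b sum_mul_h by auto
qed

end

no_notation fps_nth (infixl "$" 75)

section \<open>Consequences of the height and minimality assumptions\<close>

text \<open>Restriction of a polynomial to the line through the origin with direction \<open>P\<close>: a ring homomorphism whose kernel
  is generated by \<open>lf P\<close>.\<close>

definition line_restr :: "'k::field \<times> 'k \<Rightarrow> 'k bipoly \<Rightarrow> 'k poly" where
  "line_restr P F = (if fst P = 0 then map_poly (\<lambda>q. poly q 0) F else poly F [:0, snd P:])"

lemma line_restr_mult: "line_restr P (F * G) = line_restr P F * line_restr P G"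
proof -
  have "map_poly (\<lambda>q. poly q 0) (F * G) = map_poly (\<lambda>q. poly q 0) F * map_poly (\<lambda>q. poly q (0::'a)) G"
    by (rule poly_eqI) (simp add: coeff_map_poly coeff_mult poly_sum)
  then show ?thesis by (simp add: line_restr_def)
qed

lemma line_restr_kernel:
  assumes P: "P \<in> pts"
  shows "line_restr P F = 0 \<longleftrightarrow> lf P dvd (F :: 'k::field bipoly)"
proof (cases "P = (0, 1)")
  case True
  show ?thesis
  proof
    assume z: "line_restr P F = 0"
    have c0: "ccf F j 0 = 0" for j
    proof -
      have "Polynomial.coeff (line_restr P F) j = poly (Polynomial.coeff F j) 0"
        by (simp add: line_restr_def True coeff_map_poly)
      then show ?thesis using z by (simp add: poly_0_coeff_0)
    qed
    define G where "G = map_poly (poly_shift 1) F"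
    have cG: "Polynomial.coeff G j = poly_shift 1 (Polynomial.coeff F j)" for j
      unfolding G_def by (rule coeff_map_poly) (simp add: poly_shift_0)
    have "F = lf P * G"
    proof (intro poly_eqI)
      fix j i
      have "lf P * G = Polynomial.smult [:0, 1:] G" by (simp add: lf_def True)
      then have "ccf (lf P * G) j i = Polynomial.coeff ([:0, 1:] * poly_shift 1 (Polynomial.coeff F j)) i"
        by (simp add: cG)
      also have "\<dots> = ccf F j i" using c0 by (cases i) (auto simp: coeff_poly_shift coeff_pCons)
      finally show "ccf F j i = ccf (lf P * G) j i" by simp
    qed
    then show "lf P dvd F" by simp
  next
    assume "lf P dvd F"
    then obtain G where G: "F = lf P * G" by (elim dvdE)
    have "line_restr P (lf P) = 0" by (simp add: line_restr_def lf_def True map_poly_pCons)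
    then show "line_restr P F = 0" unfolding G line_restr_mult by simp
  qed
next
  case False
  then obtain t where t: "P = (1, t)" using P by (auto simp: pts_def)
  have l: "lf P = - [:- [:0, t:], 1:]" by (simp add: lf_def t one_pCons)
  have "lf P dvd F \<longleftrightarrow> [:- [:0, t:], 1:] dvd F" unfolding l by (rule minus_dvd_iff)
  moreover have "line_restr P F = poly F [:0, t:]" by (simp add: line_restr_def t)
  ultimately show ?thesis by (simp only: poly_eq_0_iff_dvd)
qed

lemma line_restr_1: "line_restr P (1 :: 'k::field bipoly) = 1"
proof -
  have "map_poly (\<lambda>q. poly q 0) (1 :: 'k bipoly) = 1"
    by (rule poly_eqI) (simp add: coeff_map_poly one_pCons coeff_pCons split: nat.splits)
  then show ?thesis by (simp add: line_restr_def)
qed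

text \<open>A degree that is additive without homogeneity: the one of the leading term for a lexicographic order.\<close>

definition bidegree_sum :: "'k::field bipoly \<Rightarrow> nat" where
  "bidegree_sum F = Polynomial.degree F + Polynomial.degree (Polynomial.lead_coeff F)"

lemma bidegree_sum_mult: "F \<noteq> 0 \<Longrightarrow> G \<noteq> 0 \<Longrightarrow> bidegree_sum (F * G) = bidegree_sum F + bidegree_sum G"
  by (simp add: bidegree_sum_def degree_mult_eq coeff_mult_degree_sum)

lemma bidegree_sum_lf: "P \<in> pts \<Longrightarrow> bidegree_sum (lf P) = 1"
  by (auto simp: pts_def bidegree_sum_def lf_def)

lemma ideal_type_algebra:
  assumes "ideal J (ring_of_type_algebra :: 'a::comm_ring_1 ring)"
  shows "0 \<in> J" "x \<in> J \<Longrightarrow> y \<in> J \<Longrightarrow> x + y \<in> J" "x \<in> J \<Longrightarrow> r * x \<in> J"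
proof -
  interpret ideal J "ring_of_type_algebra :: 'a ring" by (rule assms)
  show "0 \<in> J" using additive_subgroup.zero_closed[OF is_additive_subgroup] by simp
  show "x + y \<in> J" if "x \<in> J" "y \<in> J" using additive_subgroup.a_closed[OF is_additive_subgroup that] by simp
  show "r * x \<in> J" if "x \<in> J" using I_l_closed[OF that, of r] by simp
qed

lemma ideal_lf:
  assumes P: "P \<in> pts"
  shows "primeideal {F. lf P dvd F} (ring_of_type_algebra :: 'k::field bipoly ring)"
proof -
  interpret cring "ring_of_type_algebra :: 'k bipoly ring" by (rule cring_from_type_algebra)
  have inv: "inv\<^bsub>add_monoid (ring_of_type_algebra :: 'k bipoly ring)\<^esub> F = - F" for F
    using type_algebra_uminus[of F] unfolding a_inv_def .
  have id: "ideal {F. lf P dvd F} (ring_of_type_algebra :: 'k bipoly ring)"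
  proof (rule idealI)
    show "subgroup {F. lf P dvd F} (add_monoid (ring_of_type_algebra :: 'k bipoly ring))"
    proof (rule subgroup.intro)
      show "inv\<^bsub>add_monoid ring_of_type_algebra\<^esub> x \<in> {F. lf P dvd F}" if "x \<in> {F. lf P dvd F}" for x
        using that unfolding inv by simp
    qed auto
  qed (auto simp: ring_axioms)
  show ?thesis
  proof (rule primeidealI[OF id])
    show "cring (ring_of_type_algebra :: 'k bipoly ring)" by (rule cring_from_type_algebra)
    have "\<not> lf P dvd 1" using line_restr_kernel[OF P, of 1] line_restr_1[of P] by simp
    then show "carrier (ring_of_type_algebra :: 'k bipoly ring) \<noteq> {F. lf P dvd F}" by auto
    fix F G assume "F \<otimes>\<^bsub>ring_of_type_algebra\<^esub> G \<in> {F. lf P dvd F}"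
    then have "line_restr P F * line_restr P G = 0"
      using line_restr_kernel[OF P, of "F * G"] by (simp add: line_restr_mult)
    then show "F \<in> {F. lf P dvd F} \<or> G \<in> {F. lf P dvd F}" using line_restr_kernel[OF P] by auto
  qed
qed

text \<open>A prime ideal properly contained in \<open>(lf P)\<close> does not contain \<open>lf P\<close>, so an element of it can be divided by \<open>lf P\<close>
  within the ideal for ever, unless it is zero.\<close>

lemma height_lf:
  assumes P: "P \<in> pts"
  shows "prime_height (ring_of_type_algebra :: 'k::field bipoly ring) {F. lf P dvd F} \<le> 1"
  unfolding prime_height_def
proof (rule Sup_least)
  let ?B = "ring_of_type_algebra :: 'k bipoly ring"
  fix y assume "y \<in> {enat n |n. \<exists>J. prime_chain ?B J n \<and> J n = {F. lf P dvd F}}"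
  then obtain n J where J: "y = enat n" "prime_chain ?B J n" "J n = {F. lf P dvd F}" by blast
  have "n \<le> 1"
  proof (rule ccontr)
    assume "\<not> n \<le> 1"
    then obtain m where m: "n = Suc (Suc m)" by (metis One_nat_def le_Suc_eq not0_implies_Suc zero_le)
    have ch: "primeideal (J m) ?B" "primeideal (J (Suc m)) ?B" "J m \<subset> J (Suc m)" "J (Suc m) \<subset> {F. lf P dvd F}"
      using J m by (auto simp: prime_chain_def)
    have id: "ideal (J m) ?B" "ideal (J (Suc m)) ?B" using ch by (auto simp: primeideal_def)
    have "0 \<in> J m" by (rule ideal_type_algebra(1)[OF id(1)])
    then obtain F0 where F0: "F0 \<in> J (Suc m)" "F0 \<noteq> 0" using ch(3) by auto
    have nl: "lf P \<notin> J (Suc m)"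
    proof
      assume l: "lf P \<in> J (Suc m)"
      have "F \<in> J (Suc m)" if dv: "lf P dvd F" for F
      proof -
        obtain G where "F = lf P * G" using dv by (elim dvdE)
        then show ?thesis using ideal_type_algebra(3)[OF id(2) l, of G] by (simp add: mult.commute)
      qed
      then show False using ch(4) by auto
    qed
    have "False" if "F \<in> J (Suc m)" "F \<noteq> 0" for F
      using that
    proof (induction "bidegree_sum F" arbitrary: F rule: less_induct)
      case less
      have "lf P dvd F" using less(2) ch(4) by auto
      then obtain G where G: "F = lf P * G" by (elim dvdE)
      have G0: "G \<noteq> 0" using G less by auto
      have "lf P \<otimes>\<^bsub>?B\<^esub> G \<in> J (Suc m)" using less(2) G by simp
      then have "G \<in> J (Suc m)" using primeideal.I_prime[OF ch(2), of "lf P" G] nl by auto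
      moreover have "bidegree_sum G < bidegree_sum F"
        unfolding G using bidegree_sum_mult[OF lf_nonzero[OF P] G0] bidegree_sum_lf[OF P] by simp
      ultimately show False using less(1) G0 by blast
    qed
    then show False using F0 by blast
  qed
  then show "y \<le> 1" using J(1) by (simp add: one_enat_def)
qed

text \<open>If all \<open>g i\<close> vanished at \<open>P\<close>, the ideal would lie in the prime ideal \<open>(lf P)\<close> of height at most one.\<close>

lemma height_two_no_common_root:
  fixes g :: "('k::field bipoly)^3"
  assumes g: "\<And>i. homog d (g $ i)" and ht: "ideal_height ring_of_type_algebra (gen_ideal g UNIV) = 2"
    and P: "P \<in> pts"
  shows "\<exists>i. ev P (g $ i) \<noteq> 0"
proof (rule ccontr)
  let ?B = "ring_of_type_algebra :: 'k bipoly ring"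
  assume "\<not> ?thesis"
  then have dv: "lf P dvd g $ i" for i
    using form_root_factor[OF g P, of i] by (metis dvd_triv_left)
  have pr: "primeideal {F. lf P dvd F} ?B" by (rule ideal_lf[OF P])
  interpret ring ?B by (rule ring_from_type_algebra)
  have "gen_ideal g UNIV \<subseteq> {F. lf P dvd F}"
    unfolding gen_ideal_def using pr dv by (intro genideal_minimal) (auto simp: primeideal_def)
  then have "ideal_height ?B (gen_ideal g UNIV) \<le> prime_height ?B {F. lf P dvd F}"
    unfolding ideal_height_def using pr by (intro Inf_lower) blast
  also have "\<dots> \<le> 1" by (rule height_lf[OF P])
  finally have "(2 :: enat) \<le> 1" using ht by simp
  then show False by (simp add: numeral_eq_enat one_enat_def)
qed

text \<open>A linear relation would express one of the \<open>g i\<close> by the other two.\<close>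

lemma min_gen_independent:
  fixes g :: "('k::field bipoly)^3"
  assumes mg: "minimally_generating g" and z: "(\<Sum>i\<in>UNIV. const2 (a $ i) * g $ i) = 0"
  shows "a = (0 :: 'k^3)"
proof (rule ccontr)
  let ?B = "ring_of_type_algebra :: 'k bipoly ring"
  assume "a \<noteq> 0"
  then obtain k where k: "a $ k \<noteq> 0" by (auto simp: vec_eq_iff)
  interpret ring ?B by (rule ring_from_type_algebra)
  define J where "J = gen_ideal g (UNIV - {k})"
  have id: "ideal J ?B" unfolding J_def gen_ideal_def by (rule genideal_ideal) simp
  note J = ideal_type_algebra[OF id]
  have mem: "g $ i \<in> J" if "i \<noteq> k" for i
    unfolding J_def gen_ideal_def using genideal_self[of "(\<lambda>i. g $ i) ` (UNIV - {k})"] that by auto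
  have "(\<Sum>i\<in>UNIV. const2 (a $ i) * g $ i) = const2 (a $ k) * g $ k + (\<Sum>i\<in>UNIV - {k}. const2 (a $ i) * g $ i)"
    by (rule sum.remove) auto
  then have e: "const2 (a $ k) * g $ k = - (\<Sum>i\<in>UNIV - {k}. const2 (a $ i) * g $ i)"
    using z by (simp only: eq_neg_iff_add_eq_0)
  have "(\<Sum>i\<in>S. const2 (a $ i) * g $ i) \<in> J" if "S \<subseteq> UNIV - {k}" for S
    using finite_subset[OF that finite] that
  proof (induction S rule: finite_induct)
    case (insert i S)
    then show ?case using J(2)[OF J(3)[OF mem[of i], of "const2 (a $ i)"]] by auto
  qed (use J(1) in auto)
  then have "const2 (- inverse (a $ k)) * (\<Sum>i\<in>UNIV - {k}. const2 (a $ i) * g $ i) \<in> J" using J(3) by blast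
  moreover have "const2 (- inverse (a $ k)) * (\<Sum>i\<in>UNIV - {k}. const2 (a $ i) * g $ i) = g $ k"
  proof -
    have "const2 (- inverse (a $ k)) * (\<Sum>i\<in>UNIV - {k}. const2 (a $ i) * g $ i) = const2 (inverse (a $ k)) * (const2 (a $ k) * g $ k)"
      unfolding e const2_simps(6) by (simp only: mult_minus_left mult_minus_right)
    also have "\<dots> = const2 (inverse (a $ k) * a $ k) * g $ k" by (simp only: const2_simps(5) mult.assoc)
    also have "\<dots> = g $ k" using k by simp
    finally show ?thesis .
  qed
  ultimately have all: "g $ i \<in> J" for i using mem[of i] by (cases "i = k") auto
  have "gen_ideal g UNIV \<subseteq> J" unfolding gen_ideal_def using all by (intro genideal_minimal[OF id]) auto
  moreover have "J \<subseteq> gen_ideal g UNIV"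
  proof -
    have id': "ideal (gen_ideal g UNIV) ?B" unfolding gen_ideal_def by (rule genideal_ideal) simp
    have "(\<lambda>i. g $ i) ` UNIV \<subseteq> gen_ideal g UNIV" unfolding gen_ideal_def by (rule genideal_self) simp
    then show ?thesis unfolding J_def gen_ideal_def[of g "UNIV - {k}"] by (intro genideal_minimal[OF id']) auto
  qed
  ultimately have "gen_ideal g (UNIV - {k}) = gen_ideal g UNIV" unfolding J_def by blast
  moreover have "UNIV - {k} \<subset> (UNIV :: 3 set)" by auto
  ultimately show False using mg unfolding minimally_generating_def by blast
qed

section \<open>Forms in three variables\<close>

definition expos :: "nat \<Rightarrow> (3 \<Rightarrow> nat) set" where
  "expos n = {e. (\<Sum>i\<in>UNIV. e i) = n}"

lemma finite_expos: "finite (expos n)"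
proof -
  let ?f = "\<lambda>(a, b, c) (i::3). if i = 1 then a else if i = 2 then b else (c::nat)"
  have "expos n \<subseteq> ?f ` ({..n} \<times> {..n} \<times> {..n})"
  proof
    fix e :: "3 \<Rightarrow> nat" assume "e \<in> expos n"
    then have s: "e 1 + e 2 + e 3 = n" by (simp add: expos_def sum_3)
    have "e = ?f (e 1, e 2, e 3)" by (rule ext) (use exhaust_3 in auto)
    moreover have "(e 1, e 2, e 3) \<in> {..n} \<times> {..n} \<times> {..n}" using s by auto
    ultimately show "e \<in> ?f ` ({..n} \<times> {..n} \<times> {..n})" by (rule image_eqI)
  qed
  then show ?thesis by (rule finite_subset) auto
qed

lemma eval_form_expos: "eval_form \<iota> n c v = (\<Sum>e\<in>expos n. \<iota> (c e) * (\<Prod>i\<in>UNIV. (v $ i) ^ e i))"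
  by (simp add: eval_form_def expos_def)

lemma prod_UNIV_3: "prod f (UNIV :: 3 set) = f 1 * f 2 * f 3"
  unfolding UNIV_3 by (simp add: mult.assoc)

lemma fspan_sum: "(\<And>i. i \<in> S \<Longrightarrow> f i \<in> fspan u v w n) \<Longrightarrow> sum f S \<in> fspan u v w n"
  by (induction S rule: infinite_finite_induct) (auto intro: fspan_add fspan_0)

lemma eval_form_in_fspan:
  "eval_form const2 n c g \<in> fspan (g $ 1) (g $ 2) (g $ 3) n"
  unfolding eval_form_expos
proof (rule fspan_sum)
  fix e assume "e \<in> expos n"
  then have n: "n = e 1 * 1 + e 2 * 1 + e 3 * 1" by (simp add: expos_def sum_3)
  have "(\<Prod>i\<in>UNIV. (g $ i) ^ e i) \<in> fspan (g $ 1) (g $ 2) (g $ 3) n"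
    unfolding prod_UNIV_3 n by (intro fspan_mult fspan_power fspan_gens)
  then show "const2 (c e) * (\<Prod>i\<in>UNIV. (g $ i) ^ e i) \<in> fspan (g $ 1) (g $ 2) (g $ 3) n"
    by (rule fspan_cmult)
qed

lemma fspan_eq_eval_form:
  fixes g :: "('k::comm_ring_1 bipoly)^3"
  shows "fspan (g $ 1) (g $ 2) (g $ 3) n = range (\<lambda>c. eval_form const2 n c g)"
proof
  define V where "V n = range (\<lambda>c. eval_form const2 n c g)" for n
  have addV: "x + y \<in> V n" if xy: "x \<in> V n" "y \<in> V n" for x y n
  proof -
    obtain c c' where c: "x = eval_form const2 n c g" "y = eval_form const2 n c' g" using xy unfolding V_def by blast
    have "x + y = eval_form const2 n (\<lambda>e. c e + c' e) g"
      unfolding c eval_form_expos const2_simps(3) by (simp only: distrib_right sum.distrib)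
    then show ?thesis unfolding V_def by blast
  qed
  have cmulV: "const2 r * x \<in> V n" if x: "x \<in> V n" for r x n
  proof -
    obtain c where c: "x = eval_form const2 n c g" using x unfolding V_def by blast
    have "const2 r * x = eval_form const2 n (\<lambda>e. r * c e) g"
      unfolding c eval_form_expos const2_simps(5) by (simp only: sum_distrib_left mult.assoc)
    then show ?thesis unfolding V_def by blast
  qed
  have zeroV: "0 \<in> V n" for n
  proof -
    have "eval_form const2 n (\<lambda>_. 0) g = 0" unfolding eval_form_expos by simp
    then show ?thesis unfolding V_def by (metis rangeI)
  qed
  have sumV: "sum f S \<in> V n" if "\<And>i. i \<in> S \<Longrightarrow> f i \<in> V n" for f and S :: "(3 \<Rightarrow> nat) set" and n
    using that by (induction S rule: infinite_finite_induct) (auto intro: addV zeroV)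
  have monV: "(\<Prod>i\<in>UNIV. (g $ i) ^ e i) \<in> V n" if e: "e \<in> expos n" for e n
  proof -
    have "eval_form const2 n (\<lambda>e'. if e' = e then 1 else 0) g
      = (\<Sum>e'\<in>expos n. if e' = e then \<Prod>i\<in>UNIV. (g $ i) ^ e i else 0)"
      unfolding eval_form_expos by (intro sum.cong) auto
    also have "\<dots> = (\<Prod>i\<in>UNIV. (g $ i) ^ e i)" using e finite_expos by simp
    finally have eq: "eval_form const2 n (\<lambda>e'. if e' = e then 1 else 0) g = (\<Prod>i\<in>UNIV. (g $ i) ^ e i)" .
    show ?thesis unfolding V_def eq[symmetric] by (rule rangeI)
  qed
  have genV: "g $ k * x \<in> V (Suc n)" if x: "x \<in> V n" for k x n
  proof -
    obtain c where c: "x = eval_form const2 n c g" using x unfolding V_def by blast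
    have eq: "g $ k * x = (\<Sum>e\<in>expos n. const2 (c e) * (\<Prod>i\<in>UNIV. (g $ i) ^ (e(k := Suc (e k))) i))"
      unfolding c eval_form_expos sum_distrib_left
    proof (rule sum.cong[OF refl])
      fix e :: "3 \<Rightarrow> nat"
      have "(\<Prod>i\<in>UNIV. (g $ i) ^ (e(k := Suc (e k))) i) = (g $ k) ^ Suc (e k) * (\<Prod>i\<in>UNIV - {k}. (g $ i) ^ e i)"
        by (subst prod.remove[of _ k]) (auto intro!: prod.cong)
      moreover have "(\<Prod>i\<in>UNIV. (g $ i) ^ e i) = (g $ k) ^ e k * (\<Prod>i\<in>UNIV - {k}. (g $ i) ^ e i)"
        by (rule prod.remove) auto
      ultimately have "(\<Prod>i\<in>UNIV. (g $ i) ^ (e(k := Suc (e k))) i) = g $ k * (\<Prod>i\<in>UNIV. (g $ i) ^ e i)"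
        by (simp add: mult.assoc)
      then show "g $ k * (const2 (c e) * (\<Prod>i\<in>UNIV. (g $ i) ^ e i)) = const2 (c e) * (\<Prod>i\<in>UNIV. (g $ i) ^ (e(k := Suc (e k))) i)"
        by (simp only: mult.left_commute)
    qed
    have mem: "const2 (c e) * (\<Prod>i\<in>UNIV. (g $ i) ^ (e(k := Suc (e k))) i) \<in> V (Suc n)" if e: "e \<in> expos n" for e
    proof (rule cmulV[OF monV])
      have "(\<Sum>i\<in>UNIV. (e(k := Suc (e k))) i) = Suc (e k) + (\<Sum>i\<in>UNIV - {k}. e i)"
        by (subst sum.remove[of _ k]) (auto intro!: sum.cong)
      moreover have "(\<Sum>i\<in>UNIV. e i) = e k + (\<Sum>i\<in>UNIV - {k}. e i)" by (rule sum.remove) auto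
      ultimately show "e(k := Suc (e k)) \<in> expos (Suc n)" using e by (simp add: expos_def)
    qed
    show ?thesis unfolding eq by (rule sumV[OF mem])
  qed
  show "fspan (g $ 1) (g $ 2) (g $ 3) n \<subseteq> range (\<lambda>c. eval_form const2 n c g)"
    unfolding V_def[symmetric]
  proof (induction n)
    case 0
    have z: "(\<lambda>_. 0) \<in> expos 0" by (simp add: expos_def)
    have "const2 r \<in> V 0" for r
      using cmulV[OF monV[OF z], of r] by simp
    then show ?case by auto
  next
    case (Suc n)
    show ?case unfolding fspan.simps(2) using Suc by (auto intro!: addV genV)
  qed
qed (use eval_form_in_fspan in auto)

lemma fspan_change:
  assumes "u' \<in> fspan u v w 1" "v' \<in> fspan u v w 1" "w' \<in> fspan u v w 1"
  shows "fspan u' v' w' n \<subseteq> fspan u v w n"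
proof (induction n)
  case (Suc n)
  show ?case
  proof
    fix x assume "x \<in> fspan u' v' w' (Suc n)"
    then obtain a b c where *: "x = u' * a + v' * b + w' * c" "a \<in> fspan u v w n" "b \<in> fspan u v w n" "c \<in> fspan u v w n"
      using Suc unfolding fspan.simps(2) by blast
    have "u' * a + v' * b + w' * c \<in> fspan u v w (1 + n)"
      by (intro fspan_add fspan_mult assms *)
    then show "x \<in> fspan u v w (Suc n)" using *(1) by simp
  qed
qed simp

lemma ev_eval_form:
  fixes g :: "('k::comm_ring_1 bipoly)^3" and p :: "'k^3"
  assumes "\<And>i. ev P (g $ i) = u * p $ i"
  shows "ev P (eval_form const2 n c g) = u ^ n * eval_form (\<lambda>a. a) n c p"
proof -
  have "ev P (eval_form const2 n c g) = (\<Sum>e\<in>expos n. c e * (\<Prod>i\<in>UNIV. (u * p $ i) ^ e i))"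
    unfolding eval_form_expos ev_sum by (intro sum.cong) (auto simp: ev_prod assms)
  also have "\<dots> = (\<Sum>e\<in>expos n. u ^ n * (c e * (\<Prod>i\<in>UNIV. (p $ i) ^ e i)))"
  proof (rule sum.cong[OF refl])
    fix e :: "3 \<Rightarrow> nat" assume "e \<in> expos n"
    then have n: "n = e 1 + e 2 + e 3" by (simp add: expos_def sum_3)
    show "c e * (\<Prod>i\<in>UNIV. (u * p $ i) ^ e i) = u ^ n * (c e * (\<Prod>i\<in>UNIV. (p $ i) ^ e i))"
      unfolding prod_UNIV_3 n by (simp add: power_mult_distrib power_add algebra_simps)
  qed
  finally show ?thesis unfolding eval_form_expos sum_distrib_left .
qed

section \<open>Coordinates adapted to a point\<close>

abbreviation cm :: "'k::comm_ring_1^'n^'m \<Rightarrow> ('k bipoly)^'n^'m" where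
  "cm M \<equiv> map_matrix const2 M"

lemma const2_sum: "const2 (sum f S) = (\<Sum>i\<in>S. const2 (f i :: 'k::comm_ring_1))"
  by (induction S rule: infinite_finite_induct) (simp_all add: const2_simps)

lemma cm_mult: "cm (M ** N) = cm M ** cm (N :: 'k::comm_ring_1^'n^'m)"
proof (unfold vec_eq_iff, intro allI)
  fix i j
  show "cm (M ** N) $ i $ j = (cm M ** cm N) $ i $ j"
    by (simp only: matrix_matrix_mult_def map_matrix_def vec_lambda_beta const2_sum const2_simps(5))
qed

lemma cm_1: "cm (mat 1) = (mat 1 :: ('k::comm_ring_1 bipoly)^'n^'n)"
  by (auto simp: vec_eq_iff mat_def map_matrix_def one_pCons)

definition coords :: "'k::field^3 \<Rightarrow> 'k^3^3 \<Rightarrow> 'k^3^3 \<Rightarrow> bool" where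
  "coords p M E \<longleftrightarrow> M ** E = mat 1 \<and> E ** M = mat 1 \<and> p = vector [0, 0, 1] v* M"

lemma e3_row: "vector [0, 0, 1] v* (M :: 'k::field^3^3) = M $ 3"
  by (simp add: vec_eq_iff vector_matrix_mult_def sum_3)

lemma coords_of_invertible:
  assumes "invertible M" "p = vector [0, 0, 1] v* (M :: 'k::field^3^3)"
  obtains E where "coords p M E"
  using assms unfolding invertible_def coords_def by blast

lemma coords_exist:
  assumes "p \<noteq> (0 :: 'k::field^3)"
  obtains M E where "coords p M E"
proof -
  have "\<exists>M :: 'k^3^3. det M \<noteq> 0 \<and> M $ 3 = p"
  proof -
    consider "p $ 3 \<noteq> 0" | "p $ 2 \<noteq> 0" | "p $ 1 \<noteq> 0" using assms by (auto simp: vec_eq_iff forall_3)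
    then show ?thesis
    proof cases
      case 1
      then show ?thesis by (intro exI[of _ "vector [vector [1,0,0], vector [0,1,0], p]"]) (simp add: det_3)
    next
      case 2
      then show ?thesis by (intro exI[of _ "vector [vector [1,0,0], vector [0,0,1], p]"]) (simp add: det_3)
    next
      case 3
      then show ?thesis by (intro exI[of _ "vector [vector [0,1,0], vector [0,0,1], p]"]) (simp add: det_3)
    qed
  qed
  then obtain M :: "'k^3^3" where M: "det M \<noteq> 0" "M $ 3 = p" by blast
  have "invertible M" using M(1) by (simp add: invertible_det_nz)
  moreover have "p = vector [0, 0, 1] v* M" using M(2) by (simp add: e3_row)
  ultimately show ?thesis using coords_of_invertible that by blast
qed

lemma coords_mult:
  fixes T U M E :: "'k::field^3^3" and p :: "'k^3"
  assumes "coords p M E" "T ** U = mat 1" "U ** T = mat 1" "T $ 3 = vector [0, 0, 1]"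
  shows "coords p (T ** M) (E ** U)"
proof -
  have "T ** M ** (E ** U) = T ** (M ** E) ** U" "E ** U ** (T ** M) = E ** (U ** T) ** M"
    by (simp_all only: matrix_mul_assoc)
  moreover have e3: "vector [0, 0, 1] v* T = vector [0, 0, 1]" by (simp only: e3_row assms(4))
  have "vector [0, 0, 1] v* (T ** M) = (vector [0, 0, 1] v* T) v* M"
    by (simp add: vector_matrix_mul_assoc)
  then have "vector [0, 0, 1] v* (T ** M) = vector [0, 0, 1] v* M" unfolding e3 .
  ultimately show ?thesis using assms unfolding coords_def by simp
qed

lemma dot_transform:
  fixes g w :: "('k::comm_ring_1 bipoly)^3"
  shows "(\<Sum>j\<in>UNIV. (g v* F) $ j * w $ j) = (\<Sum>i\<in>UNIV. g $ i * (F *v w) $ i)"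
  by (simp add: sum_3 vector_matrix_mult_def matrix_vector_mult_def algebra_simps)

lemma hilbert_burch_transform:
  assumes hb: "hilbert_burch g \<phi> d1 d2" and c: "coords p M E"
  shows "hilbert_burch (g v* cm E) (cm M ** \<phi>) d1 d2"
proof -
  have ME: "cm M ** cm E = mat 1" "cm E ** cm M = mat 1"
    using c by (simp_all only: coords_def flip: cm_mult) (simp_all add: cm_1)
  have "homog d1 ((cm M ** \<phi>) $ i $ 1)" "homog d2 ((cm M ** \<phi>) $ i $ 2)" for i
    using hb unfolding hilbert_burch_def matrix_matrix_mult_def map_matrix_def
    by (auto intro!: homog_sum homog_cmult simp del: mult_pCons_left)
  moreover have "inj (\<lambda>v. (cm M ** \<phi>) *v v)"
  proof (rule injI)
    fix v w assume "(cm M ** \<phi>) *v v = (cm M ** \<phi>) *v w"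
    then have "cm E *v ((cm M ** \<phi>) *v v) = cm E *v ((cm M ** \<phi>) *v w)" by simp
    then have "\<phi> *v v = \<phi> *v w" by (simp add: matrix_vector_mul_assoc matrix_mul_assoc ME)
    then show "v = w" using hb by (auto simp: hilbert_burch_def inj_def)
  qed
  moreover have "{w. (\<Sum>i\<in>UNIV. (g v* cm E) $ i * w $ i) = 0} = range (\<lambda>v. (cm M ** \<phi>) *v v)"
  proof -
    have rng: "{w. (\<Sum>i\<in>UNIV. g $ i * w $ i) = 0} = range (\<lambda>v. \<phi> *v v)" using hb by (simp add: hilbert_burch_def)
    have "w \<in> range (\<lambda>v. (cm M ** \<phi>) *v v) \<longleftrightarrow> cm E *v w \<in> range (\<lambda>v. \<phi> *v v)" for w
    proof
      assume "w \<in> range (\<lambda>v. (cm M ** \<phi>) *v v)"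
      then obtain v where "w = (cm M ** \<phi>) *v v" by blast
      then have "cm E *v w = \<phi> *v v" by (simp add: matrix_vector_mul_assoc matrix_mul_assoc ME)
      then show "cm E *v w \<in> range (\<lambda>v. \<phi> *v v)" by blast
    next
      assume "cm E *v w \<in> range (\<lambda>v. \<phi> *v v)"
      then obtain v where "cm E *v w = \<phi> *v v" by blast
      then have "cm M *v (cm E *v w) = cm M *v (\<phi> *v v)" by simp
      then have "w = (cm M ** \<phi>) *v v" by (simp add: matrix_vector_mul_assoc ME)
      then show "w \<in> range (\<lambda>v. (cm M ** \<phi>) *v v)" by blast
    qed
    then show ?thesis unfolding dot_transform using rng by blast
  qed
  ultimately show ?thesis by (simp add: hilbert_burch_def)
qed

locale rational_curve =
  fixes g :: "('k::alg_closed_field bipoly)^3" and d :: nat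
  assumes homogeneous: "homog d (g $ i)"
    and min_gen: "minimally_generating g"
    and height_two: "ideal_height ring_of_type_algebra (gen_ideal g UNIV) = 2"
    and birational: "birational_param g"
begin

text \<open>The change of coordinates preserves all spaces \<open>fspan\<close>. The local ring is defined by non-vanishing at \<open>p\<close>; this
  is the same as non-vanishing on the whole preimage \<open>Z\<close>, on which a form of the coordinate ring vanishes
  everywhere or nowhere.\<close>

lemma curve_in_coords:
  assumes on: "on_curve g p" and c: "coords p M E"
  defines "g' \<equiv> g v* cm E"
  shows "curve (g' $ 1) (g' $ 2) (g' $ 3) d" "curve.R (g' $ 1) (g' $ 2) (g' $ 3) = curve_local_ring g p"
proof -
  have ME: "M ** E = mat 1" "E ** M = mat 1" "p = vector [0, 0, 1] v* M" using c by (auto simp: coords_def)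
  have g'c: "g' $ j = const2 (E $ 1 $ j) * g $ 1 + const2 (E $ 2 $ j) * g $ 2 + const2 (E $ 3 $ j) * g $ 3" for j
    unfolding g'_def vector_matrix_mult_def sum_3 map_matrix_def by (simp only: vec_lambda_beta mult.commute)
  have gg': "g = g' v* cm M"
    unfolding g'_def vector_matrix_mul_assoc using ME(2) by (simp flip: cm_mult add: cm_1)
  have gc: "g $ j = const2 (M $ 1 $ j) * g' $ 1 + const2 (M $ 2 $ j) * g' $ 2 + const2 (M $ 3 $ j) * g' $ 3" for j
    by (subst gg', unfold vector_matrix_mult_def sum_3 map_matrix_def) (simp only: vec_lambda_beta mult.commute)
  have span_eq: "fspan (g' $ 1) (g' $ 2) (g' $ 3) n = fspan (g $ 1) (g $ 2) (g $ 3) n" for n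
  proof
    have "g' $ j \<in> fspan (g $ 1) (g $ 2) (g $ 3) 1" for j
      unfolding g'c by (intro fspan_add fspan_cmult fspan_gens)
    then show "fspan (g' $ 1) (g' $ 2) (g' $ 3) n \<subseteq> fspan (g $ 1) (g $ 2) (g $ 3) n" by (intro fspan_change)
    have "g $ j \<in> fspan (g' $ 1) (g' $ 2) (g' $ 3) 1" for j
      unfolding gc[of j] by (intro fspan_add fspan_cmult fspan_gens)
    then show "fspan (g $ 1) (g $ 2) (g $ 3) n \<subseteq> fspan (g' $ 1) (g' $ 2) (g' $ 3) n" by (intro fspan_change)
  qed
  obtain s t u where st: "(s, t) \<noteq> (0, 0)" "u \<noteq> 0" "\<And>i. eval2 (g $ i) s t = u * p $ i"
    using on unfolding on_curve_def by blast
  obtain P r where P: "P \<in> pts" "r \<noteq> 0" "s = r * fst P" "t = r * snd P" using proj_rep[OF st(1)] .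
  define u' where "u' = u / r ^ d"
  have u'0: "u' \<noteq> 0" using st P by (simp add: u'_def)
  have evP: "ev P (g $ i) = u' * p $ i" for i
  proof -
    have "eval2 (g $ i) s t = r ^ d * ev P (g $ i)"
      using ev_scale[OF homogeneous[of i], of r "fst P" "snd P"] P by (simp add: ev_def)
    then show ?thesis using st(3)[of i] P(2) by (simp add: u'_def field_simps)
  qed
  have pE: "(\<Sum>i\<in>UNIV. p $ i * E $ i $ j) = (if j = 3 then 1 else 0)" for j
  proof -
    have "p v* E = vector [0, 0, 1]" unfolding ME(3) vector_matrix_mul_assoc ME(1) by simp
    then have "(p v* E) $ j = (vector [0, 0, 1] :: 'k^3) $ j" by simp
    then show ?thesis unfolding vector_matrix_mult_def using exhaust_3[of j] by (auto simp: mult.commute)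
  qed
  have evg': "ev P (g' $ j) = u' * (if j = 3 then 1 else 0)" for j
    unfolding pE[of j, symmetric] g'c sum_3 using evP by (simp add: algebra_simps)
  show C: "curve (g' $ 1) (g' $ 2) (g' $ 3) d"
  proof
    have hg: "homog d (g' $ j)" for j unfolding g'c by (intro homog_add homog_cmult homogeneous)
    show "homog d (g' $ 1)" "homog d (g' $ 2)" "homog d (g' $ 3)" using hg by auto
    show "ev Q (g' $ 1) \<noteq> 0 \<or> ev Q (g' $ 2) \<noteq> 0 \<or> ev Q (g' $ 3) \<noteq> 0" if Q: "Q \<in> pts" for Q
    proof (rule ccontr)
      assume "\<not> ?thesis"
      then have "ev Q (g $ i) = 0" for i unfolding gc[of i] by simp
      then show False using height_two_no_common_root[OF homogeneous height_two Q] by blast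
    qed
    show "a = 0 \<and> b = 0 \<and> c = 0" if z: "const2 a * g' $ 1 + const2 b * g' $ 2 + const2 c * g' $ 3 = 0" for a b c
    proof -
      define x :: "'k^3" where "x = vector [a, b, c]"
      have cx: "const2 ((E *v x) $ i) = const2 (E $ i $ 1) * const2 a + const2 (E $ i $ 2) * const2 b + const2 (E $ i $ 3) * const2 c" for i
        unfolding matrix_vector_mult_def x_def by (simp add: sum_3)
      have "(\<Sum>i\<in>UNIV. const2 ((E *v x) $ i) * g $ i) = const2 a * g' $ 1 + const2 b * g' $ 2 + const2 c * g' $ 3"
        unfolding sum_3 cx g'c by (simp only: distrib_left distrib_right ac_simps)
      then have "E *v x = 0" using min_gen_independent[OF min_gen] z by simp
      then have "M *v (E *v x) = 0" by simp
      then have "x = 0" unfolding matrix_vector_mul_assoc ME(1) by simp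
      then show ?thesis unfolding x_def by (simp add: vec_eq_iff forall_3)
    qed
    show "\<exists>P\<in>pts. ev P (g' $ 1) = 0 \<and> ev P (g' $ 2) = 0"
      using P(1) evg'[of 1] evg'[of 2] by (intro bexI[of _ P]) simp_all
    show "\<exists>n a b. x = Fract a b \<and> a \<in> fspan (g' $ 1) (g' $ 2) (g' $ 3) n \<and> b \<in> fspan (g' $ 1) (g' $ 2) (g' $ 3) n \<and> b \<noteq> 0"
      if "x \<in> P1_function_field" for x
    proof -
      have "x \<in> curve_function_field g" using that birational by (simp add: birational_param_def)
      then obtain n F G where "x = Fract (eval_form const2 n F g) (eval_form const2 n G g)" "eval_form const2 n G g \<noteq> 0"
        unfolding curve_function_field_def by blast
      then show ?thesis unfolding span_eq using eval_form_in_fspan by blast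
    qed
  qed
  interpret curve "g' $ 1" "g' $ 2" "g' $ 3" d by (rule C)
  have PZ: "P \<in> Z" using P(1) evg'[of 1] evg'[of 2] by (simp add: Z_def)
  have nz: "eval_form (\<lambda>a. a) n G p \<noteq> 0 \<longleftrightarrow> (\<forall>Q\<in>Z. ev Q (eval_form const2 n G g) \<noteq> 0)" for n G
  proof -
    have "eval_form const2 n G g \<in> A n" unfolding span_eq by (rule eval_form_in_fspan)
    then have "(\<forall>Q\<in>Z. ev Q (eval_form const2 n G g) \<noteq> 0) \<longleftrightarrow> ev P (eval_form const2 n G g) \<noteq> 0"
      using ev_A_iff[OF _ PZ] PZ by blast
    then show ?thesis using ev_eval_form[OF evP, of n G] u'0 by simp
  qed
  show "R = curve_local_ring g p"
  proof
    show "R \<subseteq> curve_local_ring g p"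
    proof
      fix x assume "x \<in> R"
      then obtain n a b where ab: "x = Fract a b" "a \<in> A n" "b \<in> A n" "\<forall>P\<in>Z. ev P b \<noteq> 0" by (rule R_E)
      have "a \<in> fspan (g $ 1) (g $ 2) (g $ 3) n" "b \<in> fspan (g $ 1) (g $ 2) (g $ 3) n"
        using ab(2,3) by (simp_all only: span_eq)
      then obtain F G where FG: "a = eval_form const2 n F g" "b = eval_form const2 n G g"
        unfolding fspan_eq_eval_form by blast
      then show "x \<in> curve_local_ring g p" using ab nz unfolding curve_local_ring_def by blast
    qed
    show "curve_local_ring g p \<subseteq> R"
      unfolding curve_local_ring_def R_def span_eq using nz eval_form_in_fspan by blast
  qed
qed

end

section \<open>Syzygies\<close>

text \<open>The homogeneous component of degree \<open>k\<close>.\<close>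

definition homog_component :: "nat \<Rightarrow> 'k::comm_ring_1 bipoly \<Rightarrow> 'k bipoly" where
  "homog_component k F = (\<Sum>j\<le>k. Polynomial.monom (Polynomial.monom (ccf F j (k - j)) (k - j)) j)"

lemma ccf_homog_component: "ccf (homog_component k F) j i = (if i + j = k then ccf F j i else 0)"
proof -
  have "ccf (homog_component k F) j i = (\<Sum>l\<le>k. if l = j then (if k - j = i then ccf F j (k - j) else 0) else 0)"
    unfolding homog_component_def coeff_sum by (intro sum.cong) auto
  also have "\<dots> = (if j \<le> k \<and> k - j = i then ccf F j (k - j) else 0)" by auto
  also have "\<dots> = (if i + j = k then ccf F j i else 0)" by auto
  finally show ?thesis .
qed

lemma homog_homog_component: "homog k (homog_component k F)"
  by (auto simp: homog_def ccf_homog_component split: if_splits)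

lemma homog_component_homog: "homog k F \<Longrightarrow> homog_component k F = F"
proof (intro poly_eqI)
  fix j i assume "homog k F"
  then show "ccf (homog_component k F) j i = ccf F j i"
    using homogD[of k F j i] by (cases "ccf F j i = 0") (auto simp: ccf_homog_component)
qed

lemma homog_component_add: "homog_component k (F + G) = homog_component k F + homog_component k G"
  by (intro poly_eqI) (simp add: ccf_homog_component)

lemma homog_component_mult:
  assumes A: "homog a A"
  shows "homog_component k (A * V) = (if a \<le> k then A * homog_component (k - a) V else 0)"
proof (intro poly_eqI)
  fix j i
  have prod: "ccf (A * W) j i = (\<Sum>p\<le>j. \<Sum>q\<le>i. ccf A p q * ccf W (j - p) (i - q))" for W
    by (simp add: coeff_mult coeff_sum)
  show "ccf (homog_component k (A * V)) j i = ccf (if a \<le> k then A * homog_component (k - a) V else 0) j i"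
  proof (cases "a \<le> k")
    case True
    have "(if i + j = k then ccf A p q * ccf V (j - p) (i - q) else 0) = ccf A p q * ccf (homog_component (k - a) V) (j - p) (i - q)"
      if "p \<le> j" "q \<le> i" for p q
      using homogD[OF A, of p q] that True by (cases "ccf A p q = 0") (auto simp: ccf_homog_component)
    then have "(\<Sum>p\<le>j. \<Sum>q\<le>i. if i + j = k then ccf A p q * ccf V (j - p) (i - q) else 0)
      = (\<Sum>p\<le>j. \<Sum>q\<le>i. ccf A p q * ccf (homog_component (k - a) V) (j - p) (i - q))"
      by (intro sum.cong refl) auto
    moreover have "ccf (homog_component k (A * V)) j i = (\<Sum>p\<le>j. \<Sum>q\<le>i. if i + j = k then ccf A p q * ccf V (j - p) (i - q) else 0)"
      by (cases "i + j = k") (simp_all only: ccf_homog_component prod if_True if_False sum.neutral_const simp_thms)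
    ultimately have "ccf (homog_component k (A * V)) j i = ccf (A * homog_component (k - a) V) j i" by (simp only: prod)
    then show ?thesis using True by simp
  next
    case False
    have "ccf A p q * ccf V (j - p) (i - q) = 0" if "p \<le> j" "q \<le> i" "i + j = k" for p q
      using homogD[OF A, of p q] that False by (cases "ccf A p q = 0") auto
    then have "i + j = k \<Longrightarrow> (\<Sum>p\<le>j. \<Sum>q\<le>i. ccf A p q * ccf V (j - p) (i - q)) = 0"
      by (intro sum.neutral ballI) auto
    then have "ccf (homog_component k (A * V)) j i = 0" by (simp only: ccf_homog_component prod split: if_split) blast
    then show ?thesis using False by simp
  qed
qed

text \<open>A basis of the syzygies of \<open>(g1, g2, g3)\<close>, given by the columns \<open>(a1, a2, a3)\<close> and \<open>(b1, b2, b3)\<close>, at a point of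
  multiplicity \<open>d / 2\<close>.\<close>

locale syzygy_basis = curve_factored g1 g2 g3 d h s1 s2 e
  for g1 g2 g3 :: "'k::alg_closed_field bipoly" and d h s1 s2 e +
  fixes a1 a2 a3 b1 b2 b3 :: "'k bipoly" and d1 d2 :: nat
  assumes a_homog: "homog d1 a1" "homog d1 a2" "homog d1 a3"
    and b_homog: "homog d2 b1" "homog d2 b2" "homog d2 b3"
    and a_syz: "g1 * a1 + g2 * a2 + g3 * a3 = 0" and b_syz: "g1 * b1 + g2 * b2 + g3 * b3 = 0"
    and gen: "g1 * w1 + g2 * w2 + g3 * w3 = 0 \<Longrightarrow>
      \<exists>x y. w1 = a1 * x + b1 * y \<and> w2 = a2 * x + b2 * y \<and> w3 = a3 * x + b3 * y"
    and free: "a1 * x + b1 * y = 0 \<Longrightarrow> a2 * x + b2 * y = 0 \<Longrightarrow> a3 * x + b3 * y = 0 \<Longrightarrow> x = 0 \<and> y = 0"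
    and half: "d = 2 * e"
begin

lemma column_syz: "g1 * (a1 * u + b1 * v) + g2 * (a2 * u + b2 * v) + g3 * (a3 * u + b3 * v) = 0"
proof -
  have "g1 * (a1 * u + b1 * v) + g2 * (a2 * u + b2 * v) + g3 * (a3 * u + b3 * v)
      = u * (g1 * a1 + g2 * a2 + g3 * a3) + v * (g1 * b1 + g2 * b2 + g3 * b3)"
    by (simp only: distrib_left ac_simps)
  then show ?thesis unfolding a_syz b_syz by simp
qed

lemma s_deg: "homog e s1" "homog e s2"
  using s half by simp_all

lemma syz_third:
  assumes "g1 * w1 + g2 * w2 + g3 * w3 = 0"
  shows "w3 * g3 = h * (s1 * w2 - s2 * w1)"
proof -
  have "h * s2 * w1 + - (h * s1) * w2 + g3 * w3 = 0" using assms by (simp add: g1_eq g2_eq)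
  then show ?thesis by (simp add: algebra_simps eq_neg_iff_add_eq_0)
qed

text \<open>A root of \<open>h\<close> is not a root of \<open>g3\<close>, so the relation \<open>w3 g3 = h (s1 w2 - s2 w1)\<close> makes \<open>h\<close> a divisor of \<open>w3\<close>.\<close>

lemma h_dvd_third:
  assumes "g1 * w1 + g2 * w2 + g3 * w3 = 0" "homog k w3"
  obtains r where "w3 = h * r" "homog (k - e) r" "w3 \<noteq> 0 \<longrightarrow> e \<le> k" "r * g3 = s1 * w2 - s2 * w1"
proof -
  have nz: "ev P g3 \<noteq> 0" if "P \<in> pts" "ev P h = 0" for P using g3_Z[of P] that Z_eq by simp
  have "\<exists>r. w3 = h * r \<and> homog (k - e) r \<and> (w3 \<noteq> 0 \<longrightarrow> e \<le> k)"
    using form_coprime_dvd[OF h assms(2) nz syz_third[OF assms(1)]] by metis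
  then obtain r where r: "w3 = h * r" "homog (k - e) r" "w3 \<noteq> 0 \<longrightarrow> e \<le> k" by blast
  have "h * (r * g3) = h * (s1 * w2 - s2 * w1)" using syz_third[OF assms(1)] r(1) by (simp add: mult.assoc)
  then have "r * g3 = s1 * w2 - s2 * w1" using h(2) by simp
  then show ?thesis using r that by blast
qed

lemma s1_dvd:
  assumes "w1 * s2 = s1 * w2" "homog k w1"
  obtains r where "w1 = s1 * r" "homog (k - e) r" "w1 \<noteq> 0 \<longrightarrow> e \<le> k" "w2 = s2 * r"
proof -
  have nz: "ev P s2 \<noteq> 0" if "P \<in> pts" "ev P s1 = 0" for P using s_coprime that by blast
  have "\<exists>r. w1 = s1 * r \<and> homog (k - e) r \<and> (w1 \<noteq> 0 \<longrightarrow> e \<le> k)"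
    using form_coprime_dvd[OF s_deg(1) s_nonzero(1) assms(2) nz assms(1)] by metis
  then obtain r where r: "w1 = s1 * r" "homog (k - e) r" "w1 \<noteq> 0 \<longrightarrow> e \<le> k" by blast
  have "s1 * (s2 * r) = s1 * w2" using assms(1) r(1) by (simp add: ac_simps)
  then have "w2 = s2 * r" using s_nonzero(1) by simp
  then show ?thesis using r that by blast
qed

text \<open>The third entry is divisible by \<open>h\<close> and hence zero; then the first two are multiples of \<open>(s1, s2)\<close>, which have
  degree \<open>e\<close> as well.\<close>

lemma no_low_syzygy:
  assumes "g1 * w1 + g2 * w2 + g3 * w3 = 0" "homog k w1" "homog k w3" "k < e"
  shows "w1 = 0 \<and> w2 = 0 \<and> w3 = 0"
proof -
  obtain r where r: "w3 = h * r" "w3 \<noteq> 0 \<longrightarrow> e \<le> k" "r * g3 = s1 * w2 - s2 * w1" using h_dvd_third[OF assms(1,3)] by metis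
  then have w3: "w3 = 0" using assms(4) by auto
  then have "r = 0" using r(1) h by simp
  then have "w1 * s2 = s1 * w2" using r(3) by (simp add: mult.commute)
  then obtain r' where "w1 = s1 * r'" "w1 \<noteq> 0 \<longrightarrow> e \<le> k" "w2 = s2 * r'" using s1_dvd[OF _ assms(2)] by metis
  then show ?thesis using w3 assms(4) s_nonzero by auto
qed

lemma s_syz: "g1 * s1 + g2 * s2 + g3 * 0 = 0"
  by (simp add: g1_eq g2_eq)

lemma d1_ge: "e \<le> d1"
proof (rule ccontr)
  assume "\<not> e \<le> d1"
  then have "a1 = 0 \<and> a2 = 0 \<and> a3 = 0" using no_low_syzygy[OF a_syz a_homog(1,3)] by simp
  then show False using free[of 1 0] by simp
qed

text \<open>Some syzygy has a non-zero third entry, for example \<open>(g3, 0, - g1)\<close>.\<close>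

lemma b3_nonzero:
  assumes "a3 * x = 0" "x \<noteq> 0"
  shows "b3 \<noteq> 0"
proof
  assume "b3 = 0"
  moreover have "a3 = 0" using assms by simp
  moreover obtain x y where "- g1 = a3 * x + b3 * y" using gen[of g3 0 "- g1"] by (auto simp: mult.commute)
  ultimately show False using g_nonzero by simp
qed

text \<open>Suppose that \<open>d2 > e\<close>. Then \<open>(s1, s2, 0)\<close> is a multiple of the first column, and the cofactor of \<open>h\<close> in \<open>b3\<close>
  has a root \<open>P\<close>. There \<open>(b1, b2)\<close> is proportional to \<open>(s1, s2)\<close>, so that after subtracting a multiple of \<open>(s1, s2, 0)\<close> the
  second column becomes divisible by \<open>lf P\<close>. The quotient is again a syzygy, which contradicts that the columns
  form a basis.\<close>

lemma d2_le: "d2 \<le> e"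
proof (rule ccontr)
  assume n: "\<not> d2 \<le> e"
  obtain x y where xy: "s1 = a1 * x + b1 * y" "s2 = a2 * x + b2 * y" "0 = a3 * x + b3 * y"
    using gen[OF s_syz] by blast
  define V where "V = homog_component (e - d1) x"
  have comp: "homog_component e (a * x + b * y) = (if d1 \<le> e then a * V else 0)" if "homog d1 a" "homog d2 b" for a b
    using homog_component_mult[OF that(1), of e x] homog_component_mult[OF that(2), of e y] n by (simp add: homog_component_add V_def)
  have s1: "s1 = (if d1 \<le> e then a1 * V else 0)" using comp[OF a_homog(1) b_homog(1)] homog_component_homog[OF s_deg(1)] xy(1) by simp
  have s2: "s2 = (if d1 \<le> e then a2 * V else 0)" using comp[OF a_homog(2) b_homog(2)] homog_component_homog[OF s_deg(2)] xy(2) by simp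
  have s3: "0 = (if d1 \<le> e then a3 * V else 0)"
    unfolding comp[OF a_homog(3) b_homog(3), symmetric] xy(3)[symmetric] by (rule homog_component_homog[OF homog_0, symmetric])
  have d1: "d1 \<le> e" using s1 s_nonzero by (auto split: if_splits)
  have sV: "s1 = a1 * V" "s2 = a2 * V" "0 = a3 * V" using s1 s2 s3 d1 by auto
  have V0: "V \<noteq> 0" using sV s_nonzero by auto
  have b3: "b3 \<noteq> 0" using b3_nonzero[OF sV(3)[symmetric] V0] .
  obtain b' where b': "b3 = h * b'" "homog (d2 - e) b'" "b' * g3 = s1 * b2 - s2 * b1"
    using h_dvd_third[OF b_syz b_homog(3)] by metis
  obtain P where P: "P \<in> pts" "ev P b' = 0" using form_has_root[OF b'(2)] n by auto
  have "ev P (b' * g3) = ev P (s1 * b2 - s2 * b1)" using b'(3) by simp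
  then have cr: "ev P s1 * ev P b2 = ev P s2 * ev P b1" using P by simp
  obtain r where r: "ev P b1 = r * ev P s1" "ev P b2 = r * ev P s2"
  proof (cases "ev P s1 = 0")
    case True
    then show ?thesis using that[of "ev P b2 / ev P s2"] cr s_coprime[OF P(1)] by auto
  next
    case False
    then show ?thesis using that[of "ev P b1 / ev P s1"] cr by (simp add: field_simps)
  qed
  obtain Q :: "'k \<times> 'k" where Q: "Q \<in> pts" "Q \<noteq> P"
    using infinite_pts by (metis finite.emptyI finite_insert finite_subset insertCI subsetI)
  \<comment> \<open>The power of \<open>lf Q\<close> only serves to fill the degree; it does not vanish at \<open>P\<close>.\<close>
  define l where "l = lf Q ^ (d2 - e)"
  have evl: "ev P l \<noteq> 0" unfolding l_def using ev_lf_0_iff[OF Q(1) P(1)] Q(2) by simp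
  have hl: "homog (d2 - e) l" unfolding l_def using homog_power[OF homog_lf, of "d2 - e" Q] by simp
  define t where "t = const2 (r / ev P l) * l"
  have ht: "homog (d2 - e) t" unfolding t_def by (rule homog_cmult[OF hl])
  have evt: "ev P t = r" unfolding t_def using evl by simp
  have d2e: "d2 = (d2 - e) + e" using n by simp
  have W: "homog d2 (b1 - t * s1)" "homog d2 (b2 - t * s2)"
    using homog_diff[OF b_homog(1) homog_mult'[OF ht s_deg(1) d2e]] homog_diff[OF b_homog(2) homog_mult'[OF ht s_deg(2) d2e]] .
  have W0: "ev P (b1 - t * s1) = 0" "ev P (b2 - t * s2) = 0" "ev P b3 = 0"
    using r evt P b'(1) by simp_all
  obtain w1 where w1: "b1 - t * s1 = lf P * w1" using form_root_factor[OF W(1) P(1) W0(1)] by metis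
  obtain w2 where w2: "b2 - t * s2 = lf P * w2" using form_root_factor[OF W(2) P(1) W0(2)] by metis
  obtain w3 where w3: "b3 = lf P * w3" using form_root_factor[OF b_homog(3) P(1) W0(3)] by metis
  have "lf P * (g1 * w1 + g2 * w2 + g3 * w3) = g1 * (lf P * w1) + g2 * (lf P * w2) + g3 * (lf P * w3)"
    by (simp add: algebra_simps)
  also have "\<dots> = (g1 * b1 + g2 * b2 + g3 * b3) - t * (g1 * s1 + g2 * s2 + g3 * 0)"
    unfolding w1[symmetric] w2[symmetric] w3[symmetric] by (simp add: algebra_simps)
  also have "\<dots> = 0" unfolding b_syz s_syz by simp
  finally have "g1 * w1 + g2 * w2 + g3 * w3 = 0" using P(1) by simp
  then obtain x' y' where w: "w1 = a1 * x' + b1 * y'" "w2 = a2 * x' + b2 * y'" "w3 = a3 * x' + b3 * y'" using gen by blast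
  have "a1 * (lf P * x' + t * V) + b1 * (lf P * y' - 1) = lf P * w1 - (b1 - t * s1)"
    "a2 * (lf P * x' + t * V) + b2 * (lf P * y' - 1) = lf P * w2 - (b2 - t * s2)"
    "a3 * (lf P * x' + t * V) + b3 * (lf P * y' - 1) = lf P * w3 - b3 + t * (a3 * V)"
    unfolding w sV(1,2) by (simp_all add: algebra_simps)
  then have "lf P * y' - 1 = 0" using free[of "lf P * x' + t * V" "lf P * y' - 1"] w1 w2 w3 sV(3) by simp
  then have "ev P (lf P * y' - 1) = 0" by simp
  then show False using ev_lf_0_iff[OF P(1) P(1)] by simp
qed

lemma degrees: "d1 \<le> d2 \<Longrightarrow> d1 = e \<and> d2 = e"
  using d1_ge d2_le by simp

text \<open>Comparing degrees, the syzygy \<open>(s1, s2, 0)\<close> is a constant combination of the columns; complete it to a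
  basis. The third entry of the other member is a multiple of \<open>h\<close> of the same degree, and it is not zero by
  \<open>b3_nonzero\<close>.\<close>

lemma normal_basis:
  assumes "d1 = e" "d2 = e"
  shows "\<exists>x1 y1 x2 y2 r. x1 * y2 - y1 * x2 \<noteq> 0 \<and> r \<noteq> 0 \<and>
    s1 = a1 * const2 x1 + b1 * const2 y1 \<and> s2 = a2 * const2 x1 + b2 * const2 y1 \<and> 0 = a3 * const2 x1 + b3 * const2 y1 \<and>
    const2 r * h = a3 * const2 x2 + b3 * const2 y2"
proof -
  obtain x y where xy: "s1 = a1 * x + b1 * y" "s2 = a2 * x + b2 * y" "0 = a3 * x + b3 * y"
    using gen[OF s_syz] by blast
  define x1 y1 where "x1 = ccf (homog_component 0 x) 0 0" and "y1 = ccf (homog_component 0 y) 0 0"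
  have c: "homog_component 0 x = const2 x1" "homog_component 0 y = const2 y1"
    unfolding x1_def y1_def using homog_0_const[OF homog_homog_component] by blast+
  have comp: "homog_component e (a * x + b * y) = a * const2 x1 + b * const2 y1" if "homog e a" "homog e b" for a b
    using homog_component_mult[OF that(1), of e x] homog_component_mult[OF that(2), of e y] c by (simp add: homog_component_add)
  have s1: "s1 = a1 * const2 x1 + b1 * const2 y1"
    using comp[of a1 b1] a_homog b_homog assms homog_component_homog[OF s_deg(1)] xy(1) by simp
  have s2: "s2 = a2 * const2 x1 + b2 * const2 y1"
    using comp[of a2 b2] a_homog b_homog assms homog_component_homog[OF s_deg(2)] xy(2) by simp
  have s3: "0 = a3 * const2 x1 + b3 * const2 y1"
    unfolding comp[OF a_homog(3)[unfolded assms] b_homog(3)[unfolded assms], symmetric] xy(3)[symmetric]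
    by (rule homog_component_homog[OF homog_0, symmetric])
  have nz: "x1 \<noteq> 0 \<or> y1 \<noteq> 0" using s1 s_nonzero by auto
  obtain x2 y2 where xy2: "x1 * y2 - y1 * x2 \<noteq> 0"
  proof (cases "x1 = 0")
    case True
    then show ?thesis using that[of 0 1] that[of 1 0] nz by auto
  next
    case False
    then show ?thesis using that[of 1 0] by auto
  qed
  define w1 w2 w3 where "w1 = a1 * const2 x2 + b1 * const2 y2" and "w2 = a2 * const2 x2 + b2 * const2 y2"
    and "w3 = a3 * const2 x2 + b3 * const2 y2"
  have wsyz: "g1 * w1 + g2 * w2 + g3 * w3 = 0" unfolding w1_def w2_def w3_def by (rule column_syz)
  have hw3: "homog e w3" unfolding w3_def
    by (rule homog_add[OF homog_mult'[OF a_homog(3) homog_const2] homog_mult'[OF b_homog(3) homog_const2]])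
      (simp_all add: assms)
  obtain q where q: "w3 = h * q" "homog (e - e) q" using h_dvd_third[OF wsyz hw3] by metis
  then obtain r where r: "q = const2 r" using homog_0_const[of q] by auto
  have "w3 \<noteq> 0"
  proof
    assume w30: "w3 = 0"
    define D where "D = x1 * y2 - y1 * x2"
    have "const2 D * a3 = const2 y2 * (a3 * const2 x1 + b3 * const2 y1) - const2 y1 * (a3 * const2 x2 + b3 * const2 y2)"
      unfolding D_def const2_simps(4,5) by (simp only: algebra_simps)
    then have "const2 D * a3 = 0" using s3 w30 unfolding w3_def by simp
    then have a30: "a3 = 0" using xy2 unfolding D_def by simp
    have "const2 D * b3 = const2 x1 * (a3 * const2 x2 + b3 * const2 y2) - const2 x2 * (a3 * const2 x1 + b3 * const2 y1)"
      unfolding D_def const2_simps(4,5) by (simp only: algebra_simps)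
    then have "const2 D * b3 = 0" using s3 w30 unfolding w3_def by simp
    then have "b3 = 0" using xy2 unfolding D_def by simp
    then show False using b3_nonzero[of 1] a30 by simp
  qed
  then have "r \<noteq> 0" using q r by auto
  moreover have "const2 r * h = w3" using q r by (simp add: mult.commute)
  ultimately show ?thesis using xy2 s1 s2 s3 unfolding w3_def by blast
qed

text \<open>A syzygy with vanishing third entry is a multiple of \<open>(s1, s2, 0)\<close>, while \<open>Q3\<close>, as third entry of another syzygy,
  is a multiple of \<open>h\<close>. As \<open>Q3\<close> occurs in both columns, \<open>s2\<close> and \<open>h\<close> are proportional.\<close>

lemma shape_imp_tangent:
  assumes col1: "P = a1 * const2 x1 + b1 * const2 y1" "Q3 = a2 * const2 x1 + b2 * const2 y1" "0 = a3 * const2 x1 + b3 * const2 y1"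
    and nz: "x1 \<noteq> 0 \<or> y1 \<noteq> 0"
    and col2: "g1 * Q1 + g2 * Q2 + g3 * Q3 = 0" and hom: "homog e P" "homog e Q3"
  shows "\<exists>y m. m \<noteq> 0 \<and> s2 = const2 y * h \<and> P = const2 m * s1 \<and> Q3 = const2 m * s2"
proof -
  have syz: "g1 * P + g2 * Q3 + g3 * 0 = 0" 
    using column_syz[of "const2 x1" "const2 y1"] unfolding col1[symmetric] .
  obtain r where "0 = h * r" "r * g3 = s1 * Q3 - s2 * P" using h_dvd_third[OF syz homog_0] by metis
  then have "P * s2 = s1 * Q3" using h by (simp add: mult.commute)
  then obtain q where q: "P = s1 * q" "homog (e - e) q" "Q3 = s2 * q" using s1_dvd[OF _ hom(1)] by metis
  then obtain m where m: "q = const2 m" using homog_0_const[of q] by auto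
  have m0: "m \<noteq> 0"
  proof
    assume "m = 0"
    then have "P = 0" "Q3 = 0" using q m by simp_all
    then have "const2 x1 = 0 \<and> const2 y1 = 0" using free[of "const2 x1" "const2 y1"] col1 by simp
    then show False using nz by simp
  qed
  obtain w where w: "Q3 = h * w" "homog (e - e) w" using h_dvd_third[OF col2 hom(2)] by metis
  then obtain n where n: "w = const2 n" using homog_0_const[of w] by auto
  have Q3: "Q3 = const2 m * s2" using q m by (simp only: mult.commute)
  have "const2 (n / m) * h = const2 (inverse m) * (const2 n * h)"
    by (simp only: divide_inverse const2_simps(5) ac_simps)
  also have "const2 n * h = Q3" using w n by (simp only: mult.commute)
  also have "const2 (inverse m) * Q3 = const2 (inverse m * m) * s2" unfolding Q3 const2_simps(5) by (simp only: mult.assoc)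
  also have "\<dots> = s2" using m0 by simp
  finally have "s2 = const2 (n / m) * h" ..
  moreover have "P = const2 m * s1" using q m by (simp only: mult.commute)
  ultimately show ?thesis using m0 Q3 by blast
qed

end

lemma syzygy_basis_of_hilbert_burch:
  assumes F: "curve_factored (g' $ 1) (g' $ 2) (g' $ 3) d h s1 s2 e" and half: "d = 2 * e"
    and hb: "hilbert_burch g' \<psi> d1 d2"
  shows "syzygy_basis (g' $ 1) (g' $ 2) (g' $ 3) d h s1 s2 e
    (\<psi> $ 1 $ 1) (\<psi> $ 2 $ 1) (\<psi> $ 3 $ 1) (\<psi> $ 1 $ 2) (\<psi> $ 2 $ 2) (\<psi> $ 3 $ 2) d1 d2"
proof -
  interpret curve_factored "g' $ 1" "g' $ 2" "g' $ 3" d h s1 s2 e by (rule F)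
  have mv: "(\<psi> *v x) $ i = \<psi> $ i $ 1 * x $ 1 + \<psi> $ i $ 2 * x $ 2" for x i
    by (simp add: matrix_vector_mult_def sum_2)
  have hom: "homog d1 (\<psi> $ i $ 1)" "homog d2 (\<psi> $ i $ 2)" for i using hb by (auto simp: hilbert_burch_def)
  have inj: "inj (\<lambda>x. \<psi> *v x)" using hb by (simp add: hilbert_burch_def)
  have rng: "{w. (\<Sum>i\<in>UNIV. g' $ i * w $ i) = 0} = range (\<lambda>x. \<psi> *v x)" using hb by (simp add: hilbert_burch_def)
  have syz: "g' $ 1 * (\<psi> *v x) $ 1 + g' $ 2 * (\<psi> *v x) $ 2 + g' $ 3 * (\<psi> *v x) $ 3 = 0" for x
  proof -
    have "\<psi> *v x \<in> {w. (\<Sum>i\<in>UNIV. g' $ i * w $ i) = 0}" unfolding rng by (rule rangeI)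
    then show ?thesis by (simp add: sum_3)
  qed
  show ?thesis
  proof
    show "g' $ 1 * \<psi> $ 1 $ 1 + g' $ 2 * \<psi> $ 2 $ 1 + g' $ 3 * \<psi> $ 3 $ 1 = 0"
      using syz[of "vector [1, 0]"] by (simp add: mv)
    show "g' $ 1 * \<psi> $ 1 $ 2 + g' $ 2 * \<psi> $ 2 $ 2 + g' $ 3 * \<psi> $ 3 $ 2 = 0"
      using syz[of "vector [0, 1]"] by (simp add: mv)
    fix w1 w2 w3 assume w: "g' $ 1 * w1 + g' $ 2 * w2 + g' $ 3 * w3 = 0"
    have "vector [w1, w2, w3] \<in> {w. (\<Sum>i\<in>UNIV. g' $ i * w $ i) = 0}" using w by (simp add: sum_3)
    then obtain x where x: "vector [w1, w2, w3] = \<psi> *v x" unfolding rng by blast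
    have "(vector [w1, w2, w3] :: ('a bipoly)^3) $ i = \<psi> $ i $ 1 * x $ 1 + \<psi> $ i $ 2 * x $ 2" for i
      unfolding x mv ..
    from this[of 1] this[of 2] this[of 3]
    show "\<exists>x y. w1 = \<psi> $ 1 $ 1 * x + \<psi> $ 1 $ 2 * y \<and> w2 = \<psi> $ 2 $ 1 * x + \<psi> $ 2 $ 2 * y \<and> w3 = \<psi> $ 3 $ 1 * x + \<psi> $ 3 $ 2 * y"
      by (intro exI[of _ "x $ 1"] exI[of _ "x $ 2"]) simp
  next
    fix x y
    assume z: "\<psi> $ 1 $ 1 * x + \<psi> $ 1 $ 2 * y = 0" "\<psi> $ 2 $ 1 * x + \<psi> $ 2 $ 2 * y = 0" "\<psi> $ 3 $ 1 * x + \<psi> $ 3 $ 2 * y = 0"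
    have "\<psi> *v vector [x, y] = \<psi> *v 0" using z by (simp add: vec_eq_iff forall_3 mv)
    then have "vector [x, y] = (0 :: ('a bipoly)^2)" by (rule injD[OF inj])
    then show "x = 0 \<and> y = 0" by (simp add: vec_eq_iff forall_2)
  qed (use hom half in auto)
qed

lemma shape_entries:
  fixes \<psi> :: "('k::comm_ring_1 bipoly)^2^3" and N :: "'k^2^2"
  shows "(\<psi> ** cm N) $ i $ j = \<psi> $ i $ 1 * const2 (N $ 1 $ j) + \<psi> $ i $ 2 * const2 (N $ 2 $ j)"
  by (simp only: matrix_matrix_mult_def map_matrix_def vec_lambda_beta sum_2)

lemma matrix_eq_32: "(A :: 'a^2^3) = B \<longleftrightarrow> (\<forall>i. A $ i $ 1 = B $ i $ 1 \<and> A $ i $ 2 = B $ i $ 2)"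
  by (auto simp: vec_eq_iff forall_2)

section \<open>Shapes of the matrix and infinitely near points\<close>

context rational_curve
begin

definition tangent_coords :: "'k^3 \<Rightarrow> 'k^3^3 \<Rightarrow> 'k^3^3 \<Rightarrow> bool" where
  "tangent_coords p M E \<longleftrightarrow> coords p M E \<and>
    (\<exists>h s1 s2 e y. curve_tangent ((g v* cm E) $ 1) ((g v* cm E) $ 2) ((g v* cm E) $ 3) d h s1 s2 e y)"

lemma local_facts:
  assumes on: "on_curve g p"
  shows "P1.planar (curve_local_ring g p) \<and> (\<exists>e\<le>d. curve_mult g p = real e \<and>
    (\<forall>q\<in>first_nbhd (curve_local_ring g p). local_mult (as_ring q) \<le> real (d - e)))"
proof -
  have "p \<noteq> 0" using on by (simp add: on_curve_def)
  then obtain M E where c: "coords p M E" by (rule coords_exist)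
  interpret curve "(g v* cm E) $ 1" "(g v* cm E) $ 2" "(g v* cm E) $ 3" d
    by (rule curve_in_coords(1)[OF on c])
  note R = curve_in_coords(2)[OF on c]
  obtain h s1 s2 e where F: "curve_factored ((g v* cm E) $ 1) ((g v* cm E) $ 2) ((g v* cm E) $ 3) d h s1 s2 e"
    using factored_exists by blast
  interpret curve_factored "(g v* cm E) $ 1" "(g v* cm E) $ 2" "(g v* cm E) $ 3" d h s1 s2 e by (rule F)
  show ?thesis
    using R_planar R_local_mult nbr_bound e_le unfolding R curve_mult_def by blast
qed

text \<open>Multiplicities do not increase along a chain of neighborhoods, so the first point of the chain leading to \<open>q\<close> has
  the multiplicity of \<open>q\<close> too.\<close>

lemma chain_in_first_nbhd:
  assumes pl: "P1.planar S" and m: "local_mult (as_ring S) = m" and q: "q \<in> nbhd (Suc j) S" "local_mult (as_ring q) = m"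
  shows "\<exists>A\<in>first_nbhd S. local_mult (as_ring A) = m \<and> P1.planar A \<and> q \<in> nbhd j A"
proof -
  obtain A where A: "A \<in> first_nbhd S" "q \<in> nbhd j A" using nbhd_Suc_front[OF q(1)] by blast
  note f = P1.first_nbhd_planar[OF pl A(1)]
  have "local_mult (as_ring q) \<le> local_mult (as_ring A)" using P1.nbhd_planar[OF f(1) A(2)] by blast
  then show ?thesis using f A m q by (intro bexI[of _ A]) auto
qed

text \<open>The combination \<open>a s1 + b s2\<close> of \<open>nbr_full\<close> becomes the new \<open>s2\<close> under the substitution that replaces \<open>g1\<close> by
  \<open>b g1 - a g2\<close> and, if \<open>b\<close> is zero, \<open>g2\<close> by the old \<open>g1\<close>. It fixes the point \<open>[0:0:1]\<close>.\<close>

lemma exists_tangent_coords: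
  assumes on: "on_curve g p" and half: "d = 2 * c" and m: "curve_mult g p = real c"
    and q: "q \<in> first_nbhd (curve_local_ring g p)" "local_mult (as_ring q) = real c"
  shows "\<exists>M E. tangent_coords p M E"
proof -
  have "p \<noteq> 0" using on by (simp add: on_curve_def)
  then obtain M E where cd: "coords p M E" by (rule coords_exist)
  define g' where "g' = g v* cm E"
  interpret curve "g' $ 1" "g' $ 2" "g' $ 3" d
    unfolding g'_def by (rule curve_in_coords(1)[OF on cd])
  have R: "curve.R (g' $ 1) (g' $ 2) (g' $ 3) = curve_local_ring g p"
    unfolding g'_def by (rule curve_in_coords(2)[OF on cd])
  obtain h s1 s2 e where F: "curve_factored (g' $ 1) (g' $ 2) (g' $ 3) d h s1 s2 e"
    using factored_exists by blast
  interpret F: curve_factored "g' $ 1" "g' $ 2" "g' $ 3" d h s1 s2 e by (rule F)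
  have ec: "e = c" using F.R_local_mult m unfolding R curve_mult_def by simp
  obtain a b r where ab: "(a, b) \<noteq> (0, 0)" "const2 a * s1 + const2 b * s2 = h * r" "homog (d - e - e) r"
    using F.nbr_full[of q] q unfolding R ec by blast
  have "d - e - e = 0" using half ec by simp
  then obtain y where y: "r = const2 y" using homog_0_const[of r] ab(3) by auto
  have s2y: "const2 a * s1 + const2 b * s2 = const2 y * h" using ab(2) y by (simp only: mult.commute)
  have mk: "\<exists>M E. tangent_coords p M E"
    if TU: "T ** U = mat 1" "U ** T = mat 1" "T $ 3 = vector [0, 0, 1]"
      and g1: "(g' v* cm U) $ 1 = const2 b * g' $ 1 - const2 a * g' $ 2"
      and g2: "(g' v* cm U) $ 2 = - (h * t)" and ht: "homog (d - e) t"
      and cop: "\<And>P. P \<in> pts \<Longrightarrow> ev P t \<noteq> 0 \<or> ev P (const2 a * s1 + const2 b * s2) \<noteq> 0"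
    for T U :: "'k^3^3" and t
  proof -
    have cd': "coords p (T ** M) (E ** U)" by (rule coords_mult[OF cd TU])
    have g'': "g v* cm (E ** U) = g' v* cm U" unfolding g'_def cm_mult by (simp add: vector_matrix_mul_assoc)
    have C: "curve ((g' v* cm U) $ 1) ((g' v* cm U) $ 2) ((g' v* cm U) $ 3) d"
      using curve_in_coords(1)[OF on cd'] unfolding g'' .
    have "(g' v* cm U) $ 1 = h * (const2 a * s1 + const2 b * s2)"
    proof -
      have "v * (h * s2) - u * (- (h * s1)) = h * (u * s1 + v * s2)" for u v by (simp add: algebra_simps)
      then show ?thesis unfolding g1 F.g1_eq F.g2_eq .
    qed
    moreover have "homog (d - e) (const2 a * s1 + const2 b * s2)" by (intro homog_add homog_cmult F.s)
    ultimately have "curve_factored ((g' v* cm U) $ 1) ((g' v* cm U) $ 2) ((g' v* cm U) $ 3) d h t (const2 a * s1 + const2 b * s2) e"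
      using g2 ht cop F.h F.e_le by (intro curve_factored.intro curve_factored_axioms.intro C) simp_all
    then have "curve_tangent ((g' v* cm U) $ 1) ((g' v* cm U) $ 2) ((g' v* cm U) $ 3) d h t (const2 a * s1 + const2 b * s2) e y"
      using s2y by (intro curve_tangent.intro curve_tangent_axioms.intro)
    then show ?thesis using cd' unfolding tangent_coords_def g''[symmetric] by blast
  qed
  have gU: "(g' v* cm U) $ j = const2 (U $ 1 $ j) * g' $ 1 + const2 (U $ 2 $ j) * g' $ 2 + const2 (U $ 3 $ j) * g' $ 3" for U :: "'k^3^3" and j
    unfolding vector_matrix_mult_def sum_3 map_matrix_def by (simp only: vec_lambda_beta mult.commute)
  show ?thesis
  proof (cases "b = 0")
    case False
    define U :: "'k^3^3" where "U = vector [vector [b, 0, 0], vector [- a, 1, 0], vector [0, 0, 1]]"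
    define T :: "'k^3^3" where "T = vector [vector [1 / b, 0, 0], vector [a / b, 1, 0], vector [0, 0, 1]]"
    show ?thesis
    proof (rule mk[of T U s1])
      show "T ** U = mat 1" "U ** T = mat 1" using False unfolding T_def U_def
        by (simp_all add: vec_eq_iff forall_3 matrix_matrix_mult_def sum_3 mat_def)
      show "T $ 3 = vector [0, 0, 1]" by (simp add: T_def)
      show "(g' v* cm U) $ 1 = const2 b * g' $ 1 - const2 a * g' $ 2" 
        unfolding gU by (simp add: U_def smult_minus_left[of "[:a:]", simplified])
      show "(g' v* cm U) $ 2 = - (h * s1)" unfolding gU using F.g2_eq by (simp add: U_def)
      show "ev P s1 \<noteq> 0 \<or> ev P (const2 a * s1 + const2 b * s2) \<noteq> 0" if "P \<in> pts" for P
        using F.s_coprime[OF that] False by auto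
    qed (rule F.s)
  next
    case True
    then have a: "a \<noteq> 0" using ab by auto
    define U :: "'k^3^3" where "U = vector [vector [0, 1, 0], vector [- a, 0, 0], vector [0, 0, 1]]"
    define T :: "'k^3^3" where "T = vector [vector [0, - 1 / a, 0], vector [1, 0, 0], vector [0, 0, 1]]"
    show ?thesis
    proof (rule mk[of T U "- s2"])
      show "T ** U = mat 1" "U ** T = mat 1" using a unfolding T_def U_def
        by (simp_all add: vec_eq_iff forall_3 matrix_matrix_mult_def sum_3 mat_def)
      show "T $ 3 = vector [0, 0, 1]" by (simp add: T_def)
      show "(g' v* cm U) $ 1 = const2 b * g' $ 1 - const2 a * g' $ 2" 
        unfolding gU by (simp add: U_def True smult_minus_left[of "[:a:]", simplified])
      show "(g' v* cm U) $ 2 = - (h * - s2)" unfolding gU using F.g1_eq by (simp add: U_def)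
      show "homog (d - e) (- s2)" by (rule homog_uminus[OF F.s(2)])
      show "ev P (- s2) \<noteq> 0 \<or> ev P (const2 a * s1 + const2 b * s2) \<noteq> 0" if "P \<in> pts" for P
        using F.s_coprime[OF that] a True by auto
    qed
  qed
qed

text \<open>The first point of the chain leading to \<open>q\<close> has multiplicity at least \<open>c\<close>, and at most both \<open>e\<close> and \<open>d - e\<close>, where
  \<open>e\<close> is the multiplicity of \<open>p\<close>.\<close>

lemma half_mult_of_infinitely_near:
  assumes on: "on_curve g p" and half: "d = 2 * c"
    and q: "q \<in> nbhd (Suc j) (curve_local_ring g p)" "local_mult (as_ring q) = real c"
  shows "curve_mult g p = real c"
proof -
  obtain e where e: "P1.planar (curve_local_ring g p)" "e \<le> d" "curve_mult g p = real e"
    "\<forall>q\<in>first_nbhd (curve_local_ring g p). local_mult (as_ring q) \<le> real (d - e)"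
    using local_facts[OF on] by blast
  obtain A where A: "A \<in> first_nbhd (curve_local_ring g p)" "q \<in> nbhd j A" using nbhd_Suc_front[OF q(1)] by blast
  note f = P1.first_nbhd_planar[OF e(1) A(1)]
  have "real c \<le> local_mult (as_ring A)" using P1.nbhd_planar[OF f(1) A(2)] q(2) by simp
  moreover have "local_mult (as_ring A) \<le> real (d - e)" using e(4) A(1) by blast
  moreover have "local_mult (as_ring A) \<le> real e" using f(2) e(3) unfolding curve_mult_def by simp
  ultimately have "c \<le> d - e" "c \<le> e" by linarith+
  then show ?thesis using e half by simp
qed

lemma syzygy_basis_in_coords:
  assumes on: "on_curve g p" and half: "d = 2 * c" and m: "curve_mult g p = real c"
    and cd: "coords p M E" and hb: "hilbert_burch g \<phi> d1 d2"
    and F: "curve_factored ((g v* cm E) $ 1) ((g v* cm E) $ 2) ((g v* cm E) $ 3) d h s1 s2 e"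
  defines "\<psi> \<equiv> cm (M :: 'k^3^3) ** \<phi>"
  shows "e = c \<and> syzygy_basis ((g v* cm E) $ 1) ((g v* cm E) $ 2) ((g v* cm E) $ 3) d h s1 s2 c
    (\<psi> $ 1 $ 1) (\<psi> $ 2 $ 1) (\<psi> $ 3 $ 1) (\<psi> $ 1 $ 2) (\<psi> $ 2 $ 2) (\<psi> $ 3 $ 2) d1 d2"
proof -
  interpret F: curve_factored "(g v* cm E) $ 1" "(g v* cm E) $ 2" "(g v* cm E) $ 3" d h s1 s2 e by (rule F)
  have ec: "e = c" using F.R_local_mult m unfolding curve_in_coords(2)[OF on cd] curve_mult_def by simp
  show ?thesis using syzygy_basis_of_hilbert_burch[OF F _ hilbert_burch_transform[OF hb cd]] half
    unfolding \<psi>_def ec by blast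
qed

lemma degrees_half:
  assumes on: "on_curve g p" and half: "d = 2 * c" and m: "curve_mult g p = real c"
    and hb: "hilbert_burch g \<phi> d1 d2" and le: "d1 \<le> d2"
  shows "d1 = c \<and> d2 = c"
proof -
  have "p \<noteq> 0" using on by (simp add: on_curve_def)
  then obtain M E where cd: "coords p M E" by (rule coords_exist)
  interpret curve "(g v* cm E) $ 1" "(g v* cm E) $ 2" "(g v* cm E) $ 3" d
    by (rule curve_in_coords(1)[OF on cd])
  obtain h s1 s2 e where F: "curve_factored ((g v* cm E) $ 1) ((g v* cm E) $ 2) ((g v* cm E) $ 3) d h s1 s2 e"
    using factored_exists by blast
  note S = syzygy_basis_in_coords[OF on half m cd hb F]
  show ?thesis by (rule syzygy_basis.degrees[OF conjunct2[OF S] le])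
qed

lemma shape_imp_curve_tangent:
  fixes M :: "'k^3^3" and N :: "'k^2^2"
  assumes on: "on_curve g p" and half: "d = 2 * c" and m: "curve_mult g p = real c"
    and cd: "coords p M E" and hb: "hilbert_burch g \<phi> d1 d2" and N: "invertible N"
    and shape: "cm M ** \<phi> ** cm N = vector [vector [P, Q1], vector [Q3, Q2], vector [0, Q3]]"
    and hom: "homog c P" "homog c Q3"
  defines "g' \<equiv> g v* cm E"
  shows "\<exists>h s1 s2 y m. curve_tangent (g' $ 1) (g' $ 2) (g' $ 3) d h s1 s2 c y \<and> m \<noteq> 0 \<and>
    P = const2 m * s1 \<and> Q3 = const2 m * s2 \<and> Q3 * g' $ 3 = h * (s1 * Q2 - s2 * Q1)"
proof -
  interpret curve "g' $ 1" "g' $ 2" "g' $ 3" d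
    unfolding g'_def by (rule curve_in_coords(1)[OF on cd])
  obtain h s1 s2 e where F: "curve_factored (g' $ 1) (g' $ 2) (g' $ 3) d h s1 s2 e"
    using factored_exists by blast
  define \<psi> where "\<psi> = cm M ** \<phi>"
  note S = syzygy_basis_in_coords[OF on half m cd hb F[unfolded g'_def], folded \<psi>_def g'_def]
  interpret S: syzygy_basis "g' $ 1" "g' $ 2" "g' $ 3" d h s1 s2 c "\<psi> $ 1 $ 1" "\<psi> $ 2 $ 1" "\<psi> $ 3 $ 1"
    "\<psi> $ 1 $ 2" "\<psi> $ 2 $ 2" "\<psi> $ 3 $ 2" d1 d2 by (rule conjunct2[OF S])
  have ent: "\<psi> $ i $ 1 * const2 (N $ 1 $ j) + \<psi> $ i $ 2 * const2 (N $ 2 $ j)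
      = (vector [vector [P, Q1], vector [Q3, Q2], vector [0, Q3]] :: ('k bipoly)^2^3) $ i $ j" for i :: 3 and j :: 2
    unfolding shape[folded \<psi>_def, symmetric] shape_entries ..
  have nz: "N $ 1 $ 1 \<noteq> 0 \<or> N $ 2 $ 1 \<noteq> 0"
    using N by (auto simp: invertible_det_nz det_2)
  have c2: "g' $ 1 * Q1 + g' $ 2 * Q2 + g' $ 3 * Q3 = 0"
    using S.column_syz[of "const2 (N $ 1 $ 2)" "const2 (N $ 2 $ 2)"] unfolding ent by simp
  obtain y m where ym: "m \<noteq> 0" "s2 = const2 y * h" "P = const2 m * s1" "Q3 = const2 m * s2"
  proof -
    have "P = \<psi> $ 1 $ 1 * const2 (N $ 1 $ 1) + \<psi> $ 1 $ 2 * const2 (N $ 2 $ 1)"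
      "Q3 = \<psi> $ 2 $ 1 * const2 (N $ 1 $ 1) + \<psi> $ 2 $ 2 * const2 (N $ 2 $ 1)"
      "0 = \<psi> $ 3 $ 1 * const2 (N $ 1 $ 1) + \<psi> $ 3 $ 2 * const2 (N $ 2 $ 1)"
      unfolding ent by simp_all
    from S.shape_imp_tangent[OF this nz c2 hom] that show thesis by (elim exE conjE)
  qed
  have "curve_tangent (g' $ 1) (g' $ 2) (g' $ 3) d h s1 s2 c y"
    using S.curve_factored_axioms ym(2) by (intro curve_tangent.intro curve_tangent_axioms.intro)
  then show ?thesis using ym S.syz_third[OF c2] by blast
qed

text \<open>The matrix of \<open>normal_basis\<close>, with the first column scaled by \<open>r / y\<close> so that the entry \<open>s2 = y h\<close> becomes the
  corner entry \<open>r h\<close>.\<close>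

lemma tangent_normal_form:
  assumes on: "on_curve g p" and half: "d = 2 * c" and m: "curve_mult g p = real c"
    and tg: "tangent_coords p M E" and hb: "hilbert_burch g \<phi> c c"
  defines "g' \<equiv> g v* cm E"
  shows "\<exists>h s1 s2 y r (N :: 'k^2^2) Q1 Q2. curve_tangent (g' $ 1) (g' $ 2) (g' $ 3) d h s1 s2 c y \<and> r \<noteq> 0 \<and> invertible N \<and>
    homog c Q1 \<and> homog c Q2 \<and> const2 r * g' $ 3 = s1 * Q2 - s2 * Q1 \<and>
    cm M ** \<phi> ** cm N = vector [vector [const2 (r / y) * s1, Q1], vector [const2 r * h, Q2], vector [0, const2 r * h]]"
proof -
  obtain h s1 s2 e y where cd: "coords p M E" and T: "curve_tangent (g' $ 1) (g' $ 2) (g' $ 3) d h s1 s2 e y"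
    using tg unfolding tangent_coords_def g'_def by blast
  note F = curve_tangent.axioms(1)[OF T]
  define \<psi> where "\<psi> = cm M ** \<phi>"
  note S = syzygy_basis_in_coords[OF on half m cd hb F[unfolded g'_def], folded \<psi>_def g'_def]
  interpret S: syzygy_basis "g' $ 1" "g' $ 2" "g' $ 3" d h s1 s2 c "\<psi> $ 1 $ 1" "\<psi> $ 2 $ 1" "\<psi> $ 3 $ 1"
    "\<psi> $ 1 $ 2" "\<psi> $ 2 $ 2" "\<psi> $ 3 $ 2" c c by (rule conjunct2[OF S])
  interpret T: curve_tangent "g' $ 1" "g' $ 2" "g' $ 3" d h s1 s2 c y
    using T conjunct1[OF S] by simp
  obtain x1 y1 x2 y2 r where nb: "x1 * y2 - y1 * x2 \<noteq> 0" "r \<noteq> 0"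
    "s1 = \<psi> $ 1 $ 1 * const2 x1 + \<psi> $ 1 $ 2 * const2 y1" "s2 = \<psi> $ 2 $ 1 * const2 x1 + \<psi> $ 2 $ 2 * const2 y1"
    "0 = \<psi> $ 3 $ 1 * const2 x1 + \<psi> $ 3 $ 2 * const2 y1" "const2 r * h = \<psi> $ 3 $ 1 * const2 x2 + \<psi> $ 3 $ 2 * const2 y2"
    using S.normal_basis[OF refl refl] by metis
  define Q1 Q2 where "Q1 = \<psi> $ 1 $ 1 * const2 x2 + \<psi> $ 1 $ 2 * const2 y2"
    and "Q2 = \<psi> $ 2 $ 1 * const2 x2 + \<psi> $ 2 $ 2 * const2 y2"
  define t where "t = r / y"
  have t0: "t \<noteq> 0" "t * y = r" using nb(2) T.y_nonzero by (simp_all add: t_def)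
  define N :: "'k^2^2" where "N = vector [vector [x1 * t, x2], vector [y1 * t, y2]]"
  have "det N = t * (x1 * y2 - y1 * x2)" by (simp add: N_def det_2 algebra_simps)
  then have N: "invertible N" using nb(1) t0 by (simp add: invertible_det_nz)
  have sc: "A * const2 (u * t) + B * const2 (v * t) = const2 t * (A * const2 u + B * const2 v)" for A B u v
    by (simp only: const2_simps(5) distrib_left ac_simps)
  have "const2 t * s2 = const2 (t * y) * h" unfolding T.s2_eq const2_simps(5) by (simp only: mult.assoc)
  then have ts2: "const2 t * s2 = const2 r * h" unfolding t0(2) .
  have "\<psi> ** cm N = vector [vector [const2 t * s1, Q1], vector [const2 r * h, Q2], vector [0, const2 r * h]]"
    unfolding matrix_eq_32 shape_entries forall_3
    using sc nb(3-6)[symmetric] ts2 Q1_def[symmetric] Q2_def[symmetric]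
    by (simp add: N_def del: mult_pCons_left mult_pCons_right)
  moreover have "homog c Q1" "homog c Q2" unfolding Q1_def Q2_def
    by (intro homog_add homog_mult'[OF S.a_homog(1) homog_const2] homog_mult'[OF S.b_homog(1) homog_const2]
      homog_mult'[OF S.a_homog(2) homog_const2] homog_mult'[OF S.b_homog(2) homog_const2] add_0_right[symmetric])+
  moreover have "const2 r * g' $ 3 = s1 * Q2 - s2 * Q1"
  proof -
    have "h * (const2 r * g' $ 3) = h * (s1 * Q2 - s2 * Q1)"
      using S.syz_third[OF S.column_syz[of "const2 x2" "const2 y2"], folded Q1_def Q2_def] nb(6)[symmetric]
      by (simp only: ac_simps)
    then show ?thesis using S.h by (simp only: mult_cancel_left) simp
  qed
  ultimately show ?thesis using T.curve_tangent_axioms nb(2) N unfolding \<psi>_def t_def by blast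
qed

lemma infinitely_near_imp_shape:
  assumes on: "on_curve g p" and half: "d = 2 * c" and m: "curve_mult g p = real c"
    and hb: "hilbert_burch g \<phi> c c"
    and q: "q \<in> nbhd (Suc j) (curve_local_ring g p)" "local_mult (as_ring q) = real c"
  shows "\<exists>(M :: 'k^3^3) (N :: 'k^2^2) P Q1 Q2 Q3. invertible M \<and> invertible N \<and> p = vector [0, 0, 1] v* M \<and>
    cm M ** \<phi> ** cm N = vector [vector [P, Q1], vector [Q3, Q2], vector [0, Q3]] \<and>
    homog c P \<and> homog c Q1 \<and> homog c Q2 \<and> homog c Q3"
proof -
  have pl: "P1.planar (curve_local_ring g p)" using local_facts[OF on] by blast
  obtain A where A: "A \<in> first_nbhd (curve_local_ring g p)" "local_mult (as_ring A) = real c"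
    using chain_in_first_nbhd[OF pl m[unfolded curve_mult_def] q] by blast
  obtain M E where tg: "tangent_coords p M E" using exists_tangent_coords[OF on half m A] by blast
  obtain h s1 s2 y r and N :: "'k^2^2" and Q1 Q2 where
    T: "curve_tangent ((g v* cm E) $ 1) ((g v* cm E) $ 2) ((g v* cm E) $ 3) d h s1 s2 c y"
    and N: "invertible N" and Q: "homog c Q1" "homog c Q2"
    and sh: "cm M ** \<phi> ** cm N = vector [vector [const2 (r / y) * s1, Q1], vector [const2 r * h, Q2], vector [0, const2 r * h]]"
    using tangent_normal_form[OF on half m tg hb] by (elim exE conjE)
  interpret T: curve_tangent "(g v* cm E) $ 1" "(g v* cm E) $ 2" "(g v* cm E) $ 3" d h s1 s2 c y by (rule T)
  have M: "invertible M" "p = vector [0, 0, 1] v* M"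
    using tg unfolding tangent_coords_def coords_def invertible_def by blast+
  have "homog c (const2 (r / y) * s1)" "homog c (const2 r * h)"
    using homog_cmult[OF T.s(1)] homog_cmult[OF T.h(1)] T.d_eq(2) by simp_all
  then show ?thesis using M N Q sh by blast
qed

text \<open>If the top left entry is \<open>Q2\<close>, then \<open>Q2 = m' s1\<close> and \<open>Q3 = m' y h\<close>, so that \<open>Q3 g3 = h (s1 Q2 - s2 Q1)\<close> becomes
  \<open>m' y g3 = m' s1^2 - y h Q1\<close>. This is the condition for the second neighborhood, with \<open>\<kappa> = y\<close>.\<close>

lemma shape_imp_infinitely_near:
  fixes M :: "'k^3^3" and N :: "'k^2^2"
  assumes on: "on_curve g p" and half: "d = 2 * c" and m: "curve_mult g p = real c"
    and hb: "hilbert_burch g \<phi> d1 d2" and M: "invertible M" "p = vector [0, 0, 1] v* M" and N: "invertible N"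
    and shape: "cm M ** \<phi> ** cm N = vector [vector [P, Q1], vector [Q3, Q2], vector [0, Q3]]"
    and hom: "homog c P" "homog c Q3"
  shows "\<exists>q\<in>first_nbhd (curve_local_ring g p). local_mult (as_ring q) = real c \<and>
    (P = Q2 \<longrightarrow> (\<exists>q2\<in>first_nbhd q. local_mult (as_ring q2) = real c))"
proof -
  obtain E where cd: "coords p M E" using coords_of_invertible[OF M] .
  define g' where "g' = g v* cm E"
  obtain h s1 s2 y m' where T: "curve_tangent (g' $ 1) (g' $ 2) (g' $ 3) d h s1 s2 c y"
    and m': "m' \<noteq> 0" "P = const2 m' * s1" "Q3 = const2 m' * s2" "Q3 * g' $ 3 = h * (s1 * Q2 - s2 * Q1)"
    using shape_imp_curve_tangent[OF on half m cd hb N shape hom] unfolding g'_def by (elim exE conjE)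
  interpret T: curve_tangent "g' $ 1" "g' $ 2" "g' $ 3" d h s1 s2 c y by (rule T)
  have R: "T.R = curve_local_ring g p" unfolding g'_def by (rule curve_in_coords(2)[OF on cd])
  obtain q where q: "q \<in> first_nbhd T.R" "local_mult (as_ring q) = real c"
    "P1.gen2 T.Z q (Fract s2 (- s1)) T.xY" using T.tangent_nbr by blast
  have "\<exists>q2\<in>first_nbhd q. local_mult (as_ring q2) = real c" if P: "P = Q2"
  proof (rule T.second_nbr_exists[OF q(3)])
    define i where "i = const2 (inverse m')"
    have i: "i * const2 m' = 1" using m'(1) unfolding i_def by (simp add: const2_simps(5)[symmetric] one_pCons del: mult_pCons_left)
    have "h * (const2 m' * (const2 y * g' $ 3)) = Q3 * g' $ 3" unfolding m'(3) T.s2_eq by (simp only: ac_simps)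
    also have "\<dots> = h * (const2 m' * (s1 * s1) - const2 y * h * Q1)" unfolding m'(4) P[symmetric] m'(2) T.s2_eq
      by (simp only: ac_simps)
    finally have "const2 m' * (const2 y * g' $ 3) = const2 m' * (s1 * s1) - const2 y * h * Q1"
      using T.h(2) by (simp only: mult_cancel_left) simp
    then have "i * (const2 m' * (const2 y * g' $ 3)) = i * (const2 m' * (s1 * s1) - const2 y * h * Q1)" by (simp only:)
    then have "(i * const2 m') * (const2 y * g' $ 3) = (i * const2 m') * (s1 * s1) - h * (i * const2 y * Q1)"
      by (simp only: right_diff_distrib ac_simps)
    then show "s1 * s1 - const2 y * g' $ 3 = h * (i * const2 y * Q1)" unfolding i mult_1_left by (simp only: diff_diff_eq2) simp
  qed
  then show ?thesis using q unfolding R by blast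
qed

text \<open>The first points of the two chains coincide by \<open>first_nbhd_unique\<close>. As \<open>q1\<close> and \<open>q2\<close> differ, one of the chains continues.\<close>

lemma two_infinitely_near_chain:
  assumes on: "on_curve g p" and m: "curve_mult g p = real c"
    and q1: "q1 \<in> nbhd (Suc i) (curve_local_ring g p)" "local_mult (as_ring q1) = real c"
    and q2: "q2 \<in> nbhd (Suc j) (curve_local_ring g p)" "local_mult (as_ring q2) = real c"
    and ne: "q1 \<noteq> q2"
  shows "\<exists>A\<in>first_nbhd (curve_local_ring g p). local_mult (as_ring A) = real c \<and>
    (\<exists>A'\<in>first_nbhd A. local_mult (as_ring A') = real c)"
proof -
  have pl: "P1.planar (curve_local_ring g p)" using local_facts[OF on] by blast
  note m' = m[unfolded curve_mult_def]
  obtain A where A: "A \<in> first_nbhd (curve_local_ring g p)" "local_mult (as_ring A) = real c" "P1.planar A" "q1 \<in> nbhd i A"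
    using chain_in_first_nbhd[OF pl m' q1] by blast
  obtain B where B: "B \<in> first_nbhd (curve_local_ring g p)" "local_mult (as_ring B) = real c" "P1.planar B" "q2 \<in> nbhd j B"
    using chain_in_first_nbhd[OF pl m' q2] by blast
  have AB: "A = B" using P1.first_nbhd_unique[OF pl A(1) _ B(1)] A(2) B(2) m' by simp
  have "\<exists>q k. q \<in> nbhd (Suc k) A \<and> local_mult (as_ring q) = real c"
  proof (cases i)
    case (Suc k)
    then show ?thesis using A(4) q1(2) by blast
  next
    case 0
    then have "q1 = A" using A(4) by simp
    then have "j \<noteq> 0" using B(4) ne AB by (cases j) auto
    then obtain k where "j = Suc k" using not0_implies_Suc by blast
    then show ?thesis using B(4) q2(2) AB by blast
  qed
  then obtain q k where qk: "q \<in> nbhd (Suc k) A" "local_mult (as_ring q) = real c" by blast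
  have "\<exists>A'\<in>first_nbhd A. local_mult (as_ring A') = real c"
    using chain_in_first_nbhd[OF A(3) A(2) qk] by blast
  then show ?thesis using A by blast
qed

text \<open>From \<open>s1^2 - \<kappa> g3 = h r'\<close> and \<open>r g3 = s1 Q2 - s2 Q1\<close> one gets that \<open>h\<close> divides \<open>(r s1 - \<kappa> Q2) s1\<close>. Here \<open>s1\<close> has
  no root in common with \<open>h\<close>, so \<open>r s1 - \<kappa> Q2 = \<epsilon> h\<close>. A row operation that fixes the third row, hence the point, turns
  the top left entry into \<open>Q2\<close>.\<close>

lemma two_infinitely_near_imp_shape:
  assumes on: "on_curve g p" and half: "d = 2 * c" and m: "curve_mult g p = real c"
    and hb: "hilbert_burch g \<phi> c c"
    and A: "A \<in> first_nbhd (curve_local_ring g p)" "local_mult (as_ring A) = real c"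
    and A': "A' \<in> first_nbhd A" "local_mult (as_ring A') = real c"
  shows "\<exists>(M :: 'k^3^3) (N :: 'k^2^2) Q1 Q2 Q3. invertible M \<and> invertible N \<and> p = vector [0, 0, 1] v* M \<and>
    cm M ** \<phi> ** cm N = vector [vector [Q2, Q1], vector [Q3, Q2], vector [0, Q3]] \<and>
    homog c Q1 \<and> homog c Q2 \<and> homog c Q3"
proof -
  have pl: "P1.planar (curve_local_ring g p)" using local_facts[OF on] by blast
  obtain M E where tg: "tangent_coords p M E" using exists_tangent_coords[OF on half m A] by blast
  define g' where "g' = g v* cm E"
  obtain h s1 s2 y r and N :: "'k^2^2" and Q1 Q2 where T: "curve_tangent (g' $ 1) (g' $ 2) (g' $ 3) d h s1 s2 c y"
    and r: "r \<noteq> 0" and N: "invertible N" and Q: "homog c Q1" "homog c Q2"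
    and rel: "const2 r * g' $ 3 = s1 * Q2 - s2 * Q1"
    and sh: "cm M ** \<phi> ** cm N = vector [vector [const2 (r / y) * s1, Q1], vector [const2 r * h, Q2], vector [0, const2 r * h]]"
    using tangent_normal_form[OF on half m tg hb] unfolding g'_def by (elim exE conjE)
  interpret T: curve_tangent "g' $ 1" "g' $ 2" "g' $ 3" d h s1 s2 c y by (rule T)
  have cd: "coords p M E" using tg unfolding tangent_coords_def by blast
  have M: "invertible M" "p = vector [0, 0, 1] v* M" using cd unfolding coords_def invertible_def by blast+
  have R: "T.R = curve_local_ring g p" unfolding g'_def by (rule curve_in_coords(2)[OF on cd])
  obtain q where q: "q \<in> first_nbhd T.R" "local_mult (as_ring q) = real c"
    "P1.gen2 T.Z q (Fract s2 (- s1)) T.xY" using T.tangent_nbr by blast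
  have qA: "q = A" using P1.first_nbhd_unique[OF pl _ _ A(1)] q A(2) m unfolding R curve_mult_def by simp
  obtain k r' where k: "k \<noteq> 0" "s1 * s1 - const2 k * g' $ 3 = h * r'"
    using T.second_nbr_full[OF q(3) _ A'(2)] A'(1) unfolding qA by blast
  have "const2 r * (s1 * s1 - const2 k * g' $ 3) = const2 r * (s1 * s1) - const2 k * (const2 r * g' $ 3)"
    by (simp only: right_diff_distrib ac_simps)
  also have "\<dots> = (const2 r * s1 - const2 k * Q2) * s1 + h * (const2 k * const2 y * Q1)"
    unfolding rel T.s2_eq by (simp only: algebra_simps)
  finally have "(const2 r * s1 - const2 k * Q2) * s1 = h * (const2 r * r') - h * (const2 k * const2 y * Q1)"
    unfolding k(2) by (simp only: eq_diff_eq ac_simps)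
  then have eq: "(const2 r * s1 - const2 k * Q2) * s1 = h * (const2 r * r' - const2 k * const2 y * Q1)"
    by (simp only: right_diff_distrib)
  have s1: "homog c s1" using T.s(1) T.d_eq(2) by simp
  have hw: "homog c (const2 r * s1 - const2 k * Q2)" by (rule homog_diff[OF homog_cmult[OF s1] homog_cmult[OF Q(2)]])
  have nz: "ev P s1 \<noteq> 0" if "P \<in> pts" "ev P h = 0" for P
    using T.ev_s1[of P] that T.Z_eq by simp
  obtain w where w: "const2 r * s1 - const2 k * Q2 = h * w" "homog (c - c) w"
    using form_coprime_dvd[OF T.h hw nz eq] by metis
  then obtain \<epsilon> where eps: "w = const2 \<epsilon>" using homog_0_const[of w] by auto
  have kQ2: "const2 k * Q2 = const2 r * s1 - const2 \<epsilon> * h" using w(1) unfolding eps by (simp only: algebra_simps)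
  \<comment> \<open>The first row is multiplied by \<open>y / k\<close>, which turns \<open>(r / y) s1\<close> into \<open>(r / k) s1 = Q2 + (\<epsilon> / k) h\<close>; the multiple \<open>\<eta>\<close> of
    the second row, whose first entry is \<open>r h\<close>, removes the second summand.\<close>
  define \<eta> where "\<eta> = - \<epsilon> / (k * r)"
  define T' :: "'k^3^3" where "T' = vector [vector [y / k, \<eta>, 0], vector [0, 1, 0], vector [0, 0, 1]]"
  have "det T' = y / k" by (simp add: T'_def det_3)
  then have T'M: "invertible (T' ** M)" using T.y_nonzero k(1) M(1) by (intro invertible_mult) (simp_all add: invertible_det_nz)
  have e3: "vector [0, 0, 1] v* T' = vector [0, 0, 1]" by (simp only: e3_row) (simp add: T'_def)
  have "vector [0, 0, 1] v* (T' ** M) = (vector [0, 0, 1] v* T') v* M" by (simp add: vector_matrix_mul_assoc)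
  then have p: "p = vector [0, 0, 1] v* (T' ** M)" unfolding e3 M(2)[symmetric] by (rule sym)
  have Q2: "const2 (y / k) * (const2 (r / y) * s1) + const2 \<eta> * (const2 r * h) = Q2"
  proof -
    have "y / k * (r / y) = inverse k * r" "\<eta> * r = - (inverse k * \<epsilon>)"
      using T.y_nonzero r k(1) by (simp_all add: \<eta>_def field_simps)
    then have "const2 (y / k) * (const2 (r / y) * s1) + const2 \<eta> * (const2 r * h)
        = const2 (inverse k * r) * s1 + const2 (- (inverse k * \<epsilon>)) * h"
      by (simp only: mult.assoc[symmetric] const2_simps(5)[symmetric])
    also have "\<dots> = const2 (inverse k) * (const2 r * s1 - const2 \<epsilon> * h)"
    proof -
      have "const2 (- (inverse k * \<epsilon>)) = - (const2 (inverse k) * const2 \<epsilon>)" by simp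
      then show ?thesis unfolding const2_simps(5) by (simp only: right_diff_distrib mult.assoc mult_minus_left add_uminus_conv_diff)
    qed
    also have "\<dots> = const2 (inverse k * k) * Q2" unfolding kQ2[symmetric] const2_simps(5) by (simp only: mult.assoc)
    also have "\<dots> = Q2" using k(1) by simp
    finally show ?thesis .
  qed
  define Q1' where "Q1' = const2 (y / k) * Q1 + const2 \<eta> * Q2"
  have tr: "(cm T' ** A) $ i $ j = const2 (T' $ i $ 1) * A $ 1 $ j + const2 (T' $ i $ 2) * A $ 2 $ j + const2 (T' $ i $ 3) * A $ 3 $ j"
    for A :: "('k bipoly)^2^3" and i j
    by (simp only: matrix_matrix_mult_def map_matrix_def vec_lambda_beta sum_3)
  have "cm (T' ** M) ** \<phi> ** cm N = cm T' ** (cm M ** \<phi> ** cm N)" by (simp only: cm_mult matrix_mul_assoc)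
  also have "\<dots> = vector [vector [Q2, Q1'], vector [const2 r * h, Q2], vector [0, const2 r * h]]"
    unfolding sh matrix_eq_32 forall_3 tr
    using Q2 by (simp add: T'_def Q1'_def one_pCons[symmetric] del: mult_pCons_left)
  finally have shape: "cm (T' ** M) ** \<phi> ** cm N = vector [vector [Q2, Q1'], vector [const2 r * h, Q2], vector [0, const2 r * h]]" .
  have "homog c Q1'" unfolding Q1'_def by (intro homog_add homog_cmult Q)
  then show ?thesis using T'M N p shape Q(2) homog_cmult[OF T.h(1), of r] by blast
qed

end

theorem corollary2p5:
  fixes g :: "('k::alg_closed_field bipoly)^3"
    and \<phi> :: "('k bipoly)^2^3"
    and c d d1 d2 :: nat
  assumes homogeneous: "\<And>i. homog d (g $ i)"
    and min_gen: "minimally_generating g"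
    and height_two: "ideal_height ring_of_type_algebra (gen_ideal g UNIV) = 2"
    and birational: "birational_param g"
    and resolution: "hilbert_burch g \<phi> d1 d2"
    and d1_le_d2: "d1 \<le> d2"
    and d_even: "d = 2 * c"
  shows
    "(\<forall>p q. on_curve g p \<and> q \<in> inf_near_sing (curve_local_ring g p) \<and>
        local_mult (as_ring q) = real c \<longrightarrow> curve_mult g p = real c)
     \<and>
     (\<forall>p. curve_singular g p \<and> curve_mult g p = real c \<longrightarrow> d1 = c \<and> d2 = c)
     \<and>
     (\<forall>p. curve_singular g p \<and> curve_mult g p = real c \<longrightarrow>
        ((\<exists>q \<in> inf_near_sing (curve_local_ring g p). local_mult (as_ring q) = real c) \<longleftrightarrow>
         (\<exists>(M :: 'k^3^3) (N :: 'k^2^2) P1 Q1 Q2 Q3.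
            invertible M \<and> invertible N \<and>
            p = vector [0, 0, 1] v* M \<and>
            map_matrix const2 M ** \<phi> ** map_matrix const2 N =
              vector [vector [P1, Q1], vector [Q3, Q2], vector [0, Q3]] \<and>
            homog c P1 \<and> homog c Q1 \<and> homog c Q2 \<and> homog c Q3)))
     \<and>
     (\<forall>p. curve_singular g p \<and> curve_mult g p = real c \<longrightarrow>
        ((\<exists>q1 \<in> inf_near_sing (curve_local_ring g p).
          \<exists>q2 \<in> inf_near_sing (curve_local_ring g p).
            q1 \<noteq> q2 \<and> local_mult (as_ring q1) = real c \<and> local_mult (as_ring q2) = real c) \<longleftrightarrow>
         (\<exists>(M :: 'k^3^3) (N :: 'k^2^2) Q1 Q2 Q3.
            invertible M \<and> invertible N \<and>
            p = vector [0, 0, 1] v* M \<and>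
            map_matrix const2 M ** \<phi> ** map_matrix const2 N =
              vector [vector [Q2, Q1], vector [Q3, Q2], vector [0, Q3]] \<and>
            homog c Q1 \<and> homog c Q2 \<and> homog c Q3)))"
proof -
  have rc: "rational_curve g d"
    by (rule rational_curve.intro) (rule homogeneous min_gen height_two birational)+
  interpret rational_curve g d by (rule rc)
  have nbhd: "\<exists>j. q \<in> nbhd (Suc j) R" if q: "q \<in> inf_near_sing R" for q R :: "'k bipoly fract set"
  proof -
    obtain i where i: "1 \<le> i" "q \<in> nbhd i R" using q unfolding inf_near_sing_def by blast
    then have "q \<in> nbhd (Suc (i - 1)) R" by (simp del: nbhd.simps)
    then show ?thesis ..
  qed
  have first: "q \<in> inf_near_sing R" if "q \<in> first_nbhd R" "\<not> regular_local (as_ring q)" for q R :: "'k bipoly fract set"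
  proof -
    have "q \<in> nbhd (Suc 0) R" using that(1) by simp
    then show ?thesis using that(2) unfolding inf_near_sing_def by (intro CollectI conjI exI[of _ "Suc 0"]) simp_all
  qed
  have second: "q2 \<in> inf_near_sing R" if "q \<in> first_nbhd R" "q2 \<in> first_nbhd q" "\<not> regular_local (as_ring q2)"
    for q q2 R :: "'k bipoly fract set"
  proof -
    have "q2 \<in> nbhd (Suc (Suc 0)) R" using that(1,2) by auto
    then show ?thesis using that(3) unfolding inf_near_sing_def
      by (intro CollectI conjI exI[of _ "Suc (Suc 0)"]) (simp_all del: nbhd.simps)
  qed
  have one: "curve_mult g p = real c" if "on_curve g p" "q \<in> inf_near_sing (curve_local_ring g p)" "local_mult (as_ring q) = real c" for p q
    using nbhd[OF that(2)] half_mult_of_infinitely_near[OF that(1) d_even _ that(3)] by blast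
  have two: "d1 = c \<and> d2 = c" if "curve_singular g p" "curve_mult g p = real c" for p
    using degrees_half[OF _ d_even that(2) resolution d1_le_d2] that(1) by (simp add: curve_singular_def)
  have sing: "P1.planar (curve_local_ring g p) \<and> c \<noteq> 1" if "curve_singular g p" "curve_mult g p = real c" for p
  proof -
    have "P1.planar (curve_local_ring g p)" using local_facts that(1) unfolding curve_singular_def by blast
    then show ?thesis using P1.planar_regular_iff that unfolding curve_singular_def curve_mult_def by force
  qed
  have nonreg: "\<not> regular_local (as_ring q)" if "P1.planar q" "local_mult (as_ring q) = real c" "c \<noteq> 1" for q
    using P1.planar_regular_iff[OF that(1)] that(2,3) by simp
  have three: "(\<exists>q\<in>inf_near_sing (curve_local_ring g p). local_mult (as_ring q) = real c) \<longleftrightarrow>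
      (\<exists>(M :: 'k^3^3) (N :: 'k^2^2) P1 Q1 Q2 Q3. invertible M \<and> invertible N \<and> p = vector [0, 0, 1] v* M \<and>
        cm M ** \<phi> ** cm N = vector [vector [P1, Q1], vector [Q3, Q2], vector [0, Q3]] \<and>
        homog c P1 \<and> homog c Q1 \<and> homog c Q2 \<and> homog c Q3)"
    if p: "curve_singular g p" "curve_mult g p = real c" for p
  proof -
    have on: "on_curve g p" using p(1) by (simp add: curve_singular_def)
    have hb: "hilbert_burch g \<phi> c c" using two[OF p] resolution by simp
    show ?thesis
    proof
      assume "\<exists>q\<in>inf_near_sing (curve_local_ring g p). local_mult (as_ring q) = real c"
      then obtain q j where "q \<in> nbhd (Suc j) (curve_local_ring g p)" "local_mult (as_ring q) = real c" using nbhd by blast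
      then show "\<exists>(M :: 'k^3^3) (N :: 'k^2^2) P1 Q1 Q2 Q3. invertible M \<and> invertible N \<and> p = vector [0, 0, 1] v* M \<and>
        cm M ** \<phi> ** cm N = vector [vector [P1, Q1], vector [Q3, Q2], vector [0, Q3]] \<and>
        homog c P1 \<and> homog c Q1 \<and> homog c Q2 \<and> homog c Q3"
        by (rule infinitely_near_imp_shape[OF on d_even p(2) hb])
    next
      assume "\<exists>(M :: 'k^3^3) (N :: 'k^2^2) P1 Q1 Q2 Q3. invertible M \<and> invertible N \<and> p = vector [0, 0, 1] v* M \<and>
        cm M ** \<phi> ** cm N = vector [vector [P1, Q1], vector [Q3, Q2], vector [0, Q3]] \<and>
        homog c P1 \<and> homog c Q1 \<and> homog c Q2 \<and> homog c Q3"
      then obtain M :: "'k^3^3" and N :: "'k^2^2" and P1 Q1 Q2 Q3 where "invertible M" "invertible N" "p = vector [0, 0, 1] v* M"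
        "cm M ** \<phi> ** cm N = vector [vector [P1, Q1], vector [Q3, Q2], vector [0, Q3]]" "homog c P1" "homog c Q3"
        by (elim exE conjE)
      then obtain q where q: "q \<in> first_nbhd (curve_local_ring g p)" "local_mult (as_ring q) = real c"
        using shape_imp_infinitely_near[OF on d_even p(2) hb] by metis
      have "P1.planar q" using P1.first_nbhd_planar(1)[OF _ q(1)] sing[OF p] by blast
      then show "\<exists>q\<in>inf_near_sing (curve_local_ring g p). local_mult (as_ring q) = real c"
        using first[OF q(1) nonreg] q(2) sing[OF p] by blast
    qed
  qed
  have four: "(\<exists>q1\<in>inf_near_sing (curve_local_ring g p). \<exists>q2\<in>inf_near_sing (curve_local_ring g p).
        q1 \<noteq> q2 \<and> local_mult (as_ring q1) = real c \<and> local_mult (as_ring q2) = real c) \<longleftrightarrow>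
      (\<exists>(M :: 'k^3^3) (N :: 'k^2^2) Q1 Q2 Q3. invertible M \<and> invertible N \<and> p = vector [0, 0, 1] v* M \<and>
        cm M ** \<phi> ** cm N = vector [vector [Q2, Q1], vector [Q3, Q2], vector [0, Q3]] \<and>
        homog c Q1 \<and> homog c Q2 \<and> homog c Q3)"
    if p: "curve_singular g p" "curve_mult g p = real c" for p
  proof -
    have on: "on_curve g p" using p(1) by (simp add: curve_singular_def)
    have hb: "hilbert_burch g \<phi> c c" using two[OF p] resolution by simp
    show ?thesis
    proof
      assume "\<exists>q1\<in>inf_near_sing (curve_local_ring g p). \<exists>q2\<in>inf_near_sing (curve_local_ring g p).
        q1 \<noteq> q2 \<and> local_mult (as_ring q1) = real c \<and> local_mult (as_ring q2) = real c"
      then obtain q1 q2 where q: "q1 \<in> inf_near_sing (curve_local_ring g p)" "q2 \<in> inf_near_sing (curve_local_ring g p)"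
        "q1 \<noteq> q2" "local_mult (as_ring q1) = real c" "local_mult (as_ring q2) = real c" by blast
      obtain i j where "q1 \<in> nbhd (Suc i) (curve_local_ring g p)" "q2 \<in> nbhd (Suc j) (curve_local_ring g p)"
        using nbhd[OF q(1)] nbhd[OF q(2)] by blast
      then obtain A A' where A: "A \<in> first_nbhd (curve_local_ring g p)" "local_mult (as_ring A) = real c"
        "A' \<in> first_nbhd A" "local_mult (as_ring A') = real c"
        using two_infinitely_near_chain[OF on p(2) _ q(4) _ q(5) q(3)] by blast
      then show "\<exists>(M :: 'k^3^3) (N :: 'k^2^2) Q1 Q2 Q3. invertible M \<and> invertible N \<and> p = vector [0, 0, 1] v* M \<and>
        cm M ** \<phi> ** cm N = vector [vector [Q2, Q1], vector [Q3, Q2], vector [0, Q3]] \<and>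
        homog c Q1 \<and> homog c Q2 \<and> homog c Q3"
        by (rule two_infinitely_near_imp_shape[OF on d_even p(2) hb])
    next
      assume "\<exists>(M :: 'k^3^3) (N :: 'k^2^2) Q1 Q2 Q3. invertible M \<and> invertible N \<and> p = vector [0, 0, 1] v* M \<and>
        cm M ** \<phi> ** cm N = vector [vector [Q2, Q1], vector [Q3, Q2], vector [0, Q3]] \<and>
        homog c Q1 \<and> homog c Q2 \<and> homog c Q3"
      then obtain M :: "'k^3^3" and N :: "'k^2^2" and Q1 Q2 Q3 where "invertible M" "invertible N" "p = vector [0, 0, 1] v* M"
        "cm M ** \<phi> ** cm N = vector [vector [Q2, Q1], vector [Q3, Q2], vector [0, Q3]]" "homog c Q2" "homog c Q3"
        by (elim exE conjE)
      then obtain q q2 where q: "q \<in> first_nbhd (curve_local_ring g p)" "local_mult (as_ring q) = real c"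
        and q2: "q2 \<in> first_nbhd q" "local_mult (as_ring q2) = real c"
        using shape_imp_infinitely_near[OF on d_even p(2) hb] by metis
      note s = sing[OF p]
      have pl: "P1.planar q" using P1.first_nbhd_planar(1)[OF _ q(1)] s by blast
      have pl2: "P1.planar q2" by (rule P1.first_nbhd_planar(1)[OF pl q2(1)])
      have n: "\<not> regular_local (as_ring q)" "\<not> regular_local (as_ring q2)" using nonreg pl pl2 q(2) q2(2) s by blast+
      have "q \<noteq> q2" using P1.planar_self_nbhd[OF pl] q2(1) n(1) by blast
      then show "\<exists>q1\<in>inf_near_sing (curve_local_ring g p). \<exists>q2\<in>inf_near_sing (curve_local_ring g p).
        q1 \<noteq> q2 \<and> local_mult (as_ring q1) = real c \<and> local_mult (as_ring q2) = real c"
        using first[OF q(1) n(1)] second[OF q(1) q2(1) n(2)] q(2) q2(2) by blast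
    qed
  qed
  show ?thesis
    by (intro conjI allI impI; elim conjE; rule one two[THEN conjunct1] two[THEN conjunct2] three four; assumption)
qed

end
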